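(* Let $k$ be an algebraically closed field and let $\pi\colon\mathcal{T}\to\overline{\mathcal{T}}=\mathcal{T}/G$ be a Galois covering of algebraic $2$-Calabi-Yau triangulated $k$-categories. Let $\overline{T}=\overline{T}_m\oplus\overline{T}_f$ be a basic cluster-tilting object in $\overline{\mathcal{T}}$ with $\overline{T}_m$ indecomposable, and let $\overline{T}'_m$ be the other complement of the almost complete cluster-tilting object $\overline{T}_f$. Write $T=T_m\oplus T_f$ for the lift of $\overline{T}$ to $\mathcal{T}$ via $\pi$, where $T_m=\pi^{-1}(\overline{T}_m)$ and $T_f=\pi^{-1}(\overline{T}_f)$. Let $\mathcal{U}={}^{\perp}(\operatorname{add}T_f[1])/[\operatorname{add}T_f]$ with shift functor $\langle1\rangle$, let $T'=T_m\langle1\rangle\oplus T_f$, and let $Q$, $Q'$, $\overline{Q}$ be the quivers of $\operatorname{End}_{\mathcal{T}}(T)$, $\operatorname{End}_{\mathcal{T}}(T')$, $\operatorname{End}_{\overline{\mathcal{T}}}(\overline{T})$, respectively. Assume: (a) no cluster-tilting object in $\mathcal{T}$ has loops or $2$-cycles (in the quiver of its endomorphism algebra); (b) the quiver $Q_{m,m}$ is a (possibly disjoint union of) oriented cycle(s) of length $l\ge3$; (c) the relations of $\operatorname{End}_{\mathcal{T}}(T)$ are given by a potential; (d) the algebra $\mathcal{T}(T_m,T_m)/[\operatorname{add}T_f]$ is the path algebra of $Q_{m,m}$ with minimal relations given by the paths of length $l-1$; (e) the quiver $\overline{Q}_{m,m}$ of $\overline{\mathcal{T}}(\overline{T}_m,\overline{T}_m)/[\operatorname{add}\overline{T}_f]$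 has a single vertex, possibly with a loop and/or with $2$-cycles adjacent to this vertex in $\overline{Q}$. Then $\overline{T}':=\overline{T}'_m\oplus\overline{T}_f=\pi(T')$. Furthermore, if $\overline{Q}'$ denotes the quiver of $\operatorname{End}_{\overline{\mathcal{T}}}(\overline{T}')$, then $\overline{Q}'=\pi(Q')$.
   Context: All categories are $k$-linear additive with finite dimensional morphism spaces, and $\mathcal{T}(X,Y)$ denotes morphisms from $X$ to $Y$. Algebraic means triangle equivalent to the stable category of a Frobenius exact category; $2$-Calabi-Yau means that $[2]$ is a Serre functor. ${}^{\perp}\mathcal{X}$ is the full subcategory of objects $X$ with $\operatorname{Hom}(X,\mathcal{X})=0$, and $[\mathcal{D}]$ is the ideal of morphisms factoring through objects of $\mathcal{D}$. A $k$-linear functor $F\colon\mathcal{C}\to\mathcal{D}$ is a covering functor if for all $X\in\mathcal{C}$ and indecomposable $A\in\mathcal{D}$ the induced maps $\bigoplus\mathcal{C}(X,Y)\to\mathcal{D}(FX,A)$ and $\bigoplus\mathcal{C}(Y,X)\to\mathcal{D}(A,FX)$ are bijective, both sums running over the isomorphism classes of objects $Y$ with $FY\simeq A$. Let $G$ be a group of $k$-linear automorphisms of $\mathcal{C}$ acting freely ($gX\not\simeq X$ for $1\ne g\in G$) and locally boundedly (for each pair $X,Y$ only finitely many $g\in G$ satisfy $\mathcal{C}(X,gY)\neq0$). A covering functor $F$ with $Fg=F$ for all $g\in G$ is a Galois covering (with group $G$) if it is surjective on objects and $G$ acts transitively on each fibre $F^{-1}(A)$; equivalently, it induces $\mathcal{C}/G\simeq\mathcal{D}$.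 A Galois covering of triangulated categories is moreover a triangle functor. The lift $\pi^{-1}(Y)$ of a basic object $Y\in\overline{\mathcal{T}}$ is the direct sum of representatives of all isomorphism classes of indecomposable $X\in\mathcal{T}$ such that $\pi(X)$ is isomorphic to a direct summand of $Y$; it is assumed to be an object of $\mathcal{T}$ (finite sum). The object $\pi(T')$ is understood up to multiplicity of indecomposable summands. An almost complete cluster-tilting object (a basic cluster-tilting object with one indecomposable summand removed) has exactly two complements, i.e. indecomposable objects completing it to a cluster-tilting object. Iyama–Yoshino reduction: put $\mathcal{D}=\operatorname{add}T_f$, $\mathcal{Z}={}^{\perp}(\mathcal{D}[1])$, $\mathcal{U}=\mathcal{Z}/[\mathcal{D}]$. The category $\mathcal{U}$ is triangulated with shift $\langle1\rangle$ given on objects by a triangle $X\to D_X\to X\langle 1\rangle\to X[1]$ in $\mathcal{T}$ with $X\to D_X$ a left $\mathcal{D}$-approximation (taken minimal in the case $X=T_m$) and $D_X\in\mathcal{D}$. $Q_{m,m}$ is the subquiver of $Q$ whose arrows correspond to maps from (summands of) $T_m$ to (summands of) $T_m$. "Given by a potential" means that $\operatorname{End}_{\mathcal T}(T)$ is the Jacobian algebra of a quiver with potential $(Q,\mathcal P)$. The functor $\pi$ induces covering morphisms of quivers, also denoted $\pi$, such as $\pi\colon Q\to\overline{Q}$; $\pi(Q')$ denotes the quotient quiver whose vertices and arrows are the $G$-orbits of those of $Q'$. *)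

theory Defs
  imports
    "HOL-Algebra.Algebraic_Closure_Type"
    "HOL-Algebra.Module"
    "HOL-Algebra.QuotRing"
    "HOL-Algebra.Ideal_Product"
    "HOL-Algebra.Group_Action"
    "HOL-Computational_Algebra.Polynomial"
    "Graph_Theory.Digraph_Isomorphism"
begin

no_notation var (\<open>X\<index>\<close>)

section \<open>Linear categories\<close>

text \<open>
  Small categories with explicit carriers. Every arrow determines its domain and codomain, so that
  Hom sets are disjoint. Scalars come from a type of class \<open>alg_closed_field\<close>.
  The values of the operations outside the carriers are irrelevant.
\<close>

record ('o, 'm, 'k) lcat =
  Obj :: "'o set"
  Arr :: "'m set"
  Dom :: "'m \<Rightarrow> 'o"
  Cod :: "'m \<Rightarrow> 'o"
  Idn :: "'o \<Rightarrow> 'm"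
  Cmp :: "'m \<Rightarrow> 'm \<Rightarrow> 'm" (infixr "\<star>\<index>" 75)
  Zro :: "'o \<Rightarrow> 'o \<Rightarrow> 'm"
  Pls :: "'m \<Rightarrow> 'm \<Rightarrow> 'm"
  Scl :: "'k \<Rightarrow> 'm \<Rightarrow> 'm"

definition Hom :: "('o, 'm, 'k, 'z) lcat_scheme \<Rightarrow> 'o \<Rightarrow> 'o \<Rightarrow> 'm set" where
  "Hom C X Y = {f \<in> Arr C. Dom C f = X \<and> Cod C f = Y}"

text \<open>
  The morphism space as a module record. The multiplicative fields are only meaningful for
  \<open>Y = X\<close>, where this record is the endomorphism algebra.
\<close>

definition hom_mod ::
  "('o, 'm, 'k, 'z) lcat_scheme \<Rightarrow> 'o \<Rightarrow> 'o \<Rightarrow> ('k, 'm) module" where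
  "hom_mod C X Y =
    \<lparr>carrier = Hom C X Y, monoid.mult = Cmp C, one = Idn C X, ring.zero = Zro C X Y, add = Pls C,
     module.smult = Scl C\<rparr>"

abbreviation End :: "('o, 'm, 'k, 'z) lcat_scheme \<Rightarrow> 'o \<Rightarrow> ('k, 'm) module" where
  "End C X \<equiv> hom_mod C X X"

definition linear_category :: "('o, 'm, 'k::field, 'z) lcat_scheme \<Rightarrow> bool" where
  "linear_category C \<longleftrightarrow>
    (\<forall>f\<in>Arr C. Dom C f \<in> Obj C \<and> Cod C f \<in> Obj C) \<and>
    (\<forall>X\<in>Obj C. Idn C X \<in> Hom C X X) \<and>
    (\<forall>X\<in>Obj C. \<forall>Y\<in>Obj C. \<forall>f\<in>Hom C X Y. f \<star>\<^bsub>C\<^esub> Idn C X = f \<and> Idn C Y \<star>\<^bsub>C\<^esub> f = f) \<and>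
    (\<forall>X\<in>Obj C. \<forall>Y\<in>Obj C. \<forall>Z\<in>Obj C. \<forall>f\<in>Hom C X Y. \<forall>g\<in>Hom C Y Z. g \<star>\<^bsub>C\<^esub> f \<in> Hom C X Z) \<and>
    (\<forall>W\<in>Obj C. \<forall>X\<in>Obj C. \<forall>Y\<in>Obj C. \<forall>Z\<in>Obj C.
       \<forall>f\<in>Hom C W X. \<forall>g\<in>Hom C X Y. \<forall>h\<in>Hom C Y Z. (h \<star>\<^bsub>C\<^esub> g) \<star>\<^bsub>C\<^esub> f = h \<star>\<^bsub>C\<^esub> (g \<star>\<^bsub>C\<^esub> f)) \<and>
    (\<forall>X\<in>Obj C. \<forall>Y\<in>Obj C. Module.module (ring_of_type_algebra :: 'k ring) (hom_mod C X Y)) \<and>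
    (\<forall>X\<in>Obj C. \<forall>Y\<in>Obj C. \<forall>Z\<in>Obj C.
       \<forall>f\<in>Hom C X Y. \<forall>f'\<in>Hom C X Y. \<forall>g\<in>Hom C Y Z. \<forall>g'\<in>Hom C Y Z. \<forall>c.
         g \<star>\<^bsub>C\<^esub> Pls C f f' = Pls C (g \<star>\<^bsub>C\<^esub> f) (g \<star>\<^bsub>C\<^esub> f') \<and>
         Pls C g g' \<star>\<^bsub>C\<^esub> f = Pls C (g \<star>\<^bsub>C\<^esub> f) (g' \<star>\<^bsub>C\<^esub> f) \<and>
         g \<star>\<^bsub>C\<^esub> Scl C c f = Scl C c (g \<star>\<^bsub>C\<^esub> f) \<and>
         Scl C c g \<star>\<^bsub>C\<^esub> f = Scl C c (g \<star>\<^bsub>C\<^esub> f))"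

definition iso_pair :: "('o, 'm, 'k, 'z) lcat_scheme \<Rightarrow> 'o \<Rightarrow> 'o \<Rightarrow> 'm \<Rightarrow> 'm \<Rightarrow> bool" where
  "iso_pair C X Y f g \<longleftrightarrow>
    f \<in> Hom C X Y \<and> g \<in> Hom C Y X \<and> g \<star>\<^bsub>C\<^esub> f = Idn C X \<and> f \<star>\<^bsub>C\<^esub> g = Idn C Y"

definition is_iso :: "('o, 'm, 'k, 'z) lcat_scheme \<Rightarrow> 'm \<Rightarrow> bool" where
  "is_iso C f \<longleftrightarrow> (\<exists>g. iso_pair C (Dom C f) (Cod C f) f g)"

definition isomorphic :: "('o, 'm, 'k, 'z) lcat_scheme \<Rightarrow> 'o \<Rightarrow> 'o \<Rightarrow> bool" where
  "isomorphic C X Y \<longleftrightarrow> X \<in> Obj C \<and> Y \<in> Obj C \<and> (\<exists>f g. iso_pair C X Y f g)"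

definition iso_class :: "('o, 'm, 'k, 'z) lcat_scheme \<Rightarrow> 'o \<Rightarrow> 'o set" where
  "iso_class C X = {Y. isomorphic C X Y}"

definition zero_object :: "('o, 'm, 'k, 'z) lcat_scheme \<Rightarrow> 'o \<Rightarrow> bool" where
  "zero_object C X \<longleftrightarrow> X \<in> Obj C \<and> Idn C X = Zro C X X"

definition dsum :: "('o, 'm, 'k, 'z) lcat_scheme \<Rightarrow> 'o \<Rightarrow> 'i set \<Rightarrow> ('i \<Rightarrow> 'o) \<Rightarrow> bool" where
  "dsum C Z I X \<longleftrightarrow> finite I \<and> Z \<in> Obj C \<and> (\<forall>i\<in>I. X i \<in> Obj C) \<and>
    (\<exists>inj prj.
      (\<forall>i\<in>I. inj i \<in> Hom C (X i) Z \<and> prj i \<in> Hom C Z (X i)) \<and>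
      (\<forall>i\<in>I. \<forall>j\<in>I. prj j \<star>\<^bsub>C\<^esub> inj i = (if i = j then Idn C (X i) else Zro C (X i) (X j))) \<and>
      finsum (End C Z) (\<lambda>i. inj i \<star>\<^bsub>C\<^esub> prj i) I = Idn C Z)"

definition dsum2 :: "('o, 'm, 'k, 'z) lcat_scheme \<Rightarrow> 'o \<Rightarrow> 'o \<Rightarrow> 'o \<Rightarrow> bool" where
  "dsum2 C Z X Y \<longleftrightarrow> dsum C Z UNIV (\<lambda>b::bool. if b then X else Y)"

definition additive_category :: "('o, 'm, 'k::field, 'z) lcat_scheme \<Rightarrow> bool" where
  "additive_category C \<longleftrightarrow> linear_category C \<and>
    (\<exists>Z. zero_object C Z) \<and> (\<forall>X\<in>Obj C. \<forall>Y\<in>Obj C. \<exists>Z. dsum2 C Z X Y)"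

definition summand :: "('o, 'm, 'k, 'z) lcat_scheme \<Rightarrow> 'o \<Rightarrow> 'o \<Rightarrow> bool" where
  "summand C X Z \<longleftrightarrow> (\<exists>Y. dsum2 C Z X Y)"

definition indecomposable :: "('o, 'm, 'k, 'z) lcat_scheme \<Rightarrow> 'o \<Rightarrow> bool" where
  "indecomposable C X \<longleftrightarrow> X \<in> Obj C \<and> \<not> zero_object C X \<and>
    (\<forall>A B. dsum2 C X A B \<longrightarrow> zero_object C A \<or> zero_object C B)"

definition ind_summands :: "('o, 'm, 'k, 'z) lcat_scheme \<Rightarrow> 'o \<Rightarrow> 'o set" where
  "ind_summands C Z = {X. indecomposable C X \<and> summand C X Z}"

definition same_ind_summands :: "('o, 'm, 'k, 'z) lcat_scheme \<Rightarrow> 'o \<Rightarrow> 'o \<Rightarrow> bool" where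
  "same_ind_summands C Y Z \<longleftrightarrow> Y \<in> Obj C \<and> Z \<in> Obj C \<and> ind_summands C Y = ind_summands C Z"

definition basic_object :: "('o, 'm, 'k, 'z) lcat_scheme \<Rightarrow> 'o \<Rightarrow> bool" where
  "basic_object C Z \<longleftrightarrow> (\<exists>S. (\<forall>X\<in>S. indecomposable C X) \<and>
    (\<forall>X\<in>S. \<forall>Y\<in>S. isomorphic C X Y \<longrightarrow> X = Y) \<and> dsum C Z S (\<lambda>X. X))"

definition add_closure :: "('o, 'm, 'k, 'z) lcat_scheme \<Rightarrow> 'o \<Rightarrow> 'o set" where
  "add_closure C X = {Y. \<exists>(n::nat) Z. dsum C Z {..<n} (\<lambda>_. X) \<and> summand C Y Z}"

text \<open>
  \<open>B\<close> maps bijectively to a basis of the quotient of a subspace \<open>V\<close> of \<open>M\<close> by a subspace \<open>W\<close>;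
  \<open>quot_dim M V W\<close> is the dimension of this quotient.
\<close>

definition quot_basis :: "('k, 'm) module \<Rightarrow> 'm set \<Rightarrow> 'm set \<Rightarrow> 'm set \<Rightarrow> bool" where
  "quot_basis M V W B \<longleftrightarrow> finite B \<and> B \<subseteq> V \<and>
    (\<forall>v\<in>V. \<exists>!c. c \<in> B \<rightarrow>\<^sub>E UNIV \<and> v \<ominus>\<^bsub>M\<^esub> finsum M (\<lambda>b. c b \<odot>\<^bsub>M\<^esub> b) B \<in> W)"

definition quot_dim :: "('k, 'm) module \<Rightarrow> 'm set \<Rightarrow> 'm set \<Rightarrow> nat" where
  "quot_dim M V W = (THE n. \<exists>B. quot_basis M V W B \<and> card B = n)"

definition hom_finite :: "('o, 'm, 'k, 'z) lcat_scheme \<Rightarrow> bool" where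
  "hom_finite C \<longleftrightarrow>
    (\<forall>X\<in>Obj C. \<forall>Y\<in>Obj C. \<exists>B. quot_basis (hom_mod C X Y) (Hom C X Y) {Zro C X Y} B)"

text \<open>
  A Hom-finite additive category is Krull-Schmidt if and only if its idempotents split.
\<close>

definition split_idempotents :: "('o, 'm, 'k, 'z) lcat_scheme \<Rightarrow> bool" where
  "split_idempotents C \<longleftrightarrow>
    (\<forall>X\<in>Obj C. \<forall>e\<in>Hom C X X. e \<star>\<^bsub>C\<^esub> e = e \<longrightarrow>
      (\<exists>Y\<in>Obj C. \<exists>i\<in>Hom C Y X. \<exists>p\<in>Hom C X Y. p \<star>\<^bsub>C\<^esub> i = Idn C Y \<and> i \<star>\<^bsub>C\<^esub> p = e))"

definition hom_finite_krull_schmidt :: "('o, 'm, 'k::field, 'z) lcat_scheme \<Rightarrow> bool" where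
  "hom_finite_krull_schmidt C \<longleftrightarrow>
    additive_category C \<and> hom_finite C \<and> split_idempotents C"

definition full_sub :: "('o, 'm, 'k, 'z) lcat_scheme \<Rightarrow> 'o set \<Rightarrow> ('o, 'm, 'k) lcat" where
  "full_sub C S =
    \<lparr>Obj = S, Arr = {f \<in> Arr C. Dom C f \<in> S \<and> Cod C f \<in> S}, Dom = Dom C, Cod = Cod C,
     Idn = Idn C, Cmp = Cmp C, Zro = Zro C, Pls = Pls C, Scl = Scl C\<rparr>"

definition factor_ideal :: "('o, 'm, 'k, 'z) lcat_scheme \<Rightarrow> 'o set \<Rightarrow> 'm set" where
  "factor_ideal C S = {b \<star>\<^bsub>C\<^esub> a | a b X W Y.
    X \<in> Obj C \<and> W \<in> S \<and> Y \<in> Obj C \<and> a \<in> Hom C X W \<and> b \<in> Hom C W Y}"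

definition mor_class :: "('o, 'm, 'k, 'z) lcat_scheme \<Rightarrow> 'm set \<Rightarrow> 'm \<Rightarrow> 'm set" where
  "mor_class C I f = {Pls C f h | h. h \<in> I \<inter> Hom C (Dom C f) (Cod C f)}"

definition quot_cat ::
  "('o, 'm, 'k, 'z) lcat_scheme \<Rightarrow> 'm set \<Rightarrow> ('o, 'm set, 'k) lcat" where
  "quot_cat C I =
    \<lparr>Obj = Obj C, Arr = mor_class C I ` Arr C,
     Dom = (\<lambda>A. Dom C (SOME f. f \<in> A)), Cod = (\<lambda>A. Cod C (SOME f. f \<in> A)),
     Idn = (\<lambda>X. mor_class C I (Idn C X)),
     Cmp = (\<lambda>B A. \<Union>b\<in>B. \<Union>a\<in>A. mor_class C I (b \<star>\<^bsub>C\<^esub> a)),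
     Zro = (\<lambda>X Y. mor_class C I (Zro C X Y)),
     Pls = (\<lambda>A B. \<Union>a\<in>A. \<Union>b\<in>B. mor_class C I (Pls C a b)),
     Scl = (\<lambda>c A. \<Union>a\<in>A. mor_class C I (Scl C c a))\<rparr>"


section \<open>Functors\<close>

record ('o, 'm, 'p, 'n) func =
  fob :: "'o \<Rightarrow> 'p"
  fmor :: "'m \<Rightarrow> 'n"

definition linear_functor ::
  "('o, 'm, 'k, 'y) lcat_scheme \<Rightarrow> ('p, 'n, 'k, 'z) lcat_scheme \<Rightarrow> ('o, 'm, 'p, 'n) func \<Rightarrow> bool"
where
  "linear_functor C D F \<longleftrightarrow>
    (\<forall>X\<in>Obj C. fob F X \<in> Obj D \<and> fmor F (Idn C X) = Idn D (fob F X)) \<and>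
    (\<forall>X\<in>Obj C. \<forall>Y\<in>Obj C. \<forall>f\<in>Hom C X Y. fmor F f \<in> Hom D (fob F X) (fob F Y)) \<and>
    (\<forall>X\<in>Obj C. \<forall>Y\<in>Obj C. \<forall>Z\<in>Obj C. \<forall>f\<in>Hom C X Y. \<forall>g\<in>Hom C Y Z.
       fmor F (g \<star>\<^bsub>C\<^esub> f) = fmor F g \<star>\<^bsub>D\<^esub> fmor F f) \<and>
    (\<forall>X\<in>Obj C. \<forall>Y\<in>Obj C. \<forall>f\<in>Hom C X Y. \<forall>g\<in>Hom C X Y. \<forall>c.
       fmor F (Pls C f g) = Pls D (fmor F f) (fmor F g) \<and>
       fmor F (Scl C c f) = Scl D c (fmor F f))"

definition linear_equivalence ::
  "('o, 'm, 'k, 'y) lcat_scheme \<Rightarrow> ('p, 'n, 'k, 'z) lcat_scheme \<Rightarrow> ('o, 'm, 'p, 'n) func \<Rightarrow> bool"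
where
  "linear_equivalence C D F \<longleftrightarrow> linear_functor C D F \<and>
    (\<forall>X\<in>Obj C. \<forall>Y\<in>Obj C. bij_betw (fmor F) (Hom C X Y) (Hom D (fob F X) (fob F Y))) \<and>
    (\<forall>A\<in>Obj D. \<exists>X\<in>Obj C. isomorphic D (fob F X) A)"

definition linear_automorphism ::
  "('o, 'm, 'k, 'z) lcat_scheme \<Rightarrow> ('o, 'm, 'o, 'm) func \<Rightarrow> bool" where
  "linear_automorphism C F \<longleftrightarrow> linear_functor C C F \<and>
    bij_betw (fob F) (Obj C) (Obj C) \<and> bij_betw (fmor F) (Arr C) (Arr C)"


section \<open>Triangulated categories\<close>

text \<open>The shift \<open>[1]\<close> is an autoequivalence; axiom TR2 is stated as an equivalence accordingly.\<close>

record ('o, 'm, 'k) tcat = "('o, 'm, 'k) lcat" +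
  Sh :: "('o, 'm, 'o, 'm) func"
  Tri :: "('m \<times> 'm \<times> 'm) set"

definition triangles_on :: "('o, 'm, 'k, 'z) tcat_scheme \<Rightarrow> 'o \<Rightarrow> 'o \<Rightarrow> 'o \<Rightarrow> ('m \<times> 'm \<times> 'm) set" where
  "triangles_on C X Y Z = Hom C X Y \<times> Hom C Y Z \<times> Hom C Z (fob (Sh C) X)"

definition triangle_map ::
  "('o, 'm, 'k, 'z) tcat_scheme \<Rightarrow> 'm \<times> 'm \<times> 'm \<Rightarrow> 'm \<times> 'm \<times> 'm \<Rightarrow> 'm \<times> 'm \<times> 'm \<Rightarrow> bool" where
  "triangle_map C = (\<lambda>(f, g, h) (f', g', h') (u, v, w).
    u \<in> Hom C (Dom C f) (Dom C f') \<and> v \<in> Hom C (Dom C g) (Dom C g') \<and>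
    w \<in> Hom C (Dom C h) (Dom C h') \<and>
    v \<star>\<^bsub>C\<^esub> f = f' \<star>\<^bsub>C\<^esub> u \<and> w \<star>\<^bsub>C\<^esub> g = g' \<star>\<^bsub>C\<^esub> v \<and> fmor (Sh C) u \<star>\<^bsub>C\<^esub> h = h' \<star>\<^bsub>C\<^esub> w)"

definition triangle_iso ::
  "('o, 'm, 'k, 'z) tcat_scheme \<Rightarrow> 'm \<times> 'm \<times> 'm \<Rightarrow> 'm \<times> 'm \<times> 'm \<Rightarrow> bool" where
  "triangle_iso C s t \<longleftrightarrow>
    (\<exists>u v w. triangle_map C s t (u, v, w) \<and> is_iso C u \<and> is_iso C v \<and> is_iso C w)"

definition triangulated_category :: "('o, 'm, 'k::field, 'z) tcat_scheme \<Rightarrow> bool" where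
  "triangulated_category C \<longleftrightarrow> additive_category C \<and> linear_equivalence C C (Sh C) \<and>
    \<comment> \<open>TR1\<close>
    (\<forall>t\<in>Tri C. \<exists>X\<in>Obj C. \<exists>Y\<in>Obj C. \<exists>Z\<in>Obj C. t \<in> triangles_on C X Y Z) \<and>
    (\<forall>X\<in>Obj C. \<forall>Y\<in>Obj C. \<forall>Z\<in>Obj C. \<forall>s\<in>Tri C. \<forall>t\<in>triangles_on C X Y Z.
       triangle_iso C s t \<longrightarrow> t \<in> Tri C) \<and>
    (\<forall>X\<in>Obj C. \<forall>Z. zero_object C Z \<longrightarrow>
       (Idn C X, Zro C X Z, Zro C Z (fob (Sh C) X)) \<in> Tri C) \<and>
    (\<forall>X\<in>Obj C. \<forall>Y\<in>Obj C. \<forall>f\<in>Hom C X Y. \<exists>g h. (f, g, h) \<in> Tri C) \<and>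
    \<comment> \<open>TR2\<close>
    (\<forall>X\<in>Obj C. \<forall>Y\<in>Obj C. \<forall>Z\<in>Obj C. \<forall>f g h. (f, g, h) \<in> triangles_on C X Y Z \<longrightarrow>
       ((f, g, h) \<in> Tri C \<longleftrightarrow> (g, h, Scl C (- 1) (fmor (Sh C) f)) \<in> Tri C)) \<and>
    \<comment> \<open>TR3\<close>
    (\<forall>f g h f' g' h' u v. (f, g, h) \<in> Tri C \<and> (f', g', h') \<in> Tri C \<and>
       u \<in> Hom C (Dom C f) (Dom C f') \<and> v \<in> Hom C (Dom C g) (Dom C g') \<and>
       v \<star>\<^bsub>C\<^esub> f = f' \<star>\<^bsub>C\<^esub> u \<longrightarrow>
       (\<exists>w. triangle_map C (f, g, h) (f', g', h') (u, v, w))) \<and>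
    \<comment> \<open>TR4\<close>
    (\<forall>f f1 f2 g g1 g2 h1 h2.
       (f, f1, f2) \<in> Tri C \<and> (g, g1, g2) \<in> Tri C \<and> Cod C f = Dom C g \<and>
       (g \<star>\<^bsub>C\<^esub> f, h1, h2) \<in> Tri C \<longrightarrow>
       (\<exists>a\<in>Hom C (Dom C f2) (Dom C h2). \<exists>b\<in>Hom C (Dom C h2) (Dom C g2).
          (a, b, fmor (Sh C) f1 \<star>\<^bsub>C\<^esub> g2) \<in> Tri C \<and>
          a \<star>\<^bsub>C\<^esub> f1 = h1 \<star>\<^bsub>C\<^esub> g \<and> h2 \<star>\<^bsub>C\<^esub> a = f2 \<and> b \<star>\<^bsub>C\<^esub> h1 = g1 \<and>
          g2 \<star>\<^bsub>C\<^esub> b = fmor (Sh C) f \<star>\<^bsub>C\<^esub> h2))"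

definition triangle_functor ::
  "('o, 'm, 'k, 'y) tcat_scheme \<Rightarrow> ('p, 'n, 'k, 'z) tcat_scheme \<Rightarrow> ('o, 'm, 'p, 'n) func \<Rightarrow> bool"
where
  "triangle_functor C D F \<longleftrightarrow> linear_functor C D F \<and>
    (\<exists>\<theta>. (\<forall>X\<in>Obj C. \<theta> X \<in> Hom D (fob F (fob (Sh C) X)) (fob (Sh D) (fob F X)) \<and> is_iso D (\<theta> X)) \<and>
      (\<forall>X\<in>Obj C. \<forall>Y\<in>Obj C. \<forall>f\<in>Hom C X Y.
         \<theta> Y \<star>\<^bsub>D\<^esub> fmor F (fmor (Sh C) f) = fmor (Sh D) (fmor F f) \<star>\<^bsub>D\<^esub> \<theta> X) \<and>
      (\<forall>(f, g, h)\<in>Tri C. (fmor F f, fmor F g, \<theta> (Dom C f) \<star>\<^bsub>D\<^esub> fmor F h) \<in> Tri D))"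

definition triangle_equivalent ::
  "('o, 'm, 'k, 'y) tcat_scheme \<Rightarrow> ('p, 'n, 'k, 'z) tcat_scheme \<Rightarrow> bool" where
  "triangle_equivalent C D \<longleftrightarrow> (\<exists>F. linear_equivalence C D F \<and> triangle_functor C D F)"

text \<open>
  \<open>[2]\<close> is a Serre functor: linear bijections \<open>\<eta> X Y\<close> from \<open>Hom(X, Y)\<close> to the dual space of
  \<open>Hom(Y, X[2])\<close>, natural in \<open>X\<close> and \<open>Y\<close>.
\<close>

definition linear_forms :: "('k::field, 'm) module \<Rightarrow> ('m \<Rightarrow> 'k) set" where
  "linear_forms M = {\<phi> \<in> extensional (carrier M).
    (\<forall>x\<in>carrier M. \<forall>y\<in>carrier M. \<phi> (x \<oplus>\<^bsub>M\<^esub> y) = \<phi> x + \<phi> y) \<and>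
    (\<forall>c. \<forall>x\<in>carrier M. \<phi> (c \<odot>\<^bsub>M\<^esub> x) = c * \<phi> x)}"

definition two_calabi_yau :: "('o, 'm, 'k::field, 'z) tcat_scheme \<Rightarrow> bool" where
  "two_calabi_yau C \<longleftrightarrow>
    (let S = (\<lambda>X. fob (Sh C) (fob (Sh C) X)); s = (\<lambda>f. fmor (Sh C) (fmor (Sh C) f)) in
     \<exists>\<eta>. (\<forall>X\<in>Obj C. \<forall>Y\<in>Obj C.
           bij_betw (\<eta> X Y) (Hom C X Y) (linear_forms (hom_mod C Y (S X))) \<and>
           (\<forall>f\<in>Hom C X Y. \<forall>f'\<in>Hom C X Y. \<forall>c. \<forall>g\<in>Hom C Y (S X).
              \<eta> X Y (Pls C f f') g = \<eta> X Y f g + \<eta> X Y f' g \<and>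
              \<eta> X Y (Scl C c f) g = c * \<eta> X Y f g)) \<and>
        (\<forall>X\<in>Obj C. \<forall>Y\<in>Obj C. \<forall>Y'\<in>Obj C.
           \<forall>f\<in>Hom C X Y. \<forall>v\<in>Hom C Y Y'. \<forall>g\<in>Hom C Y' (S X).
             \<eta> X Y' (v \<star>\<^bsub>C\<^esub> f) g = \<eta> X Y f (g \<star>\<^bsub>C\<^esub> v)) \<and>
        (\<forall>X\<in>Obj C. \<forall>X'\<in>Obj C. \<forall>Y\<in>Obj C.
           \<forall>f\<in>Hom C X Y. \<forall>u\<in>Hom C X' X. \<forall>g\<in>Hom C Y (S X').
             \<eta> X' Y (f \<star>\<^bsub>C\<^esub> u) g = \<eta> X Y f (s u \<star>\<^bsub>C\<^esub> g)))"


section \<open>Frobenius exact categories and algebraic triangulated categories\<close>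

record ('o, 'm, 'k) ecat = "('o, 'm, 'k) lcat" +
  Conf :: "('m \<times> 'm) set"

definition kernel_cokernel_pair :: "('o, 'm, 'k, 'z) lcat_scheme \<Rightarrow> 'm \<Rightarrow> 'm \<Rightarrow> bool" where
  "kernel_cokernel_pair C i p \<longleftrightarrow>
    (\<exists>X\<in>Obj C. \<exists>Y\<in>Obj C. \<exists>Z\<in>Obj C. i \<in> Hom C X Y \<and> p \<in> Hom C Y Z \<and> p \<star>\<^bsub>C\<^esub> i = Zro C X Z \<and>
      (\<forall>W\<in>Obj C. \<forall>f\<in>Hom C W Y. p \<star>\<^bsub>C\<^esub> f = Zro C W Z \<longrightarrow> (\<exists>!g. g \<in> Hom C W X \<and> i \<star>\<^bsub>C\<^esub> g = f)) \<and>
      (\<forall>W\<in>Obj C. \<forall>f\<in>Hom C Y W. f \<star>\<^bsub>C\<^esub> i = Zro C X W \<longrightarrow> (\<exists>!g. g \<in> Hom C Z W \<and> g \<star>\<^bsub>C\<^esub> p = f)))"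

definition pushout :: "('o, 'm, 'k, 'z) lcat_scheme \<Rightarrow> 'm \<Rightarrow> 'm \<Rightarrow> 'm \<Rightarrow> 'm \<Rightarrow> bool" where
  "pushout C i f i' f' \<longleftrightarrow>
    (\<exists>A\<in>Obj C. \<exists>B\<in>Obj C. \<exists>A'\<in>Obj C. \<exists>B'\<in>Obj C.
      i \<in> Hom C A B \<and> f \<in> Hom C A A' \<and> i' \<in> Hom C A' B' \<and> f' \<in> Hom C B B' \<and>
      f' \<star>\<^bsub>C\<^esub> i = i' \<star>\<^bsub>C\<^esub> f \<and>
      (\<forall>W\<in>Obj C. \<forall>u\<in>Hom C B W. \<forall>v\<in>Hom C A' W. u \<star>\<^bsub>C\<^esub> i = v \<star>\<^bsub>C\<^esub> f \<longrightarrow>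
        (\<exists>!w. w \<in> Hom C B' W \<and> w \<star>\<^bsub>C\<^esub> f' = u \<and> w \<star>\<^bsub>C\<^esub> i' = v)))"

definition pullback :: "('o, 'm, 'k, 'z) lcat_scheme \<Rightarrow> 'm \<Rightarrow> 'm \<Rightarrow> 'm \<Rightarrow> 'm \<Rightarrow> bool" where
  "pullback C p f p' f' \<longleftrightarrow>
    (\<exists>A\<in>Obj C. \<exists>B\<in>Obj C. \<exists>A'\<in>Obj C. \<exists>B'\<in>Obj C.
      p \<in> Hom C B A \<and> f \<in> Hom C A' A \<and> p' \<in> Hom C B' A' \<and> f' \<in> Hom C B' B \<and>
      p \<star>\<^bsub>C\<^esub> f' = f \<star>\<^bsub>C\<^esub> p' \<and>
      (\<forall>W\<in>Obj C. \<forall>u\<in>Hom C W B. \<forall>v\<in>Hom C W A'. p \<star>\<^bsub>C\<^esub> u = f \<star>\<^bsub>C\<^esub> v \<longrightarrow>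
        (\<exists>!w. w \<in> Hom C W B' \<and> f' \<star>\<^bsub>C\<^esub> w = u \<and> p' \<star>\<^bsub>C\<^esub> w = v)))"

definition inflation :: "('o, 'm, 'k, 'z) ecat_scheme \<Rightarrow> 'm \<Rightarrow> bool" where
  "inflation E i \<longleftrightarrow> (\<exists>p. (i, p) \<in> Conf E)"

definition deflation :: "('o, 'm, 'k, 'z) ecat_scheme \<Rightarrow> 'm \<Rightarrow> bool" where
  "deflation E p \<longleftrightarrow> (\<exists>i. (i, p) \<in> Conf E)"

definition exact_category :: "('o, 'm, 'k::field, 'z) ecat_scheme \<Rightarrow> bool" where
  "exact_category E \<longleftrightarrow> additive_category E \<and>
    (\<forall>(i, p)\<in>Conf E. kernel_cokernel_pair E i p) \<and>
    (\<forall>(i, p)\<in>Conf E. \<forall>i' p' u v w.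
       i' \<in> Hom E (Dom E i') (Dom E p') \<and> p' \<in> Hom E (Dom E p') (Cod E p') \<and>
       u \<in> Hom E (Dom E i) (Dom E i') \<and> v \<in> Hom E (Dom E p) (Dom E p') \<and>
       w \<in> Hom E (Cod E p) (Cod E p') \<and>
       is_iso E u \<and> is_iso E v \<and> is_iso E w \<and> v \<star>\<^bsub>E\<^esub> i = i' \<star>\<^bsub>E\<^esub> u \<and> w \<star>\<^bsub>E\<^esub> p = p' \<star>\<^bsub>E\<^esub> v \<longrightarrow>
       (i', p') \<in> Conf E) \<and>
    (\<forall>X\<in>Obj E. inflation E (Idn E X) \<and> deflation E (Idn E X)) \<and>
    (\<forall>i j. inflation E i \<and> inflation E j \<and> Cod E i = Dom E j \<longrightarrow> inflation E (j \<star>\<^bsub>E\<^esub> i)) \<and>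
    (\<forall>p q. deflation E p \<and> deflation E q \<and> Cod E p = Dom E q \<longrightarrow> deflation E (q \<star>\<^bsub>E\<^esub> p)) \<and>
    (\<forall>i f. inflation E i \<and> f \<in> Arr E \<and> Dom E f = Dom E i \<longrightarrow>
       (\<exists>i' f'. pushout E i f i' f' \<and> inflation E i')) \<and>
    (\<forall>p f. deflation E p \<and> f \<in> Arr E \<and> Cod E f = Cod E p \<longrightarrow>
       (\<exists>p' f'. pullback E p f p' f' \<and> deflation E p'))"

definition projective :: "('o, 'm, 'k, 'z) ecat_scheme \<Rightarrow> 'o \<Rightarrow> bool" where
  "projective E P \<longleftrightarrow> P \<in> Obj E \<and>
    (\<forall>p. deflation E p \<longrightarrow> (\<forall>f\<in>Hom E P (Cod E p). \<exists>g\<in>Hom E P (Dom E p). p \<star>\<^bsub>E\<^esub> g = f))"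

definition injective :: "('o, 'm, 'k, 'z) ecat_scheme \<Rightarrow> 'o \<Rightarrow> bool" where
  "injective E I \<longleftrightarrow> I \<in> Obj E \<and>
    (\<forall>i. inflation E i \<longrightarrow> (\<forall>f\<in>Hom E (Dom E i) I. \<exists>g\<in>Hom E (Cod E i) I. g \<star>\<^bsub>E\<^esub> i = f))"

definition frobenius_category :: "('o, 'm, 'k::field, 'z) ecat_scheme \<Rightarrow> bool" where
  "frobenius_category E \<longleftrightarrow> exact_category E \<and>
    (\<forall>X\<in>Obj E. \<exists>(i, p)\<in>Conf E. projective E (Dom E p) \<and> Cod E p = X) \<and>
    (\<forall>X\<in>Obj E. \<exists>(i, p)\<in>Conf E. injective E (Cod E i) \<and> Dom E i = X) \<and>
    (\<forall>X. projective E X \<longleftrightarrow> injective E X)"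

text \<open>
  The stable category, following Happel. The suspension is computed from a chosen conflation
  \<open>X \<rightarrow> I X \<rightarrow> \<Sigma> X\<close> with \<open>I X\<close> injective; other choices give triangle equivalent categories. A conflation
  \<open>(i, p)\<close>, extended to a map to the chosen conflation of the domain of \<open>i\<close> with last component
  \<open>h\<close>, yields the standard triangle given by the classes of \<open>i\<close>, \<open>p\<close> and \<open>- h\<close>.
\<close>

definition inj_conf :: "('o, 'm, 'k, 'z) ecat_scheme \<Rightarrow> 'o \<Rightarrow> 'm \<times> 'm" where
  "inj_conf E X = (SOME (i, p). (i, p) \<in> Conf E \<and> injective E (Cod E i) \<and> Dom E i = X)"

definition stable_shift :: "('o, 'm, 'k, 'z) ecat_scheme \<Rightarrow> ('o, 'm set, 'o, 'm set) func" where
  "stable_shift E =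
    \<lparr>fob = (\<lambda>X. Cod E (snd (inj_conf E X))),
     fmor = (\<lambda>A. \<Union>{mor_class E (factor_ideal E {P. projective E P}) s | s e f.
       f \<in> A \<and>
       e \<in> Hom E (Cod E (fst (inj_conf E (Dom E f)))) (Cod E (fst (inj_conf E (Cod E f)))) \<and>
       s \<in> Hom E (Cod E (snd (inj_conf E (Dom E f)))) (Cod E (snd (inj_conf E (Cod E f)))) \<and>
       e \<star>\<^bsub>E\<^esub> fst (inj_conf E (Dom E f)) = fst (inj_conf E (Cod E f)) \<star>\<^bsub>E\<^esub> f \<and>
       s \<star>\<^bsub>E\<^esub> snd (inj_conf E (Dom E f)) = snd (inj_conf E (Cod E f)) \<star>\<^bsub>E\<^esub> e})\<rparr>"

definition stable_pre :: "('o, 'm, 'k, 'z) ecat_scheme \<Rightarrow> ('o, 'm set, 'k) tcat" where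
  "stable_pre E = lcat.extend (quot_cat E (factor_ideal E {P. projective E P}))
    \<lparr>Sh = stable_shift E, Tri = {}\<rparr>"

definition stable_standard_triangles ::
  "('o, 'm, 'k::field, 'z) ecat_scheme \<Rightarrow> ('m set \<times> 'm set \<times> 'm set) set" where
  "stable_standard_triangles E =
    (let cl = mor_class E (factor_ideal E {P. projective E P}) in
     {(cl i, cl p, cl (Scl E (- 1) h)) | i p e h.
       (i, p) \<in> Conf E \<and>
       e \<in> Hom E (Dom E p) (Cod E (fst (inj_conf E (Dom E i)))) \<and>
       h \<in> Hom E (Cod E p) (Cod E (snd (inj_conf E (Dom E i)))) \<and>
       e \<star>\<^bsub>E\<^esub> i = fst (inj_conf E (Dom E i)) \<and>
       h \<star>\<^bsub>E\<^esub> p = snd (inj_conf E (Dom E i)) \<star>\<^bsub>E\<^esub> e})"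

definition stable_category :: "('o, 'm, 'k::field, 'z) ecat_scheme \<Rightarrow> ('o, 'm set, 'k) tcat" where
  "stable_category E = (stable_pre E)\<lparr>Tri :=
    {t. (\<exists>X\<in>Obj E. \<exists>Y\<in>Obj E. \<exists>Z\<in>Obj E. t \<in> triangles_on (stable_pre E) X Y Z) \<and>
        (\<exists>s\<in>stable_standard_triangles E. triangle_iso (stable_pre E) s t)}\<rparr>"

text \<open>
  HOL cannot quantify existentially over the types of the Frobenius category, so the latter is
  an argument; as a theorem hypothesis with \<open>E\<close> and its types universally quantified this is
  algebraicity.
\<close>

definition algebraic_via ::
  "('a, 'b, 'k::field, 'y) ecat_scheme \<Rightarrow> ('o, 'm, 'k, 'z) tcat_scheme \<Rightarrow> bool" where
  "algebraic_via E C \<longleftrightarrow> frobenius_category E \<and> triangle_equivalent C (stable_category E)"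


section \<open>Cluster-tilting objects and Iyama--Yoshino reduction\<close>

text \<open>
  Functorial finiteness of \<open>add T\<close> is automatic, since morphism spaces are finite dimensional.
\<close>

definition cluster_tilting :: "('o, 'm, 'k, 'z) tcat_scheme \<Rightarrow> 'o \<Rightarrow> bool" where
  "cluster_tilting C T \<longleftrightarrow> T \<in> Obj C \<and>
    add_closure C T =
      {X \<in> Obj C. \<forall>Y\<in>add_closure C T. Hom C Y (fob (Sh C) X) = {Zro C Y (fob (Sh C) X)}} \<and>
    add_closure C T =
      {X \<in> Obj C. \<forall>Y\<in>add_closure C T. Hom C X (fob (Sh C) Y) = {Zro C X (fob (Sh C) Y)}}"

definition complement :: "('o, 'm, 'k, 'z) tcat_scheme \<Rightarrow> 'o \<Rightarrow> 'o \<Rightarrow> bool" where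
  "complement C F M \<longleftrightarrow> indecomposable C M \<and> (\<exists>T. dsum2 C T M F \<and> cluster_tilting C T)"

definition left_perp :: "('o, 'm, 'k, 'z) lcat_scheme \<Rightarrow> 'o set \<Rightarrow> 'o set" where
  "left_perp C S = {X \<in> Obj C. \<forall>Y\<in>S. Hom C X Y = {Zro C X Y}}"

definition iy_reduction :: "('o, 'm, 'k, 'z) tcat_scheme \<Rightarrow> 'o set \<Rightarrow> ('o, 'm set, 'k) lcat" where
  "iy_reduction C D =
    (let Z = full_sub C (left_perp C (fob (Sh C) ` D)) in quot_cat Z (factor_ideal Z D))"

definition minimal_left_approx ::
  "('o, 'm, 'k, 'z) lcat_scheme \<Rightarrow> 'o set \<Rightarrow> 'o \<Rightarrow> 'o \<Rightarrow> 'm \<Rightarrow> bool" where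
  "minimal_left_approx C D X W f \<longleftrightarrow> W \<in> D \<and> f \<in> Hom C X W \<and>
    (\<forall>V\<in>D. \<forall>g\<in>Hom C X V. \<exists>h\<in>Hom C W V. h \<star>\<^bsub>C\<^esub> f = g) \<and>
    (\<forall>h\<in>Hom C W W. h \<star>\<^bsub>C\<^esub> f = f \<longrightarrow> is_iso C h)"

text \<open>\<open>X'\<close> is the object \<open>X\<langle>1\<rangle>\<close>, computed from a minimal left approximation of \<open>X\<close>.\<close>

definition iy_shift :: "('o, 'm, 'k, 'z) tcat_scheme \<Rightarrow> 'o set \<Rightarrow> 'o \<Rightarrow> 'o \<Rightarrow> bool" where
  "iy_shift C D X X' \<longleftrightarrow>
    X \<in> Obj (iy_reduction C D) \<and> X' \<in> Obj (iy_reduction C D) \<and>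
    (\<exists>W f g h. minimal_left_approx C D X W f \<and>
      (f, g, h) \<in> triangles_on C X W X' \<and> (f, g, h) \<in> Tri C)"


section \<open>Quivers of endomorphism algebras\<close>

definition maximal_left_ideal :: "('a, 'z) ring_scheme \<Rightarrow> 'a set \<Rightarrow> bool" where
  "maximal_left_ideal R I \<longleftrightarrow>
    (let left = (\<lambda>L. additive_subgroup L R \<and> (\<forall>r\<in>carrier R. \<forall>x\<in>L. r \<otimes>\<^bsub>R\<^esub> x \<in> L)) in
     left I \<and> I \<noteq> carrier R \<and> (\<forall>L. left L \<and> I \<subseteq> L \<longrightarrow> L = I \<or> L = carrier R))"

definition jacobson_radical :: "('a, 'z) ring_scheme \<Rightarrow> 'a set" where
  "jacobson_radical R = carrier R \<inter> \<Inter>{I. maximal_left_ideal R I}"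

text \<open>
  The quiver of \<open>End C T\<close>. Its vertices are the isomorphism classes of indecomposable summands
  \<open>X\<close> of \<open>T\<close>, a summand being represented in the algebra by the idempotent \<open>X\<close> cuts out. With
  \<open>J\<close> the Jacobson radical, the number of arrows from \<open>X\<close> to \<open>Y\<close> is the dimension of
  \<open>f (J / J\<^sup>2) e\<close>, where \<open>e\<close> and \<open>f\<close> are idempotents for \<open>X\<close> and \<open>Y\<close> (it does not depend on
  their choice). So arrows correspond to maps in the same direction. The arrows from
  \<open>x\<close> to \<open>y\<close> are the triples \<open>(x, y, n)\<close> with \<open>n\<close> below that number.
\<close>

definition summand_idempotent :: "('o, 'm, 'k, 'z) lcat_scheme \<Rightarrow> 'o \<Rightarrow> 'o set \<Rightarrow> 'm" where
  "summand_idempotent C T x = (SOME e. \<exists>X\<in>x. \<exists>i\<in>Hom C X T. \<exists>p\<in>Hom C T X.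
     p \<star>\<^bsub>C\<^esub> i = Idn C X \<and> e = i \<star>\<^bsub>C\<^esub> p)"

definition arrow_number :: "('o, 'm, 'k, 'z) lcat_scheme \<Rightarrow> 'o \<Rightarrow> 'o set \<Rightarrow> 'o set \<Rightarrow> nat" where
  "arrow_number C T x y =
    (let A = End C T; J = jacobson_radical A;
         e = summand_idempotent C T x; f = summand_idempotent C T y
     in quot_dim A ((\<lambda>r. f \<otimes>\<^bsub>A\<^esub> (r \<otimes>\<^bsub>A\<^esub> e)) ` J) ((\<lambda>r. f \<otimes>\<^bsub>A\<^esub> (r \<otimes>\<^bsub>A\<^esub> e)) ` (ideal_prod A J J)))"

definition quiver_vertices :: "('o, 'm, 'k, 'z) lcat_scheme \<Rightarrow> 'o \<Rightarrow> 'o set set" where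
  "quiver_vertices C T = iso_class C ` ind_summands C T"

definition end_quiver ::
  "('o, 'm, 'k, 'z) lcat_scheme \<Rightarrow> 'o \<Rightarrow> ('o set, 'o set \<times> 'o set \<times> nat) pre_digraph" where
  "end_quiver C T =
    \<lparr>verts = quiver_vertices C T,
     arcs = {(x, y, n). x \<in> quiver_vertices C T \<and> y \<in> quiver_vertices C T \<and> n < arrow_number C T x y},
     tail = (\<lambda>(x, y, n). x), head = (\<lambda>(x, y, n). y)\<rparr>"

definition no_loops_or_2cycles :: "('v, 'a) pre_digraph \<Rightarrow> bool" where
  "no_loops_or_2cycles Q \<longleftrightarrow> (\<forall>a\<in>arcs Q. tail Q a \<noteq> head Q a) \<and>
    \<not> (\<exists>a\<in>arcs Q. \<exists>b\<in>arcs Q. a \<noteq> b \<and> head Q a = tail Q b \<and> head Q b = tail Q a)"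

definition oriented_cycles :: "nat \<Rightarrow> nat \<Rightarrow> (nat \<times> nat, nat \<times> nat) pre_digraph" where
  "oriented_cycles r l =
    \<lparr>verts = {..<r} \<times> {..<l}, arcs = {..<r} \<times> {..<l},
     tail = (\<lambda>a. a), head = (\<lambda>(i, j). (i, Suc j mod l))\<rparr>"


section \<open>Path algebras and Jacobian algebras\<close>

text \<open>
  A path is its start vertex together with the list of its arrows in order of traversal.
  In accordance with composition of maps, the product \<open>p * q\<close> of two paths is \<open>q\<close> followed by \<open>p\<close>.
  The complete path algebra consists of all functions on the set of paths.
\<close>

definition paths :: "('v, 'a) pre_digraph \<Rightarrow> ('v \<times> 'a list) set" where
  "paths Q = {(u, p). \<exists>v. pre_digraph.awalk Q u p v}"

abbreviation path_end :: "('v, 'a) pre_digraph \<Rightarrow> 'v \<Rightarrow> 'a list \<Rightarrow> 'v" where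
  "path_end Q u p \<equiv> pre_digraph.awlast Q u p"

definition complete_path_algebra ::
  "('v, 'a) pre_digraph \<Rightarrow> ('k::field, ('v \<times> 'a list) \<Rightarrow> 'k) module" where
  "complete_path_algebra Q =
    \<lparr>carrier = {f. \<forall>w. w \<notin> paths Q \<longrightarrow> f w = 0},
     monoid.mult = (\<lambda>f g (u, p). \<Sum>i\<le>length p. f (path_end Q u (take i p), drop i p) * g (u, take i p)),
     one = (\<lambda>(u, p). if u \<in> verts Q \<and> p = [] then 1 else 0),
     ring.zero = (\<lambda>w. 0), add = (\<lambda>f g w. f w + g w), module.smult = (\<lambda>c f w. c * f w)\<rparr>"

definition path_algebra ::
  "('v, 'a) pre_digraph \<Rightarrow> ('k::field, ('v \<times> 'a list) \<Rightarrow> 'k) module" where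
  "path_algebra Q = (complete_path_algebra Q)
    \<lparr>carrier := {f. (\<forall>w. w \<notin> paths Q \<longrightarrow> f w = 0) \<and> finite {w. f w \<noteq> 0}}\<rparr>"

definition path_element :: "('v \<times> 'a list) \<Rightarrow> ('v \<times> 'a list) \<Rightarrow> 'k::field" where
  "path_element w = (\<lambda>w'. if w' = w then 1 else 0)"

text \<open>A possibly infinite linear combination of oriented cycles of positive length.\<close>

definition potential :: "('v, 'a) pre_digraph \<Rightarrow> (('v \<times> 'a list) \<Rightarrow> 'k::field) \<Rightarrow> bool" where
  "potential Q P \<longleftrightarrow>
    (\<forall>u p. P (u, p) \<noteq> 0 \<longrightarrow> (u, p) \<in> paths Q \<and> p \<noteq> [] \<and> path_end Q u p = u)"

text \<open>
  The cyclic derivative with respect to \<open>a\<close> is the continuous linear map sending a cycle \<open>c\<close> to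
  the sum of the paths \<open>x @ y\<close> over all decompositions \<open>c = y @ [a] @ x\<close>.
  Below, \<open>x = take i p\<close> and \<open>y = drop i p\<close>.
\<close>

definition cyclic_derivative ::
  "('v, 'a) pre_digraph \<Rightarrow> 'a \<Rightarrow> (('v \<times> 'a list) \<Rightarrow> 'k::field) \<Rightarrow> ('v \<times> 'a list) \<Rightarrow> 'k" where
  "cyclic_derivative Q a P = (\<lambda>(u, p).
    if (u, p) \<in> paths Q \<and> u = head Q a \<and> path_end Q u p = tail Q a
    then \<Sum>i\<le>length p. P (path_end Q u (take i p), drop i p @ [a] @ take i p)
    else 0)"

text \<open>
  The Jacobian ideal is the closure, with respect to the arrow ideal, of the two-sided ideal
  generated by the cyclic derivatives of \<open>P\<close>.
\<close>

definition jacobian_ideal ::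
  "('v, 'a) pre_digraph \<Rightarrow> (('v \<times> 'a list) \<Rightarrow> 'k::field) \<Rightarrow> (('v \<times> 'a list) \<Rightarrow> 'k) set" where
  "jacobian_ideal Q P =
    {f \<in> carrier (complete_path_algebra Q). \<forall>n.
      \<exists>g \<in> genideal (complete_path_algebra Q) ((\<lambda>a. cyclic_derivative Q a P) ` arcs Q).
        \<forall>u p. length p < n \<longrightarrow> f (u, p) = g (u, p)}"

definition quot_algebra_iso ::
  "('k, 'a) module \<Rightarrow> 'a set \<Rightarrow> ('k, 'b) module \<Rightarrow> bool" where
  "quot_algebra_iso R I A \<longleftrightarrow> (\<exists>h\<in>ring_iso (R Quot I) A. \<forall>c. \<forall>x\<in>carrier R.
     h (I +>\<^bsub>R\<^esub> (c \<odot>\<^bsub>R\<^esub> x)) = c \<odot>\<^bsub>A\<^esub> h (I +>\<^bsub>R\<^esub> x))"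

definition given_by_potential :: "('v, 'a) pre_digraph \<Rightarrow> ('k::field, 'b) module \<Rightarrow> bool" where
  "given_by_potential Q A \<longleftrightarrow>
    (\<exists>P. potential Q P \<and> quot_algebra_iso (complete_path_algebra Q) (jacobian_ideal Q P) A)"

text \<open>
  For \<open>n \<ge> 2\<close> the paths of length \<open>n\<close> are automatically a minimal set of relations: none of
  them lies in the ideal generated by the others.
\<close>

definition given_by_paths_of_length :: "nat \<Rightarrow> ('v, 'a) pre_digraph \<Rightarrow> ('k::field, 'b) module \<Rightarrow> bool"
where
  "given_by_paths_of_length n Q A \<longleftrightarrow>
    quot_algebra_iso (path_algebra Q)
      (genideal (path_algebra Q) {path_element (u, p) | u p. (u, p) \<in> paths Q \<and> length p = n}) A"


section \<open>Galois coverings\<close>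

text \<open>
  The direct sum of the spaces \<open>Hom(X, Y)\<close> (resp. \<open>Hom(Y, X)\<close>) over \<open>Y \<in> R\<close>, as finitely
  supported families.
\<close>

definition fam_out :: "('o, 'm, 'k, 'z) lcat_scheme \<Rightarrow> 'o \<Rightarrow> 'o set \<Rightarrow> ('o \<Rightarrow> 'm) set" where
  "fam_out C X R = {u \<in> (\<Pi>\<^sub>E Y\<in>R. Hom C X Y). finite {Y \<in> R. u Y \<noteq> Zro C X Y}}"

definition fam_in :: "('o, 'm, 'k, 'z) lcat_scheme \<Rightarrow> 'o \<Rightarrow> 'o set \<Rightarrow> ('o \<Rightarrow> 'm) set" where
  "fam_in C X R = {u \<in> (\<Pi>\<^sub>E Y\<in>R. Hom C Y X). finite {Y \<in> R. u Y \<noteq> Zro C Y X}}"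

text \<open>
  \<open>R\<close> represents the isomorphism classes of objects \<open>Y\<close> with \<open>F Y\<close> isomorphic to \<open>A\<close>, and
  \<open>\<phi> Y\<close>, \<open>\<psi> Y\<close> are the mutually inverse isomorphisms identifying \<open>F Y\<close> with \<open>A\<close>.
\<close>

definition covering_functor ::
  "('o, 'm, 'k, 'y) lcat_scheme \<Rightarrow> ('p, 'n, 'k, 'z) lcat_scheme \<Rightarrow> ('o, 'm, 'p, 'n) func \<Rightarrow> bool"
where
  "covering_functor C D F \<longleftrightarrow> linear_functor C D F \<and>
    (\<forall>A. indecomposable D A \<longrightarrow>
      (\<exists>R \<phi> \<psi>. R \<subseteq> {Y \<in> Obj C. isomorphic D (fob F Y) A} \<and>
        (\<forall>Y\<in>Obj C. isomorphic D (fob F Y) A \<longrightarrow> (\<exists>!Z. Z \<in> R \<and> isomorphic C Y Z)) \<and>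
        (\<forall>Y\<in>R. iso_pair D (fob F Y) A (\<phi> Y) (\<psi> Y)) \<and>
        (\<forall>X\<in>Obj C.
          bij_betw (\<lambda>u. finsum (hom_mod D (fob F X) A) (\<lambda>Y. \<phi> Y \<star>\<^bsub>D\<^esub> fmor F (u Y))
                     {Y \<in> R. u Y \<noteq> Zro C X Y})
            (fam_out C X R) (Hom D (fob F X) A) \<and>
          bij_betw (\<lambda>u. finsum (hom_mod D A (fob F X)) (\<lambda>Y. fmor F (u Y) \<star>\<^bsub>D\<^esub> \<psi> Y)
                     {Y \<in> R. u Y \<noteq> Zro C Y X})
            (fam_in C X R) (Hom D A (fob F X)))))"

definition acts_by_automorphisms ::
  "('g, 'r) monoid_scheme \<Rightarrow> ('o, 'm, 'k, 'z) lcat_scheme \<Rightarrow> ('g \<Rightarrow> ('o, 'm, 'o, 'm) func) \<Rightarrow> bool"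
where
  "acts_by_automorphisms G C \<rho> \<longleftrightarrow> group G \<and>
    (\<forall>g\<in>carrier G. linear_automorphism C (\<rho> g)) \<and>
    (\<forall>X\<in>Obj C. fob (\<rho> \<one>\<^bsub>G\<^esub>) X = X) \<and> (\<forall>f\<in>Arr C. fmor (\<rho> \<one>\<^bsub>G\<^esub>) f = f) \<and>
    (\<forall>g\<in>carrier G. \<forall>h\<in>carrier G.
       (\<forall>X\<in>Obj C. fob (\<rho> (g \<otimes>\<^bsub>G\<^esub> h)) X = fob (\<rho> g) (fob (\<rho> h) X)) \<and>
       (\<forall>f\<in>Arr C. fmor (\<rho> (g \<otimes>\<^bsub>G\<^esub> h)) f = fmor (\<rho> g) (fmor (\<rho> h) f)))"

text \<open>
  In an additive category, free actions and transitivity on fibres only make sense for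
  indecomposable objects: the zero object is always fixed up to isomorphism, and
  \<open>X \<oplus> Y\<close> and \<open>X \<oplus> g Y\<close> have the same image. A fibre consists of the objects whose image
  lies in a given isomorphism class.
\<close>

definition acts_freely ::
  "('g, 'r) monoid_scheme \<Rightarrow> ('o, 'm, 'k, 'z) lcat_scheme \<Rightarrow> ('g \<Rightarrow> ('o, 'm, 'o, 'm) func) \<Rightarrow> bool"
where
  "acts_freely G C \<rho> \<longleftrightarrow>
    (\<forall>g\<in>carrier G. \<forall>X. g \<noteq> \<one>\<^bsub>G\<^esub> \<and> indecomposable C X \<longrightarrow> \<not> isomorphic C (fob (\<rho> g) X) X)"

definition acts_locally_boundedly ::
  "('g, 'r) monoid_scheme \<Rightarrow> ('o, 'm, 'k, 'z) lcat_scheme \<Rightarrow> ('g \<Rightarrow> ('o, 'm, 'o, 'm) func) \<Rightarrow> bool"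
where
  "acts_locally_boundedly G C \<rho> \<longleftrightarrow> (\<forall>X\<in>Obj C. \<forall>Y\<in>Obj C.
    finite {g \<in> carrier G. Hom C X (fob (\<rho> g) Y) \<noteq> {Zro C X (fob (\<rho> g) Y)}})"

definition galois_covering ::
  "('g, 'r) monoid_scheme \<Rightarrow> ('g \<Rightarrow> ('o, 'm, 'o, 'm) func) \<Rightarrow>
   ('o, 'm, 'k, 'y) lcat_scheme \<Rightarrow> ('p, 'n, 'k, 'z) lcat_scheme \<Rightarrow> ('o, 'm, 'p, 'n) func \<Rightarrow> bool"
where
  "galois_covering G \<rho> C D F \<longleftrightarrow>
    acts_by_automorphisms G C \<rho> \<and> acts_freely G C \<rho> \<and> acts_locally_boundedly G C \<rho> \<and>
    covering_functor C D F \<and>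
    (\<forall>g\<in>carrier G. (\<forall>X\<in>Obj C. fob F (fob (\<rho> g) X) = fob F X) \<and>
                   (\<forall>f\<in>Arr C. fmor F (fmor (\<rho> g) f) = fmor F f)) \<and>
    (\<forall>A\<in>Obj D. \<exists>X\<in>Obj C. isomorphic D (fob F X) A) \<and>
    (\<forall>A. indecomposable D A \<longrightarrow> (\<forall>X\<in>Obj C. \<forall>Y\<in>Obj C.
       isomorphic D (fob F X) A \<and> isomorphic D (fob F Y) A \<longrightarrow>
       (\<exists>g\<in>carrier G. isomorphic C (fob (\<rho> g) X) Y)))"

definition is_lift ::
  "('o, 'm, 'k, 'y) lcat_scheme \<Rightarrow> ('p, 'n, 'k, 'z) lcat_scheme \<Rightarrow> ('o, 'm, 'p, 'n) func \<Rightarrow>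
   'p \<Rightarrow> 'o \<Rightarrow> bool" where
  "is_lift C D F Y L \<longleftrightarrow>
    (\<exists>S. (\<forall>X\<in>S. indecomposable C X \<and> summand D (fob F X) Y) \<and>
         (\<forall>X. indecomposable C X \<and> summand D (fob F X) Y \<longrightarrow> (\<exists>!Z. Z \<in> S \<and> isomorphic C X Z)) \<and>
         dsum C L S (\<lambda>X. X))"

text \<open>
  The action of \<open>G\<close> on the quiver of an endomorphism algebra. On vertices it is
  \<open>[X] \<mapsto> [g X]\<close>. As it is free on vertices, the bases representing the arrows can be chosen
  to be permuted by \<open>G\<close>, transporting them along each orbit of pairs of vertices; hence
  \<open>g\<close> sends the \<open>n\<close>-th arrow from \<open>x\<close> to \<open>y\<close> to the \<open>n\<close>-th arrow from \<open>g x\<close> to \<open>g y\<close>.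
\<close>

definition vertex_action ::
  "('o, 'm, 'k, 'z) lcat_scheme \<Rightarrow> ('g \<Rightarrow> ('o, 'm, 'o, 'm) func) \<Rightarrow> 'g \<Rightarrow> 'o set \<Rightarrow> 'o set" where
  "vertex_action C \<rho> g x = (\<Union>X\<in>x. iso_class C (fob (\<rho> g) X))"

definition arrow_action ::
  "('o, 'm, 'k, 'z) lcat_scheme \<Rightarrow> ('g \<Rightarrow> ('o, 'm, 'o, 'm) func) \<Rightarrow> 'g \<Rightarrow>
   'o set \<times> 'o set \<times> nat \<Rightarrow> 'o set \<times> 'o set \<times> nat" where
  "arrow_action C \<rho> g = (\<lambda>(x, y, n). (vertex_action C \<rho> g x, vertex_action C \<rho> g y, n))"

definition orbit_quiver ::
  "('g, 'r) monoid_scheme \<Rightarrow> ('g \<Rightarrow> 'v \<Rightarrow> 'v) \<Rightarrow> ('g \<Rightarrow> 'a \<Rightarrow> 'a) \<Rightarrow> ('v, 'a) pre_digraph \<Rightarrow>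
   ('v set, 'a set) pre_digraph" where
  "orbit_quiver G va aa Q =
    \<lparr>verts = orbits G (verts Q) va, arcs = orbits G (arcs Q) aa,
     tail = (\<lambda>\<alpha>. tail Q ` \<alpha>), head = (\<lambda>\<alpha>. head Q ` \<alpha>)\<rparr>"

definition quiver_iso_over ::
  "('v \<Rightarrow> 'w) \<Rightarrow> ('v, 'a) pre_digraph \<Rightarrow> ('w, 'b) pre_digraph \<Rightarrow> bool" where
  "quiver_iso_over b Q Q' \<longleftrightarrow> (\<exists>h. pre_digraph.digraph_isomorphism Q h \<and> Q' = app_iso h Q \<and>
    (\<forall>v\<in>verts Q. iso_verts h v = b v))"

text \<open>
  The map from \<open>G\<close>-orbits of isomorphism classes of objects to isomorphism classes of objects
  induced by a \<open>G\<close>-invariant functor.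
\<close>

definition orbit_image ::
  "('p, 'n, 'k, 'z) lcat_scheme \<Rightarrow> ('o, 'm, 'p, 'n) func \<Rightarrow> 'o set set \<Rightarrow> 'p set" where
  "orbit_image D F v = (\<Union>x\<in>v. \<Union>X\<in>x. iso_class D (fob F X))"

end

theory Submission
  imports Defs
begin

text \<open>
  The theorem splits into a statement about coverings, which computes quivers, and a statement
  about triangulated categories, which identifies the indecomposable summands of the mutated
  objects.

  Coverings (\<open>quiver_of_image\<close>). Suppose that an indecomposable object is a summand
  of a given object upstairs exactly when its image is a summand of a given object downstairs. The
  arrows of the quiver of an endomorphism algebra are counted by the quotients of the radical by
  its square, taken inside the category of summands. A covering functor decomposes the maps from
  the image of \<open>X\<close> to an indecomposable object \<open>A\<close> into maps from
  \<open>X\<close> to the objects in the fibre of \<open>A\<close>, and this decomposition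
  respects the radical and its square. So the arrows from the image of \<open>X\<close> to
  \<open>A\<close> are as many as the arrows from \<open>X\<close> to all members of the fibre.
  The group acts freely on vertices and transitively on fibres, so these numbers count the orbits
  of arrows, and the quiver downstairs is the orbit quiver.

  Mutation (\<open>summands_of_mutation\<close>). It remains to verify the assumption of the first
  part for the mutated objects. The two complements exchanged by the mutation have the property
  that every map from the old one to the new one factors through the additive closure of the
  common part (\<open>exchange\<close>). With this, a map from the image of
  \<open>T\<^sub>m\<langle>1\<rangle>\<close> to the shift of the new cluster-tilting object is
  seen to vanish, so that image lies in its additive closure. Conversely, if the image of
  \<open>X\<close> is the new complement, the cocone of an approximation of \<open>X\<close> by
  \<open>T\<^sub>f\<close> turns out to have only summands of \<open>T\<^sub>m\<close> and
  \<open>T\<^sub>f\<close>. Comparison with the triangle that defines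
  \<open>T\<^sub>m\<langle>1\<rangle>\<close> then exhibits \<open>X\<close> as one of its
  summands.

  Both parts need that the covering functor kills no indecomposable object
  (\<open>indec_not_killed\<close>). An object that is killed is a summand of both
  \<open>T\<^sub>m\<close> and \<open>T\<^sub>f\<close>, so its idempotent vanishes modulo the
  maps through \<open>add T\<^sub>f\<close>. But the presentation of the endomorphism algebra of
  \<open>T\<^sub>m\<close> modulo these maps by paths of positive length provides as many algebra
  homomorphisms to the ground field as \<open>T\<^sub>m\<close> has indecomposable summands, and
  only a summand with nonzero idempotent can carry one.
\<close>

section \<open>Dimensions of quotient spaces\<close>

text \<open>
  The elimination argument that makes dimensions well defined and that bounds the size of
  independent families.
\<close>

lemma underdetermined_system:
  fixes a :: "'i \<Rightarrow> 'j \<Rightarrow> 'k::field"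
  assumes "finite J" "finite I" "card J < card I"
  shows "\<exists>c. (\<exists>i\<in>I. c i \<noteq> 0) \<and> (\<forall>j\<in>J. (\<Sum>i\<in>I. c i * a i j) = 0)"
  using assms
proof (induction J arbitrary: I a rule: finite_induct)
  case empty
  then have "I \<noteq> {}" by auto
  then show ?case by (intro exI[of _ "\<lambda>_. 1"]) auto
next
  case (insert j J)
  show ?case
  proof (cases "\<forall>i\<in>I. a i j = 0")
    case True
    have "card J < card I" using insert by auto
    then obtain c where c: "\<exists>i\<in>I. c i \<noteq> 0" "\<forall>j\<in>J. (\<Sum>i\<in>I. c i * a i j) = 0"
      using insert.IH[OF insert.prems(1)] by blast
    then show ?thesis using True by (intro exI[of _ c]) auto
  next
    case False
    then obtain i0 where i0: "i0 \<in> I" "a i0 j \<noteq> 0" by blast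
    \<comment> \<open>Eliminate the unknown with index \<open>i0\<close> by means of the equation with index \<open>j\<close>.\<close>
    let ?I = "I - {i0}"
    let ?a = "\<lambda>i j'. a i j' - a i j / a i0 j * a i0 j'"
    have "card J < card ?I" using insert i0 by (simp add: card_Diff_singleton)
    moreover have fI: "finite ?I" using insert.prems by auto
    ultimately obtain c where c: "\<exists>i\<in>?I. c i \<noteq> 0" "\<forall>j'\<in>J. (\<Sum>i\<in>?I. c i * ?a i j') = 0"
      using insert.IH[of ?I ?a] by blast
    define s where "s = (\<Sum>i\<in>?I. c i * a i j)"
    define d where "d = c(i0 := - s / a i0 j)"
    have split: "(\<Sum>i\<in>I. d i * a i j') = - s / a i0 j * a i0 j' + (\<Sum>i\<in>?I. c i * a i j')" for j'
    proof -
      have "(\<Sum>i\<in>I. d i * a i j') = d i0 * a i0 j' + (\<Sum>i\<in>?I. d i * a i j')"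
        using insert.prems i0 by (simp add: sum.remove)
      also have "(\<Sum>i\<in>?I. d i * a i j') = (\<Sum>i\<in>?I. c i * a i j')"
        by (intro sum.cong) (auto simp: d_def)
      finally show ?thesis by (simp add: d_def)
    qed
    have "(\<Sum>i\<in>I. d i * a i j') = 0" if "j' \<in> insert j J" for j'
    proof (cases "j' = j")
      case True
      then show ?thesis using split[of j] i0 by (simp add: s_def)
    next
      case False
      then have "(\<Sum>i\<in>?I. c i * ?a i j') = 0" using c that by auto
      moreover have "(\<Sum>i\<in>?I. c i * ?a i j') =
          (\<Sum>i\<in>?I. c i * a i j') - (\<Sum>i\<in>?I. c i * a i j * (a i0 j' / a i0 j))"
        by (simp add: sum_subtractf [symmetric] algebra_simps)
      moreover have "(\<Sum>i\<in>?I. c i * a i j * (a i0 j' / a i0 j)) = s * (a i0 j' / a i0 j)"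
        by (simp add: s_def sum_distrib_right sum_divide_distrib)
      ultimately show ?thesis using split[of j'] by (simp add: algebra_simps)
    qed
    moreover have "\<exists>i\<in>I. d i \<noteq> 0" using c i0 by (auto simp: d_def)
    ultimately show ?thesis by blast
  qed
qed

locale kspace =
  fixes M :: "('k::field, 'm) module" (structure)
  assumes is_module: "Module.module (ring_of_type_algebra :: 'k ring) M"
begin

sublocale module "ring_of_type_algebra :: 'k ring" M
  by (rule is_module)

lemma sm_closed [simp, intro]: "x \<in> carrier M \<Longrightarrow> (c::'k) \<odot> x \<in> carrier M"
  using smult_closed by (simp add: ring_of_type_algebra_def)

lemma sm_add_left: "x \<in> carrier M \<Longrightarrow> (a + b) \<odot> x = a \<odot> x \<oplus> b \<odot> x"
  using smult_l_distr[of a b x] by (simp add: ring_of_type_algebra_def)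

lemma sm_add_right: "x \<in> carrier M \<Longrightarrow> y \<in> carrier M \<Longrightarrow> a \<odot> (x \<oplus> y) = a \<odot> x \<oplus> a \<odot> y"
  using smult_r_distr[of a x y] by (simp add: ring_of_type_algebra_def)

lemma sm_mult: "x \<in> carrier M \<Longrightarrow> (a * b) \<odot> x = a \<odot> (b \<odot> x)"
  using smult_assoc1[of a b x] by (simp add: ring_of_type_algebra_def)

lemma sm_one [simp]: "x \<in> carrier M \<Longrightarrow> 1 \<odot> x = x"
  using smult_one[of x] by (simp add: ring_of_type_algebra_def)

lemma sm_zero [simp]: "x \<in> carrier M \<Longrightarrow> 0 \<odot> x = \<zero>"
  using smult_l_null[of x] by (simp add: ring_of_type_algebra_def)

lemma sm_null [simp]: "(a::'k) \<odot> \<zero> = \<zero>"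
  using smult_r_null[of a] by (simp add: ring_of_type_algebra_def)

lemma sm_minus: "x \<in> carrier M \<Longrightarrow> (- a) \<odot> x = \<ominus> (a \<odot> x)"
  by (metis M.minus_equality add.left_inverse sm_add_left sm_closed sm_zero)

lemma sm_minus_one: "x \<in> carrier M \<Longrightarrow> (- 1) \<odot> x = \<ominus> x"
  by (simp add: sm_minus)

lemma neg_cancel: "x \<in> carrier M \<Longrightarrow> y \<in> carrier M \<Longrightarrow> x \<oplus> (\<ominus> x \<oplus> y) = y"
  by (metis M.a_assoc M.a_inv_closed M.l_zero M.r_neg)

lemma neg_cancel': "x \<in> carrier M \<Longrightarrow> y \<in> carrier M \<Longrightarrow> \<ominus> x \<oplus> (x \<oplus> y) = y"
  by (metis M.a_assoc M.a_inv_closed M.l_zero M.l_neg)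

lemmas ab = M.a_ac M.minus_eq M.minus_add neg_cancel neg_cancel' M.r_neg M.l_neg

definition lincomb :: "'i set \<Rightarrow> ('i \<Rightarrow> 'k) \<Rightarrow> ('i \<Rightarrow> 'm) \<Rightarrow> 'm" where
  "lincomb I c b = (\<Oplus>i\<in>I. c i \<odot> b i)"

definition vsubspace :: "'m set \<Rightarrow> bool" where
  "vsubspace V \<longleftrightarrow> V \<subseteq> carrier M \<and> \<zero> \<in> V \<and> (\<forall>x\<in>V. \<forall>y\<in>V. x \<oplus> y \<in> V) \<and> (\<forall>c. \<forall>x\<in>V. c \<odot> x \<in> V)"

lemma vsubspaceD:
  assumes "vsubspace V"
  shows "x \<in> V \<Longrightarrow> x \<in> carrier M" "\<zero> \<in> V" "x \<in> V \<Longrightarrow> y \<in> V \<Longrightarrow> x \<oplus> y \<in> V" "x \<in> V \<Longrightarrow> c \<odot> x \<in> V"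
    "x \<in> V \<Longrightarrow> \<ominus> x \<in> V" "x \<in> V \<Longrightarrow> y \<in> V \<Longrightarrow> x \<ominus> y \<in> V"
proof -
  show *: "x \<in> V \<Longrightarrow> x \<in> carrier M" "\<zero> \<in> V" "x \<in> V \<Longrightarrow> y \<in> V \<Longrightarrow> x \<oplus> y \<in> V" "x \<in> V \<Longrightarrow> c \<odot> x \<in> V" for x y c
    using assms unfolding vsubspace_def by auto
  show **: "x \<in> V \<Longrightarrow> \<ominus> x \<in> V" for x
    using *(4)[of x "-1"] *(1) by (simp add: sm_minus_one)
  show "x \<in> V \<Longrightarrow> y \<in> V \<Longrightarrow> x \<ominus> y \<in> V"
    using * ** by (simp add: M.minus_eq)
qed

lemma vsubspace_zero: "vsubspace {\<zero>}" and vsubspace_carrier: "vsubspace (carrier M)"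
  by (auto simp: vsubspace_def)

lemma vsubspace_finsum:
  assumes "vsubspace V" "finite I" "\<And>i. i \<in> I \<Longrightarrow> f i \<in> V"
  shows "finsum M f I \<in> V"
  using assms(2,3)
proof (induction I rule: finite_induct)
  case empty
  then show ?case using assms(1) by (simp add: vsubspaceD)
next
  case (insert x F)
  then have "f \<in> F \<rightarrow> carrier M" "f x \<in> carrier M" using vsubspaceD(1)[OF assms(1)] by auto
  with insert show ?case by (simp add: vsubspaceD[OF assms(1)])
qed

lemma lincomb_closed [simp]: "(\<And>i. i \<in> I \<Longrightarrow> b i \<in> carrier M) \<Longrightarrow> lincomb I c b \<in> carrier M"
  unfolding lincomb_def by (rule M.finsum_closed) auto

lemma lincomb_empty [simp]: "lincomb {} c b = \<zero>"
  by (simp add: lincomb_def)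

lemma lincomb_insert:
  "finite I \<Longrightarrow> i \<notin> I \<Longrightarrow> b \<in> insert i I \<rightarrow> carrier M \<Longrightarrow>
    lincomb (insert i I) c b = c i \<odot> b i \<oplus> lincomb I c b"
  unfolding lincomb_def by (rule M.finsum_insert) auto

lemma lincomb_cong:
  assumes "I = I'" "\<And>i. i \<in> I' \<Longrightarrow> c i = c' i" "\<And>i. i \<in> I' \<Longrightarrow> b i = b' i"
    and "\<And>i. i \<in> I' \<Longrightarrow> b' i \<in> carrier M"
  shows "lincomb I c b = lincomb I' c' b'"
  unfolding lincomb_def using assms by (intro M.finsum_cong') auto

lemma lincomb_add:
  assumes "finite I" "b \<in> I \<rightarrow> carrier M"
  shows "lincomb I (\<lambda>i. c i + d i) b = lincomb I c b \<oplus> lincomb I d b"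
  using assms
proof (induction I rule: finite_induct)
  case (insert x F)
  then have "b x \<in> carrier M" "\<And>c. lincomb F c b \<in> carrier M" by (auto intro!: lincomb_closed)
  with insert show ?case by (simp add: lincomb_insert sm_add_left M.a_ac)
qed simp

lemma lincomb_smult:
  assumes "finite I" "b \<in> I \<rightarrow> carrier M"
  shows "lincomb I (\<lambda>i. a * c i) b = a \<odot> lincomb I c b"
  using assms
proof (induction I rule: finite_induct)
  case (insert x F)
  then have "b x \<in> carrier M" "\<And>c. lincomb F c b \<in> carrier M" by (auto intro!: lincomb_closed)
  with insert show ?case by (simp add: lincomb_insert sm_add_right sm_mult)
qed simp

lemma lincomb_zero: "(\<And>i. i \<in> I \<Longrightarrow> c i = 0) \<Longrightarrow> (\<And>i. i \<in> I \<Longrightarrow> b i \<in> carrier M) \<Longrightarrow> lincomb I c b = \<zero>"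
  unfolding lincomb_def by (rule M.add.finprod_one_eqI) auto

lemma lincomb_uminus:
  assumes "finite I" "b \<in> I \<rightarrow> carrier M"
  shows "lincomb I (\<lambda>i. - c i) b = \<ominus> lincomb I c b"
  using lincomb_smult[OF assms, of "-1" c] assms by (simp add: Pi_iff sm_minus_one)

lemma lincomb_diff:
  assumes "finite I" "b \<in> I \<rightarrow> carrier M"
  shows "lincomb I (\<lambda>i. c i - d i) b = lincomb I c b \<ominus> lincomb I d b"
  using lincomb_add[OF assms, of c "\<lambda>i. - d i"] lincomb_uminus[OF assms, of d]
  by (simp add: M.minus_eq)

lemma lincomb_delta:
  assumes "finite I" "i \<in> I" "b \<in> I \<rightarrow> carrier M"
  shows "lincomb I (\<lambda>j. if j = i then 1 else 0) b = b i"
proof -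
  have "I = insert i (I - {i})" using assms by auto
  then have "lincomb I (\<lambda>j. if j = i then 1 else 0) b
      = lincomb (insert i (I - {i})) (\<lambda>j. if j = i then 1 else 0) b" by simp
  also have "\<dots> = b i \<oplus> lincomb (I - {i}) (\<lambda>j. if j = i then 1 else 0) b"
    using assms by (subst lincomb_insert) (auto simp: Pi_iff)
  also have "lincomb (I - {i}) (\<lambda>j. if j = i then 1 else 0) b = \<zero>"
    using assms by (intro lincomb_zero) auto
  also have "b i \<oplus> \<zero> = b i" using assms by (auto simp: Pi_iff)
  finally show ?thesis .
qed

lemma lincomb_lincomb:
  assumes "finite I" "finite J" "e \<in> J \<rightarrow> carrier M"
  shows "lincomb I c (\<lambda>i. lincomb J (a i) e) = lincomb J (\<lambda>j. \<Sum>i\<in>I. c i * a i j) e"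
  using assms(1)
proof (induction I rule: finite_induct)
  case empty
  then show ?case using assms by (subst lincomb_zero) (auto simp: Pi_iff)
next
  case (insert x F)
  have cl: "lincomb J f e \<in> carrier M" for f using assms by (auto simp: Pi_iff)
  show ?case using insert assms cl
    by (simp add: lincomb_insert lincomb_add[OF assms(2,3)] lincomb_smult[OF assms(2,3)])
qed

lemma lincomb_add_vec:
  assumes "finite I" "b \<in> I \<rightarrow> carrier M" "b' \<in> I \<rightarrow> carrier M"
  shows "lincomb I c (\<lambda>i. b i \<oplus> b' i) = lincomb I c b \<oplus> lincomb I c b'"
  unfolding lincomb_def
  using assms by (simp add: sm_add_right Pi_iff M.finsum_addf cong: M.finsum_cong)

lemma vsubspace_lincomb:
  "vsubspace V \<Longrightarrow> finite I \<Longrightarrow> (\<And>i. i \<in> I \<Longrightarrow> b i \<in> V) \<Longrightarrow> lincomb I c b \<in> V"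
  unfolding lincomb_def by (rule vsubspace_finsum) (auto dest: vsubspaceD)

text \<open>
  Bases of \<open>V / W\<close> are indexed by arbitrary finite sets, because the bases of several
  spaces are to be glued.
\<close>

definition independent_mod :: "'m set \<Rightarrow> 'i set \<Rightarrow> ('i \<Rightarrow> 'm) \<Rightarrow> bool" where
  "independent_mod W I b \<longleftrightarrow> (\<forall>c. lincomb I c b \<in> W \<longrightarrow> (\<forall>i\<in>I. c i = 0))"

definition qbasis :: "'m set \<Rightarrow> 'm set \<Rightarrow> 'i set \<Rightarrow> ('i \<Rightarrow> 'm) \<Rightarrow> bool" where
  "qbasis V W I b \<longleftrightarrow> finite I \<and> b \<in> I \<rightarrow> V \<and> (\<forall>v\<in>V. \<exists>c. v \<ominus> lincomb I c b \<in> W) \<and> independent_mod W I b"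

lemma qbasisD:
  assumes "qbasis V W I b"
  shows "finite I" "i \<in> I \<Longrightarrow> b i \<in> V" "v \<in> V \<Longrightarrow> \<exists>c. v \<ominus> lincomb I c b \<in> W"
    "lincomb I c b \<in> W \<Longrightarrow> i \<in> I \<Longrightarrow> c i = 0"
  using assms unfolding qbasis_def independent_mod_def by blast+

lemma steinitz:
  assumes W: "vsubspace W" and I: "finite I" "b \<in> I \<rightarrow> carrier M" and J: "finite J" "e \<in> J \<rightarrow> carrier M"
    and sp: "\<And>i. i \<in> I \<Longrightarrow> \<exists>a. b i \<ominus> lincomb J a e \<in> W" and ind: "independent_mod W I b"
  shows "card I \<le> card J"
proof (rule ccontr)
  assume "\<not> card I \<le> card J"
  then have less: "card J < card I" by simp
  from sp obtain a where a: "\<And>i. i \<in> I \<Longrightarrow> b i \<ominus> lincomb J (a i) e \<in> W" by metis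
  obtain c where c: "\<exists>i\<in>I. c i \<noteq> 0" "\<forall>j\<in>J. (\<Sum>i\<in>I. c i * a i j) = 0"
    using underdetermined_system[OF J(1) I(1) less] by blast
  have cl: "lincomb J f e \<in> carrier M" for f using J by (auto simp: Pi_iff)
  have "lincomb I c b = lincomb I c (\<lambda>i. (b i \<ominus> lincomb J (a i) e) \<oplus> lincomb J (a i) e)"
  proof (rule lincomb_cong)
    fix i assume "i \<in> I"
    then have "b i \<in> carrier M" using I by auto
    then show "b i = b i \<ominus> lincomb J (a i) e \<oplus> lincomb J (a i) e"
      using cl by (simp add: ab)
    then show "b i \<ominus> lincomb J (a i) e \<oplus> lincomb J (a i) e \<in> carrier M"
      using \<open>b i \<in> carrier M\<close> by simp
  qed auto
  also have "\<dots> = lincomb I c (\<lambda>i. b i \<ominus> lincomb J (a i) e) \<oplus> lincomb I c (\<lambda>i. lincomb J (a i) e)"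
    using I cl by (intro lincomb_add_vec) auto
  also have "lincomb I c (\<lambda>i. lincomb J (a i) e) = \<zero>"
    unfolding lincomb_lincomb[OF I(1) J] using c J by (intro lincomb_zero) auto
  finally have "lincomb I c b = lincomb I c (\<lambda>i. b i \<ominus> lincomb J (a i) e)"
    using I cl by (subst (asm) M.r_zero) (auto intro!: lincomb_closed)
  also have "\<dots> \<in> W" using a W I by (intro vsubspace_lincomb)
  finally show False using ind c unfolding independent_mod_def by blast
qed

lemma qbasis_card_unique:
  assumes W: "vsubspace W" "V \<subseteq> carrier M" and b: "qbasis V W I b" and b': "qbasis V W J e"
  shows "card I = card J"
  using steinitz[OF W(1), of I b J e] steinitz[OF W(1), of J e I b] assms
  unfolding qbasis_def by (intro le_antisym) (auto simp: Pi_iff subset_iff)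

lemma qbasis_imp_quot_basis:
  assumes W: "vsubspace W" "vsubspace V" and b: "qbasis V W I b"
  shows "quot_basis M V W (b ` I) \<and> card (b ` I) = card I"
proof -
  have fin: "finite I" and bV: "\<And>i. i \<in> I \<Longrightarrow> b i \<in> V"
    and sp: "\<And>v. v \<in> V \<Longrightarrow> \<exists>c. v \<ominus> lincomb I c b \<in> W"
    and ind: "\<And>c. lincomb I c b \<in> W \<Longrightarrow> (\<forall>i\<in>I. c i = 0)"
    using b unfolding qbasis_def independent_mod_def by auto
  have bM: "b \<in> I \<rightarrow> carrier M" using bV W vsubspaceD(1) by blast
  have inj: "inj_on b I"
  proof (rule inj_onI)
    fix i j assume ij: "i \<in> I" "j \<in> I" "b i = b j"
    let ?d = "\<lambda>i j. if j = i then 1 else (0::'k)"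
    have "lincomb I (\<lambda>l. ?d i l - ?d j l) b = b i \<ominus> b j"
      using ij fin bM by (simp add: lincomb_diff lincomb_delta)
    also have "\<dots> = \<zero>" using ij bM by (auto simp: M.r_neg M.minus_eq Pi_iff)
    also have "\<zero> \<in> W" using W by (simp add: vsubspaceD)
    finally have "?d i i - ?d j i = 0" using ind[of "\<lambda>l. ?d i l - ?d j l"] ij by blast
    then show "i = j" by (auto split: if_splits)
  qed
  have trans: "finsum M (\<lambda>x. c x \<odot> x) (b ` I) = lincomb I (c \<circ> b) b" for c
    unfolding lincomb_def using M.finsum_reindex[OF _ inj, of "\<lambda>x. c x \<odot> x"] bM by auto
  have "\<exists>!c. c \<in> b ` I \<rightarrow>\<^sub>E UNIV \<and> v \<ominus> finsum M (\<lambda>x. c x \<odot> x) (b ` I) \<in> W" if v: "v \<in> V" for v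
  proof -
    have vM: "v \<in> carrier M" using v W vsubspaceD(1) by blast
    obtain c where c: "v \<ominus> lincomb I c b \<in> W" using sp[OF v] by blast
    define d where "d = (\<lambda>x\<in>b ` I. c (the_inv_into I b x))"
    have dc: "lincomb I (d \<circ> b) b = lincomb I c b"
      using inj bM by (intro lincomb_cong) (auto simp: d_def the_inv_into_f_f)
    show ?thesis
    proof (rule ex1I[of _ d])
      show "d \<in> b ` I \<rightarrow>\<^sub>E UNIV \<and> v \<ominus> finsum M (\<lambda>x. d x \<odot> x) (b ` I) \<in> W"
        unfolding trans dc using c by (auto simp: d_def)
    next
      fix e assume e: "e \<in> b ` I \<rightarrow>\<^sub>E UNIV \<and> v \<ominus> finsum M (\<lambda>x. e x \<odot> x) (b ` I) \<in> W"
      have cl: "lincomb I f b \<in> carrier M" for f using bM by (auto simp: Pi_iff)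
      have "lincomb I (\<lambda>i. (e \<circ> b) i - c i) b = lincomb I (e \<circ> b) b \<ominus> lincomb I c b"
        by (rule lincomb_diff[OF fin bM])
      also have "\<dots> = (v \<ominus> lincomb I c b) \<ominus> (v \<ominus> lincomb I (e \<circ> b) b)"
        using cl[of c] cl[of "e \<circ> b"] vM by (simp add: ab)
      also have "\<dots> \<in> W" using c e unfolding trans by (blast intro!: vsubspaceD(6)[OF W(1), of "v \<ominus> lincomb I c b"])
      finally have *: "\<forall>i\<in>I. (e \<circ> b) i = c i" using ind[of "\<lambda>i. (e \<circ> b) i - c i"] by auto
      show "e = d"
      proof (rule PiE_ext[of _ "b ` I" "\<lambda>_. UNIV"])
        show "e \<in> b ` I \<rightarrow>\<^sub>E UNIV" using e by blast
        show "d \<in> b ` I \<rightarrow>\<^sub>E UNIV" by (auto simp: d_def)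
        show "\<And>x. x \<in> b ` I \<Longrightarrow> e x = d x" using * inj by (auto simp: d_def the_inv_into_f_f)
      qed
    qed
  qed
  then show ?thesis using fin bV inj by (auto simp: quot_basis_def card_image)
qed

lemma quot_basis_imp_qbasis:
  assumes W: "vsubspace W" "vsubspace V" "W \<subseteq> V" and B: "quot_basis M V W B"
  shows "qbasis V W B (\<lambda>x. x)"
proof -
  have fin: "finite B" and BV: "B \<subseteq> V"
    and ex: "\<And>v. v \<in> V \<Longrightarrow> \<exists>!c. c \<in> B \<rightarrow>\<^sub>E UNIV \<and> v \<ominus> lincomb B c (\<lambda>x. x) \<in> W"
    using B unfolding quot_basis_def lincomb_def by auto
  have BM: "(\<lambda>x. x) \<in> B \<rightarrow> carrier M" using BV W vsubspaceD(1) by blast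
  have "independent_mod W B (\<lambda>x. x)"
    unfolding independent_mod_def
  proof (intro allI impI)
    fix c assume c: "lincomb B c (\<lambda>x. x) \<in> W"
    let ?z = "\<lambda>x\<in>B. 0::'k" and ?c = "restrict c B"
    have z: "lincomb B ?z (\<lambda>x. x) = \<zero>" using BM by (intro lincomb_zero) auto
    have "lincomb B ?c (\<lambda>x. x) = lincomb B c (\<lambda>x. x)"
      using BM by (intro lincomb_cong) auto
    then have "\<zero> \<ominus> lincomb B ?c (\<lambda>x. x) \<in> W" using c W by (auto intro!: vsubspaceD)
    moreover have "\<zero> \<ominus> lincomb B ?z (\<lambda>x. x) \<in> W" using z W by (auto intro!: vsubspaceD)
    moreover have "?c \<in> B \<rightarrow>\<^sub>E UNIV" "?z \<in> B \<rightarrow>\<^sub>E UNIV" by auto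
    ultimately have "?c = ?z" using ex[OF vsubspaceD(2)[OF W(2)]]
      by (elim ex1E) (metis (mono_tags, lifting))
    then show "\<forall>i\<in>B. c i = 0" by (metis restrict_apply')
  qed
  then show ?thesis unfolding qbasis_def using fin BV ex by blast
qed

theorem quot_dim_eq_card:
  assumes W: "vsubspace W" "vsubspace V" "W \<subseteq> V" and b: "qbasis V W I b"
  shows "quot_dim M V W = card I"
  unfolding quot_dim_def
proof (rule the_equality)
  show "\<exists>B. quot_basis M V W B \<and> card B = card I"
    using qbasis_imp_quot_basis[OF W(1,2) b] by blast
  fix n assume "\<exists>B. quot_basis M V W B \<and> card B = n"
  then obtain B where B: "quot_basis M V W B" "card B = n" by blast
  show "n = card I"
    using qbasis_card_unique[OF W(1) _ quot_basis_imp_qbasis[OF W B(1)] b] W B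
    by (auto simp: vsubspace_def)
qed

definition fin_dim :: bool where
  "fin_dim \<longleftrightarrow> (\<exists>B. quot_basis M (carrier M) {\<zero>} B)"

definition vdim :: nat where
  "vdim = quot_dim M (carrier M) {\<zero>}"

lemma fin_dim_basis:
  assumes fin_dim
  obtains B where "qbasis (carrier M) {\<zero>} B (\<lambda>x. x)" "card B = vdim"
proof -
  obtain B where "quot_basis M (carrier M) {\<zero>} B" using assms unfolding fin_dim_def by blast
  then have B: "qbasis (carrier M) {\<zero>} B (\<lambda>x. x)"
    by (intro quot_basis_imp_qbasis vsubspace_zero vsubspace_carrier) auto
  then show thesis using quot_dim_eq_card[OF vsubspace_zero vsubspace_carrier _ B] that
    by (auto simp: vdim_def)
qed

lemma independent_card_le:
  assumes "fin_dim" "vsubspace W" "finite I" "b \<in> I \<rightarrow> carrier M" "independent_mod W I b"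
  shows "card I \<le> vdim"
proof -
  obtain B where B: "qbasis (carrier M) {\<zero>} B (\<lambda>x. x)" "card B = vdim"
    using fin_dim_basis[OF assms(1)] .
  have "card I \<le> card B"
  proof (rule steinitz[OF assms(2-4), of B "\<lambda>x. x"])
    fix i assume "i \<in> I"
    then show "\<exists>a. b i \<ominus> lincomb B a (\<lambda>x. x) \<in> W"
      using B assms unfolding qbasis_def by (metis PiE singletonD vsubspaceD(2))
  qed (use B assms in \<open>auto simp: qbasis_def\<close>)
  then show ?thesis using B by simp
qed

text \<open>A longest independent family is a basis.\<close>

lemma qbasis_exists:
  assumes "fin_dim" and W: "vsubspace W" and V: "vsubspace V"
  shows "\<exists>n b. qbasis V W {..<n::nat} b"
proof -
  let ?P = "\<lambda>n. \<exists>b. b \<in> {..<n} \<rightarrow> V \<and> independent_mod W {..<n::nat} b"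
  have VM: "V \<subseteq> carrier M" using V vsubspaceD(1) by blast
  have "?P 0" by (auto simp: independent_mod_def)
  moreover have bound: "n \<le> vdim" if "?P n" for n
  proof -
    obtain b where "b \<in> {..<n} \<rightarrow> V" "independent_mod W {..<n} b" using \<open>?P n\<close> by blast
    then have "card {..<n} \<le> vdim" using VM by (intro independent_card_le[OF assms(1,2)]) auto
    then show ?thesis by simp
  qed
  ultimately obtain n where n: "?P n" and max: "\<And>m. ?P m \<Longrightarrow> m \<le> n"
    using Greatest_le_nat[of ?P _ vdim] GreatestI_nat[of ?P 0 vdim] by blast
  then obtain b where b: "b \<in> {..<n} \<rightarrow> V" and ind: "independent_mod W {..<n} b" by blast
  have bM: "b \<in> {..<n} \<rightarrow> carrier M" using b VM by blast
  have "\<exists>c. v \<ominus> lincomb {..<n} c b \<in> W" if v: "v \<in> V" for v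
  proof (rule ccontr)
    assume no: "\<not> ?thesis"
    have vM: "v \<in> carrier M" using v VM by auto
    define b' where "b' = b(n := v)"
    have "independent_mod W {..<Suc n} b'"
      unfolding independent_mod_def
    proof (intro allI impI)
      fix c assume c: "lincomb {..<Suc n} c b' \<in> W"
      have eq: "lincomb {..<n} c b' = lincomb {..<n} c b"
        using bM by (intro lincomb_cong) (auto simp: b'_def)
      have cl: "lincomb {..<n} f b \<in> carrier M" for f by (rule lincomb_closed) (use bM in auto)
      have sp: "c n \<odot> v \<oplus> lincomb {..<n} c b \<in> W"
        using c vM bM eq by (simp add: lessThan_Suc lincomb_insert b'_def Pi_iff)
      have "c n = 0"
      proof (rule ccontr)
        assume cn: "c n \<noteq> 0"
        have "v \<ominus> lincomb {..<n} (\<lambda>i. (- inverse (c n)) * c i) b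
            = inverse (c n) \<odot> (c n \<odot> v \<oplus> lincomb {..<n} c b)"
          unfolding lincomb_smult[OF finite_lessThan bM]
          using cn vM cl[of c]
          by (simp add: sm_add_right sm_minus M.minus_eq sm_mult[symmetric])
        also have "\<dots> \<in> W" using sp W by (simp add: vsubspaceD)
        finally show False using no by blast
      qed
      moreover from this have "lincomb {..<n} c b \<in> W" using sp vM cl by simp
      ultimately show "\<forall>i\<in>{..<Suc n}. c i = 0"
        using ind unfolding independent_mod_def by (auto simp: less_Suc_eq)
    qed
    moreover have "b' \<in> {..<Suc n} \<rightarrow> V" using b v by (auto simp: b'_def less_Suc_eq)
    ultimately have "Suc n \<le> n" using max by blast
    then show False by simp
  qed
  then show ?thesis using b ind unfolding qbasis_def by blast
qed

end

locale klinear = M: kspace M + N: kspace N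
  for M :: "('k::field, 'm) module" and N :: "('k, 'n) module" +
  fixes L :: "'m \<Rightarrow> 'n"
  assumes L_closed: "x \<in> carrier M \<Longrightarrow> L x \<in> carrier N"
    and L_add: "x \<in> carrier M \<Longrightarrow> y \<in> carrier M \<Longrightarrow> L (x \<oplus>\<^bsub>M\<^esub> y) = L x \<oplus>\<^bsub>N\<^esub> L y"
    and L_smult: "x \<in> carrier M \<Longrightarrow> L (c \<odot>\<^bsub>M\<^esub> x) = c \<odot>\<^bsub>N\<^esub> L x"
begin

lemma L_zero: "L \<zero>\<^bsub>M\<^esub> = \<zero>\<^bsub>N\<^esub>"
  using L_smult[of "\<zero>\<^bsub>M\<^esub>" 0] L_closed by simp

lemma L_neg: "x \<in> carrier M \<Longrightarrow> L (\<ominus>\<^bsub>M\<^esub> x) = \<ominus>\<^bsub>N\<^esub> L x"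
  using L_smult[of x "-1"] L_closed by (simp add: M.sm_minus_one N.sm_minus_one)

lemma L_diff: "x \<in> carrier M \<Longrightarrow> y \<in> carrier M \<Longrightarrow> L (x \<ominus>\<^bsub>M\<^esub> y) = L x \<ominus>\<^bsub>N\<^esub> L y"
  by (simp add: L_add L_neg M.M.minus_eq N.M.minus_eq)

lemma L_lincomb:
  assumes "finite I" "b \<in> I \<rightarrow> carrier M"
  shows "L (M.lincomb I c b) = N.lincomb I c (\<lambda>i. L (b i))"
  using assms
proof (induction I rule: finite_induct)
  case (insert x F)
  then have "b x \<in> carrier M" "M.lincomb F c b \<in> carrier M" "(\<lambda>i. L (b i)) \<in> insert x F \<rightarrow> carrier N"
    by (auto intro!: M.lincomb_closed L_closed)
  with insert show ?case by (simp add: M.lincomb_insert N.lincomb_insert L_add L_smult)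
qed (simp add: L_zero)

end

text \<open>
  Quotient dimensions add up along a direct sum decomposition: glue bases of the summands.
  The maps \<open>L j\<close> embed the summands into \<open>N\<close>.
\<close>

theorem quot_dim_direct_sum:
  fixes N :: "('k::field, 'n) module" and M :: "'j \<Rightarrow> ('k, 'm) module"
  assumes J: "finite J" and lin: "\<And>j. j \<in> J \<Longrightarrow> klinear (M j) N (L j)"
    and fd: "\<And>j. j \<in> J \<Longrightarrow> kspace.fin_dim (M j)"
    and V: "\<And>j. j \<in> J \<Longrightarrow> kspace.vsubspace (M j) (V j)"
    and W: "\<And>j. j \<in> J \<Longrightarrow> kspace.vsubspace (M j) (W j)" and WV: "\<And>j. j \<in> J \<Longrightarrow> W j \<subseteq> V j"
    and N: "kspace N"
    and inj: "\<And>u. (\<And>j. j \<in> J \<Longrightarrow> u j \<in> carrier (M j)) \<Longrightarrow> finsum N (\<lambda>j. L j (u j)) J = \<zero>\<^bsub>N\<^esub> \<Longrightarrow>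
      (\<forall>j\<in>J. u j = \<zero>\<^bsub>M j\<^esub>)"
    and V': "kspace.vsubspace N V'" "V' = {finsum N (\<lambda>j. L j (u j)) J | u. \<forall>j\<in>J. u j \<in> V j}"
    and W': "kspace.vsubspace N W'" "W' = {finsum N (\<lambda>j. L j (u j)) J | u. \<forall>j\<in>J. u j \<in> W j}"
  shows "quot_dim N V' W' = (\<Sum>j\<in>J. quot_dim (M j) (V j) (W j))"
proof -
  interpret N: kspace N by (rule N)
  have M: "kspace (M j)" if "j \<in> J" for j using lin[OF that] by (simp add: klinear_def)
  have "\<exists>n b. kspace.qbasis (M j) (V j) (W j) {..<n::nat} b" if "j \<in> J" for j
    using kspace.qbasis_exists[OF M fd W V] that by blast
  then have "\<forall>j\<in>J. \<exists>n b. kspace.qbasis (M j) (V j) (W j) {..<n::nat} b" by blast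
  then obtain n where "\<forall>j\<in>J. \<exists>b. kspace.qbasis (M j) (V j) (W j) {..<n j::nat} b"
    by (rule bchoice[THEN exE])
  then obtain b where b': "\<forall>j\<in>J. kspace.qbasis (M j) (V j) (W j) {..<n j::nat} (b j)"
    by (rule bchoice[THEN exE])
  then have b: "kspace.qbasis (M j) (V j) (W j) {..<n j::nat} (b j)" if "j \<in> J" for j
    using that by (rule bspec)
  have bV: "b j i \<in> V j" if "j \<in> J" "i < n j" for j i
    using kspace.qbasisD(2)[OF M b] that by simp
  have VM: "V j \<subseteq> carrier (M j)" if "j \<in> J" for j
    using kspace.vsubspaceD(1)[OF M V] that by blast
  have bM: "b j i \<in> carrier (M j)" if "j \<in> J" "i < n j" for j i
    using bV VM that by blast
  have LM: "x \<in> carrier (M j) \<Longrightarrow> L j x \<in> carrier N" if "j \<in> J" for j x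
    by (rule klinear.L_closed[OF lin[OF that]])
  define I where "I = Sigma J (\<lambda>j. {..<n j})"
  define e where "e = (\<lambda>(j, i). L j (b j i))"
  have eN: "e \<in> I \<rightarrow> carrier N" using bM LM by (auto simp: I_def e_def)
  have finI: "finite I" using J by (auto simp: I_def)
  define comb where "comb = (\<lambda>c j. kspace.lincomb (M j) {..<n j} (\<lambda>i. c (j, i)) (b j))"
  have combV: "comb c j \<in> V j" if "j \<in> J" for c j
    unfolding comb_def
    by (rule kspace.vsubspace_lincomb[OF M[OF that] V[OF that]]) (use bV that in auto)
  have glue: "N.lincomb I c e = finsum N (\<lambda>j. L j (comb c j)) J" for c
  proof -
    have "N.lincomb I c e = finsum N (\<lambda>j. finsum N (\<lambda>i. c (j, i) \<odot>\<^bsub>N\<^esub> e (j, i)) {..<n j}) J"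
      unfolding N.lincomb_def I_def
      using J eN[unfolded I_def]
    proof (induction J rule: finite_induct)
      case (insert x F)
      have S: "Sigma (insert x F) (\<lambda>j. {..<n j}) = Pair x ` {..<n x} \<union> Sigma F (\<lambda>j. {..<n j})"
        by auto
      have cl: "e (x, i) \<in> carrier N" if "i < n x" for i
        using insert.prems that by (auto simp: Pi_iff)
      have "finsum N (\<lambda>i. c i \<odot>\<^bsub>N\<^esub> e i) (Sigma (insert x F) (\<lambda>j. {..<n j}))
          = finsum N (\<lambda>i. c i \<odot>\<^bsub>N\<^esub> e i) (Pair x ` {..<n x}) \<oplus>\<^bsub>N\<^esub>
            finsum N (\<lambda>i. c i \<odot>\<^bsub>N\<^esub> e i) (Sigma F (\<lambda>j. {..<n j}))"
        unfolding S using insert by (intro N.M.finsum_Un_disjoint) (auto simp: Pi_iff)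
      also have "finsum N (\<lambda>i. c i \<odot>\<^bsub>N\<^esub> e i) (Pair x ` {..<n x})
          = finsum N (\<lambda>i. c (x, i) \<odot>\<^bsub>N\<^esub> e (x, i)) {..<n x}"
        using cl by (intro N.M.finsum_reindex) (auto simp: inj_on_def)
      also have "finsum N (\<lambda>i. c i \<odot>\<^bsub>N\<^esub> e i) (Sigma F (\<lambda>j. {..<n j}))
          = finsum N (\<lambda>j. finsum N (\<lambda>i. c (j, i) \<odot>\<^bsub>N\<^esub> e (j, i)) {..<n j}) F"
        using insert by (auto simp: Pi_iff)
      finally show ?case
        using insert by (subst N.M.finsum_insert) (auto simp: Pi_iff intro!: N.M.finsum_closed)
    qed simp
    also have "\<dots> = finsum N (\<lambda>j. L j (comb c j)) J"
    proof (rule N.M.finsum_cong')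
      fix j assume j: "j \<in> J"
      interpret L: klinear "M j" N "L j" using lin[OF j] .
      have "L j (comb c j) = N.lincomb {..<n j} (\<lambda>i. c (j, i)) (\<lambda>i. L j (b j i))"
        unfolding comb_def using bM[OF j] by (intro L.L_lincomb) auto
      then show "finsum N (\<lambda>i. c (j, i) \<odot>\<^bsub>N\<^esub> e (j, i)) {..<n j} = L j (comb c j)"
        by (simp add: N.lincomb_def e_def)
    qed (use combV VM LM in blast)+
    finally show ?thesis .
  qed
  have diff: "finsum N (\<lambda>j. L j (u j)) J \<ominus>\<^bsub>N\<^esub> finsum N (\<lambda>j. L j (v j)) J
      = finsum N (\<lambda>j. L j (u j \<ominus>\<^bsub>M j\<^esub> v j)) J"
    if "\<And>j. j \<in> J \<Longrightarrow> u j \<in> carrier (M j)" "\<And>j. j \<in> J \<Longrightarrow> v j \<in> carrier (M j)" for u v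
  proof -
    have *: "L j (u j) = L j (u j \<ominus>\<^bsub>M j\<^esub> v j) \<oplus>\<^bsub>N\<^esub> L j (v j)" if j: "j \<in> J" for j
    proof -
      interpret L: klinear "M j" N "L j" using lin[OF j] .
      have "u j \<in> carrier (M j)" "v j \<in> carrier (M j)" using that \<open>\<And>j. j \<in> J \<Longrightarrow> u j \<in> carrier (M j)\<close>
          \<open>\<And>j. j \<in> J \<Longrightarrow> v j \<in> carrier (M j)\<close> by auto
      then show ?thesis by (simp add: L.L_diff N.ab L.L_closed)
    qed
    have cl: "(\<lambda>j. L j (u j)) \<in> J \<rightarrow> carrier N" "(\<lambda>j. L j (v j)) \<in> J \<rightarrow> carrier N"
      "(\<lambda>j. L j (u j \<ominus>\<^bsub>M j\<^esub> v j)) \<in> J \<rightarrow> carrier N"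
      using that LM kspace.vsubspaceD(6)[OF M kspace.vsubspace_carrier[OF M]] by auto
    have "finsum N (\<lambda>j. L j (u j)) J = finsum N (\<lambda>j. L j (u j \<ominus>\<^bsub>M j\<^esub> v j) \<oplus>\<^bsub>N\<^esub> L j (v j)) J"
      using * cl by (intro N.M.finsum_cong') auto
    also have "\<dots> = finsum N (\<lambda>j. L j (u j \<ominus>\<^bsub>M j\<^esub> v j)) J \<oplus>\<^bsub>N\<^esub> finsum N (\<lambda>j. L j (v j)) J"
      using cl by (intro N.M.finsum_addf)
    finally show ?thesis using cl
      by (simp add: N.ab)
  qed
  have "N.qbasis V' W' I e"
    unfolding N.qbasis_def N.independent_mod_def
  proof (intro conjI allI impI ballI)
    show "finite I" by (rule finI)
    show "e \<in> I \<rightarrow> V'"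
    proof
      fix p assume p: "p \<in> I"
      have "e p = N.lincomb I (\<lambda>q. if q = p then 1 else 0) e"
        using N.lincomb_delta[OF finI p eN] by simp
      also have "\<dots> \<in> V'" unfolding glue V'(2) using combV by blast
      finally show "e p \<in> V'" .
    qed
  next
    fix v assume "v \<in> V'"
    then obtain u where u: "v = finsum N (\<lambda>j. L j (u j)) J" "\<forall>j\<in>J. u j \<in> V j" using V' by blast
    have "\<exists>c. u j \<ominus>\<^bsub>M j\<^esub> kspace.lincomb (M j) {..<n j} c (b j) \<in> W j" if "j \<in> J" for j
      using kspace.qbasisD(3)[OF M b, OF that that] u that by blast
    then have "\<forall>j\<in>J. \<exists>c. u j \<ominus>\<^bsub>M j\<^esub> kspace.lincomb (M j) {..<n j} c (b j) \<in> W j" by blast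
    then obtain c where "\<forall>j\<in>J. u j \<ominus>\<^bsub>M j\<^esub> kspace.lincomb (M j) {..<n j} (c j) (b j) \<in> W j"
      by (rule bchoice[THEN exE])
    then have c: "u j \<ominus>\<^bsub>M j\<^esub> kspace.lincomb (M j) {..<n j} (c j) (b j) \<in> W j" if "j \<in> J" for j
      using that by (rule bspec)
    define d where "d = (\<lambda>(j, i). c j i)"
    have "v \<ominus>\<^bsub>N\<^esub> N.lincomb I d e = finsum N (\<lambda>j. L j (u j \<ominus>\<^bsub>M j\<^esub> comb d j)) J"
      unfolding u(1) glue using u combV VM by (intro diff) blast+
    also have "\<dots> \<in> W'" unfolding W'(2) using c by (auto simp: comb_def d_def)
    finally show "\<exists>c. v \<ominus>\<^bsub>N\<^esub> N.lincomb I c e \<in> W'" by blast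
  next
    fix c p assume c: "N.lincomb I c e \<in> W'" and p: "p \<in> I"
    then obtain w where w: "N.lincomb I c e = finsum N (\<lambda>j. L j (w j)) J" "\<forall>j\<in>J. w j \<in> W j"
      using W' by blast
    have wM: "w j \<in> carrier (M j)" if "j \<in> J" for j using w WV VM that by blast
    have cM: "comb c j \<in> carrier (M j)" if "j \<in> J" for j using combV VM that by blast
    have "finsum N (\<lambda>j. L j (comb c j \<ominus>\<^bsub>M j\<^esub> w j)) J = \<zero>\<^bsub>N\<^esub>"
      using diff[of "comb c" w] w(1) wM cM N.vsubspaceD(1)[OF W'(1) c] unfolding glue
      by (simp add: N.M.minus_eq N.M.r_neg)
    then have *: "\<forall>j\<in>J. comb c j \<ominus>\<^bsub>M j\<^esub> w j = \<zero>\<^bsub>M j\<^esub>"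
      using wM cM kspace.vsubspaceD(6)[OF M kspace.vsubspace_carrier[OF M]] by (intro inj) auto
    obtain j i where ji: "p = (j, i)" "j \<in> J" "i < n j" using p by (auto simp: I_def)
    interpret M: kspace "M j" using M ji by blast
    have "comb c j = w j" using * ji wM cM
      by (metis M.M.add.inv_equality M.M.a_inv_closed M.M.minus_eq M.M.minus_minus)
    then have "M.lincomb {..<n j} (\<lambda>i. c (j, i)) (b j) \<in> W j" using w ji by (auto simp: comb_def)
    then show "c p = 0"
      using M.qbasisD(4)[OF b[OF ji(2)], of "\<lambda>i. c (j, i)" i] ji by simp
  qed
  moreover have "W' \<subseteq> V'" unfolding V'(2) W'(2) using WV by blast
  ultimately have "quot_dim N V' W' = card I"
    using N.quot_dim_eq_card V' W' by blast
  also have "\<dots> = (\<Sum>j\<in>J. n j)" using J by (simp add: I_def)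
  also have "\<dots> = (\<Sum>j\<in>J. quot_dim (M j) (V j) (W j))"
    using kspace.quot_dim_eq_card[OF M W V WV b] by (intro sum.cong) auto
  finally show ?thesis .
qed

section \<open>Finite dimensional algebras\<close>

locale kalgebra = kspace A + ring A for A :: "('k::field, 'm) module" (structure) +
  assumes sm_mult_left: "x \<in> carrier A \<Longrightarrow> y \<in> carrier A \<Longrightarrow> (c \<odot> x) \<otimes> y = c \<odot> (x \<otimes> y)"
    and sm_mult_right: "x \<in> carrier A \<Longrightarrow> y \<in> carrier A \<Longrightarrow> x \<otimes> (c \<odot> y) = c \<odot> (x \<otimes> y)"
begin

lemma sm_neg: "x \<in> carrier A \<Longrightarrow> a \<odot> (\<ominus> x) = (- a) \<odot> x"
  using sm_mult[of x a "-1"] by (simp add: sm_minus_one)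

lemma lincomb_powers_factor:
  assumes "f \<in> carrier A"
  shows "\<exists>b\<in>carrier A. b \<otimes> f = f \<otimes> b \<and> lincomb {k..<k+j} c (\<lambda>i. f [^] i) = f [^] (k::nat) \<otimes> b"
proof (induction j)
  case 0
  then show ?case using assms by (intro bexI[of _ \<zero>]) auto
next
  case (Suc j)
  then obtain b where b: "b \<in> carrier A" "b \<otimes> f = f \<otimes> b"
    "lincomb {k..<k+j} c (\<lambda>i. f [^] i) = f [^] k \<otimes> b" by blast
  let ?b = "c (k + j) \<odot> f [^] j \<oplus> b"
  have comm: "f [^] j \<otimes> f = f \<otimes> f [^] j" using assms by (metis nat_pow_Suc nat_pow_Suc2)
  have "{k..<k + Suc j} = insert (k + j) {k..<k+j}" by auto
  then have "lincomb {k..<k + Suc j} c (\<lambda>i. f [^] i)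
      = c (k + j) \<odot> f [^] (k + j) \<oplus> lincomb {k..<k+j} c (\<lambda>i. f [^] i)"
    using assms by (simp add: lincomb_insert)
  also have "\<dots> = f [^] k \<otimes> ?b"
    using assms b by (simp add: r_distr sm_mult_right nat_pow_mult)
  finally show ?case
    using assms b comm
    by (intro bexI[of _ ?b]) (simp_all add: l_distr r_distr sm_mult_left sm_mult_right)
qed

text \<open>
  Fitting's lemma. By finite dimension \<open>f\<^sup>n = f\<^sup>n\<^sup>+\<^sup>1 b\<close> for some \<open>n\<close> and some \<open>b\<close> commuting with
  \<open>f\<close>; then \<open>e = f\<^sup>n b\<^sup>n\<close> is the idempotent projecting onto the part where \<open>f\<close> is invertible.
\<close>

lemma fitting:
  assumes fd: fin_dim and f: "f \<in> carrier A"
  obtains e u n where "e \<in> carrier A" "u \<in> carrier A" "e \<otimes> e = e" "f \<otimes> u = e" "u \<otimes> f = e"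
    "f [^] (n::nat) \<otimes> e = f [^] n"
proof -
  have pw: "f [^] i \<in> carrier A" for i :: nat using f by simp
  have "\<not> independent_mod {\<zero>} {..<Suc vdim} (\<lambda>i. f [^] i)"
    using independent_card_le[OF fd vsubspace_zero, of "{..<Suc vdim}" "\<lambda>i. f [^] i"] pw by auto
  then obtain c where c: "lincomb {..<Suc vdim} c (\<lambda>i. f [^] i) = \<zero>"
    and "\<exists>i<Suc vdim. c i \<noteq> 0" unfolding independent_mod_def by auto
  \<comment> \<open>The powers of \<open>f\<close> are linearly dependent. In a relation between them, solve
    for the lowest power that occurs.\<close>
  then obtain m where m: "m < Suc vdim" "c m \<noteq> 0" and small: "\<And>i. i < m \<Longrightarrow> c i = 0"
    using exists_least_iff[of "\<lambda>i. i < Suc vdim \<and> c i \<noteq> 0"] by (metis less_trans)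
  obtain b0 where b0: "b0 \<in> carrier A" "b0 \<otimes> f = f \<otimes> b0"
    "lincomb {Suc m..<Suc m + (vdim - m)} c (\<lambda>i. f [^] i) = f [^] Suc m \<otimes> b0"
    using lincomb_powers_factor[OF f] by blast
  define b where "b = (- inverse (c m)) \<odot> b0"
  have bc: "b \<in> carrier A" and bf: "b \<otimes> f = f \<otimes> b"
    using b0 f by (auto simp: b_def sm_mult_left sm_mult_right)
  have pc: "(\<lambda>i. f [^] i) \<in> I \<rightarrow> carrier A" for I :: "nat set" using pw by simp
  have set: "{..<Suc vdim} = {..<m} \<union> insert m {Suc m..<Suc m + (vdim - m)}" using m by auto
  have "lincomb ({..<m} \<union> insert m {Suc m..<Suc m + (vdim - m)}) c (\<lambda>i. f [^] i)
      = lincomb {..<m} c (\<lambda>i. f [^] i) \<oplus> lincomb (insert m {Suc m..<Suc m + (vdim - m)}) c (\<lambda>i. f [^] i)"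
    unfolding lincomb_def by (rule M.finsum_Un_disjoint) (use pw in auto)
  moreover have "lincomb {..<m} c (\<lambda>i. f [^] i) = \<zero>" using small pw by (intro lincomb_zero) auto
  moreover have "lincomb (insert m {Suc m..<Suc m + (vdim - m)}) c (\<lambda>i. f [^] i)
      = c m \<odot> f [^] m \<oplus> lincomb {Suc m..<Suc m + (vdim - m)} c (\<lambda>i. f [^] i)"
    by (rule lincomb_insert[OF _ _ pc]) auto
  moreover have "c m \<odot> f [^] m \<oplus> f [^] Suc m \<otimes> b0 \<in> carrier A"
    using pw b0(1) by (intro M.add.m_closed sm_closed m_closed)
  ultimately have "c m \<odot> f [^] m \<oplus> f [^] Suc m \<otimes> b0 = \<zero>"
    using c unfolding set b0(3) by (simp only: M.l_zero)
  then have "c m \<odot> f [^] m = \<ominus> (f [^] Suc m \<otimes> b0)"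
    using b0 f by (intro M.minus_equality[symmetric]) auto
  then have "inverse (c m) \<odot> (c m \<odot> f [^] m) = inverse (c m) \<odot> (\<ominus> (f [^] Suc m \<otimes> b0))" by simp
  also have "inverse (c m) \<odot> (c m \<odot> f [^] m) = f [^] m"
    using m pw[of m] by (simp flip: sm_mult)
  also have "inverse (c m) \<odot> (\<ominus> (f [^] Suc m \<otimes> b0)) = (- inverse (c m)) \<odot> (f [^] Suc m \<otimes> b0)"
    using pw[of "Suc m"] b0 by (intro sm_neg) auto
  also have "\<dots> = f [^] Suc m \<otimes> b"
    using pw[of "Suc m"] b0 by (simp add: b_def sm_mult_right del: nat_pow_Suc)
  finally have step0: "f [^] m = f [^] Suc m \<otimes> b" .
  define n where "n = Suc m"
  have step: "f [^] n = f [^] n \<otimes> (f \<otimes> b)"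
  proof -
    have "f [^] n = f \<otimes> f [^] m" using f by (metis n_def nat_pow_Suc2)
    also have "\<dots> = f \<otimes> (f [^] Suc m \<otimes> b)" by (rule arg_cong[OF step0])
    also have "\<dots> = (f \<otimes> f [^] n) \<otimes> b" using f bc pw by (simp add: n_def m_assoc)
    also have "f \<otimes> f [^] n = f [^] n \<otimes> f" using f by (metis nat_pow_Suc nat_pow_Suc2)
    finally show ?thesis using f bc pw by (simp add: m_assoc)
  qed
  let ?e = "(f \<otimes> b) [^] n"
  have fb: "f \<otimes> b \<in> carrier A" using f bc by simp
  have en: "f [^] n \<otimes> (f \<otimes> b) [^] k = f [^] n" for k :: nat
  proof (induction k)
    case (Suc k)
    have "f [^] n \<otimes> (f \<otimes> b) [^] Suc k = (f [^] n \<otimes> (f \<otimes> b)) \<otimes> (f \<otimes> b) [^] k"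
      using fb pw by (metis m_assoc nat_pow_Suc2 nat_pow_closed)
    also have "\<dots> = f [^] n" unfolding step[symmetric] by (rule Suc)
    finally show ?case .
  qed (use pw in simp)
  have e: "?e = f [^] n \<otimes> b [^] n" by (rule pow_mult_distrib[OF bf[symmetric] f bc])
  have comm: "(f \<otimes> b) [^] k \<otimes> f = f \<otimes> (f \<otimes> b) [^] k" for k :: nat
  proof (induction k)
    case (Suc k)
    have "(f \<otimes> b) [^] Suc k \<otimes> f = (f \<otimes> b) [^] k \<otimes> (f \<otimes> (b \<otimes> f))" using f bc by (simp add: m_assoc)
    also have "\<dots> = ((f \<otimes> b) [^] k \<otimes> f) \<otimes> (f \<otimes> b)" using f bc bf by (simp add: m_assoc)
    also have "\<dots> = f \<otimes> (f \<otimes> b) [^] Suc k" using f bc Suc by (simp add: m_assoc)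
    finally show ?case .
  qed (use f in simp)
  have bcomm: "b \<otimes> (f \<otimes> b) [^] k = (f \<otimes> b) [^] k \<otimes> b" for k :: nat
  proof (induction k)
    case (Suc k)
    have "b \<otimes> (f \<otimes> b) [^] Suc k = (b \<otimes> (f \<otimes> b) [^] k) \<otimes> (f \<otimes> b)" using f bc by (simp add: m_assoc)
    also have "\<dots> = (f \<otimes> b) [^] k \<otimes> ((b \<otimes> f) \<otimes> b)" using f bc Suc by (simp add: m_assoc)
    also have "\<dots> = (f \<otimes> b) [^] Suc k \<otimes> b" using f bc bf by (simp add: m_assoc)
    finally show ?case .
  qed (use bc in simp)
  define u where "u = b \<otimes> (f \<otimes> b) [^] m"
  have eS: "?e = (f \<otimes> b) \<otimes> (f \<otimes> b) [^] m" by (simp only: n_def nat_pow_Suc2[OF fb])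
  show thesis
  proof (rule that[of ?e u n])
    show "?e \<in> carrier A" "u \<in> carrier A" using fb bc by (auto simp: u_def)
    show "f [^] n \<otimes> ?e = f [^] n" by (rule en)
    have "?e \<otimes> ?e = (f [^] n \<otimes> ?e) \<otimes> b [^] n"
      using e f bc fb
      by (metis bf bcomm m_assoc nat_pow_closed group_commutes_pow)
    then show "?e \<otimes> ?e = ?e" by (simp only: en e[symmetric])
    show "f \<otimes> u = ?e" unfolding eS u_def using f bc by (simp add: m_assoc)
    have "u \<otimes> f = b \<otimes> (f \<otimes> (f \<otimes> b) [^] m)" using f bc comm by (simp add: u_def m_assoc)
    also have "\<dots> = (f \<otimes> b) \<otimes> (f \<otimes> b) [^] m"
      unfolding bf[symmetric] using f bc by (simp add: m_assoc)
    also have "\<dots> = ?e" by (rule eS[symmetric])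
    finally show "u \<otimes> f = ?e" .
  qed
qed

end

section \<open>Calculating in linear categories\<close>

locale lincat =
  fixes C :: "('o, 'm, 'k::field, 'z) lcat_scheme" (structure)
  assumes linear: "linear_category C"
begin

abbreviation pls (infixl "\<boxplus>" 65) where "f \<boxplus> g \<equiv> Pls C f g"
abbreviation neg where "neg f \<equiv> Scl C (- 1) f"

lemmas linear_parts = linear[unfolded linear_category_def]
lemmas linear_dom = linear_parts[THEN conjunct1, rule_format]
lemmas linear_idn = linear_parts[THEN conjunct2, THEN conjunct1, rule_format]
lemmas linear_unit = linear_parts[THEN conjunct2, THEN conjunct2, THEN conjunct1, rule_format]
lemmas linear_cmp = linear_parts[THEN conjunct2, THEN conjunct2, THEN conjunct2, THEN conjunct1, rule_format]
lemmas linear_assoc = linear_parts[THEN conjunct2, THEN conjunct2, THEN conjunct2, THEN conjunct2,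
    THEN conjunct1, rule_format]
lemmas linear_mod = linear_parts[THEN conjunct2, THEN conjunct2, THEN conjunct2, THEN conjunct2,
    THEN conjunct2, THEN conjunct1, rule_format]
lemmas linear_distrib = linear_parts[THEN conjunct2, THEN conjunct2, THEN conjunct2, THEN conjunct2,
    THEN conjunct2, THEN conjunct2, rule_format]

lemma Hom_ob: "f \<in> Hom C X Y \<Longrightarrow> X \<in> Obj C \<and> Y \<in> Obj C"
  using linear_dom unfolding Hom_def by blast

lemma hom_kspace: "X \<in> Obj C \<Longrightarrow> Y \<in> Obj C \<Longrightarrow> kspace (hom_mod C X Y)"
  unfolding kspace_def by (rule linear_mod)

lemma hom_sel [simp]:
  "carrier (hom_mod C X Y) = Hom C X Y" "add (hom_mod C X Y) = Pls C"
  "module.smult (hom_mod C X Y) = Scl C" "ring.zero (hom_mod C X Y) = Zro C X Y"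
  "monoid.mult (hom_mod C X Y) = Cmp C" "one (hom_mod C X Y) = Idn C X"
  by (simp_all add: hom_mod_def)

lemma idn_hom: "X \<in> Obj C \<Longrightarrow> Idn C X \<in> Hom C X X"
  by (rule linear_idn)

lemma cmp_hom: "f \<in> Hom C X Y \<Longrightarrow> g \<in> Hom C Y Z \<Longrightarrow> g \<star> f \<in> Hom C X Z"
  using linear_cmp[of X Y Z f g] Hom_ob by blast

lemma zro_hom: "X \<in> Obj C \<Longrightarrow> Y \<in> Obj C \<Longrightarrow> Zro C X Y \<in> Hom C X Y"
  using kspace.vsubspaceD(2)[OF hom_kspace kspace.vsubspace_carrier[OF hom_kspace]] by simp

lemma pls_hom: "f \<in> Hom C X Y \<Longrightarrow> g \<in> Hom C X Y \<Longrightarrow> f \<boxplus> g \<in> Hom C X Y"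
  using kspace.vsubspaceD(3)[OF hom_kspace kspace.vsubspace_carrier[OF hom_kspace]] Hom_ob by simp

lemma scl_hom: "f \<in> Hom C X Y \<Longrightarrow> Scl C c f \<in> Hom C X Y"
  using kspace.vsubspaceD(4)[OF hom_kspace kspace.vsubspace_carrier[OF hom_kspace]] Hom_ob by simp

lemmas hom_intros = idn_hom cmp_hom zro_hom pls_hom scl_hom

lemma cmp_idn: "f \<in> Hom C X Y \<Longrightarrow> f \<star> Idn C X = f" "f \<in> Hom C X Y \<Longrightarrow> Idn C Y \<star> f = f"
  using linear_unit[of X Y f] Hom_ob by blast+

lemma assoc: "f \<in> Hom C W X \<Longrightarrow> g \<in> Hom C X Y \<Longrightarrow> h \<in> Hom C Y Z \<Longrightarrow> (h \<star> g) \<star> f = h \<star> (g \<star> f)"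
  using linear_assoc[of W X Y Z f g h] Hom_ob by blast

lemma distrib:
  assumes "f \<in> Hom C X Y" "g \<in> Hom C Y Z"
  shows "f' \<in> Hom C X Y \<Longrightarrow> g \<star> (f \<boxplus> f') = (g \<star> f) \<boxplus> (g \<star> f')"
    and "g' \<in> Hom C Y Z \<Longrightarrow> (g \<boxplus> g') \<star> f = (g \<star> f) \<boxplus> (g' \<star> f)"
    and "g \<star> Scl C c f = Scl C c (g \<star> f)"
    and "Scl C c g \<star> f = Scl C c (g \<star> f)"
proof -
  have ob: "X \<in> Obj C" "Y \<in> Obj C" "Z \<in> Obj C" using Hom_ob assms by auto
  note ** = linear_distrib[OF ob]
  show "f' \<in> Hom C X Y \<Longrightarrow> g \<star> (f \<boxplus> f') = (g \<star> f) \<boxplus> (g \<star> f')" using ** assms by blast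
  show "g' \<in> Hom C Y Z \<Longrightarrow> (g \<boxplus> g') \<star> f = (g \<star> f) \<boxplus> (g' \<star> f)" using ** assms by blast
  show "g \<star> Scl C c f = Scl C c (g \<star> f)" "Scl C c g \<star> f = Scl C c (g \<star> f)" using ** assms by blast+
qed

lemma hom_module_laws:
  assumes "f \<in> Hom C X Y"
  shows "f \<boxplus> Zro C X Y = f" "Zro C X Y \<boxplus> f = f" "f \<boxplus> neg f = Zro C X Y" "neg f \<boxplus> f = Zro C X Y"
    "g \<in> Hom C X Y \<Longrightarrow> f \<boxplus> g = g \<boxplus> f"
    "g \<in> Hom C X Y \<Longrightarrow> h \<in> Hom C X Y \<Longrightarrow> (f \<boxplus> g) \<boxplus> h = f \<boxplus> (g \<boxplus> h)"
    "g \<in> Hom C X Y \<Longrightarrow> h \<in> Hom C X Y \<Longrightarrow> f \<boxplus> (g \<boxplus> h) = g \<boxplus> (f \<boxplus> h)"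
    "g \<in> Hom C X Y \<Longrightarrow> f \<boxplus> (neg f \<boxplus> g) = g"
    "g \<in> Hom C X Y \<Longrightarrow> neg f \<boxplus> (f \<boxplus> g) = g"
    "Scl C 1 f = f" "Scl C 0 f = Zro C X Y" "Scl C c (Scl C d f) = Scl C (c * d) f"
    "g \<in> Hom C X Y \<Longrightarrow> Scl C c (f \<boxplus> g) = Scl C c f \<boxplus> Scl C c g"
    "Scl C c (Zro C X Y) = Zro C X Y"
proof -
  interpret kspace "hom_mod C X Y" using hom_kspace Hom_ob assms by blast
  note l = M.a_ac[unfolded hom_sel] M.r_zero[unfolded hom_sel] M.l_zero[unfolded hom_sel]
    M.r_neg[unfolded hom_sel] M.l_neg[unfolded hom_sel] sm_minus_one[unfolded hom_sel]
    neg_cancel[unfolded hom_sel] neg_cancel'[unfolded hom_sel]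
    sm_one[unfolded hom_sel] sm_zero[unfolded hom_sel] sm_mult[unfolded hom_sel] sm_null[unfolded hom_sel]
    sm_add_right[unfolded hom_sel]
  show "f \<boxplus> Zro C X Y = f" "Zro C X Y \<boxplus> f = f" "f \<boxplus> neg f = Zro C X Y" "neg f \<boxplus> f = Zro C X Y"
    "g \<in> Hom C X Y \<Longrightarrow> f \<boxplus> g = g \<boxplus> f"
    "g \<in> Hom C X Y \<Longrightarrow> h \<in> Hom C X Y \<Longrightarrow> (f \<boxplus> g) \<boxplus> h = f \<boxplus> (g \<boxplus> h)"
    "g \<in> Hom C X Y \<Longrightarrow> h \<in> Hom C X Y \<Longrightarrow> f \<boxplus> (g \<boxplus> h) = g \<boxplus> (f \<boxplus> h)"
    "g \<in> Hom C X Y \<Longrightarrow> f \<boxplus> (neg f \<boxplus> g) = g"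
    "g \<in> Hom C X Y \<Longrightarrow> neg f \<boxplus> (f \<boxplus> g) = g"
    "Scl C 1 f = f" "Scl C 0 f = Zro C X Y" "Scl C c (Scl C d f) = Scl C (c * d) f"
    "g \<in> Hom C X Y \<Longrightarrow> Scl C c (f \<boxplus> g) = Scl C c f \<boxplus> Scl C c g"
    "Scl C c (Zro C X Y) = Zro C X Y"
    using assms by (simp_all add: l)
qed

lemma cmp_zro:
  assumes "g \<in> Hom C Y Z" "X \<in> Obj C"
  shows "g \<star> Zro C X Y = Zro C X Z" "Zro C Z X \<star> g = Zro C Y X"
proof -
  have ob: "Y \<in> Obj C" "Z \<in> Obj C" using Hom_ob assms by auto
  have z: "Zro C X Y \<in> Hom C X Y" "Zro C Z X \<in> Hom C Z X" using zro_hom ob assms by auto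
  have "g \<star> Scl C 0 (Zro C X Y) = Scl C 0 (g \<star> Zro C X Y)" using distrib(3)[OF z(1) assms(1)] .
  then show "g \<star> Zro C X Y = Zro C X Z"
    using hom_module_laws(14)[OF z(1)] hom_module_laws(11)[OF cmp_hom[OF z(1) assms(1)]] by simp
  have "Scl C 0 (Zro C Z X) \<star> g = Scl C 0 (Zro C Z X \<star> g)" using distrib(4)[OF assms(1) z(2)] .
  then show "Zro C Z X \<star> g = Zro C Y X"
    using hom_module_laws(14)[OF z(2)] hom_module_laws(11)[OF cmp_hom[OF assms(1) z(2)]] by simp
qed

text \<open>
  The same laws with domains and codomains as side conditions, which the simplifier can solve
  without guessing intermediate objects. Together with the unfolded membership facts of the
  morphisms involved they normalise every expression.
\<close>

lemma arrs:
  "X \<in> Obj C \<Longrightarrow> Idn C X \<in> Arr C" "X \<in> Obj C \<Longrightarrow> Dom C (Idn C X) = X" "X \<in> Obj C \<Longrightarrow> Cod C (Idn C X) = X"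
  "X \<in> Obj C \<Longrightarrow> Y \<in> Obj C \<Longrightarrow> Zro C X Y \<in> Arr C"
  "X \<in> Obj C \<Longrightarrow> Y \<in> Obj C \<Longrightarrow> Dom C (Zro C X Y) = X" "X \<in> Obj C \<Longrightarrow> Y \<in> Obj C \<Longrightarrow> Cod C (Zro C X Y) = Y"
  "f \<in> Arr C \<Longrightarrow> g \<in> Arr C \<Longrightarrow> Cod C f = Dom C g \<Longrightarrow> g \<star> f \<in> Arr C"
  "f \<in> Arr C \<Longrightarrow> g \<in> Arr C \<Longrightarrow> Cod C f = Dom C g \<Longrightarrow> Dom C (g \<star> f) = Dom C f"
  "f \<in> Arr C \<Longrightarrow> g \<in> Arr C \<Longrightarrow> Cod C f = Dom C g \<Longrightarrow> Cod C (g \<star> f) = Cod C g"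
  "f \<in> Arr C \<Longrightarrow> g \<in> Arr C \<Longrightarrow> Dom C f = Dom C g \<Longrightarrow> Cod C f = Cod C g \<Longrightarrow> f \<boxplus> g \<in> Arr C"
  "f \<in> Arr C \<Longrightarrow> g \<in> Arr C \<Longrightarrow> Dom C f = Dom C g \<Longrightarrow> Cod C f = Cod C g \<Longrightarrow> Dom C (f \<boxplus> g) = Dom C g"
  "f \<in> Arr C \<Longrightarrow> g \<in> Arr C \<Longrightarrow> Dom C f = Dom C g \<Longrightarrow> Cod C f = Cod C g \<Longrightarrow> Cod C (f \<boxplus> g) = Cod C g"
  "f \<in> Arr C \<Longrightarrow> Scl C c f \<in> Arr C" "f \<in> Arr C \<Longrightarrow> Dom C (Scl C c f) = Dom C f"
  "f \<in> Arr C \<Longrightarrow> Cod C (Scl C c f) = Cod C f"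
  using hom_intros unfolding Hom_def by simp_all

lemma laws:
  "f \<in> Arr C \<Longrightarrow> Dom C f = X \<Longrightarrow> f \<star> Idn C X = f" "f \<in> Arr C \<Longrightarrow> Cod C f = X \<Longrightarrow> Idn C X \<star> f = f"
  "f \<in> Arr C \<Longrightarrow> g \<in> Arr C \<Longrightarrow> h \<in> Arr C \<Longrightarrow> Cod C f = Dom C g \<Longrightarrow> Cod C g = Dom C h \<Longrightarrow>
    (h \<star> g) \<star> f = h \<star> (g \<star> f)"
  "f \<in> Arr C \<Longrightarrow> f' \<in> Arr C \<Longrightarrow> g \<in> Arr C \<Longrightarrow> Cod C f = Dom C g \<Longrightarrow> Dom C f = Dom C f' \<Longrightarrow>
    Cod C f = Cod C f' \<Longrightarrow> g \<star> (f \<boxplus> f') = (g \<star> f) \<boxplus> (g \<star> f')"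
  "f \<in> Arr C \<Longrightarrow> g' \<in> Arr C \<Longrightarrow> g \<in> Arr C \<Longrightarrow> Cod C f = Dom C g \<Longrightarrow> Dom C g = Dom C g' \<Longrightarrow>
    Cod C g = Cod C g' \<Longrightarrow> (g \<boxplus> g') \<star> f = (g \<star> f) \<boxplus> (g' \<star> f)"
  "f \<in> Arr C \<Longrightarrow> g \<in> Arr C \<Longrightarrow> Cod C f = Dom C g \<Longrightarrow> g \<star> Scl C c f = Scl C c (g \<star> f)"
  "f \<in> Arr C \<Longrightarrow> g \<in> Arr C \<Longrightarrow> Cod C f = Dom C g \<Longrightarrow> Scl C c g \<star> f = Scl C c (g \<star> f)"
  "g \<in> Arr C \<Longrightarrow> X \<in> Obj C \<Longrightarrow> Dom C g = Y \<Longrightarrow> g \<star> Zro C X Y = Zro C X (Cod C g)"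
  "g \<in> Arr C \<Longrightarrow> X \<in> Obj C \<Longrightarrow> Cod C g = Z \<Longrightarrow> Zro C Z X \<star> g = Zro C (Dom C g) X"
  "f \<in> Arr C \<Longrightarrow> Dom C f = X \<Longrightarrow> Cod C f = Y \<Longrightarrow> f \<boxplus> Zro C X Y = f"
  "f \<in> Arr C \<Longrightarrow> Dom C f = X \<Longrightarrow> Cod C f = Y \<Longrightarrow> Zro C X Y \<boxplus> f = f"
  "f \<in> Arr C \<Longrightarrow> f \<boxplus> neg f = Zro C (Dom C f) (Cod C f)"
  "f \<in> Arr C \<Longrightarrow> neg f \<boxplus> f = Zro C (Dom C f) (Cod C f)"
  "f \<in> Arr C \<Longrightarrow> g \<in> Arr C \<Longrightarrow> Dom C f = Dom C g \<Longrightarrow> Cod C f = Cod C g \<Longrightarrow> f \<boxplus> (neg f \<boxplus> g) = g"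
  "f \<in> Arr C \<Longrightarrow> g \<in> Arr C \<Longrightarrow> Dom C f = Dom C g \<Longrightarrow> Cod C f = Cod C g \<Longrightarrow> neg f \<boxplus> (f \<boxplus> g) = g"
  "f \<in> Arr C \<Longrightarrow> Scl C 1 f = f" "f \<in> Arr C \<Longrightarrow> Scl C 0 f = Zro C (Dom C f) (Cod C f)"
  "f \<in> Arr C \<Longrightarrow> Scl C c (Scl C d f) = Scl C (c * d) f"
  "f \<in> Arr C \<Longrightarrow> g \<in> Arr C \<Longrightarrow> Dom C f = Dom C g \<Longrightarrow> Cod C f = Cod C g \<Longrightarrow>
    Scl C c (f \<boxplus> g) = Scl C c f \<boxplus> Scl C c g"
  "X \<in> Obj C \<Longrightarrow> Y \<in> Obj C \<Longrightarrow> Scl C c (Zro C X Y) = Zro C X Y"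
  "f \<in> Arr C \<Longrightarrow> g \<in> Arr C \<Longrightarrow> h \<in> Arr C \<Longrightarrow> Dom C f = Dom C g \<Longrightarrow> Cod C f = Cod C g \<Longrightarrow>
    Dom C g = Dom C h \<Longrightarrow> Cod C g = Cod C h \<Longrightarrow> (f \<boxplus> g) \<boxplus> h = f \<boxplus> (g \<boxplus> h)"
proof (goal_cases)
  case 3 then show ?case by (intro assoc) (auto simp: Hom_def)
next case 4 then show ?case by (intro distrib(1)) (auto simp: Hom_def)
next case 5 then show ?case by (intro distrib(2)) (auto simp: Hom_def)
next case 6 then show ?case by (intro distrib(3)) (auto simp: Hom_def)
next case 7 then show ?case by (intro distrib(4)) (auto simp: Hom_def)
next case 8 then show ?case by (intro cmp_zro) (auto simp: Hom_def)
next case 9 then show ?case by (intro cmp_zro) (auto simp: Hom_def)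
next case 14 then show ?case by (intro hom_module_laws(8)) (auto simp: Hom_def)
next case 15 then show ?case by (intro hom_module_laws(9)) (auto simp: Hom_def)
next case 19 then show ?case by (intro hom_module_laws(13)) (auto simp: Hom_def)
next case 20 then show ?case by (intro hom_module_laws(14)[OF zro_hom])
next case 21 then show ?case by (intro hom_module_laws(6)) (auto simp: Hom_def)
qed (use hom_module_laws cmp_idn in \<open>auto simp: Hom_def\<close>)

lemma pls_ac:
  "f \<in> Arr C \<Longrightarrow> g \<in> Arr C \<Longrightarrow> Dom C f = Dom C g \<Longrightarrow> Cod C f = Cod C g \<Longrightarrow> f \<boxplus> g = g \<boxplus> f"
  "f \<in> Arr C \<Longrightarrow> g \<in> Arr C \<Longrightarrow> h \<in> Arr C \<Longrightarrow> Dom C f = Dom C g \<Longrightarrow> Cod C f = Cod C g \<Longrightarrow>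
    Dom C g = Dom C h \<Longrightarrow> Cod C g = Cod C h \<Longrightarrow> f \<boxplus> (g \<boxplus> h) = g \<boxplus> (f \<boxplus> h)"
  by (intro hom_module_laws(5)) (auto simp: Hom_def, intro hom_module_laws(7), auto simp: Hom_def)

lemmas cs = Hom_def arrs laws

lemma cmp_reduce:
  assumes "p \<star> i = c" "i \<in> Hom C X Y" "p \<in> Hom C Y Z"
  shows "f \<in> Arr C \<Longrightarrow> Cod C f = X \<Longrightarrow> p \<star> (i \<star> f) = c \<star> f"
  using assms by (simp add: cs flip: laws(3))

lemma neg_eq_zro_iff:
  assumes "f \<in> Hom C X Y" "g \<in> Hom C X Y"
  shows "f \<boxplus> neg g = Zro C X Y \<longleftrightarrow> f = g"
proof
  assume "f \<boxplus> neg g = Zro C X Y"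
  then have "(f \<boxplus> neg g) \<boxplus> g = Zro C X Y \<boxplus> g" by simp
  then show "f = g" using assms Hom_ob[OF assms(1)] by (simp add: cs)
qed (use assms Hom_ob[OF assms(1)] in \<open>simp add: cs\<close>)

subsection \<open>Additive closures of sets of morphisms\<close>

text \<open>
  Ideals, \<open>add T\<close> and the square of the radical all consist of finite sums of
  morphisms of a certain kind. Closing the generators inductively avoids index sets and allows
  proofs by induction.
\<close>

inductive_set asum :: "'o \<Rightarrow> 'o \<Rightarrow> 'm set \<Rightarrow> 'm set" for X Y K where
  asum_zro: "Zro C X Y \<in> asum X Y K"
| asum_gen: "k \<in> K \<Longrightarrow> k \<in> asum X Y K"
| asum_pls: "f \<in> asum X Y K \<Longrightarrow> g \<in> asum X Y K \<Longrightarrow> f \<boxplus> g \<in> asum X Y K"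

lemma asum_hom:
  assumes "f \<in> asum X Y K" "K \<subseteq> Hom C X Y" "X \<in> Obj C" "Y \<in> Obj C"
  shows "f \<in> Hom C X Y"
  using assms(1) by induction (use assms(2-) in \<open>auto intro: hom_intros\<close>)

lemma asum_map:
  assumes "f \<in> asum X Y K" and K: "K \<subseteq> Hom C X Y" "X \<in> Obj C" "Y \<in> Obj C"
    and "F (Zro C X Y) \<in> S" "\<And>k. k \<in> K \<Longrightarrow> F k \<in> S"
    and "\<And>f g. f \<in> Hom C X Y \<Longrightarrow> g \<in> Hom C X Y \<Longrightarrow> F f \<in> S \<Longrightarrow> F g \<in> S \<Longrightarrow> F (f \<boxplus> g) \<in> S"
  shows "F f \<in> S"
  using assms(1)
  by induction (use asum_hom[OF _ K] assms(5-) in auto)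

lemma asum_mono:
  assumes "f \<in> asum X Y K" "K \<subseteq> asum X Y K'"
  shows "f \<in> asum X Y K'"
  using assms(1) by induction (use assms(2) in \<open>auto intro: asum.intros\<close>)

lemma asum_cmp:
  assumes f: "f \<in> asum X Y K" and K: "K \<subseteq> Hom C X Y" "X \<in> Obj C" "Y \<in> Obj C"
    and ab: "a \<in> Hom C X' X" "b \<in> Hom C Y Y'"
    and gen: "\<And>k. k \<in> K \<Longrightarrow> b \<star> (k \<star> a) \<in> asum X' Y' K'"
  shows "b \<star> (f \<star> a) \<in> asum X' Y' K'"
proof -
  have ob: "X' \<in> Obj C" "Y' \<in> Obj C" using ab Hom_ob by auto
  show ?thesis
  proof (rule asum_map[OF f K, where F = "\<lambda>f. b \<star> (f \<star> a)"])
    have "b \<star> (Zro C X Y \<star> a) = Zro C X' Y'" using ab K ob by (simp add: cs)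
    then show "b \<star> (Zro C X Y \<star> a) \<in> asum X' Y' K'" by (simp add: asum_zro)
    show "b \<star> ((f \<boxplus> g) \<star> a) \<in> asum X' Y' K'"
      if "f \<in> Hom C X Y" "g \<in> Hom C X Y" "b \<star> (f \<star> a) \<in> asum X' Y' K'" "b \<star> (g \<star> a) \<in> asum X' Y' K'" for f g
      using that ab asum_pls[OF that(3,4)] by (simp add: cs)
  qed (rule gen)
qed

lemma asum_finite:
  assumes "f \<in> asum X Y K"
  shows "\<exists>K'. finite K' \<and> K' \<subseteq> K \<and> f \<in> asum X Y K'"
  using assms
proof induction
  case asum_zro
  then show ?case by (intro exI[of _ "{}"]) (auto intro: asum.intros)
next
  case (asum_gen k)
  then show ?case by (intro exI[of _ "{k}"]) (auto intro: asum.intros)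
next
  case (asum_pls f g)
  then obtain K1 K2 where K: "finite K1" "K1 \<subseteq> K" "f \<in> asum X Y K1" "finite K2" "K2 \<subseteq> K" "g \<in> asum X Y K2"
    by blast
  have "f \<in> asum X Y (K1 \<union> K2)" "g \<in> asum X Y (K1 \<union> K2)"
    using asum_mono[OF K(3), of "K1 \<union> K2"] asum_mono[OF K(6), of "K1 \<union> K2"]
    by (auto intro: asum.asum_gen)
  then show ?case using K by (intro exI[of _ "K1 \<union> K2"]) (auto intro: asum.intros)
qed

lemma asum_smult:
  assumes "f \<in> asum X Y K" and K: "K \<subseteq> Hom C X Y" "X \<in> Obj C" "Y \<in> Obj C"
    and "\<And>k. k \<in> K \<Longrightarrow> Scl C c k \<in> asum X Y K"
  shows "Scl C c f \<in> asum X Y K"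
proof (rule asum_map[OF assms(1) K, where F = "Scl C c"])
  show "Scl C c (Zro C X Y) \<in> asum X Y K" using K by (simp add: cs asum_zro)
  show "Scl C c (f \<boxplus> g) \<in> asum X Y K"
    if "f \<in> Hom C X Y" "g \<in> Hom C X Y" "Scl C c f \<in> asum X Y K" "Scl C c g \<in> asum X Y K" for f g
    using that asum_pls[OF that(3,4)] by (simp add: cs)
qed (rule assms)

lemma finsum_in_asum:
  assumes "X \<in> Obj C" "Y \<in> Obj C" "finite I" "\<And>i. i \<in> I \<Longrightarrow> f i \<in> K" "K \<subseteq> Hom C X Y"
  shows "finsum (hom_mod C X Y) f I \<in> asum X Y K"
proof -
  interpret kspace "hom_mod C X Y" using hom_kspace assms by blast
  show ?thesis using assms(3,4)
  proof (induction I rule: finite_induct)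
    case empty
    then show ?case by (simp add: asum_zro)
  next
    case (insert x F)
    then have "f \<in> F \<rightarrow> Hom C X Y" "f x \<in> Hom C X Y" using assms(5) by auto
    then have "finsum (hom_mod C X Y) f (insert x F) = f x \<boxplus> finsum (hom_mod C X Y) f F"
      using insert by (subst M.finsum_insert) auto
    then show ?case using insert by (auto intro: asum.intros)
  qed
qed

lemma klinear_cmp:
  assumes "a \<in> Hom C X' X" "b \<in> Hom C Y Y'"
  shows "klinear (hom_mod C X Y) (hom_mod C X' Y') (\<lambda>r. b \<star> (r \<star> a))"
proof -
  have ob: "X \<in> Obj C" "X' \<in> Obj C" "Y \<in> Obj C" "Y' \<in> Obj C" using assms Hom_ob by auto
  show ?thesis unfolding klinear_def klinear_axioms_def
    using hom_kspace ob assms by (simp add: cs)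
qed

lemma End_algebra:
  assumes X: "X \<in> Obj C"
  shows "kalgebra (End C X)"
proof -
  interpret kspace "End C X" using hom_kspace X by blast
  show ?thesis
  proof (intro kalgebra.intro kalgebra_axioms.intro)
    show "kspace (End C X)" using hom_kspace X by blast
    show "ring (End C X)"
    proof (rule ringI)
      show "abelian_group (End C X)" ..
      show "monoid (End C X)" by unfold_locales (use X in \<open>auto intro: hom_intros simp: cs\<close>)
    qed (use X in \<open>auto simp: cs\<close>)
  qed (use X in \<open>auto simp: cs\<close>)
qed

subsection \<open>The radical\<close>

text \<open>
  The radical of the category. Only left invertibility is asked for; this is what membership in
  all maximal left ideals amounts to.
\<close>

definition crad :: "'o \<Rightarrow> 'o \<Rightarrow> 'm set" where
  "crad X Y = {f \<in> Hom C X Y. \<forall>g\<in>Hom C Y X. \<exists>h\<in>Hom C X X. h \<star> (Idn C X \<boxplus> neg (g \<star> f)) = Idn C X}"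

lemma crad_hom: "f \<in> crad X Y \<Longrightarrow> f \<in> Hom C X Y"
  by (simp add: crad_def)

lemma crad_zro: "X \<in> Obj C \<Longrightarrow> Y \<in> Obj C \<Longrightarrow> Zro C X Y \<in> crad X Y"
  unfolding crad_def using hom_intros by (auto simp: cs intro!: exI[of _ "Idn C X"])

lemma crad_cmp_left:
  assumes f: "f \<in> crad X Y" and b: "b \<in> Hom C Y Z"
  shows "b \<star> f \<in> crad X Z"
  unfolding crad_def
proof (intro CollectI conjI ballI)
  have fh: "f \<in> Hom C X Y" using f by (rule crad_hom)
  show "b \<star> f \<in> Hom C X Z" using fh b by (rule cmp_hom)
  fix g assume g: "g \<in> Hom C Z X"
  have "g \<star> b \<in> Hom C Y X" using b g by (rule cmp_hom)
  then obtain h where "h \<in> Hom C X X" "h \<star> (Idn C X \<boxplus> neg ((g \<star> b) \<star> f)) = Idn C X"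
    using f unfolding crad_def by blast
  then show "\<exists>h\<in>Hom C X X. h \<star> (Idn C X \<boxplus> neg (g \<star> (b \<star> f))) = Idn C X"
    using assoc[OF fh b g] by auto
qed

text \<open>If \<open>h\<close> is left inverse to \<open>1 - v u\<close> then \<open>1 + u h v\<close> is left inverse to \<open>1 - u v\<close>.\<close>

lemma crad_cmp_right:
  assumes f: "f \<in> crad X Y" and a: "a \<in> Hom C W X"
  shows "f \<star> a \<in> crad W Y"
  unfolding crad_def
proof (intro CollectI conjI ballI)
  have fh: "f \<in> Hom C X Y" using f by (rule crad_hom)
  have ob: "W \<in> Obj C" "X \<in> Obj C" "Y \<in> Obj C" using fh a Hom_ob by auto
  show "f \<star> a \<in> Hom C W Y" using a fh by (rule cmp_hom)
  fix g assume g: "g \<in> Hom C Y W"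
  have "a \<star> g \<in> Hom C Y X" using g a by (rule cmp_hom)
  then obtain h where h: "h \<in> Hom C X X" "h \<star> (Idn C X \<boxplus> neg ((a \<star> g) \<star> f)) = Idn C X"
    using f unfolding crad_def by blast
  let ?h = "Idn C W \<boxplus> (g \<star> (f \<star> (h \<star> a)))"
  have "h \<boxplus> neg (h \<star> (a \<star> (g \<star> f))) = Idn C X"
    using h fh a g ob by (simp add: cs)
  then have hh: "(g \<star> f) \<star> ((h \<boxplus> neg (h \<star> (a \<star> (g \<star> f)))) \<star> a) = (g \<star> f) \<star> (Idn C X \<star> a)" by simp
  have "?h \<star> (Idn C W \<boxplus> neg (g \<star> (f \<star> a)))
    = (Idn C W \<boxplus> neg (g \<star> (f \<star> a))) \<boxplus> ((g \<star> f) \<star> ((h \<boxplus> neg (h \<star> (a \<star> (g \<star> f)))) \<star> a))"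
    using h(1) fh a g ob by (simp add: cs pls_ac)
  also have "\<dots> = Idn C W" unfolding hh using fh a g ob by (simp add: cs)
  finally show "\<exists>h\<in>Hom C W W. h \<star> (Idn C W \<boxplus> neg (g \<star> (f \<star> a))) = Idn C W"
    using h(1) fh a g ob by (intro bexI[of _ ?h]) (simp_all add: cs)
qed

lemma crad_pls:
  assumes f: "f \<in> crad X Y" and f': "f' \<in> crad X Y"
  shows "f \<boxplus> f' \<in> crad X Y"
  unfolding crad_def
proof (intro CollectI conjI ballI)
  have fh: "f \<in> Hom C X Y" "f' \<in> Hom C X Y" using f f' by (auto intro: crad_hom)
  have ob: "X \<in> Obj C" "Y \<in> Obj C" using fh Hom_ob by auto
  show "f \<boxplus> f' \<in> Hom C X Y" using fh by (rule pls_hom)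
  fix g assume g: "g \<in> Hom C Y X"
  then obtain h where h: "h \<in> Hom C X X" "h \<star> (Idn C X \<boxplus> neg (g \<star> f)) = Idn C X"
    using f unfolding crad_def by blast
  have "h \<star> g \<in> Hom C Y X" using g h cmp_hom by blast
  then obtain h' where h': "h' \<in> Hom C X X" "h' \<star> (Idn C X \<boxplus> neg ((h \<star> g) \<star> f')) = Idn C X"
    using f' unfolding crad_def by blast
  have "(h' \<star> h) \<star> (Idn C X \<boxplus> neg (g \<star> (f \<boxplus> f')))
    = h' \<star> ((h \<star> (Idn C X \<boxplus> neg (g \<star> f))) \<boxplus> neg ((h \<star> g) \<star> f'))"
    using h(1) h'(1) fh g ob by (simp add: cs)
  also have "\<dots> = Idn C X" using h h' by simp
  finally show "\<exists>h\<in>Hom C X X. h \<star> (Idn C X \<boxplus> neg (g \<star> (f \<boxplus> f'))) = Idn C X"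
    using h(1) h'(1) cmp_hom by blast
qed

lemma crad_scl: "f \<in> crad X Y \<Longrightarrow> Scl C c f \<in> crad X Y"
  using crad_cmp_left[of f X Y "Scl C c (Idn C Y)" Y] crad_hom[of f X Y] Hom_ob[of f X Y]
  by (simp add: cs)

lemma crad_asum:
  assumes "f \<in> asum X Y K" "K \<subseteq> crad X Y" "X \<in> Obj C" "Y \<in> Obj C"
  shows "f \<in> crad X Y"
  using assms(1) by induction (use assms in \<open>auto intro: crad_zro crad_pls\<close>)

lemma crad_vsubspace:
  assumes "X \<in> Obj C" "Y \<in> Obj C"
  shows "kspace.vsubspace (hom_mod C X Y) (crad X Y)"
  using kspace.vsubspace_def[OF hom_kspace[OF assms]] assms
  by (auto intro: crad_zro crad_pls crad_scl crad_hom)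

lemma idn_in_crad: "Idn C X \<in> crad X X \<Longrightarrow> zero_object C X"
proof -
  assume r: "Idn C X \<in> crad X X"
  then have X: "X \<in> Obj C" using crad_hom Hom_ob by blast
  obtain h where "h \<in> Hom C X X" "h \<star> (Idn C X \<boxplus> neg (Idn C X \<star> Idn C X)) = Idn C X"
    using r unfolding crad_def using X by (auto intro: hom_intros)
  then show ?thesis using X by (simp add: cs zero_object_def)
qed

lemma zero_object_hom:
  assumes "zero_object C X" "f \<in> Hom C X Y" shows "f = Zro C X Y"
proof -
  have "f = f \<star> Idn C X" using assms by (simp add: cs)
  also have "\<dots> = f \<star> Zro C X X" using assms by (simp add: zero_object_def)
  also have "\<dots> = Zro C X Y" using assms Hom_ob[OF assms(2)] by (simp add: cs)
  finally show ?thesis .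
qed

end

section \<open>Krull-Schmidt categories\<close>

context lincat
begin

lemma zero_objectI: "X \<in> Obj C \<Longrightarrow> Idn C X = Zro C X X \<Longrightarrow> zero_object C X"
  by (simp add: zero_object_def)

definition retract :: "'o \<Rightarrow> 'o \<Rightarrow> bool" where
  "retract X Z \<longleftrightarrow> (\<exists>i p. i \<in> Hom C X Z \<and> p \<in> Hom C Z X \<and> p \<star> i = Idn C X)"

lemma retractI: "i \<in> Hom C X Z \<Longrightarrow> p \<in> Hom C Z X \<Longrightarrow> p \<star> i = Idn C X \<Longrightarrow> retract X Z"
  unfolding retract_def by blast

lemma retract_ob: "retract X Z \<Longrightarrow> X \<in> Obj C \<and> Z \<in> Obj C"
  unfolding retract_def using Hom_ob by blast

lemma retract_refl: "X \<in> Obj C \<Longrightarrow> retract X X"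
  by (rule retractI[of "Idn C X" _ _ "Idn C X"]) (auto intro: hom_intros simp: cs)

lemma retract_trans:
  assumes "retract X Y" "retract Y Z" shows "retract X Z"
proof -
  obtain i p j q where *: "i \<in> Hom C X Y" "p \<in> Hom C Y X" "p \<star> i = Idn C X"
    "j \<in> Hom C Y Z" "q \<in> Hom C Z Y" "q \<star> j = Idn C Y"
    using assms unfolding retract_def by blast
  show ?thesis
    by (rule retractI[of "j \<star> i" _ _ "p \<star> q"])
      (use * cmp_reduce[OF *(6,4,5)] in \<open>simp_all add: cs\<close>)
qed

lemma iso_pair_retract: "iso_pair C X Y f g \<Longrightarrow> retract X Y \<and> retract Y X"
  unfolding iso_pair_def using retractI by blast

lemma isomorphic_retract: "isomorphic C X Y \<Longrightarrow> retract X Y \<and> retract Y X"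
  unfolding isomorphic_def using iso_pair_retract by blast

lemma iso_pair_sym: "iso_pair C X Y f g \<Longrightarrow> iso_pair C Y X g f"
  unfolding iso_pair_def by blast

lemma isomorphic_sym: "isomorphic C X Y \<Longrightarrow> isomorphic C Y X"
  unfolding isomorphic_def using iso_pair_sym by blast

lemma isomorphic_refl: "X \<in> Obj C \<Longrightarrow> isomorphic C X X"
  unfolding isomorphic_def iso_pair_def
  by (auto intro!: exI[of _ "Idn C X"] simp: cs)

lemma iso_pair_trans:
  assumes "iso_pair C X Y f g" "iso_pair C Y Z f' g'"
  shows "iso_pair C X Z (f' \<star> f) (g \<star> g')"
proof -
  note * = assms[unfolded iso_pair_def]
  show ?thesis unfolding iso_pair_def
    using * cmp_reduce[of g' f' "Idn C Y" Y Z Y] cmp_reduce[of f g "Idn C Y" Y X Y]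
    by (simp add: cs)
qed

lemma isomorphic_trans: "isomorphic C X Y \<Longrightarrow> isomorphic C Y Z \<Longrightarrow> isomorphic C X Z"
  unfolding isomorphic_def using iso_pair_trans by blast

lemma isomorphicI: "iso_pair C X Y f g \<Longrightarrow> isomorphic C X Y"
  unfolding isomorphic_def iso_pair_def using Hom_ob by blast

lemma zero_object_retract:
  assumes "zero_object C Z" "retract X Z" shows "zero_object C X"
proof -
  obtain i p where ip: "i \<in> Hom C X Z" "p \<in> Hom C Z X" "p \<star> i = Idn C X"
    using assms(2) unfolding retract_def by blast
  have "p = Zro C Z X" using zero_object_hom assms(1) ip by blast
  then have "Idn C X = Zro C X X" using ip Hom_ob[OF ip(1)] by (simp add: cs)
  then show ?thesis using ip Hom_ob by (blast intro: zero_objectI)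
qed

lemma dsumD:
  assumes "dsum C Z I X"
  obtains i p where "\<And>k. k \<in> I \<Longrightarrow> i k \<in> Hom C (X k) Z" "\<And>k. k \<in> I \<Longrightarrow> p k \<in> Hom C Z (X k)"
    "\<And>k. k \<in> I \<Longrightarrow> p k \<star> i k = Idn C (X k)"
    "\<And>k l. k \<in> I \<Longrightarrow> l \<in> I \<Longrightarrow> k \<noteq> l \<Longrightarrow> p l \<star> i k = Zro C (X k) (X l)"
    "Idn C Z \<in> asum Z Z ((\<lambda>k. i k \<star> p k) ` I)"
proof -
  obtain i p where ip: "\<forall>k\<in>I. i k \<in> Hom C (X k) Z \<and> p k \<in> Hom C Z (X k)"
    "\<forall>k\<in>I. \<forall>l\<in>I. p l \<star> i k = (if k = l then Idn C (X k) else Zro C (X k) (X l))"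
    "finsum (End C Z) (\<lambda>k. i k \<star> p k) I = Idn C Z"
    using assms unfolding dsum_def by blast
  have "finsum (End C Z) (\<lambda>k. i k \<star> p k) I \<in> asum Z Z ((\<lambda>k. i k \<star> p k) ` I)"
    using assms ip unfolding dsum_def by (intro finsum_in_asum) (auto intro: hom_intros)
  then show thesis using ip by (intro that[of i p]) auto
qed

lemma dsum2D:
  assumes "dsum2 C Z X Y"
  obtains i p j q where "i \<in> Hom C X Z" "p \<in> Hom C Z X" "j \<in> Hom C Y Z" "q \<in> Hom C Z Y"
    "p \<star> i = Idn C X" "q \<star> j = Idn C Y" "q \<star> i = Zro C X Y" "p \<star> j = Zro C Y X"
    "(i \<star> p) \<boxplus> (j \<star> q) = Idn C Z"
proof -
  let ?X = "\<lambda>b::bool. if b then X else Y"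
  obtain i p where ip: "\<forall>k. i k \<in> Hom C (?X k) Z \<and> p k \<in> Hom C Z (?X k)"
    "\<forall>k l. p l \<star> i k = (if k = l then Idn C (?X k) else Zro C (?X k) (?X l))"
    "finsum (End C Z) (\<lambda>k. i k \<star> p k) UNIV = Idn C Z" and Z: "Z \<in> Obj C"
    using assms unfolding dsum2_def dsum_def by blast
  interpret kspace "End C Z" using hom_kspace Z by blast
  have h: "i True \<in> Hom C X Z" "p True \<in> Hom C Z X" "i False \<in> Hom C Y Z" "p False \<in> Hom C Z Y"
    using ip(1)[rule_format, of True] ip(1)[rule_format, of False] by auto
  have "i True \<star> p True \<in> Hom C Z Z" "i False \<star> p False \<in> Hom C Z Z" using h cmp_hom by blast+
  then have "finsum (End C Z) (\<lambda>k. i k \<star> p k) UNIV = (i True \<star> p True) \<boxplus> (i False \<star> p False)"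
    unfolding UNIV_bool by (simp add: h hom_module_laws(1,5)[of _ Z Z])
  then show thesis
    using ip(2)[rule_format, of True True] ip(2)[rule_format, of False False]
      ip(2)[rule_format, of True False] ip(2)[rule_format, of False True] ip(3)
    by (intro that[OF h]) auto
qed

lemma dsum2I:
  assumes h: "i \<in> Hom C X Z" "p \<in> Hom C Z X" "j \<in> Hom C Y Z" "q \<in> Hom C Z Y"
    and "p \<star> i = Idn C X" "q \<star> j = Idn C Y" "q \<star> i = Zro C X Y" "p \<star> j = Zro C Y X"
    "(i \<star> p) \<boxplus> (j \<star> q) = Idn C Z"
  shows "dsum2 C Z X Y"
proof -
  have ob: "X \<in> Obj C" "Y \<in> Obj C" "Z \<in> Obj C" using h Hom_ob by auto
  interpret kspace "End C Z" using hom_kspace ob by blast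
  let ?i = "\<lambda>b. if b then i else j" and ?p = "\<lambda>b. if b then p else q"
  have "i \<star> p \<in> Hom C Z Z" "j \<star> q \<in> Hom C Z Z" using h cmp_hom by blast+
  then have "finsum (End C Z) (\<lambda>k. ?i k \<star> ?p k) UNIV = Idn C Z"
    unfolding UNIV_bool using assms by (simp add: h hom_module_laws(1,5)[of _ Z Z])
  then show ?thesis unfolding dsum2_def dsum_def
    using assms ob by (intro conjI exI[of _ ?i] exI[of _ ?p]) auto
qed

lemma summand_imp_retract: "summand C X Z \<Longrightarrow> retract X Z"
  unfolding summand_def by (elim exE dsum2D) (rule retractI)

lemma dsum2_retract: "dsum2 C Z X Y \<Longrightarrow> retract X Z \<and> retract Y Z"
  by (elim dsum2D) (blast intro: retractI)

definition thru_gens :: "'o \<Rightarrow> 'o \<Rightarrow> 'o \<Rightarrow> 'm set" where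
  "thru_gens T X Y = {b \<star> a | a b. a \<in> Hom C X T \<and> b \<in> Hom C T Y}"

abbreviation thru :: "'o \<Rightarrow> 'o \<Rightarrow> 'o \<Rightarrow> 'm set" where
  "thru T X Y \<equiv> asum X Y (thru_gens T X Y)"

text \<open>
  An object lies in \<open>add T\<close> when its identity is a sum of maps factoring through \<open>T\<close>. In this form
  no direct powers of \<open>T\<close> have to be formed.
\<close>

definition in_add :: "'o \<Rightarrow> 'o \<Rightarrow> bool" where
  "in_add T X \<longleftrightarrow> X \<in> Obj C \<and> Idn C X \<in> thru T X X"

lemma thru_gens_hom: "thru_gens T X Y \<subseteq> Hom C X Y"
  unfolding thru_gens_def using cmp_hom by blast

lemma thru_gensI: "a \<in> Hom C X T \<Longrightarrow> b \<in> Hom C T Y \<Longrightarrow> b \<star> a \<in> thru_gens T X Y"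
  unfolding thru_gens_def by blast

lemma thruI: "a \<in> Hom C X T \<Longrightarrow> b \<in> Hom C T Y \<Longrightarrow> b \<star> a \<in> thru T X Y"
  by (intro asum_gen thru_gensI)

lemma thru_cmp:
  assumes "f \<in> thru T X Y" "a \<in> Hom C X' X" "b \<in> Hom C Y Y'"
  shows "b \<star> (f \<star> a) \<in> thru T X' Y'"
proof (rule asum_cmp[OF assms(1) thru_gens_hom _ _ assms(2,3)])
  show "X \<in> Obj C" "Y \<in> Obj C" using assms Hom_ob by auto
  fix k assume "k \<in> thru_gens T X Y"
  then obtain c d where cd: "k = d \<star> c" "c \<in> Hom C X T" "d \<in> Hom C T Y" unfolding thru_gens_def by blast
  have "b \<star> (k \<star> a) = (b \<star> d) \<star> (c \<star> a)" using cd assms by (simp add: cs)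
  then show "b \<star> (k \<star> a) \<in> thru T X' Y'" using cd assms by (auto intro: thruI cmp_hom)
qed

lemma in_add_trans_gen:
  assumes "X \<in> Obj C" "Idn C X \<in> asum X X K"
    and "\<And>k. k \<in> K \<Longrightarrow> \<exists>Y a b. in_add T Y \<and> a \<in> Hom C X Y \<and> b \<in> Hom C Y X \<and> k = b \<star> a"
  shows "in_add T X"
  unfolding in_add_def
proof
  show "Idn C X \<in> thru T X X"
  proof (rule asum_mono[OF assms(2)], rule subsetI)
    fix k assume "k \<in> K"
    then obtain Y a b where Y: "in_add T Y" "a \<in> Hom C X Y" "b \<in> Hom C Y X" "k = b \<star> a"
      using assms(3) by blast
    then have "b \<star> (Idn C Y \<star> a) \<in> thru T X X" unfolding in_add_def by (blast intro: thru_cmp)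
    then show "k \<in> thru T X X" using Y by (simp add: cs)
  qed
qed (rule assms)

lemma in_add_retract:
  assumes "in_add T Y" "retract X Y" shows "in_add T X"
proof -
  obtain i p where ip: "i \<in> Hom C X Y" "p \<in> Hom C Y X" "p \<star> i = Idn C X"
    using assms unfolding retract_def by blast
  have "p \<star> (Idn C Y \<star> i) \<in> thru T X X"
    using assms ip unfolding in_add_def by (intro thru_cmp) auto
  then show ?thesis using ip Hom_ob unfolding in_add_def by (auto simp: cs)
qed

lemma in_add_refl: "T \<in> Obj C \<Longrightarrow> in_add T T"
  unfolding in_add_def using thruI[of "Idn C T" T T "Idn C T" T] by (simp add: cs)

lemma retract_in_add: "retract X T \<Longrightarrow> in_add T X"
  using in_add_retract in_add_refl retract_ob by blast

lemma in_add_trans: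
  assumes W: "in_add T W" and X: "in_add W X" shows "in_add T X"
proof (rule in_add_trans_gen)
  show "X \<in> Obj C" "Idn C X \<in> asum X X (thru_gens W X X)" using X unfolding in_add_def by blast+
  show "\<exists>Y a b. in_add T Y \<and> a \<in> Hom C X Y \<and> b \<in> Hom C Y X \<and> k = b \<star> a"
    if "k \<in> thru_gens W X X" for k using that W unfolding thru_gens_def by blast
qed

lemma in_add_ob: "in_add T X \<Longrightarrow> X \<in> Obj C"
  by (simp add: in_add_def)

lemma add_closure_in_add:
  assumes "Y \<in> add_closure C T" shows "in_add T Y"
proof -
  obtain n Z where Z: "dsum C Z {..<n::nat} (\<lambda>_. T)" "summand C Y Z"
    using assms unfolding add_closure_def by blast
  from Z(1) obtain i p where ip: "\<And>k. k \<in> {..<n} \<Longrightarrow> i k \<in> Hom C T Z"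
    "\<And>k. k \<in> {..<n} \<Longrightarrow> p k \<in> Hom C Z T" "Idn C Z \<in> asum Z Z ((\<lambda>k. i k \<star> p k) ` {..<n})"
    by (rule dsumD) blast
  have "in_add T Z"
  proof (rule in_add_trans_gen[OF _ ip(3)])
    show "Z \<in> Obj C" using Z(1) unfolding dsum_def by blast
    fix k assume "k \<in> (\<lambda>k. i k \<star> p k) ` {..<n}"
    then obtain l where l: "l \<in> {..<n}" "k = i l \<star> p l" by blast
    then show "\<exists>Y a b. in_add T Y \<and> a \<in> Hom C Z Y \<and> b \<in> Hom C Y Z \<and> k = b \<star> a"
      using ip(1,2)[OF l(1)] in_add_refl Hom_ob by blast
  qed
  then show ?thesis using in_add_retract summand_imp_retract[OF Z(2)] by blast
qed

lemma in_add_zero_left: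
  assumes "in_add T Y" "\<And>h. h \<in> Hom C T W \<Longrightarrow> h = Zro C T W" "f \<in> Hom C Y W"
  shows "f = Zro C Y W"
proof -
  have ob: "Y \<in> Obj C" "W \<in> Obj C" using assms Hom_ob by auto
  have "f \<star> Idn C Y \<in> {Zro C Y W}"
  proof (rule asum_map[OF _ thru_gens_hom, where F = "\<lambda>g. f \<star> g"])
    show "Idn C Y \<in> thru T Y Y" using assms unfolding in_add_def by blast
    show "f \<star> Zro C Y Y \<in> {Zro C Y W}" using assms ob by (simp add: cs)
    show "f \<star> k \<in> {Zro C Y W}" if k: "k \<in> thru_gens T Y Y" for k
    proof -
      obtain a b where ab: "a \<in> Hom C Y T" "b \<in> Hom C T Y" "k = b \<star> a" using k unfolding thru_gens_def by blast
      have "f \<star> k = (f \<star> b) \<star> a" using ab assms by (simp add: cs)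
      also have "f \<star> b = Zro C T W" using ab assms cmp_hom by blast
      finally show ?thesis using ab ob by (simp add: cs)
    qed
  qed (use ob assms in \<open>auto simp: cs\<close>)
  then show ?thesis using assms by (simp add: cs)
qed

definition ind_gens :: "'o \<Rightarrow> 'm set" where
  "ind_gens X = {i \<star> p | i p Y. indecomposable C Y \<and> i \<in> Hom C Y X \<and> p \<in> Hom C X Y \<and> p \<star> i = Idn C Y}"

lemma ind_gens_hom: "ind_gens X \<subseteq> Hom C X X"
  unfolding ind_gens_def using cmp_hom by blast

end

locale kscat =
  fixes C :: "('o, 'm, 'k::field, 'z) lcat_scheme" (structure)
  assumes kscat: "hom_finite_krull_schmidt C"
begin

sublocale lincat C
  using kscat unfolding hom_finite_krull_schmidt_def additive_category_def by unfold_locales blast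

lemma fin: "X \<in> Obj C \<Longrightarrow> Y \<in> Obj C \<Longrightarrow> kspace.fin_dim (hom_mod C X Y)"
  using kscat kspace.fin_dim_def[OF hom_kspace]
  unfolding hom_finite_krull_schmidt_def hom_finite_def by simp

lemma zero_exists: "\<exists>Z. zero_object C Z"
  using kscat unfolding hom_finite_krull_schmidt_def additive_category_def by blast

lemma dsum2_exists: "X \<in> Obj C \<Longrightarrow> Y \<in> Obj C \<Longrightarrow> \<exists>Z. dsum2 C Z X Y"
  using kscat unfolding hom_finite_krull_schmidt_def additive_category_def by blast

lemma split_idem:
  assumes "e \<in> Hom C X X" "e \<star> e = e"
  obtains Y i p where "i \<in> Hom C Y X" "p \<in> Hom C X Y" "p \<star> i = Idn C Y" "i \<star> p = e"
  using kscat assms Hom_ob[OF assms(1)] unfolding hom_finite_krull_schmidt_def split_idempotents_def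
  by metis

text \<open>Split off the complementary idempotent.\<close>

lemma retract_dsum2:
  assumes "i \<in> Hom C X Z" "p \<in> Hom C Z X" "p \<star> i = Idn C X"
  obtains Y j q where "dsum2 C Z X Y" "j \<in> Hom C Y Z" "q \<in> Hom C Z Y" "q \<star> j = Idn C Y"
    "j \<star> q = Idn C Z \<boxplus> neg (i \<star> p)"
proof -
  let ?e = "Idn C Z \<boxplus> neg (i \<star> p)"
  have ob: "X \<in> Obj C" "Z \<in> Obj C" using assms Hom_ob by auto
  note red = cmp_reduce[OF assms(3,1,2)]
  have eh: "?e \<in> Hom C Z Z" and ee: "?e \<star> ?e = ?e" using assms ob red by (simp_all add: cs)
  obtain Y j q where jq: "j \<in> Hom C Y Z" "q \<in> Hom C Z Y" "q \<star> j = Idn C Y" "j \<star> q = ?e"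
    using split_idem[OF eh ee] .
  have obY: "Y \<in> Obj C" using jq Hom_ob by auto
  have ei: "?e \<star> i = Zro C X Z" "p \<star> ?e = Zro C Z X" using assms ob red by (simp_all add: cs cmp_reduce[OF assms(3,1,2)] assms(3))
  have "q \<star> i = Idn C Y \<star> (q \<star> i)" using jq assms by (simp add: cs)
  also have "\<dots> = q \<star> ((j \<star> q) \<star> i)" unfolding jq(3)[symmetric] using jq(1,2) assms by (simp add: cs)
  also have "\<dots> = Zro C X Y" unfolding jq(4) ei using jq ob by (simp add: cs)
  finally have qi: "q \<star> i = Zro C X Y" .
  have "p \<star> j = (p \<star> j) \<star> Idn C Y" using jq assms by (simp add: cs)
  also have "\<dots> = (p \<star> (j \<star> q)) \<star> j" unfolding jq(3)[symmetric] using jq(1,2) assms by (simp add: cs)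
  also have "\<dots> = Zro C Y X" unfolding jq(4) ei using jq ob by (simp add: cs)
  finally have pj: "p \<star> j = Zro C Y X" .
  have "dsum2 C Z X Y"
    by (rule dsum2I[OF assms(1,2) jq(1,2) assms(3) jq(3) qi pj])
      (use jq(4) assms ob in \<open>simp add: cs pls_ac\<close>)
  then show thesis using jq by (intro that) auto
qed

lemma retract_imp_summand: "retract X Z \<Longrightarrow> summand C X Z"
  unfolding retract_def summand_def using retract_dsum2 by metis

lemma summand_iff_retract: "summand C X Z \<longleftrightarrow> retract X Z"
  using retract_imp_summand summand_imp_retract by blast

lemma retract_add_closure:
  assumes "retract X T" shows "X \<in> add_closure C T"
proof -
  have T: "T \<in> Obj C" using retract_ob assms by blast
  interpret kspace "End C T" using hom_kspace T by blast
  have "dsum C T {..<1::nat} (\<lambda>_. T)"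
    unfolding dsum_def using T
    by (auto intro!: exI[of _ "\<lambda>_. Idn C T"] hom_intros simp: cs lessThan_Suc)
  then show ?thesis using retract_imp_summand[OF assms] unfolding add_closure_def by blast
qed

lemma indec_ob: "indecomposable C X \<Longrightarrow> X \<in> Obj C" and indec_nz: "indecomposable C X \<Longrightarrow> \<not> zero_object C X"
  unfolding indecomposable_def by auto

lemma indec_idem:
  assumes X: "indecomposable C X" and e: "e \<in> Hom C X X" "e \<star> e = e"
  shows "e = Zro C X X \<or> e = Idn C X"
proof -
  obtain A i p where ip: "i \<in> Hom C A X" "p \<in> Hom C X A" "p \<star> i = Idn C A" "i \<star> p = e"
    using split_idem[OF e] .
  obtain Y j q where jq: "dsum2 C X A Y" "j \<in> Hom C Y X" "q \<in> Hom C X Y" "q \<star> j = Idn C Y"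
    "j \<star> q = Idn C X \<boxplus> neg (i \<star> p)"
    using retract_dsum2[OF ip(1-3)] .
  have ob: "X \<in> Obj C" using indec_ob X by blast
  from X jq(1) consider "zero_object C A" | "zero_object C Y" unfolding indecomposable_def by blast
  then show ?thesis
  proof cases
    case 1
    then have "i = Zro C A X" using zero_object_hom ip by blast
    then show ?thesis using ip ob Hom_ob by (auto simp: cs)
  next
    case 2
    then have "j = Zro C Y X" using zero_object_hom jq by blast
    then have "Idn C X \<boxplus> neg e = Zro C X X" using jq(3,5) ip(4) ob by (auto simp: cs)
    then have "Idn C X = e" using neg_eq_zro_iff e idn_hom ob by blast
    then show ?thesis by blast
  qed
qed

text \<open>
  The composite \<open>s r\<close> is an idempotent of the indecomposable object \<open>B\<close>,
  hence zero or the identity.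
\<close>

lemma retract_indec_iso:
  assumes "s \<in> Hom C A B" "r \<in> Hom C B A" "r \<star> s = Idn C A" "\<not> zero_object C A" "indecomposable C B"
  shows "iso_pair C A B s r"
proof -
  have ob: "A \<in> Obj C" "B \<in> Obj C" using assms Hom_ob by auto
  note red = cmp_reduce[OF assms(3,1,2)]
  have "s \<star> r \<in> Hom C B B" "(s \<star> r) \<star> (s \<star> r) = s \<star> r" using assms ob red by (simp_all add: cs)
  then consider "s \<star> r = Zro C B B" | "s \<star> r = Idn C B" using indec_idem[OF assms(5)] by blast
  then show ?thesis
  proof cases
    case 1
    have "Idn C A = r \<star> ((s \<star> r) \<star> s)" using assms red ob by (simp add: cs)
    also have "\<dots> = Zro C A A" unfolding 1 using assms ob by (simp add: cs)
    finally show ?thesis using assms ob zero_objectI by blast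
  next
    case 2
    then show ?thesis using assms unfolding iso_pair_def by blast
  qed
qed

lemma retract_indec_isomorphic:
  "retract A B \<Longrightarrow> \<not> zero_object C A \<Longrightarrow> indecomposable C B \<Longrightarrow> isomorphic C A B"
  unfolding retract_def using retract_indec_iso isomorphicI by blast

lemma iso_pair_not_crad: "iso_pair C X Y f g \<Longrightarrow> f \<in> crad X Y \<Longrightarrow> zero_object C X"
  unfolding iso_pair_def using crad_cmp_left[of f X Y g X] idn_in_crad by auto

lemma End_pow:
  assumes "f \<in> Hom C X X"
  shows "f [^]\<^bsub>End C X\<^esub> (n::nat) \<in> Hom C X X"
    "f [^]\<^bsub>End C X\<^esub> Suc n = (f [^]\<^bsub>End C X\<^esub> n) \<star> f"
    "f [^]\<^bsub>End C X\<^esub> (0::nat) = Idn C X"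
proof -
  interpret kalgebra "End C X" using End_algebra Hom_ob assms by blast
  show "f [^]\<^bsub>End C X\<^esub> (n::nat) \<in> Hom C X X" using nat_pow_closed[of f n] assms by simp
qed simp_all

text \<open>
  The idempotent provided by Fitting's lemma is zero or the identity. This is the locality of the
  endomorphism ring.
\<close>

lemma indec_nilpotent_or_iso:
  assumes X: "indecomposable C X" and f: "f \<in> Hom C X X"
  shows "(\<exists>g. iso_pair C X X f g) \<or> (\<exists>n::nat. f [^]\<^bsub>End C X\<^esub> n = Zro C X X)"
proof -
  have ob: "X \<in> Obj C" using indec_ob X by blast
  interpret kalgebra "End C X" using End_algebra ob by blast
  obtain e u and n :: nat where e: "e \<in> Hom C X X" "u \<in> Hom C X X" "e \<star> e = e" "f \<star> u = e" "u \<star> f = e"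
    "(f [^]\<^bsub>End C X\<^esub> n) \<star> e = f [^]\<^bsub>End C X\<^esub> n"
    using fitting[OF fin[OF ob ob], of f] f by (metis hom_sel(1,5))
  from indec_idem[OF X e(1,3)] show ?thesis
  proof
    assume "e = Zro C X X"
    then have "f [^]\<^bsub>End C X\<^esub> n = Zro C X X"
      using e(6) End_pow(1)[OF f, of n] ob by (simp add: cs)
    then show ?thesis by blast
  next
    assume "e = Idn C X"
    then show ?thesis using e f unfolding iso_pair_def by blast
  qed
qed

text \<open>The geometric series inverts \<open>1 - f\<close>.\<close>

lemma nilpotent_left_inverse:
  assumes "f \<in> Hom C X X" "f [^]\<^bsub>End C X\<^esub> (n::nat) = Zro C X X"
  shows "\<exists>h\<in>Hom C X X. h \<star> (Idn C X \<boxplus> neg f) = Idn C X"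
proof -
  have ob: "X \<in> Obj C" using assms Hom_ob by blast
  interpret kalgebra "End C X" using End_algebra ob by blast
  have "\<exists>h\<in>Hom C X X. h \<star> (Idn C X \<boxplus> neg f) = Idn C X \<boxplus> neg (f [^]\<^bsub>End C X\<^esub> n)" for n :: nat
  proof (induction n)
    case 0
    then show ?case using ob assms by (intro bexI[of _ "Zro C X X"]) (simp_all add: End_pow cs)
  next
    case (Suc n)
    then obtain h where h: "h \<in> Hom C X X" "h \<star> (Idn C X \<boxplus> neg f) = Idn C X \<boxplus> neg (f [^]\<^bsub>End C X\<^esub> n)"
      by blast
    have p: "f [^]\<^bsub>End C X\<^esub> n \<in> Hom C X X" using End_pow assms by blast
    let ?h = "h \<boxplus> f [^]\<^bsub>End C X\<^esub> n"
    have "?h \<star> (Idn C X \<boxplus> neg f) = (h \<star> (Idn C X \<boxplus> neg f)) \<boxplus> ((f [^]\<^bsub>End C X\<^esub> n) \<star> (Idn C X \<boxplus> neg f))"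
      using h(1) p assms(1) ob by (simp add: cs pls_ac)
    also have "\<dots> = Idn C X \<boxplus> neg (f [^]\<^bsub>End C X\<^esub> Suc n)"
      unfolding h(2) using p assms(1) ob by (simp add: cs)
    finally show ?case using h p by (intro bexI[of _ ?h]) (simp_all add: pls_hom)
  qed
  moreover have "Idn C X \<boxplus> neg (f [^]\<^bsub>End C X\<^esub> n) = Idn C X" unfolding assms(2) using ob by (simp add: cs)
  ultimately show ?thesis by metis
qed

text \<open>
  If \<open>1 - g f\<close> has no left inverse, then \<open>g f\<close> is not nilpotent, hence
  invertible.
\<close>

lemma indec_local:
  assumes X: "indecomposable C X" and f: "f \<in> Hom C X X" and r: "f \<notin> crad X X"
  shows "\<exists>g. iso_pair C X X f g"
proof -
  obtain g where g: "g \<in> Hom C X X" "\<not> (\<exists>h\<in>Hom C X X. h \<star> (Idn C X \<boxplus> neg (g \<star> f)) = Idn C X)"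
    using r f unfolding crad_def by blast
  have gf: "g \<star> f \<in> Hom C X X" using f g cmp_hom by blast
  have "\<exists>g'. iso_pair C X X (g \<star> f) g'"
    using indec_nilpotent_or_iso[OF X gf] nilpotent_left_inverse[OF gf] g by blast
  then obtain g' where "g' \<in> Hom C X X" "g' \<star> (g \<star> f) = Idn C X" unfolding iso_pair_def by blast
  then have "iso_pair C X X f (g' \<star> g)"
    using f g X indec_nz by (intro retract_indec_iso) (auto intro: cmp_hom simp: cs)
  then show ?thesis by blast
qed

lemma not_crad_iso:
  assumes X: "indecomposable C X" and Y: "indecomposable C Y" and f: "f \<in> Hom C X Y" "f \<notin> crad X Y"
  shows "\<exists>g. iso_pair C X Y f g"
proof -
  obtain g where g: "g \<in> Hom C Y X" "\<not> (\<exists>h\<in>Hom C X X. h \<star> (Idn C X \<boxplus> neg (g \<star> f)) = Idn C X)"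
    using f unfolding crad_def by blast
  have gf: "g \<star> f \<in> Hom C X X" using f g cmp_hom by blast
  have "g \<star> f \<notin> crad X X"
  proof
    assume "g \<star> f \<in> crad X X"
    then obtain h where "h \<in> Hom C X X" "h \<star> (Idn C X \<boxplus> neg (Idn C X \<star> (g \<star> f))) = Idn C X"
      using X unfolding crad_def by (blast intro: idn_hom indec_ob)
    then show False using g gf by (auto simp: cs)
  qed
  then obtain g' where "g' \<in> Hom C X X" "g' \<star> (g \<star> f) = Idn C X"
    using indec_local[OF X gf] unfolding iso_pair_def by blast
  then have "iso_pair C X Y f (g' \<star> g)"
    using f g X Y indec_nz by (intro retract_indec_iso) (auto intro: cmp_hom simp: cs)
  then show ?thesis by blast
qed

text \<open>Otherwise all terms, and hence the identity, would be radical.\<close>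

lemma local_sum:
  assumes A: "indecomposable C A" and "Idn C A \<in> asum A A K" "K \<subseteq> Hom C A A"
  shows "\<exists>k\<in>K. \<exists>g. iso_pair C A A k g"
proof (rule ccontr)
  assume "\<not> ?thesis"
  then have "K \<subseteq> crad A A" using indec_local[OF A] assms(3) by blast
  then have "Idn C A \<in> crad A A" using crad_asum assms(2) indec_ob[OF A] by blast
  then show False using idn_in_crad indec_nz[OF A] by blast
qed

text \<open>
  One term of the decomposed identity of \<open>Z\<close> stays invertible when it is restricted
  to \<open>A\<close>. In this form the uniqueness of decompositions into indecomposables is used
  below.
\<close>

lemma indec_retract_sum:
  assumes A: "indecomposable C A" and "retract A Z" "Idn C Z \<in> asum Z Z K"
    and K: "\<And>k. k \<in> K \<Longrightarrow> \<exists>Y a b. a \<in> Hom C Z Y \<and> b \<in> Hom C Y Z \<and> k = b \<star> a \<and> P Y"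
  shows "\<exists>Y. retract A Y \<and> P Y"
proof -
  obtain i p where ip: "i \<in> Hom C A Z" "p \<in> Hom C Z A" "p \<star> i = Idn C A"
    using assms(2) unfolding retract_def by blast
  have Z: "Z \<in> Obj C" using ip Hom_ob by blast
  have Kh: "K \<subseteq> Hom C Z Z" using K cmp_hom by blast
  have "p \<star> (Idn C Z \<star> i) \<in> asum A A ((\<lambda>k. p \<star> (k \<star> i)) ` K)"
    by (rule asum_cmp[OF assms(3) Kh Z Z ip(1,2)]) (auto intro: asum_gen)
  then have "Idn C A \<in> asum A A ((\<lambda>k. p \<star> (k \<star> i)) ` K)" using ip by (simp add: cs)
  moreover have "(\<lambda>k. p \<star> (k \<star> i)) ` K \<subseteq> Hom C A A" using ip Kh by (auto intro!: cmp_hom)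
  ultimately obtain k g where k: "k \<in> K" "iso_pair C A A (p \<star> (k \<star> i)) g"
    using local_sum[OF A] by blast
  obtain Y a b where Y: "a \<in> Hom C Z Y" "b \<in> Hom C Y Z" "k = b \<star> a" "P Y" using K[OF k(1)] by blast
  have "retract A Y"
    by (rule retractI[of "a \<star> i" _ _ "g \<star> (p \<star> b)"])
      (use k(2) Y ip in \<open>auto simp: iso_pair_def cs\<close>)
  then show ?thesis using Y by blast
qed

lemma indec_retract_dsum:
  assumes "indecomposable C A" "retract A Z" "dsum C Z I X"
  shows "\<exists>i\<in>I. retract A (X i)"
  using assms(3)
proof (rule dsumD)
  fix i p assume ip: "\<And>k. k \<in> I \<Longrightarrow> i k \<in> Hom C (X k) Z" "\<And>k. k \<in> I \<Longrightarrow> p k \<in> Hom C Z (X k)"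
    and s: "Idn C Z \<in> asum Z Z ((\<lambda>k. i k \<star> p k) ` I)"
  have "\<exists>Y. retract A Y \<and> Y \<in> X ` I"
    by (rule indec_retract_sum[OF assms(1,2) s]) (use ip in blast)
  then show ?thesis by blast
qed

lemma indec_retract_dsum2:
  assumes "indecomposable C A" "retract A Z" "dsum2 C Z X Y"
  shows "retract A X \<or> retract A Y"
  using indec_retract_dsum[OF assms(1,2) assms(3)[unfolded dsum2_def]] by (auto split: if_splits)

lemma indec_in_add:
  assumes "indecomposable C A" "in_add T A" shows "retract A T"
proof -
  have "\<exists>Y. retract A Y \<and> Y = T"
    by (rule indec_retract_sum[OF assms(1) retract_refl, where K = "thru_gens T A A"])
      (use assms indec_ob in \<open>auto simp: in_add_def thru_gens_def\<close>)
  then show ?thesis by blast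
qed

text \<open>
  A basis of \<open>End A\<close> together with the idempotent belonging to \<open>B\<close> is
  independent in \<open>End X\<close>.
\<close>

lemma vdim_summand_less:
  assumes "dsum2 C X A B" "\<not> zero_object C B"
  shows "kspace.vdim (End C A) < kspace.vdim (End C X)"
  using assms(1)
proof (rule dsum2D)
  fix i p j q assume h: "i \<in> Hom C A X" "p \<in> Hom C X A" "j \<in> Hom C B X" "q \<in> Hom C X B"
    and e: "p \<star> i = Idn C A" "q \<star> j = Idn C B" "q \<star> i = Zro C A B" "p \<star> j = Zro C B A"
  have ob: "A \<in> Obj C" "B \<in> Obj C" "X \<in> Obj C" using h Hom_ob by auto
  interpret A: kspace "End C A" using hom_kspace ob by blast
  interpret X: kspace "End C X" using hom_kspace ob by blast
  obtain S where S: "A.qbasis (Hom C A A) {Zro C A A} S (\<lambda>x. x)" "card S = A.vdim"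
    using A.fin_dim_basis[OF fin[OF ob(1,1)]] by (metis hom_sel(1,4))
  have SA: "S \<subseteq> Hom C A A" and finS: "finite S" using A.qbasisD(1,2)[OF S(1)] by auto
  let ?I = "insert None (Some ` S)"
  define b where "b = (\<lambda>x. case x of None \<Rightarrow> j \<star> q | Some r \<Rightarrow> i \<star> (r \<star> p))"
  have bX: "b \<in> ?I \<rightarrow> Hom C X X" using SA h by (auto simp: b_def intro!: cmp_hom)
  have "X.independent_mod {Zro C X X} ?I b"
    unfolding X.independent_mod_def
  proof (intro allI impI)
    fix c assume "X.lincomb ?I c b \<in> {Zro C X X}"
    then have z: "X.lincomb ?I c b = Zro C X X" by simp
    interpret L: klinear "End C X" "End C A" "\<lambda>r. p \<star> (r \<star> i)" using klinear_cmp h by blast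
    interpret M: klinear "End C X" "End C B" "\<lambda>r. q \<star> (r \<star> j)" using klinear_cmp h by blast
    have pi: "p \<star> (b (Some r) \<star> i) = r" "q \<star> (b (Some r) \<star> j) = Zro C B B" if "r \<in> S" for r
    proof -
      have r: "r \<in> Hom C A A" using that SA by blast
      show "p \<star> (b (Some r) \<star> i) = r" "q \<star> (b (Some r) \<star> j) = Zro C B B"
        unfolding b_def using r h ob e cmp_reduce[OF e(1) h(1,2)] cmp_reduce[OF e(3) h(1,4)]
        by (simp_all add: cs)
    qed
    have qj: "p \<star> (b None \<star> i) = Zro C A A" "q \<star> (b None \<star> j) = Idn C B"
      unfolding b_def using h ob e cmp_reduce[OF e(2) h(3,4)] cmp_reduce[OF e(4) h(3,2)]
      by (simp_all add: cs)
    have fin': "finite ?I" "None \<notin> Some ` S" using finS by auto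
    have "p \<star> (X.lincomb ?I c b \<star> i) = A.lincomb ?I c (\<lambda>x. p \<star> (b x \<star> i))"
      using L.L_lincomb[OF fin'(1)] bX by simp
    also have "\<dots> = Scl C (c None) (Zro C A A) \<boxplus> A.lincomb (Some ` S) c (\<lambda>x. p \<star> (b x \<star> i))"
      using bX h finS qj(1) zro_hom[OF ob(1,1)] by (subst A.lincomb_insert) (auto intro!: cmp_hom)
    also have "A.lincomb (Some ` S) c (\<lambda>x. p \<star> (b x \<star> i)) = A.lincomb S (\<lambda>r. c (Some r)) (\<lambda>x. x)"
    proof -
      have "A.lincomb (Some ` S) c (\<lambda>x. p \<star> (b x \<star> i)) = A.lincomb S (\<lambda>r. c (Some r)) (\<lambda>r. p \<star> (b (Some r) \<star> i))"
        unfolding A.lincomb_def using bX h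
        by (subst A.M.finsum_reindex) (auto intro!: cmp_hom scl_hom)
      also have "\<dots> = A.lincomb S (\<lambda>r. c (Some r)) (\<lambda>x. x)"
        using pi SA by (intro A.lincomb_cong) auto
      finally show ?thesis .
    qed
    also have "Scl C (c None) (Zro C A A) = Zro C A A" using ob by (simp add: cs)
    also have "Zro C A A \<boxplus> A.lincomb S (\<lambda>r. c (Some r)) (\<lambda>x. x) = A.lincomb S (\<lambda>r. c (Some r)) (\<lambda>x. x)"
      using A.lincomb_closed[of S "\<lambda>x. x"] SA by (intro hom_module_laws(2)) auto
    finally have "A.lincomb S (\<lambda>r. c (Some r)) (\<lambda>x. x) = Zro C A A" using z h ob by (simp add: cs)
    then have cS: "c (Some r) = 0" if "r \<in> S" for r
      using A.qbasisD(4)[OF S(1), of "\<lambda>r. c (Some r)" r] that by simp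
    have "q \<star> (X.lincomb ?I c b \<star> j) = kspace.lincomb (End C B) ?I c (\<lambda>x. q \<star> (b x \<star> j))"
      using M.L_lincomb[OF fin'(1)] bX by simp
    also have "\<dots> = Scl C (c None) (Idn C B) \<boxplus> kspace.lincomb (End C B) (Some ` S) c (\<lambda>x. q \<star> (b x \<star> j))"
      using bX h finS qj(2) idn_hom[OF ob(2)] by (subst M.N.lincomb_insert) (auto intro!: cmp_hom)
    also have "kspace.lincomb (End C B) (Some ` S) c (\<lambda>x. q \<star> (b x \<star> j)) = Zro C B B"
      using M.N.lincomb_zero[of "Some ` S" c "\<lambda>x. q \<star> (b x \<star> j)"] cS bX h by (auto intro!: cmp_hom)
    finally have "Scl C (c None) (Idn C B) = Zro C B B" using z h ob by (simp add: cs)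
    then have "Scl C (inverse (c None)) (Scl C (c None) (Idn C B)) = Zro C B B" using ob by (simp add: cs)
    then have "c None = 0" using assms(2) zero_objectI[OF ob(2)] ob by (cases "c None = 0") (auto simp: cs)
    then show "\<forall>x\<in>?I. c x = 0" using cS by auto
  qed
  then have "card ?I \<le> X.vdim"
    using X.independent_card_le[OF fin[OF ob(3,3)] X.vsubspace_zero, of ?I b] bX finS by simp
  moreover have "card ?I = Suc (card S)" using finS by (simp add: card_image)
  ultimately show ?thesis using S by simp
qed

lemma dsum2_swap: "dsum2 C Z X Y \<Longrightarrow> dsum2 C Z Y X"
proof (erule dsum2D)
  fix i p j q assume *: "i \<in> Hom C X Z" "p \<in> Hom C Z X" "j \<in> Hom C Y Z" "q \<in> Hom C Z Y"
    "p \<star> i = Idn C X" "q \<star> j = Idn C Y" "q \<star> i = Zro C X Y" "p \<star> j = Zro C Y X"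
    "(i \<star> p) \<boxplus> (j \<star> q) = Idn C Z"
  have "(j \<star> q) \<boxplus> (i \<star> p) = Idn C Z" unfolding *(9)[symmetric] using *(1-4) by (simp add: cs pls_ac)
  then show "dsum2 C Z Y X" using * by (intro dsum2I[of j Y Z q i X p])
qed

text \<open>
  Induction on the dimension of the endomorphism algebra. Only the resulting expression for the
  identity is recorded.
\<close>

theorem decompose: "X \<in> Obj C \<Longrightarrow> Idn C X \<in> asum X X (ind_gens X)"
proof (induction "kspace.vdim (End C X)" arbitrary: X rule: less_induct)
  case less
  show ?case
  proof (cases "indecomposable C X \<or> zero_object C X")
    case True
    then show ?thesis
    proof
      assume "indecomposable C X"
      then have "Idn C X \<star> Idn C X \<in> ind_gens X"
        unfolding ind_gens_def using less.prems idn_hom by (fastforce simp: cs)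
      then show ?thesis using less.prems by (simp add: cs asum_gen)
    qed (simp add: zero_object_def asum_zro)
  next
    case False
    then obtain A B where AB: "dsum2 C X A B" "\<not> zero_object C A" "\<not> zero_object C B"
      using less.prems unfolding indecomposable_def by blast
    from AB(1) show ?thesis
    proof (rule dsum2D)
      fix i p j q assume h: "i \<in> Hom C A X" "p \<in> Hom C X A" "j \<in> Hom C B X" "q \<in> Hom C X B"
        and e: "p \<star> i = Idn C A" "q \<star> j = Idn C B"
        and s: "(i \<star> p) \<boxplus> (j \<star> q) = Idn C X"
      have lift: "i \<star> (Idn C A \<star> p) \<in> asum X X (ind_gens X)"
        if h: "i \<in> Hom C A X" "p \<in> Hom C X A" "p \<star> i = Idn C A" and A: "Idn C A \<in> asum A A (ind_gens A)" for i p A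
      proof (rule asum_cmp[OF A ind_gens_hom _ _ h(2,1)])
        show "A \<in> Obj C" "A \<in> Obj C" using h Hom_ob by auto
        fix k assume "k \<in> ind_gens A"
        then obtain a b Y where Y: "k = a \<star> b" "indecomposable C Y" "a \<in> Hom C Y A" "b \<in> Hom C A Y" "b \<star> a = Idn C Y"
          unfolding ind_gens_def by blast
        have "i \<star> (k \<star> p) = (i \<star> a) \<star> (b \<star> p)" "(b \<star> p) \<star> (i \<star> a) = Idn C Y"
          using h Y cmp_reduce[OF h(3,1,2)] by (simp_all add: cs)
        then have "i \<star> (k \<star> p) \<in> ind_gens X"
          unfolding ind_gens_def using h Y cmp_hom by blast
        then show "i \<star> (k \<star> p) \<in> asum X X (ind_gens X)" by (rule asum_gen)
      qed
      have "A \<in> Obj C" "B \<in> Obj C" using h Hom_ob by auto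
      then have "Idn C A \<in> asum A A (ind_gens A)" "Idn C B \<in> asum B B (ind_gens B)"
        using less.hyps vdim_summand_less AB dsum2_swap by blast+
      then have "i \<star> (Idn C A \<star> p) \<in> asum X X (ind_gens X)" "j \<star> (Idn C B \<star> q) \<in> asum X X (ind_gens X)"
        using lift h e by blast+
      then have "(i \<star> (Idn C A \<star> p)) \<boxplus> (j \<star> (Idn C B \<star> q)) \<in> asum X X (ind_gens X)" by (rule asum_pls)
      then show ?thesis using h s by (simp add: cs)
    qed
  qed
qed

lemma in_add_indecI:
  assumes "X \<in> Obj C" "\<And>A. indecomposable C A \<Longrightarrow> retract A X \<Longrightarrow> retract A T"
  shows "in_add T X"
proof (rule in_add_trans_gen[OF assms(1) decompose[OF assms(1)]])
  fix k assume "k \<in> ind_gens X"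
  then obtain a b Y where Y: "k = a \<star> b" "indecomposable C Y" "a \<in> Hom C Y X" "b \<in> Hom C X Y" "b \<star> a = Idn C Y"
    unfolding ind_gens_def by blast
  then have "retract Y T" using assms(2) retractI by blast
  then show "\<exists>Y a b. in_add T Y \<and> a \<in> Hom C X Y \<and> b \<in> Hom C Y X \<and> k = b \<star> a"
    using Y retract_in_add by blast
qed

lemma nonzero_indec_retract:
  assumes "X \<in> Obj C" "\<not> zero_object C X"
  shows "\<exists>A. indecomposable C A \<and> retract A X"
proof (rule ccontr)
  assume no: "\<not> ?thesis"
  then have "ind_gens X = {}" unfolding ind_gens_def using retractI by blast
  then have "Idn C X \<in> asum X X {}" using decompose[OF assms(1)] by simp
  then have "Idn C X = Zro C X X"
    by induction (use assms in \<open>auto simp: cs\<close>)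
  then show False using assms zero_objectI by blast
qed

lemma ind_summands_iff: "X \<in> ind_summands C Z \<longleftrightarrow> indecomposable C X \<and> retract X Z"
  by (simp add: ind_summands_def summand_iff_retract)

lemma isomorphic_indec:
  assumes "indecomposable C X" "isomorphic C X Y" shows "indecomposable C Y"
  unfolding indecomposable_def
proof (intro conjI allI impI)
  obtain f g where fg: "iso_pair C X Y f g" using assms unfolding isomorphic_def by blast
  note h = fg[unfolded iso_pair_def]
  show "Y \<in> Obj C" using assms unfolding isomorphic_def by blast
  show "\<not> zero_object C Y"
    using zero_object_retract isomorphic_retract[OF assms(2)] indec_nz[OF assms(1)] by blast
  fix A B assume "dsum2 C Y A B"
  then show "zero_object C A \<or> zero_object C B"
  proof (rule dsum2D)
    fix i p j q assume *: "i \<in> Hom C A Y" "p \<in> Hom C Y A" "j \<in> Hom C B Y" "q \<in> Hom C Y B"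
      "p \<star> i = Idn C A" "q \<star> j = Idn C B" "q \<star> i = Zro C A B" "p \<star> j = Zro C B A"
      "(i \<star> p) \<boxplus> (j \<star> q) = Idn C Y"
    note red = cmp_reduce[of f g "Idn C Y" Y X Y] cmp_reduce[of g f "Idn C X" X Y X]
    have "dsum2 C X A B"
    proof (rule dsum2I[of "g \<star> i" A X "p \<star> f" "g \<star> j" B "q \<star> f"])
      have "((g \<star> i) \<star> (p \<star> f)) \<boxplus> ((g \<star> j) \<star> (q \<star> f)) = g \<star> (((i \<star> p) \<boxplus> (j \<star> q)) \<star> f)"
        using *(1-4) h by (simp add: cs)
      also have "\<dots> = Idn C X" unfolding * using h by (simp add: cs)
      finally show "((g \<star> i) \<star> (p \<star> f)) \<boxplus> ((g \<star> j) \<star> (q \<star> f)) = Idn C X" .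
    qed (use * h red in \<open>simp_all add: cs\<close>)
    then show ?thesis using assms(1) unfolding indecomposable_def by blast
  qed
qed

lemma iso_class_eq_iff:
  assumes "X \<in> Obj C"
  shows "iso_class C X = iso_class C Y \<longleftrightarrow> isomorphic C X Y"
  unfolding iso_class_def using assms isomorphic_refl isomorphic_sym isomorphic_trans by blast

lemma finite_quiver_vertices:
  assumes "T \<in> Obj C" shows "finite (quiver_vertices C T)"
proof -
  obtain K where K: "finite K" "K \<subseteq> ind_gens T" "Idn C T \<in> asum T T K"
    using asum_finite[OF decompose[OF assms]] by blast
  have "\<exists>Y. indecomposable C Y \<and> (\<exists>a b. a \<in> Hom C Y T \<and> b \<in> Hom C T Y \<and> k = a \<star> b)" if "k \<in> K" for k
    using that K unfolding ind_gens_def by blast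
  then obtain Y where Y: "\<And>k. k \<in> K \<Longrightarrow> indecomposable C (Y k) \<and> (\<exists>a b. a \<in> Hom C (Y k) T \<and> b \<in> Hom C T (Y k) \<and> k = a \<star> b)"
    by metis
  have "quiver_vertices C T \<subseteq> (iso_class C \<circ> Y) ` K"
  proof
    fix x assume "x \<in> quiver_vertices C T"
    then obtain X where X: "x = iso_class C X" "indecomposable C X" "retract X T"
      unfolding quiver_vertices_def using ind_summands_iff by blast
    have "\<exists>Z. retract X Z \<and> Z \<in> Y ` K"
      by (rule indec_retract_sum[OF X(2,3) K(3)]) (use Y in blast)
    then obtain k where k: "k \<in> K" "retract X (Y k)" by blast
    then have "isomorphic C X (Y k)" using retract_indec_isomorphic Y X indec_nz by blast
    then show "x \<in> (iso_class C \<circ> Y) ` K" using X k iso_class_eq_iff indec_ob by auto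
  qed
  then show ?thesis using K finite_surj by blast
qed

end

section \<open>Arrows of the quiver of an endomorphism algebra\<close>

lemma (in klinear) image_vsubspace:
  assumes "M.vsubspace V" shows "N.vsubspace (L ` V)"
  unfolding N.vsubspace_def
proof (intro conjI ballI allI)
  note V = M.vsubspaceD[OF assms]
  show "L ` V \<subseteq> carrier N" using V(1) L_closed by blast
  show "\<zero>\<^bsub>N\<^esub> \<in> L ` V" using V(2) L_zero by (metis imageI)
  show "x \<oplus>\<^bsub>N\<^esub> y \<in> L ` V" if xy: "x \<in> L ` V" "y \<in> L ` V" for x y
  proof -
    obtain a b where "a \<in> V" "x = L a" "b \<in> V" "y = L b" using xy by blast
    then show ?thesis using V(3)[of a b] V(1) L_add[of a b] by (intro image_eqI[of _ L "a \<oplus>\<^bsub>M\<^esub> b"]) auto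
  qed
  show "c \<odot>\<^bsub>N\<^esub> x \<in> L ` V" if x: "x \<in> L ` V" for c x
  proof -
    obtain a where "a \<in> V" "x = L a" using x by blast
    then show ?thesis using V(4)[of a c] V(1) L_smult[of a c] by (intro image_eqI[of _ L "c \<odot>\<^bsub>M\<^esub> a"]) auto
  qed
qed

lemma (in klinear) quot_dim_image:
  assumes fd: "M.fin_dim" and V: "M.vsubspace V" and W: "M.vsubspace W" "W \<subseteq> V"
    and inj: "\<And>x. x \<in> carrier M \<Longrightarrow> L x = \<zero>\<^bsub>N\<^esub> \<Longrightarrow> x = \<zero>\<^bsub>M\<^esub>"
  shows "quot_dim N (L ` V) (L ` W) = quot_dim M V W"
proof -
  have single: "finsum N (\<lambda>j. L (u j)) {()} = L (u ())" if "u () \<in> carrier M" for u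
    using that L_closed by (simp add: N.M.finsum_insert)
  have im: "L ` U = {finsum N (\<lambda>j. L (u j)) {()} | u. \<forall>j\<in>{()}. u j \<in> U}" if "M.vsubspace U" for U
  proof (intro equalityI subsetI)
    fix y assume "y \<in> L ` U"
    then obtain x where x: "x \<in> U" "y = L x" by blast
    then have "y = finsum N (\<lambda>j. L ((\<lambda>_. x) j)) {()}"
      using single[of "\<lambda>_. x"] M.vsubspaceD(1)[OF that] by simp
    then show "y \<in> {finsum N (\<lambda>j. L (u j)) {()} | u. \<forall>j\<in>{()}. u j \<in> U}"
      using x(1) by (intro CollectI exI[of _ "\<lambda>_. x"]) simp
  next
    fix y assume "y \<in> {finsum N (\<lambda>j. L (u j)) {()} | u. \<forall>j\<in>{()}. u j \<in> U}"
    then obtain u where "u () \<in> U" "y = finsum N (\<lambda>j. L (u j)) {()}" by auto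
    then have "y = L (u ())" using single[of u] M.vsubspaceD(1)[OF that] by simp
    then show "y \<in> L ` U" using \<open>u () \<in> U\<close> by blast
  qed
  have "quot_dim N (L ` V) (L ` W) = (\<Sum>j\<in>{()}. quot_dim M V W)"
  proof (rule quot_dim_direct_sum[where L = "\<lambda>_. L"])
    show "\<forall>j\<in>{()}. u j = \<zero>\<^bsub>M\<^esub>"
      if "\<And>j. j \<in> {()} \<Longrightarrow> u j \<in> carrier M" "finsum N (\<lambda>j. L (u j)) {()} = \<zero>\<^bsub>N\<^esub>" for u
    proof -
      have u: "u () \<in> carrier M" using that(1) by simp
      then show ?thesis using inj[OF u] that(2) single[of u, OF u] by simp
    qed
  qed (use fd V W im image_vsubspace N.kspace_axioms klinear_axioms in auto)
  then show ?thesis by simp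
qed

context lincat
begin

text \<open>
  The square of the radical relative to \<open>S\<close>: the quiver of \<open>End T\<close> only
  sees composites that pass through summands of \<open>T\<close>.
\<close>

definition crad2 :: "'o set \<Rightarrow> 'o \<Rightarrow> 'o \<Rightarrow> 'm set" where
  "crad2 S X Y = asum X Y {b \<star> a | a b Z. Z \<in> S \<and> a \<in> crad X Z \<and> b \<in> crad Z Y}"

lemma crad2_gens_hom: "{b \<star> a | a b Z. Z \<in> S \<and> a \<in> crad X Z \<and> b \<in> crad Z Y} \<subseteq> Hom C X Y"
  using cmp_hom crad_hom by blast

lemma crad2_genI: "Z \<in> S \<Longrightarrow> a \<in> crad X Z \<Longrightarrow> b \<in> crad Z Y \<Longrightarrow> b \<star> a \<in> crad2 S X Y"
  unfolding crad2_def by (rule asum_gen) blast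

lemma crad2_crad: "X \<in> Obj C \<Longrightarrow> Y \<in> Obj C \<Longrightarrow> crad2 S X Y \<subseteq> crad X Y"
  unfolding crad2_def by (rule subsetI, erule crad_asum) (auto intro: crad_cmp_left crad_hom)

lemma crad2_vsubspace:
  assumes "X \<in> Obj C" "Y \<in> Obj C"
  shows "kspace.vsubspace (hom_mod C X Y) (crad2 S X Y)"
proof -
  have "Scl C c f \<in> crad2 S X Y" if "f \<in> crad2 S X Y" for c f
    unfolding crad2_def
  proof (rule asum_smult[OF that[unfolded crad2_def] crad2_gens_hom assms])
    fix k assume "k \<in> {b \<star> a | a b Z. Z \<in> S \<and> a \<in> crad X Z \<and> b \<in> crad Z Y}"
    then obtain a b Z where k: "k = b \<star> a" "Z \<in> S" "a \<in> crad X Z" "b \<in> crad Z Y" by blast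
    have "Scl C c k = b \<star> Scl C c a" using k crad_hom by (auto simp: cs dest!: crad_hom)
    then have "Scl C c k \<in> {b \<star> a | a b Z. Z \<in> S \<and> a \<in> crad X Z \<and> b \<in> crad Z Y}"
      using k crad_scl by blast
    then show "Scl C c k \<in> asum X Y {b \<star> a | a b Z. Z \<in> S \<and> a \<in> crad X Z \<and> b \<in> crad Z Y}"
      by (rule asum_gen)
  qed
  then show ?thesis
    unfolding kspace.vsubspace_def[OF hom_kspace[OF assms]] hom_sel
    using asum_hom[OF _ crad2_gens_hom assms] asum_zro asum_pls unfolding crad2_def by blast
qed

text \<open>
  The dimension of the space of irreducible maps, which is the number of arrows from
  \<open>X\<close> to \<open>Y\<close> in the quiver of an object whose indecomposable summands
  are those in \<open>S\<close>.
\<close>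

definition irr_dim :: "'o set \<Rightarrow> 'o \<Rightarrow> 'o \<Rightarrow> nat" where
  "irr_dim S X Y = quot_dim (hom_mod C X Y) (crad X Y) (crad2 S X Y)"

definition left_ideal :: "'o \<Rightarrow> 'm set \<Rightarrow> bool" where
  "left_ideal T L \<longleftrightarrow> L \<subseteq> Hom C T T \<and> Zro C T T \<in> L \<and> (\<forall>x\<in>L. \<forall>y\<in>L. x \<boxplus> y \<in> L) \<and>
    (\<forall>r\<in>Hom C T T. \<forall>x\<in>L. r \<star> x \<in> L)"

lemma left_ideal_iff:
  assumes T: "T \<in> Obj C"
  shows "left_ideal T L \<longleftrightarrow>
    additive_subgroup L (End C T) \<and> (\<forall>r\<in>Hom C T T. \<forall>x\<in>L. r \<star> x \<in> L)"
proof
  interpret kspace "End C T" using hom_kspace T by blast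
  show "additive_subgroup L (End C T) \<and> (\<forall>r\<in>Hom C T T. \<forall>x\<in>L. r \<star> x \<in> L)" if L: "left_ideal T L"
  proof
    have "neg x \<in> L" if "x \<in> L" for x
    proof -
      have "neg (Idn C T) \<star> x \<in> L" using L T that unfolding left_ideal_def by (blast intro: hom_intros)
      moreover have "x \<in> Hom C T T" using L that unfolding left_ideal_def by blast
      ultimately show ?thesis using T by (simp add: cs)
    qed
    moreover have "a_inv (End C T) x = neg x" if "x \<in> L" for x
      using L that sm_minus_one[of x] unfolding left_ideal_def by auto
    ultimately have "a_inv (End C T) x \<in> L" if "x \<in> L" for x using that by simp
    then show "additive_subgroup L (End C T)"
      using L unfolding left_ideal_def
      by (intro additive_subgroup.intro M.add.subgroupI) (auto simp: a_inv_def)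
  qed (use L in \<open>simp add: left_ideal_def\<close>)
  assume *: "additive_subgroup L (End C T) \<and> (\<forall>r\<in>Hom C T T. \<forall>x\<in>L. r \<star> x \<in> L)"
  then show "left_ideal T L"
    using additive_subgroup.a_subset[of L "End C T"] additive_subgroup.zero_closed[of L "End C T"]
      additive_subgroup.a_closed[of L "End C T"]
    unfolding left_ideal_def by auto
qed

lemma maximal_left_ideal_iff:
  assumes "T \<in> Obj C"
  shows "maximal_left_ideal (End C T) I \<longleftrightarrow> left_ideal T I \<and> I \<noteq> Hom C T T \<and>
    (\<forall>L. left_ideal T L \<and> I \<subseteq> L \<longrightarrow> L = I \<or> L = Hom C T T)"
  unfolding maximal_left_ideal_def Let_def left_ideal_iff[OF assms] by simp

lemma left_ideal_idn:
  assumes "left_ideal T L" "Idn C T \<in> L" shows "L = Hom C T T"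
proof
  show "L \<subseteq> Hom C T T" using assms unfolding left_ideal_def by blast
  show "Hom C T T \<subseteq> L"
  proof
    fix r assume r: "r \<in> Hom C T T"
    then have "r \<star> Idn C T \<in> L" using assms unfolding left_ideal_def by blast
    then show "r \<in> L" using r by (simp add: cs)
  qed
qed

lemma proper_left_ideal_in_maximal:
  assumes T: "T \<in> Obj C" and L: "left_ideal T L" "Idn C T \<notin> L"
  shows "\<exists>I. maximal_left_ideal (End C T) I \<and> L \<subseteq> I"
proof -
  let ?A = "{I. left_ideal T I \<and> L \<subseteq> I \<and> Idn C T \<notin> I}"
  have "\<exists>I\<in>?A. \<forall>J\<in>?A. I \<subseteq> J \<longrightarrow> J = I"
  proof (rule subset_Zorn_nonempty)
    show "?A \<noteq> {}" using L by blast
    fix c assume c: "c \<noteq> {}" "subset.chain ?A c"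
    have sub: "c \<subseteq> ?A" and tot: "\<And>I J. I \<in> c \<Longrightarrow> J \<in> c \<Longrightarrow> I \<subseteq> J \<or> J \<subseteq> I"
      using c(2) unfolding subset.chain_def by blast+
    have "left_ideal T (\<Union>c)"
      unfolding left_ideal_def
    proof (intro conjI ballI)
      show "\<Union>c \<subseteq> Hom C T T" using sub unfolding left_ideal_def by blast
      show "Zro C T T \<in> \<Union>c" using sub c(1) unfolding left_ideal_def by blast
      show "r \<star> x \<in> \<Union>c" if "r \<in> Hom C T T" "x \<in> \<Union>c" for r x
        using that sub unfolding left_ideal_def by blast
      show "x \<boxplus> y \<in> \<Union>c" if xy: "x \<in> \<Union>c" "y \<in> \<Union>c" for x y
      proof -
        obtain I J where "I \<in> c" "J \<in> c" "x \<in> I" "y \<in> J" using xy by blast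
        then obtain K where "K \<in> c" "x \<in> K" "y \<in> K" using tot by blast
        then show ?thesis using sub unfolding left_ideal_def by blast
      qed
    qed
    then show "\<Union>c \<in> ?A" using sub c(1) by blast
  qed
  then obtain I where "I \<in> ?A" and IM: "\<forall>J\<in>?A. I \<subseteq> J \<longrightarrow> J = I" ..
  then have I: "left_ideal T I" "L \<subseteq> I" "Idn C T \<notin> I" by auto
  have max: "J = I" if "left_ideal T J" "I \<subseteq> J" "Idn C T \<notin> J" for J
    using IM[rule_format, of J] that I by auto
  have "maximal_left_ideal (End C T) I"
    unfolding maximal_left_ideal_iff[OF T]
  proof (intro conjI allI impI)
    show "left_ideal T I" "I \<noteq> Hom C T T" using I T idn_hom by auto
    show "J = I \<or> J = Hom C T T" if "left_ideal T J \<and> I \<subseteq> J" for J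
      using that max left_ideal_idn by blast
  qed
  then show ?thesis using I by blast
qed

text \<open>
  If a maximal left ideal \<open>I\<close> misses a radical element \<open>r\<close>, then
  \<open>1 = m + a r\<close> with \<open>m\<close> in \<open>I\<close>, and \<open>m = 1 - a
  r\<close> has a left inverse, so \<open>I\<close> is everything. Conversely, if \<open>1 - g
  r\<close> has no left inverse, it lies in a maximal left ideal, which cannot contain
  \<open>r\<close>.
\<close>

theorem jacobson_radical_End:
  assumes T: "T \<in> Obj C"
  shows "jacobson_radical (End C T) = crad T T"
proof
  show "crad T T \<subseteq> jacobson_radical (End C T)"
  proof
    fix r assume r: "r \<in> crad T T"
    have rh: "r \<in> Hom C T T" using r crad_hom by blast
    have "r \<in> I" if I: "maximal_left_ideal (End C T) I" for I
    proof (rule ccontr)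
      assume rI: "r \<notin> I"
      have lI: "left_ideal T I" and proper: "I \<noteq> Hom C T T"
        and max: "\<And>L. left_ideal T L \<Longrightarrow> I \<subseteq> L \<Longrightarrow> L = I \<or> L = Hom C T T"
        using I unfolding maximal_left_ideal_iff[OF T] by auto
      have Ih: "I \<subseteq> Hom C T T" using lI unfolding left_ideal_def by blast
      let ?L = "{m \<boxplus> (a \<star> r) | m a. m \<in> I \<and> a \<in> Hom C T T}"
      have "left_ideal T ?L"
        unfolding left_ideal_def
      proof (intro conjI ballI)
        show "?L \<subseteq> Hom C T T" using Ih rh hom_intros by blast
        have "Zro C T T = Zro C T T \<boxplus> (Zro C T T \<star> r)" using rh T by (simp add: cs)
        then show "Zro C T T \<in> ?L" using lI T zro_hom unfolding left_ideal_def by blast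
        show "x \<boxplus> y \<in> ?L" if xy: "x \<in> ?L" "y \<in> ?L" for x y
        proof -
          obtain m a where 1: "m \<in> I" "a \<in> Hom C T T" "x = m \<boxplus> (a \<star> r)" using xy(1) by blast
          obtain m' a' where 2: "m' \<in> I" "a' \<in> Hom C T T" "y = m' \<boxplus> (a' \<star> r)" using xy(2) by blast
          note * = 1 2
          have "m \<in> Hom C T T" "m' \<in> Hom C T T" using * Ih by auto
          then have "x \<boxplus> y = (m \<boxplus> m') \<boxplus> ((a \<boxplus> a') \<star> r)" using * rh by (simp add: cs pls_ac)
          moreover have "m \<boxplus> m' \<in> I" "a \<boxplus> a' \<in> Hom C T T" using * lI unfolding left_ideal_def by (auto intro: hom_intros)
          ultimately show ?thesis by blast
        qed
        show "s \<star> x \<in> ?L" if s: "s \<in> Hom C T T" and x: "x \<in> ?L" for s x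
        proof -
          obtain m a where *: "m \<in> I" "a \<in> Hom C T T" "x = m \<boxplus> (a \<star> r)" using x by blast
          have "m \<in> Hom C T T" using * Ih by auto
          then have "s \<star> x = (s \<star> m) \<boxplus> ((s \<star> a) \<star> r)" using * rh s by (simp add: cs)
          moreover have "s \<star> m \<in> I" "s \<star> a \<in> Hom C T T" using * lI s unfolding left_ideal_def by (auto intro: cmp_hom)
          ultimately show ?thesis by blast
        qed
      qed
      moreover have "I \<subseteq> ?L"
      proof
        fix m assume m: "m \<in> I"
        then have "m = m \<boxplus> (Zro C T T \<star> r)" using rh T Ih by (auto simp: cs)
        then show "m \<in> ?L" using m T zro_hom by blast
      qed
      moreover have "r \<in> ?L"
      proof -
        have "r = Zro C T T \<boxplus> (Idn C T \<star> r)" using rh T by (simp add: cs)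
        moreover have "Zro C T T \<in> I" using lI unfolding left_ideal_def by blast
        ultimately show ?thesis using T idn_hom by blast
      qed
      ultimately have "?L = Hom C T T" using max rI by blast
      then have "Idn C T \<in> ?L" using idn_hom T by blast
      then obtain m a where ma: "m \<in> I" "a \<in> Hom C T T" "Idn C T = m \<boxplus> (a \<star> r)" by blast
      have mh: "m \<in> Hom C T T" using ma Ih by blast
      obtain h where h: "h \<in> Hom C T T" "h \<star> (Idn C T \<boxplus> neg (a \<star> r)) = Idn C T"
        using r ma unfolding crad_def by blast
      have "Idn C T \<boxplus> neg (a \<star> r) = m" unfolding ma(3) using mh ma(2) rh by (simp add: cs)
      then have "Idn C T \<in> I" using h lI ma(1) unfolding left_ideal_def by metis
      then show False using left_ideal_idn[OF lI] proper by blast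
    qed
    then show "r \<in> jacobson_radical (End C T)" using rh unfolding jacobson_radical_def by auto
  qed
  show "jacobson_radical (End C T) \<subseteq> crad T T"
  proof
    fix r assume "r \<in> jacobson_radical (End C T)"
    then have rh: "r \<in> Hom C T T" and rI: "\<And>I. maximal_left_ideal (End C T) I \<Longrightarrow> r \<in> I"
      unfolding jacobson_radical_def by auto
    have "\<exists>h\<in>Hom C T T. h \<star> (Idn C T \<boxplus> neg (g \<star> r)) = Idn C T" if g: "g \<in> Hom C T T" for g
    proof (rule ccontr)
      assume no: "\<not> ?thesis"
      let ?u = "Idn C T \<boxplus> neg (g \<star> r)"
      let ?L = "{h \<star> ?u | h. h \<in> Hom C T T}"
      have u: "?u \<in> Hom C T T" using rh g T by (simp add: cs)
      have "left_ideal T ?L"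
        unfolding left_ideal_def
      proof (intro conjI ballI)
        show "?L \<subseteq> Hom C T T" using u cmp_hom by blast
        have "Zro C T T = Zro C T T \<star> ?u" using u T cmp_zro by simp
        then show "Zro C T T \<in> ?L" using T zro_hom by blast
        show "x \<boxplus> y \<in> ?L" if xy: "x \<in> ?L" "y \<in> ?L" for x y
        proof -
          obtain h where 1: "h \<in> Hom C T T" "x = h \<star> ?u" using xy(1) by blast
          obtain h' where 2: "h' \<in> Hom C T T" "y = h' \<star> ?u" using xy(2) by blast
          note * = 1 2
          then have "x \<boxplus> y = (h \<boxplus> h') \<star> ?u" using distrib(2)[OF u *(1,3)] by simp
          then show ?thesis using * pls_hom by blast
        qed
        show "s \<star> x \<in> ?L" if sx: "s \<in> Hom C T T" "x \<in> ?L" for s x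
        proof -
          obtain h where *: "h \<in> Hom C T T" "x = h \<star> ?u" using sx(2) by blast
          then have "s \<star> x = (s \<star> h) \<star> ?u" using assoc[OF u *(1) sx(1)] by simp
          then show ?thesis using * sx cmp_hom by blast
        qed
      qed
      moreover have "Idn C T \<notin> ?L" using no by auto
      ultimately obtain I where I: "maximal_left_ideal (End C T) I" "?L \<subseteq> I"
        using proper_left_ideal_in_maximal[OF T] by blast
      have lI: "left_ideal T I" "I \<noteq> Hom C T T" using I(1) unfolding maximal_left_ideal_iff[OF T] by auto
      have "Idn C T \<star> ?u \<in> I" using I(2) T idn_hom by blast
      then have "?u \<in> I" using cmp_idn(2)[OF u] by simp
      moreover have "g \<star> r \<in> I" using rI[OF I(1)] lI g unfolding left_ideal_def by blast
      ultimately have "?u \<boxplus> (g \<star> r) \<in> I" using lI unfolding left_ideal_def by blast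
      moreover have "?u \<boxplus> (g \<star> r) = Idn C T" using rh g T by (simp add: cs)
      ultimately show False using left_ideal_idn[OF lI(1)] lI(2) by simp
    qed
    then show "r \<in> crad T T" using rh unfolding crad_def by blast
  qed
qed

lemma ideal_prod_End:
  assumes T: "T \<in> Obj C"
  shows "ideal_prod (End C T) (crad T T) (crad T T) = asum T T {b \<star> a | a b. a \<in> crad T T \<and> b \<in> crad T T}"
    (is "?P = asum T T ?K")
proof
  show "?P \<subseteq> asum T T ?K"
  proof
    fix x assume "x \<in> ?P"
    then show "x \<in> asum T T ?K"
      by induction (auto intro: asum.intros)
  qed
  show "asum T T ?K \<subseteq> ?P"
  proof
    fix x assume "x \<in> asum T T ?K"
    then show "x \<in> ?P"
    proof induction
      case asum_zro
      have "Zro C T T \<otimes>\<^bsub>End C T\<^esub> Zro C T T \<in> ?P"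
        using crad_zro[OF T T] by (intro ideal_prod.prod)
      then show ?case using zro_hom[OF T T] T by (simp add: cs)
    next
      case (asum_gen k)
      then show ?case using ideal_prod.prod[of _ "crad T T" _ "crad T T" "End C T"] by auto
    next
      case (asum_pls f g)
      then show ?case using ideal_prod.sum[of f "End C T" "crad T T" "crad T T" g] by simp
    qed
  qed
qed

end

context kscat
begin

lemma summand_idempotent_obtain:
  assumes X: "X \<in> ind_summands C T"
  obtains i p where "i \<in> Hom C X T" "p \<in> Hom C T X" "p \<star> i = Idn C X"
    "summand_idempotent C T (iso_class C X) = i \<star> p"
proof -
  let ?P = "\<lambda>e. \<exists>X'\<in>iso_class C X. \<exists>i\<in>Hom C X' T. \<exists>p\<in>Hom C T X'. p \<star> i = Idn C X' \<and> e = i \<star> p"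
  have "\<exists>e. ?P e"
    using X isomorphic_refl[of X] indec_ob unfolding ind_summands_iff retract_def iso_class_def by blast
  then have "?P (summand_idempotent C T (iso_class C X))"
    unfolding summand_idempotent_def by (rule someI_ex)
  then obtain X' i p where *: "isomorphic C X X'" "i \<in> Hom C X' T" "p \<in> Hom C T X'" "p \<star> i = Idn C X'"
    "summand_idempotent C T (iso_class C X) = i \<star> p" unfolding iso_class_def by blast
  then obtain f g where fg: "f \<in> Hom C X X'" "g \<in> Hom C X' X" "g \<star> f = Idn C X" "f \<star> g = Idn C X'"
    unfolding isomorphic_def iso_pair_def by blast
  show thesis
  proof (rule that[of "i \<star> f" "g \<star> p"])
    show "(g \<star> p) \<star> (i \<star> f) = Idn C X"
      using * fg cmp_reduce[OF *(4,2,3)] by (simp add: cs)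
    show "summand_idempotent C T (iso_class C X) = (i \<star> f) \<star> (g \<star> p)"
      using * fg cmp_reduce[OF fg(4,2,1)] by (simp add: cs)
  qed (use * fg in \<open>auto intro: cmp_hom\<close>)
qed

text \<open>
  Cutting the radical of \<open>End T\<close> and its square down by idempotents for \<open>X\<close> and \<open>Y\<close> gives the radical
  maps from \<open>X\<close> to \<open>Y\<close> and the sums of composites of two radical maps through summands of \<open>T\<close>.
\<close>

theorem arrow_number_eq:
  assumes X: "X \<in> ind_summands C T" and Y: "Y \<in> ind_summands C T"
  shows "arrow_number C T (iso_class C X) (iso_class C Y) = irr_dim (ind_summands C T) X Y"
proof -
  let ?S = "ind_summands C T"
  obtain i p where ip: "i \<in> Hom C X T" "p \<in> Hom C T X" "p \<star> i = Idn C X"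
    "summand_idempotent C T (iso_class C X) = i \<star> p" using summand_idempotent_obtain[OF X] .
  obtain j q where jq: "j \<in> Hom C Y T" "q \<in> Hom C T Y" "q \<star> j = Idn C Y"
    "summand_idempotent C T (iso_class C Y) = j \<star> q" using summand_idempotent_obtain[OF Y] .
  have ob: "X \<in> Obj C" "Y \<in> Obj C" "T \<in> Obj C" using ip jq Hom_ob by auto
  note red = cmp_reduce[OF ip(3,1,2)] cmp_reduce[OF jq(3,1,2)]
  let ?L = "\<lambda>r. j \<star> (r \<star> p)"
  let ?c = "\<lambda>r. (j \<star> q) \<star> (r \<star> (i \<star> p))"
  have cut: "?c r = ?L (q \<star> (r \<star> i))" if "r \<in> Hom C T T" for r
    using that ip jq by (simp add: cs)
  have cutL: "?c (?L s) = ?L s" "?L s \<in> Hom C T T" if "s \<in> Hom C X Y" for s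
    using that ip jq red by (simp_all add: cs)
  interpret L: klinear "hom_mod C X Y" "End C T" ?L by (rule klinear_cmp[OF ip(2) jq(1)])
  have J: "?c ` crad T T = ?L ` crad X Y"
  proof (intro equalityI subsetI)
    fix y assume "y \<in> ?c ` crad T T"
    then obtain r where r: "r \<in> crad T T" "y = ?c r" by blast
    have "q \<star> (r \<star> i) \<in> crad X Y" using r ip jq crad_cmp_left crad_cmp_right by blast
    then show "y \<in> ?L ` crad X Y" using cut r crad_hom by blast
  next
    fix y assume "y \<in> ?L ` crad X Y"
    then obtain s where s: "s \<in> crad X Y" "y = ?L s" by blast
    have "?L s \<in> crad T T" using s ip jq crad_cmp_left crad_cmp_right by blast
    then show "y \<in> ?c ` crad T T" using cutL s crad_hom by (metis imageI)
  qed
  let ?K = "{b \<star> a | a b. a \<in> crad T T \<and> b \<in> crad T T}"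
  have Kh: "?K \<subseteq> Hom C T T" using crad_hom cmp_hom by blast
  have J2: "?c ` asum T T ?K = ?L ` crad2 ?S X Y"
  proof (intro equalityI subsetI)
    fix y assume "y \<in> ?c ` asum T T ?K"
    then obtain r where r: "r \<in> asum T T ?K" "y = ?c r" by blast
    have "q \<star> (r \<star> i) \<in> crad2 ?S X Y"
      unfolding crad2_def
    proof (rule asum_cmp[OF r(1) Kh ob(3,3) ip(1) jq(2)])
      fix k assume "k \<in> ?K"
      then obtain a b where ab: "k = b \<star> a" "a \<in> crad T T" "b \<in> crad T T" by blast
      have abh: "a \<in> Hom C T T" "b \<in> Hom C T T" using ab crad_hom by auto
      have "(q \<star> b) \<star> (Idn C T \<star> (a \<star> i)) \<in> asum X Y {b \<star> a | a b Z. Z \<in> ?S \<and> a \<in> crad X Z \<and> b \<in> crad Z Y}"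
      proof (rule asum_cmp[OF decompose[OF ob(3)] ind_gens_hom ob(3,3)])
        show "a \<star> i \<in> Hom C X T" "q \<star> b \<in> Hom C T Y" using abh ip jq cmp_hom by auto
        fix k assume "k \<in> ind_gens T"
        then obtain u v Z where Z: "k = u \<star> v" "indecomposable C Z" "u \<in> Hom C Z T" "v \<in> Hom C T Z" "v \<star> u = Idn C Z"
          unfolding ind_gens_def by blast
        have "Z \<in> ?S" using Z ind_summands_iff retractI by blast
        moreover have "v \<star> (a \<star> i) \<in> crad X Z" "q \<star> (b \<star> u) \<in> crad Z Y"
          using ab Z ip jq crad_cmp_left crad_cmp_right by blast+
        moreover have "(q \<star> b) \<star> (k \<star> (a \<star> i)) = (q \<star> (b \<star> u)) \<star> (v \<star> (a \<star> i))"
          using Z abh ip jq by (simp add: cs)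
        ultimately show "(q \<star> b) \<star> (k \<star> (a \<star> i)) \<in> asum X Y {b \<star> a | a b Z. Z \<in> ?S \<and> a \<in> crad X Z \<and> b \<in> crad Z Y}"
          by (intro asum_gen) blast
      qed
      moreover have "(q \<star> b) \<star> (Idn C T \<star> (a \<star> i)) = q \<star> (k \<star> i)" using ab abh ip jq by (simp add: cs)
      ultimately show "q \<star> (k \<star> i) \<in> asum X Y {b \<star> a | a b Z. Z \<in> ?S \<and> a \<in> crad X Z \<and> b \<in> crad Z Y}" by simp
    qed
    moreover have "r \<in> Hom C T T" using asum_hom[OF r(1) Kh ob(3,3)] .
    ultimately show "y \<in> ?L ` crad2 ?S X Y" using cut r by blast
  next
    fix y assume "y \<in> ?L ` crad2 ?S X Y"
    then obtain s where s: "s \<in> crad2 ?S X Y" "y = ?L s" by blast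
    have sh: "s \<in> Hom C X Y" using s crad2_crad[OF ob(1,2)] crad_hom by blast
    have "?L s \<in> asum T T ?K"
    proof (rule asum_cmp[OF s(1)[unfolded crad2_def] crad2_gens_hom ob(1,2) ip(2) jq(1)])
      fix k assume "k \<in> {b \<star> a | a b Z. Z \<in> ?S \<and> a \<in> crad X Z \<and> b \<in> crad Z Y}"
      then obtain a b Z where k: "k = b \<star> a" "Z \<in> ?S" "a \<in> crad X Z" "b \<in> crad Z Y" by blast
      have abh: "a \<in> Hom C X Z" "b \<in> Hom C Z Y" using k crad_hom by auto
      obtain u v where uv: "u \<in> Hom C Z T" "v \<in> Hom C T Z" "v \<star> u = Idn C Z"
        using k(2) unfolding ind_summands_iff retract_def by blast
      have "u \<star> (a \<star> p) \<in> crad T T" "j \<star> (b \<star> v) \<in> crad T T"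
        using k uv ip jq crad_cmp_left crad_cmp_right by blast+
      moreover have "j \<star> (k \<star> p) = (j \<star> (b \<star> v)) \<star> (u \<star> (a \<star> p))"
        using k abh uv ip jq cmp_reduce[OF uv(3,1,2)] by (simp add: cs)
      ultimately show "j \<star> (k \<star> p) \<in> asum T T ?K" by (intro asum_gen) blast
    qed
    then show "y \<in> ?c ` asum T T ?K" by (rule rev_image_eqI) (simp only: cutL(1)[OF sh] s(2))
  qed
  have "arrow_number C T (iso_class C X) (iso_class C Y) = quot_dim (End C T) (?L ` crad X Y) (?L ` crad2 ?S X Y)"
    unfolding arrow_number_def Let_def jacobson_radical_End[OF ob(3)] ideal_prod_End[OF ob(3)]
      ip(4) jq(4) hom_sel J J2 ..
  also have "\<dots> = quot_dim (hom_mod C X Y) (crad X Y) (crad2 ?S X Y)"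
  proof (rule L.quot_dim_image[OF fin[OF ob(1,2)] crad_vsubspace[OF ob(1,2)] crad2_vsubspace[OF ob(1,2)] crad2_crad[OF ob(1,2)]])
    fix s assume "s \<in> carrier (hom_mod C X Y)" and z: "?L s = \<zero>\<^bsub>End C T\<^esub>"
    then have s: "s \<in> Hom C X Y" by simp
    have "s = q \<star> (?L s \<star> i)" using s ip jq red by (simp add: cs)
    also have "\<dots> = Zro C X Y" using z ip jq ob by (simp add: cs)
    finally show "s = \<zero>\<^bsub>hom_mod C X Y\<^esub>" by simp
  qed
  finally show ?thesis unfolding irr_dim_def .
qed

end

section \<open>Coverings of Krull-Schmidt categories\<close>

lemma (in klinear) L_finsum:
  assumes "finite I" "f \<in> I \<rightarrow> carrier M"
  shows "L (finsum M f I) = finsum N (\<lambda>i. L (f i)) I"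
  using assms
proof (induction I rule: finite_induct)
  case (insert x F)
  then have "f x \<in> carrier M" "f \<in> F \<rightarrow> carrier M" "(\<lambda>i. L (f i)) \<in> F \<rightarrow> carrier N" "L (f x) \<in> carrier N"
    by (auto intro: L_closed)
  with insert show ?case by (simp add: L_add)
qed (simp add: L_zero)

lemma direct_sum_vsubspace:
  fixes N :: "('k::field, 'n) module" and M :: "'j \<Rightarrow> ('k, 'm) module"
  assumes J: "finite J" and lin: "\<And>j. j \<in> J \<Longrightarrow> klinear (M j) N (L j)" and N: "kspace N"
    and V: "\<And>j. j \<in> J \<Longrightarrow> kspace.vsubspace (M j) (V j)"
  shows "kspace.vsubspace N {finsum N (\<lambda>j. L j (u j)) J | u. \<forall>j\<in>J. u j \<in> V j}"
    (is "kspace.vsubspace N ?V")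
proof -
  interpret N: kspace N by (rule N)
  have M: "kspace (M j)" if "j \<in> J" for j using lin[OF that] by (simp add: klinear_def)
  note VD = kspace.vsubspaceD[OF M V]
  have cl: "L j x \<in> carrier N" if "j \<in> J" "x \<in> V j" for j x
    using klinear.L_closed[OF lin] VD(1) that by blast
  show ?thesis unfolding N.vsubspace_def
  proof (intro conjI ballI allI)
    show "?V \<subseteq> carrier N" using cl by (auto intro!: N.M.finsum_closed)
    have "finsum N (\<lambda>j. L j (\<zero>\<^bsub>M j\<^esub>)) J = \<zero>\<^bsub>N\<^esub>"
      using klinear.L_zero[OF lin] by (intro N.M.add.finprod_one_eqI) auto
    then show "\<zero>\<^bsub>N\<^esub> \<in> ?V"
      using VD(2) by (intro CollectI exI[of _ "\<lambda>j. \<zero>\<^bsub>M j\<^esub>"]) auto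
    show "x \<oplus>\<^bsub>N\<^esub> y \<in> ?V" if xy: "x \<in> ?V" "y \<in> ?V" for x y
    proof -
      obtain u where u: "x = finsum N (\<lambda>j. L j (u j)) J" "\<forall>j\<in>J. u j \<in> V j" using xy(1) by blast
      obtain v where v: "y = finsum N (\<lambda>j. L j (v j)) J" "\<forall>j\<in>J. v j \<in> V j" using xy(2) by blast
      have "x \<oplus>\<^bsub>N\<^esub> y = finsum N (\<lambda>j. L j (u j) \<oplus>\<^bsub>N\<^esub> L j (v j)) J"
        unfolding u v using u v cl by (intro N.M.finsum_addf[symmetric]) auto
      also have "\<dots> = finsum N (\<lambda>j. L j (u j \<oplus>\<^bsub>M j\<^esub> v j)) J"
        using klinear.L_add[OF lin] u v VD(1,3) cl by (intro N.M.finsum_cong') auto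
      finally show ?thesis using u v VD(3) by (intro CollectI exI[of _ "\<lambda>j. u j \<oplus>\<^bsub>M j\<^esub> v j"]) auto
    qed
    show "c \<odot>\<^bsub>N\<^esub> x \<in> ?V" if x: "x \<in> ?V" for c x
    proof -
      obtain u where u: "x = finsum N (\<lambda>j. L j (u j)) J" "\<forall>j\<in>J. u j \<in> V j" using x by blast
      have "c \<odot>\<^bsub>N\<^esub> x = finsum N (\<lambda>j. c \<odot>\<^bsub>N\<^esub> L j (u j)) J"
        unfolding u using u cl J N.finsum_smult_ldistr[of J c] by (auto simp: ring_of_type_algebra_def)
      also have "\<dots> = finsum N (\<lambda>j. L j (c \<odot>\<^bsub>M j\<^esub> u j)) J"
        using klinear.L_smult[OF lin] u VD(1,4) cl by (intro N.M.finsum_cong') auto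
      finally show ?thesis using u VD(4) by (intro CollectI exI[of _ "\<lambda>j. c \<odot>\<^bsub>M j\<^esub> u j"]) auto
    qed
  qed
qed

context lincat
begin

lemma finsum_cmp:
  assumes "a \<in> Hom C X' X" "b \<in> Hom C Y Y'" "finite I" "\<And>i. i \<in> I \<Longrightarrow> f i \<in> Hom C X Y"
  shows "b \<star> (finsum (hom_mod C X Y) f I \<star> a) = finsum (hom_mod C X' Y') (\<lambda>i. b \<star> (f i \<star> a)) I"
proof -
  interpret klinear "hom_mod C X Y" "hom_mod C X' Y'" "\<lambda>r. b \<star> (r \<star> a)" using klinear_cmp assms by blast
  show ?thesis using L_finsum[of I f] assms by auto
qed

end

lemma (in kscat) local_sum_cmp:
  assumes A: "indecomposable C A" and f: "f \<in> asum X Y K" "K \<subseteq> Hom C X Y"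
    and a: "a \<in> Hom C A X" and b: "b \<in> Hom C Y A" and e: "b \<star> (f \<star> a) = Idn C A"
  shows "\<exists>k\<in>K. \<exists>g. iso_pair C A A (b \<star> (k \<star> a)) g"
proof -
  let ?K = "(\<lambda>k. b \<star> (k \<star> a)) ` K"
  have ob: "X \<in> Obj C" "Y \<in> Obj C" using a b Hom_ob by auto
  have "b \<star> (f \<star> a) \<in> asum A A ?K"
    by (rule asum_cmp[OF f ob a b]) (rule asum_gen, rule imageI)
  moreover have "?K \<subseteq> Hom C A A" using f(2) cmp_hom[OF cmp_hom[OF a] b] by (intro image_subsetI) blast
  ultimately have "\<exists>y\<in>?K. \<exists>g. iso_pair C A A y g" unfolding e by (rule local_sum[OF A])
  then show ?thesis by (simp only: bex_simps)
qed

locale linfunctor = C: lincat C + D: lincat D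
  for C :: "('o, 'm, 'k::field, 'y) lcat_scheme" and D :: "('p, 'n, 'k, 'z) lcat_scheme" +
  fixes F :: "('o, 'm, 'p, 'n) func"
  assumes linfunctor: "linear_functor C D F"
begin

lemma F_ob: "X \<in> Obj C \<Longrightarrow> fob F X \<in> Obj D" and F_idn: "X \<in> Obj C \<Longrightarrow> fmor F (Idn C X) = Idn D (fob F X)"
  using linfunctor unfolding linear_functor_def by blast+

lemma F_hom: "f \<in> Hom C X Y \<Longrightarrow> fmor F f \<in> Hom D (fob F X) (fob F Y)"
  using linfunctor C.Hom_ob[of f X Y] unfolding linear_functor_def by blast

lemma F_cmp: "f \<in> Hom C X Y \<Longrightarrow> g \<in> Hom C Y Z \<Longrightarrow> fmor F (g \<star>\<^bsub>C\<^esub> f) = fmor F g \<star>\<^bsub>D\<^esub> fmor F f"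
  using linfunctor C.Hom_ob[of f X Y] C.Hom_ob[of g Y Z] unfolding linear_functor_def by blast

lemma F_pls: "f \<in> Hom C X Y \<Longrightarrow> g \<in> Hom C X Y \<Longrightarrow> fmor F (Pls C f g) = Pls D (fmor F f) (fmor F g)"
  and F_scl: "f \<in> Hom C X Y \<Longrightarrow> fmor F (Scl C c f) = Scl D c (fmor F f)"
proof -
  have *: "\<forall>X\<in>Obj C. \<forall>Y\<in>Obj C. \<forall>f\<in>Hom C X Y. \<forall>g\<in>Hom C X Y. \<forall>c.
       fmor F (Pls C f g) = Pls D (fmor F f) (fmor F g) \<and> fmor F (Scl C c f) = Scl D c (fmor F f)"
    using linfunctor unfolding linear_functor_def by (elim conjE) assumption
  show "f \<in> Hom C X Y \<Longrightarrow> g \<in> Hom C X Y \<Longrightarrow> fmor F (Pls C f g) = Pls D (fmor F f) (fmor F g)"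
    using * C.Hom_ob[of f X Y] by blast
  show "f \<in> Hom C X Y \<Longrightarrow> fmor F (Scl C c f) = Scl D c (fmor F f)"
    using * C.Hom_ob[of f X Y] by blast
qed

lemma F_zro: "X \<in> Obj C \<Longrightarrow> Y \<in> Obj C \<Longrightarrow> fmor F (Zro C X Y) = Zro D (fob F X) (fob F Y)"
  using F_scl[OF C.zro_hom, of X Y 0] F_hom[OF C.zro_hom, of X Y] C.zro_hom[of X Y]
  by (simp add: C.cs D.cs)

lemma F_klinear:
  assumes "X \<in> Obj C" "Y \<in> Obj C" "b \<in> Hom D (fob F Y) A"
  shows "klinear (hom_mod C X Y) (hom_mod D (fob F X) A) (\<lambda>u. b \<star>\<^bsub>D\<^esub> fmor F u)"
proof (intro klinear.intro klinear_axioms.intro)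
  show "kspace (hom_mod C X Y)" "kspace (hom_mod D (fob F X) A)"
    using C.hom_kspace D.hom_kspace D.Hom_ob[OF assms(3)] F_ob assms by auto
next
  fix x c assume "x \<in> carrier (hom_mod C X Y)"
  then have x: "x \<in> Hom C X Y" by simp
  show "b \<star>\<^bsub>D\<^esub> fmor F x \<in> carrier (hom_mod D (fob F X) A)" using D.cmp_hom[OF F_hom[OF x] assms(3)] by simp
  show "b \<star>\<^bsub>D\<^esub> fmor F (c \<odot>\<^bsub>hom_mod C X Y\<^esub> x) = c \<odot>\<^bsub>hom_mod D (fob F X) A\<^esub> (b \<star>\<^bsub>D\<^esub> fmor F x)"
    using F_scl[OF x] D.distrib(3)[OF F_hom[OF x] assms(3)] by simp
  fix y assume "y \<in> carrier (hom_mod C X Y)"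
  then have y: "y \<in> Hom C X Y" by simp
  show "b \<star>\<^bsub>D\<^esub> fmor F (x \<oplus>\<^bsub>hom_mod C X Y\<^esub> y)
      = b \<star>\<^bsub>D\<^esub> fmor F x \<oplus>\<^bsub>hom_mod D (fob F X) A\<^esub> b \<star>\<^bsub>D\<^esub> fmor F y"
    using F_pls[OF x y] D.distrib(1)[OF F_hom[OF x] assms(3) F_hom[OF y]] by simp
qed

lemma F_iso_pair: "iso_pair C X Y f g \<Longrightarrow> iso_pair D (fob F X) (fob F Y) (fmor F f) (fmor F g)"
proof -
  assume "iso_pair C X Y f g"
  then have fg: "f \<in> Hom C X Y" "g \<in> Hom C Y X" "g \<star>\<^bsub>C\<^esub> f = Idn C X" "f \<star>\<^bsub>C\<^esub> g = Idn C Y"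
    unfolding iso_pair_def by blast+
  then show ?thesis
    unfolding iso_pair_def
    using F_hom[OF fg(1)] F_hom[OF fg(2)] F_cmp[OF fg(1,2)] F_cmp[OF fg(2,1)] F_idn C.Hom_ob[OF fg(1)] by simp
qed

lemma F_isomorphic: "isomorphic C X Y \<Longrightarrow> isomorphic D (fob F X) (fob F Y)"
  unfolding isomorphic_def using F_iso_pair F_ob by blast

lemma F_retract: "C.retract X Y \<Longrightarrow> D.retract (fob F X) (fob F Y)"
proof -
  assume "C.retract X Y"
  then obtain i p where ip: "i \<in> Hom C X Y" "p \<in> Hom C Y X" "p \<star>\<^bsub>C\<^esub> i = Idn C X"
    unfolding C.retract_def by blast
  then show ?thesis
    using F_cmp[OF ip(1,2)] F_idn C.Hom_ob[OF ip(1)] by (intro D.retractI[OF F_hom[OF ip(1)] F_hom[OF ip(2)]]) simp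
qed

lemma F_zero_object: "zero_object C X \<Longrightarrow> zero_object D (fob F X)"
  unfolding zero_object_def by (simp add: F_ob flip: F_idn F_zro)

lemma F_asum:
  assumes "f \<in> C.asum X Y K" "K \<subseteq> Hom C X Y" "X \<in> Obj C" "Y \<in> Obj C"
  shows "fmor F f \<in> D.asum (fob F X) (fob F Y) (fmor F ` K)"
  by (rule C.asum_map[OF assms])
    (use assms in \<open>auto simp: F_zro F_pls intro: D.asum.intros\<close>)

lemma F_idn_asum:
  assumes "Idn C X \<in> C.asum X X K" "K \<subseteq> Hom C X X" "X \<in> Obj C"
  shows "Idn D (fob F X) \<in> D.asum (fob F X) (fob F X) (fmor F ` K)"
  using F_asum[OF assms assms(3)] F_idn[OF assms(3)] by simp

lemma F_in_add:
  assumes "C.in_add T X" "T \<in> Obj C" shows "D.in_add (fob F T) (fob F X)"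
proof (rule D.in_add_trans_gen)
  have X: "X \<in> Obj C" using assms C.in_add_ob by blast
  show "fob F X \<in> Obj D" using F_ob X by blast
  show "Idn D (fob F X) \<in> D.asum (fob F X) (fob F X) (fmor F ` C.thru_gens T X X)"
    using F_idn_asum[OF _ C.thru_gens_hom X] assms unfolding C.in_add_def by blast
  fix k assume "k \<in> fmor F ` C.thru_gens T X X"
  then obtain a b where "a \<in> Hom C X T" "b \<in> Hom C T X" "k = fmor F b \<star>\<^bsub>D\<^esub> fmor F a"
    unfolding C.thru_gens_def using F_cmp by blast
  then show "\<exists>Y a b. D.in_add (fob F T) Y \<and> a \<in> Hom D (fob F X) Y \<and> b \<in> Hom D Y (fob F X) \<and> k = b \<star>\<^bsub>D\<^esub> a"
    using F_hom D.in_add_refl[OF F_ob[OF assms(2)]] by blast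
qed

lemma F_dsum2: "dsum2 C Z X Y \<Longrightarrow> dsum2 D (fob F Z) (fob F X) (fob F Y)"
proof (erule C.dsum2D)
  fix i p j q assume *: "i \<in> Hom C X Z" "p \<in> Hom C Z X" "j \<in> Hom C Y Z" "q \<in> Hom C Z Y"
    and e: "p \<star>\<^bsub>C\<^esub> i = Idn C X" "q \<star>\<^bsub>C\<^esub> j = Idn C Y" "q \<star>\<^bsub>C\<^esub> i = Zro C X Y" "p \<star>\<^bsub>C\<^esub> j = Zro C Y X"
    "Pls C (i \<star>\<^bsub>C\<^esub> p) (j \<star>\<^bsub>C\<^esub> q) = Idn C Z"
  have ob: "X \<in> Obj C" "Y \<in> Obj C" "Z \<in> Obj C" using * C.Hom_ob by auto
  have "fmor F (Pls C (i \<star>\<^bsub>C\<^esub> p) (j \<star>\<^bsub>C\<^esub> q))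
      = Pls D (fmor F i \<star>\<^bsub>D\<^esub> fmor F p) (fmor F j \<star>\<^bsub>D\<^esub> fmor F q)"
    using F_pls[OF C.cmp_hom[OF *(2,1)] C.cmp_hom[OF *(4,3)]] F_cmp * by simp
  then show "dsum2 D (fob F Z) (fob F X) (fob F Y)"
    using * e ob F_idn F_zro F_cmp[OF *(1,2)] F_cmp[OF *(3,4)] F_cmp[OF *(1,4)] F_cmp[OF *(3,2)]
    by (intro D.dsum2I[of "fmor F i" _ _ "fmor F p" "fmor F j" _ "fmor F q"]) (auto intro: F_hom)
qed

end

text \<open>
  Names the representatives and identifications that a covering functor provides for the fibre of
  an indecomposable object \<open>A\<close>.
\<close>

definition fibre_reps ::
  "('o, 'm, 'k, 'y) lcat_scheme \<Rightarrow> ('p, 'n, 'k, 'z) lcat_scheme \<Rightarrow> ('o, 'm, 'p, 'n) func \<Rightarrow> 'p \<Rightarrow>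
   'o set \<Rightarrow> ('o \<Rightarrow> 'n) \<Rightarrow> ('o \<Rightarrow> 'n) \<Rightarrow> bool" where
  "fibre_reps C D F A R \<phi> \<psi> \<longleftrightarrow> R \<subseteq> {Y \<in> Obj C. isomorphic D (fob F Y) A} \<and>
    (\<forall>Y\<in>Obj C. isomorphic D (fob F Y) A \<longrightarrow> (\<exists>!Z. Z \<in> R \<and> isomorphic C Y Z)) \<and>
    (\<forall>Y\<in>R. iso_pair D (fob F Y) A (\<phi> Y) (\<psi> Y)) \<and>
    (\<forall>X\<in>Obj C.
      bij_betw (\<lambda>u. finsum (hom_mod D (fob F X) A) (\<lambda>Y. \<phi> Y \<star>\<^bsub>D\<^esub> fmor F (u Y))
                 {Y \<in> R. u Y \<noteq> Zro C X Y})
        (fam_out C X R) (Hom D (fob F X) A) \<and>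
      bij_betw (\<lambda>u. finsum (hom_mod D A (fob F X)) (\<lambda>Y. fmor F (u Y) \<star>\<^bsub>D\<^esub> \<psi> Y)
                 {Y \<in> R. u Y \<noteq> Zro C Y X})
        (fam_in C X R) (Hom D A (fob F X)))"

locale covering = linfunctor C D F + C: kscat C + D: kscat D
  for C :: "('o, 'm, 'k::field, 'y) lcat_scheme" and D :: "('p, 'n, 'k, 'z) lcat_scheme" and F +
  assumes covering: "covering_functor C D F"
begin

abbreviation comp_upstairs (infixr "\<cdot>" 75) where "g \<cdot> f \<equiv> g \<star>\<^bsub>C\<^esub> f"
abbreviation comp_downstairs (infixr "\<bullet>" 75) where "g \<bullet> f \<equiv> g \<star>\<^bsub>D\<^esub> f"

lemma fibre_reps_exist:
  assumes "indecomposable D A"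
  obtains R \<phi> \<psi> where "fibre_reps C D F A R \<phi> \<psi>"
proof -
  have "\<exists>R \<phi> \<psi>. fibre_reps C D F A R \<phi> \<psi>"
    unfolding fibre_reps_def
    by (rule covering[unfolded covering_functor_def, THEN conjunct2, THEN spec, THEN mp, OF assms])
  then show thesis using that by (elim exE)
qed

lemma fibre_repsD:
  assumes "fibre_reps C D F A R \<phi> \<psi>"
  shows "Y \<in> R \<Longrightarrow> Y \<in> Obj C" "Y \<in> R \<Longrightarrow> iso_pair D (fob F Y) A (\<phi> Y) (\<psi> Y)"
    "Y \<in> Obj C \<Longrightarrow> isomorphic D (fob F Y) A \<Longrightarrow> \<exists>!Z. Z \<in> R \<and> isomorphic C Y Z"
    "Y \<in> R \<Longrightarrow> isomorphic D (fob F Y) A" "Y \<in> R \<Longrightarrow> \<phi> Y \<in> Hom D (fob F Y) A" "Y \<in> R \<Longrightarrow> \<psi> Y \<in> Hom D A (fob F Y)"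
proof -
  note R = assms[unfolded fibre_reps_def]
  note R1 = R[THEN conjunct1] and R2 = R[THEN conjunct2, THEN conjunct1]
    and R3 = R[THEN conjunct2, THEN conjunct2, THEN conjunct1]
  show "Y \<in> R \<Longrightarrow> Y \<in> Obj C" "Y \<in> R \<Longrightarrow> isomorphic D (fob F Y) A" using R1 by blast+
  show iso: "Y \<in> R \<Longrightarrow> iso_pair D (fob F Y) A (\<phi> Y) (\<psi> Y)" using R3 by blast
  show "Y \<in> R \<Longrightarrow> \<phi> Y \<in> Hom D (fob F Y) A" "Y \<in> R \<Longrightarrow> \<psi> Y \<in> Hom D A (fob F Y)"
    using iso unfolding iso_pair_def by blast+
  show "Y \<in> Obj C \<Longrightarrow> isomorphic D (fob F Y) A \<Longrightarrow> \<exists>!Z. Z \<in> R \<and> isomorphic C Y Z"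
    using R2 by (elim ballE impE) auto
qed

lemma fibre_reps_bij:
  assumes "fibre_reps C D F A R \<phi> \<psi>" "X \<in> Obj C"
  shows "bij_betw (\<lambda>u. finsum (hom_mod D (fob F X) A) (\<lambda>Y. \<phi> Y \<bullet> fmor F (u Y))
                 {Y \<in> R. u Y \<noteq> Zro C X Y}) (fam_out C X R) (Hom D (fob F X) A)"
    "bij_betw (\<lambda>u. finsum (hom_mod D A (fob F X)) (\<lambda>Y. fmor F (u Y) \<bullet> \<psi> Y)
                 {Y \<in> R. u Y \<noteq> Zro C Y X}) (fam_in C X R) (Hom D A (fob F X))"
  using assms(1)[unfolded fibre_reps_def, THEN conjunct2, THEN conjunct2, THEN conjunct2, THEN bspec, OF assms(2)]
  by (rule conjunct1, rule conjunct2)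

lemma iso_reps_eq:
  assumes "fibre_reps C D F A R \<phi> \<psi>" "Y \<in> R" "Z \<in> R" "isomorphic C Y Z" shows "Y = Z"
  using fibre_repsD(3)[OF assms(1) fibre_repsD(1,4)[OF assms(1,2)]] assms(2-4)
    C.isomorphic_refl[OF fibre_repsD(1)[OF assms(1,2)]] by blast

lemma fam_sum_superset:
  assumes R: "fibre_reps C D F A R \<phi> \<psi>" and X: "X \<in> Obj C" and u: "\<And>Y. Y \<in> R \<Longrightarrow> u Y \<in> Hom C X Y"
    and S: "finite S" "{Y \<in> R. u Y \<noteq> Zro C X Y} \<subseteq> S" "S \<subseteq> R"
  shows "finsum (hom_mod D (fob F X) A) (\<lambda>Y. \<phi> Y \<bullet> fmor F (u Y)) {Y \<in> R. u Y \<noteq> Zro C X Y}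
    = finsum (hom_mod D (fob F X) A) (\<lambda>Y. \<phi> Y \<bullet> fmor F (u Y)) S"
proof (cases "R = {}")
  case False
  then have A: "A \<in> Obj D" using fibre_repsD(5)[OF R] D.Hom_ob by blast
  interpret kspace "hom_mod D (fob F X) A" using D.hom_kspace F_ob X A by blast
  have cl: "\<phi> Y \<bullet> fmor F (u Y) \<in> Hom D (fob F X) A" if "Y \<in> S" for Y
    using fibre_repsD(5)[OF R] F_hom u S that by (blast intro: D.cmp_hom)
  have "finsum (hom_mod D (fob F X) A) (\<lambda>Y. \<phi> Y \<bullet> fmor F (u Y)) {Y \<in> R. u Y \<noteq> Zro C X Y}
    = finsum (hom_mod D (fob F X) A) (\<lambda>Y. \<phi> Y \<bullet> fmor F (u Y)) S"
  proof (rule M.add.finprod_mono_neutral_cong_left[OF S(1,2)])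
    show "\<phi> Y \<bullet> fmor F (u Y) = \<zero>\<^bsub>hom_mod D (fob F X) A\<^esub>"
      if "Y \<in> S - {Y \<in> R. u Y \<noteq> Zro C X Y}" for Y
    proof -
      have "Y \<in> R" "u Y = Zro C X Y" using that S by auto
      then show ?thesis
        using fibre_repsD(1,5)[OF R, of Y] X F_zro F_ob D.cmp_zro(1) by auto
    qed
  qed (use cl in auto)
  then show ?thesis .
qed (use S in auto)

lemma fam_out_surj:
  assumes R: "fibre_reps C D F A R \<phi> \<psi>" and X: "X \<in> Obj C" and v: "v \<in> Hom D (fob F X) A"
  shows "\<exists>u S. (\<forall>Y\<in>R. u Y \<in> Hom C X Y) \<and> finite S \<and> S \<subseteq> R \<and> (\<forall>Y\<in>R - S. u Y = Zro C X Y) \<and>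
    v = finsum (hom_mod D (fob F X) A) (\<lambda>Y. \<phi> Y \<bullet> fmor F (u Y)) S"
proof -
  have "bij_betw (\<lambda>u. finsum (hom_mod D (fob F X) A) (\<lambda>Y. \<phi> Y \<bullet> fmor F (u Y))
                 {Y \<in> R. u Y \<noteq> Zro C X Y}) (fam_out C X R) (Hom D (fob F X) A)"
    by (rule fibre_reps_bij(1)[OF R X])
  then obtain u where "u \<in> fam_out C X R" "v = finsum (hom_mod D (fob F X) A) (\<lambda>Y. \<phi> Y \<bullet> fmor F (u Y))
                 {Y \<in> R. u Y \<noteq> Zro C X Y}"
    using v unfolding bij_betw_def by blast
  then show ?thesis
    by (intro exI[of _ u] exI[of _ "{Y \<in> R. u Y \<noteq> Zro C X Y}"]) (auto simp: fam_out_def)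
qed

lemma fam_out_inj:
  assumes R: "fibre_reps C D F A R \<phi> \<psi>" and X: "X \<in> Obj C"
    and u: "\<And>Y. Y \<in> R \<Longrightarrow> u Y \<in> Hom C X Y" and u': "\<And>Y. Y \<in> R \<Longrightarrow> u' Y \<in> Hom C X Y"
    and S: "finite S" "S \<subseteq> R" "\<And>Y. Y \<in> R - S \<Longrightarrow> u Y = Zro C X Y" "\<And>Y. Y \<in> R - S \<Longrightarrow> u' Y = Zro C X Y"
    and eq: "finsum (hom_mod D (fob F X) A) (\<lambda>Y. \<phi> Y \<bullet> fmor F (u Y)) S =
      finsum (hom_mod D (fob F X) A) (\<lambda>Y. \<phi> Y \<bullet> fmor F (u' Y)) S"
    and Y: "Y \<in> R"
  shows "u Y = u' Y"
proof -
  let ?P = "\<lambda>u. finsum (hom_mod D (fob F X) A) (\<lambda>Y. \<phi> Y \<bullet> fmor F (u Y)) {Y \<in> R. u Y \<noteq> Zro C X Y}"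
  have bij: "bij_betw ?P (fam_out C X R) (Hom D (fob F X) A)"
    by (rule fibre_reps_bij(1)[OF R X])
  have A: "A \<in> Obj D" using Y fibre_repsD(5)[OF R] D.Hom_ob by blast
  interpret kspace "hom_mod D (fob F X) A" using D.hom_kspace F_ob X A by blast
  have P: "?P (restrict w R) = finsum (hom_mod D (fob F X) A) (\<lambda>Y. \<phi> Y \<bullet> fmor F (w Y)) S"
    "restrict w R \<in> fam_out C X R"
    if w: "\<And>Y. Y \<in> R \<Longrightarrow> w Y \<in> Hom C X Y" "\<And>Y. Y \<in> R - S \<Longrightarrow> w Y = Zro C X Y" for w
  proof -
    have "?P (restrict w R) = finsum (hom_mod D (fob F X) A) (\<lambda>Y. \<phi> Y \<bullet> fmor F (restrict w R Y)) S"
      by (rule fam_sum_superset[OF R X _ S(1) _ S(2)]) (use w in \<open>auto simp: restrict_def\<close>)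
    also have "\<dots> = finsum (hom_mod D (fob F X) A) (\<lambda>Y. \<phi> Y \<bullet> fmor F (w Y)) S"
    proof (rule M.finsum_cong')
      show "(\<lambda>Y. \<phi> Y \<bullet> fmor F (w Y)) \<in> S \<rightarrow> carrier (hom_mod D (fob F X) A)"
      proof
        fix Y assume "Y \<in> S"
        then have Y: "Y \<in> R" using S by blast
        show "\<phi> Y \<bullet> fmor F (w Y) \<in> carrier (hom_mod D (fob F X) A)"
          using D.cmp_hom[OF F_hom[OF w(1)[OF Y]] fibre_repsD(5)[OF R Y]] by simp
      qed
    qed (use S in auto)
    finally show "?P (restrict w R) = finsum (hom_mod D (fob F X) A) (\<lambda>Y. \<phi> Y \<bullet> fmor F (w Y)) S" .
    have "{Y \<in> R. restrict w R Y \<noteq> Zro C X Y} \<subseteq> S" using w by auto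
    then have "finite {Y \<in> R. restrict w R Y \<noteq> Zro C X Y}" using S(1) by (rule finite_subset)
    then show "restrict w R \<in> fam_out C X R"
      unfolding fam_out_def using w(1) by (intro CollectI conjI restrict_PiE_iff[THEN iffD2]) auto
  qed
  have "?P (restrict u R) = ?P (restrict u' R)"
    by (rule trans[OF P(1)[OF u S(3)] trans[OF eq P(1)[OF u' S(4), symmetric]]])
  then have "restrict u R = restrict u' R"
    by (rule inj_onD[OF bij_betw_imp_inj_on[OF bij] _ P(2)[OF u S(3)] P(2)[OF u' S(4)]])
  then show ?thesis using Y by (metis restrict_apply')
qed

lemma cov_out:
  assumes A: "indecomposable D A" and X: "X \<in> Obj C" and v: "v \<in> Hom D (fob F X) A"
  shows "v \<in> D.asum (fob F X) A {\<phi> \<bullet> fmor F u | Y \<phi> \<psi> u. iso_pair D (fob F Y) A \<phi> \<psi> \<and> u \<in> Hom C X Y}"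
    (is "_ \<in> D.asum _ _ ?K")
proof -
  obtain R \<phi> \<psi> where R: "fibre_reps C D F A R \<phi> \<psi>" using fibre_reps_exist[OF A] .
  obtain u S where u: "\<forall>Y\<in>R. u Y \<in> Hom C X Y" "finite S" "S \<subseteq> R"
    "v = finsum (hom_mod D (fob F X) A) (\<lambda>Y. \<phi> Y \<bullet> fmor F (u Y)) S"
    using fam_out_surj[OF R X v] by blast
  show ?thesis unfolding u(4)
  proof (rule D.finsum_in_asum)
    show "\<phi> Y \<bullet> fmor F (u Y) \<in> ?K" if "Y \<in> S" for Y
      using fibre_repsD(2)[OF R] u that by blast
    show "?K \<subseteq> Hom D (fob F X) A" using F_hom unfolding iso_pair_def by (blast intro: D.cmp_hom)
  qed (use u X A F_ob D.indec_ob in auto)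
qed

lemma cov_in:
  assumes A: "indecomposable D A" and X: "X \<in> Obj C" and v: "v \<in> Hom D A (fob F X)"
  shows "v \<in> D.asum A (fob F X) {fmor F u \<bullet> \<psi> | Y \<phi> \<psi> u. iso_pair D (fob F Y) A \<phi> \<psi> \<and> u \<in> Hom C Y X}"
    (is "_ \<in> D.asum _ _ ?K")
proof -
  obtain R \<phi> \<psi> where R: "fibre_reps C D F A R \<phi> \<psi>" using fibre_reps_exist[OF A] .
  have "bij_betw (\<lambda>u. finsum (hom_mod D A (fob F X)) (\<lambda>Y. fmor F (u Y) \<bullet> \<psi> Y)
                 {Y \<in> R. u Y \<noteq> Zro C Y X}) (fam_in C X R) (Hom D A (fob F X))"
    by (rule fibre_reps_bij(2)[OF R X])
  then obtain u where u: "u \<in> fam_in C X R" "v = finsum (hom_mod D A (fob F X)) (\<lambda>Y. fmor F (u Y) \<bullet> \<psi> Y)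
                 {Y \<in> R. u Y \<noteq> Zro C Y X}"
    using v unfolding bij_betw_def by blast
  show ?thesis unfolding u(2)
  proof (rule D.finsum_in_asum)
    show "fmor F (u Y) \<bullet> \<psi> Y \<in> ?K" if "Y \<in> {Y \<in> R. u Y \<noteq> Zro C Y X}" for Y
      using fibre_repsD(2)[OF R] u(1) that unfolding fam_in_def by blast
    show "?K \<subseteq> Hom D A (fob F X)" using F_hom unfolding iso_pair_def by (blast intro: D.cmp_hom)
    show "finite {Y \<in> R. u Y \<noteq> Zro C Y X}" using u(1) unfolding fam_in_def by blast
  qed (use X A F_ob D.indec_ob in auto)
qed

text \<open>Expand a retraction downstairs along the covering and compare components.\<close>

lemma split_mono_reflect:
  assumes A: "indecomposable D (fob F X)" and c: "c \<in> Hom C X Y"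
    and d: "d \<in> Hom D (fob F Y) (fob F X)" "d \<bullet> fmor F c = Idn D (fob F X)"
  shows "\<exists>c'\<in>Hom C Y X. c' \<cdot> c = Idn C X"
proof -
  let ?A = "fob F X"
  have ob: "X \<in> Obj C" "Y \<in> Obj C" using c C.Hom_ob by auto
  obtain R \<phi> \<psi> where R: "fibre_reps C D F ?A R \<phi> \<psi>" using fibre_reps_exist[OF A] .
  obtain Z where Z: "Z \<in> R" "isomorphic C X Z"
    using fibre_repsD(3)[OF R ob(1)] D.isomorphic_refl F_ob ob by blast
  obtain j j' where j: "iso_pair C X Z j j'" using Z unfolding isomorphic_def by blast
  have jh: "j \<in> Hom C X Z" "j' \<in> Hom C Z X" "j' \<cdot> j = Idn C X" using j unfolding iso_pair_def by auto
  have \<phi>: "\<phi> Y \<in> Hom D (fob F Y) ?A" if "Y \<in> R" for Y using fibre_repsD(5)[OF R that] .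
  \<comment> \<open>Expand this map on \<open>F Y\<close> along the fibre. After composition with \<open>F
    c\<close> it becomes \<open>\<phi> Z F(j)\<close>, whose only component is
    \<open>j\<close>.\<close>
  let ?v = "\<phi> Z \<bullet> (fmor F j \<bullet> d)"
  have v: "?v \<in> Hom D (fob F Y) ?A" using d jh F_hom \<phi>[OF Z(1)] by (blast intro: D.cmp_hom)
  obtain w S where w: "\<forall>Y'\<in>R. w Y' \<in> Hom C Y Y'" "finite S" "S \<subseteq> R" "\<forall>Y'\<in>R - S. w Y' = Zro C Y Y'"
    "?v = finsum (hom_mod D (fob F Y) ?A) (\<lambda>Y'. \<phi> Y' \<bullet> fmor F (w Y')) S"
    using fam_out_surj[OF R ob(2) v] by blast
  interpret kspace "hom_mod D (fob F X) ?A" using D.hom_kspace F_ob ob by blast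
  let ?S = "insert Z S"
  define t where "t = (\<lambda>Y'. if Y' = Z then j else Zro C X Y')"
  have tm: "\<phi> Y' \<bullet> fmor F (w Y' \<cdot> c) \<in> Hom D (fob F X) ?A" if "Y' \<in> R" for Y'
    using that w(1) c \<phi> F_hom by (blast intro: D.cmp_hom C.cmp_hom)
  have tt: "t Y' \<in> Hom C X Y'" if "Y' \<in> R" for Y'
    using that jh C.zro_hom ob fibre_repsD(1)[OF R] by (auto simp: t_def)
  have tm': "\<phi> Y' \<bullet> fmor F (t Y') \<in> Hom D (fob F X) ?A" if "Y' \<in> R" for Y'
    using tt that \<phi> F_hom by (blast intro: D.cmp_hom)
  have "finsum (hom_mod D (fob F X) ?A) (\<lambda>Y'. \<phi> Y' \<bullet> fmor F (w Y' \<cdot> c)) ?S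
      = finsum (hom_mod D (fob F X) ?A) (\<lambda>Y'. \<phi> Y' \<bullet> fmor F (w Y' \<cdot> c)) S"
  proof (rule M.add.finprod_mono_neutral_cong_right)
    show "\<phi> Y' \<bullet> fmor F (w Y' \<cdot> c) = \<zero>\<^bsub>hom_mod D (fob F X) ?A\<^esub>" if "Y' \<in> ?S - S" for Y'
    proof -
      have Y': "Y' \<in> R" "w Y' = Zro C Y Y'" using that w Z by auto
      then have "w Y' \<cdot> c = Zro C X Y'" using C.cmp_zro(2)[OF c] fibre_repsD(1)[OF R] by simp
      then show ?thesis using Y' \<phi> ob fibre_repsD(1)[OF R] F_zro F_ob D.cmp_zro(1) by auto
    qed
  qed (use w tm Z in auto)
  also have "\<dots> = finsum (hom_mod D (fob F X) ?A)
      (\<lambda>Y'. Idn D ?A \<bullet> ((\<phi> Y' \<bullet> fmor F (w Y')) \<bullet> fmor F c)) S"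
  proof (rule M.finsum_cong')
    have *: "\<phi> Y' \<bullet> fmor F (w Y' \<cdot> c)
        = Idn D ?A \<bullet> ((\<phi> Y' \<bullet> fmor F (w Y')) \<bullet> fmor F c)"
        "\<phi> Y' \<bullet> fmor F (w Y' \<cdot> c) \<in> Hom D (fob F X) ?A" if "Y' \<in> S" for Y'
    proof -
      have Y': "Y' \<in> R" "w Y' \<in> Hom C Y Y'" using that w by auto
      note h = \<phi>[OF Y'(1)] F_hom[OF Y'(2)] F_hom[OF c] F_ob[OF ob(1)]
      show "\<phi> Y' \<bullet> fmor F (w Y' \<cdot> c)
        = Idn D ?A \<bullet> ((\<phi> Y' \<bullet> fmor F (w Y')) \<bullet> fmor F c)"
        unfolding F_cmp[OF c Y'(2)] using h by (simp add: D.cs)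
      show "\<phi> Y' \<bullet> fmor F (w Y' \<cdot> c) \<in> Hom D (fob F X) ?A" by (rule tm[OF Y'(1)])
    qed
    show "\<phi> Y' \<bullet> fmor F (w Y' \<cdot> c)
        = Idn D ?A \<bullet> ((\<phi> Y' \<bullet> fmor F (w Y')) \<bullet> fmor F c)" if "Y' \<in> S" for Y'
      by (rule *(1)[OF that])
    show "(\<lambda>Y'. Idn D ?A \<bullet> ((\<phi> Y' \<bullet> fmor F (w Y')) \<bullet> fmor F c)) \<in> S \<rightarrow> carrier (hom_mod D (fob F X) ?A)"
    proof
      fix Y' assume "Y' \<in> S"
      from *(2)[OF this] show "Idn D ?A \<bullet> ((\<phi> Y' \<bullet> fmor F (w Y')) \<bullet> fmor F c) \<in> carrier (hom_mod D (fob F X) ?A)"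
        unfolding *(1)[OF \<open>Y' \<in> S\<close>] by simp
    qed
  qed auto
  also have "\<dots> = Idn D ?A \<bullet> (finsum (hom_mod D (fob F Y) ?A) (\<lambda>Y'. \<phi> Y' \<bullet> fmor F (w Y')) S \<bullet> fmor F c)"
    by (rule D.finsum_cmp[symmetric])
      (use w F_hom[OF c] D.idn_hom[OF F_ob[OF ob(1)]] \<phi> F_hom in \<open>auto intro!: D.cmp_hom\<close>)
  also have "\<dots> = \<phi> Z \<bullet> fmor F j"
    unfolding w(5)[symmetric]
    using d \<phi>[OF Z(1)] F_hom[OF jh(1)] F_hom[OF c] F_ob[OF ob(1)] by (simp add: D.cs)
  also have "\<dots> = finsum (hom_mod D (fob F X) ?A) (\<lambda>Y'. \<phi> Y' \<bullet> fmor F (t Y')) {Z}"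
    using tm'[OF Z(1)] D.hom_module_laws(1)[OF tm'[OF Z(1)]] by (simp add: M.finsum_insert t_def)
  also have "\<dots> = finsum (hom_mod D (fob F X) ?A) (\<lambda>Y'. \<phi> Y' \<bullet> fmor F (t Y')) ?S"
  proof (rule M.add.finprod_mono_neutral_cong_left)
    show "\<phi> Y' \<bullet> fmor F (t Y') = \<zero>\<^bsub>hom_mod D (fob F X) ?A\<^esub>" if "Y' \<in> ?S - {Z}" for Y'
    proof -
      have Y': "Y' \<in> R" "t Y' = Zro C X Y'" using that w Z by (auto simp: t_def)
      then show ?thesis
        using F_zro[OF ob(1) fibre_repsD(1)[OF R Y'(1)]] D.cmp_zro(1)[OF \<phi>[OF Y'(1)] F_ob[OF ob(1)]] by simp
    qed
  qed (use w tm' Z in auto)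
  finally have eq: "finsum (hom_mod D (fob F X) ?A) (\<lambda>Y'. \<phi> Y' \<bullet> fmor F (w Y' \<cdot> c)) ?S
      = finsum (hom_mod D (fob F X) ?A) (\<lambda>Y'. \<phi> Y' \<bullet> fmor F (t Y')) ?S" .
  have "w Z \<cdot> c = t Z"
  proof (rule fam_out_inj[OF R ob(1) _ tt _ _ _ _ eq Z(1)])
    show "w Y' \<cdot> c \<in> Hom C X Y'" if "Y' \<in> R" for Y' using w(1) that C.cmp_hom[OF c] by blast
    show "finite ?S" "?S \<subseteq> R" using w Z by auto
    show "w Y' \<cdot> c = Zro C X Y'" if "Y' \<in> R - ?S" for Y'
      using that w(4) C.cmp_zro(2)[OF c fibre_repsD(1)[OF R, of Y']] by auto
    show "t Y' = Zro C X Y'" if "Y' \<in> R - ?S" for Y' using that by (auto simp: t_def)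
  qed
  then have "(j' \<cdot> w Z) \<cdot> c = Idn C X"
    using w(1) Z(1) jh c by (simp add: C.cs t_def)
  then show ?thesis using w(1) Z(1) jh C.cmp_hom by blast
qed

text \<open>
  Up to the isomorphism between \<open>Y\<close> and its representative \<open>Z\<close>, the map
  \<open>u\<close> is the only component of \<open>F u\<close> in the expansion along the fibre.
\<close>

lemma faithful_indec:
  assumes A: "indecomposable D (fob F Y)" and u: "u \<in> Hom C X Y" and z: "fmor F u = Zro D (fob F X) (fob F Y)"
  shows "u = Zro C X Y"
proof -
  let ?A = "fob F Y"
  have ob: "X \<in> Obj C" "Y \<in> Obj C" using u C.Hom_ob by auto
  obtain R \<phi> \<psi> where R: "fibre_reps C D F ?A R \<phi> \<psi>" using fibre_reps_exist[OF A] .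
  obtain Z where Z: "Z \<in> R" "isomorphic C Y Z"
    using fibre_repsD(3)[OF R ob(2)] D.isomorphic_refl F_ob ob by blast
  obtain j j' where j: "j \<in> Hom C Y Z" "j' \<in> Hom C Z Y" "j' \<cdot> j = Idn C Y"
    using Z unfolding isomorphic_def iso_pair_def by blast
  interpret kspace "hom_mod D (fob F X) ?A" using D.hom_kspace F_ob ob by blast
  define t where "t = (\<lambda>Y'. if Y' = Z then j \<cdot> u else Zro C X Y')"
  have obZ: "Z \<in> Obj C" using Z fibre_repsD(1)[OF R] by blast
  have \<phi>: "\<phi> Z \<in> Hom D (fob F Z) ?A" using fibre_repsD(5)[OF R Z(1)] .
  have ju: "j \<cdot> u \<in> Hom C X Z" using u j C.cmp_hom by blast
  have "fmor F (j \<cdot> u) = Zro D (fob F X) (fob F Z)"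
    using F_cmp[OF u j(1)] z D.cmp_zro(1)[OF F_hom[OF j(1)] F_ob[OF ob(1)]] by simp
  moreover have "fmor F (Zro C X Z) = Zro D (fob F X) (fob F Z)" using F_zro ob obZ by simp
  ultimately have "finsum (hom_mod D (fob F X) ?A) (\<lambda>Y. \<phi> Y \<bullet> fmor F (t Y)) {Z} =
      finsum (hom_mod D (fob F X) ?A) (\<lambda>Y. \<phi> Y \<bullet> fmor F (Zro C X Y)) {Z}"
    using D.cmp_hom[OF F_hom[OF ju] \<phi>] D.cmp_hom[OF F_hom[OF C.zro_hom[OF ob(1) obZ]] \<phi>]
    by (simp add: M.finsum_insert t_def)
  then have "t Z = Zro C X Z"
    using fam_out_inj[OF R ob(1), of t "\<lambda>Y. Zro C X Y" "{Z}" Z] Z ju C.zro_hom ob fibre_repsD(1)[OF R]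
    by (auto simp: t_def)
  then have "j' \<cdot> (j \<cdot> u) = Zro C X Y" using C.cmp_zro(1)[OF j(2) ob(1)] by (simp add: t_def)
  then show ?thesis using j u C.cmp_reduce[OF j(3,1,2)] by (simp add: C.cs)
qed

end

text \<open>
  The defining property of a covering functor only concerns preimages of indecomposable objects,
  so it does not prevent such a functor from killing indecomposables. This is excluded from here
  on.
\<close>

locale covering_nz = covering +
  assumes nz: "indecomposable C X \<Longrightarrow> \<not> zero_object D (fob F X)"
begin

text \<open>
  Write the inclusion of an indecomposable summand \<open>A\<close> of \<open>F X\<close> as a sum
  of maps \<open>F u \<psi>\<close>. By locality of \<open>End A\<close>, one of the maps \<open>F
  u\<close> is a split monomorphism from some \<open>F Y\<close> isomorphic to \<open>A\<close>.
  Then \<open>u\<close> is a split monomorphism into the indecomposable object \<open>X\<close>,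
  hence an isomorphism.
\<close>

lemma indec_image:
  assumes X: "indecomposable C X" shows "indecomposable D (fob F X)"
proof -
  have ob: "X \<in> Obj C" using C.indec_ob X by blast
  obtain A where A: "indecomposable D A" "D.retract A (fob F X)"
    using D.nonzero_indec_retract[OF F_ob[OF ob] nz[OF X]] by blast
  obtain a b where ab: "a \<in> Hom D A (fob F X)" "b \<in> Hom D (fob F X) A" "b \<bullet> a = Idn D A"
    using A unfolding D.retract_def by blast
  let ?K = "{fmor F u \<bullet> \<psi> | Y \<phi> \<psi> u. iso_pair D (fob F Y) A \<phi> \<psi> \<and> u \<in> Hom C Y X}"
  have obA: "A \<in> Obj D" using D.indec_ob A by blast
  have Kh: "?K \<subseteq> Hom D A (fob F X)" using F_hom unfolding iso_pair_def by (blast intro: D.cmp_hom)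
  have "b \<bullet> (a \<bullet> Idn D A) = Idn D A" using ab obA by (simp add: D.cs)
  from D.local_sum_cmp[OF A(1) cov_in[OF A(1) ob ab(1)] Kh D.idn_hom[OF obA] ab(2) this]
  obtain k g where kK: "k \<in> ?K" and k: "iso_pair D A A (b \<bullet> (k \<bullet> Idn D A)) g"
    by (elim bexE exE)
  from kK obtain Y \<phi> \<psi> u where Y: "k = fmor F u \<bullet> \<psi>" "iso_pair D (fob F Y) A \<phi> \<psi>" "u \<in> Hom C Y X" by blast
  note h = Y(2)[unfolded iso_pair_def] k[unfolded iso_pair_def] F_hom[OF Y(3)]
  have AY: "isomorphic D A (fob F Y)" using Y(2) D.iso_pair_sym D.isomorphicI by blast
  have AFY: "indecomposable D (fob F Y)" using D.isomorphic_indec A AY by blast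
  have e1: "g \<bullet> (b \<bullet> (fmor F u \<bullet> \<psi>)) = Idn D A" using h ab obA Y(1) by (simp add: D.cs)
  have "\<psi> \<bullet> ((g \<bullet> (b \<bullet> (fmor F u \<bullet> \<psi>))) \<bullet> \<phi>) = Idn D (fob F Y)"
    unfolding e1 using h by (simp add: D.cs)
  then have "(\<psi> \<bullet> (g \<bullet> b)) \<bullet> fmor F u = Idn D (fob F Y)"
    using h ab D.cmp_reduce[of \<psi> \<phi> "Idn D (fob F Y)" "fob F Y" A "fob F Y"] by (simp add: D.cs)
  then obtain c where "c \<in> Hom C X Y" "c \<cdot> u = Idn C Y"
    using split_mono_reflect[OF AFY Y(3), of "\<psi> \<bullet> (g \<bullet> b)"] h ab by (blast intro: D.cmp_hom)
  moreover have "\<not> zero_object C Y" using F_zero_object D.indec_nz AFY by blast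
  ultimately have "isomorphic C Y X" using C.retract_indec_iso[OF Y(3) _ _ _ X] C.isomorphicI by blast
  then show ?thesis using F_isomorphic D.isomorphic_indec AFY by blast
qed

lemma faithful:
  assumes u: "u \<in> Hom C X Y" and z: "fmor F u = Zro D (fob F X) (fob F Y)"
  shows "u = Zro C X Y"
proof -
  have ob: "X \<in> Obj C" "Y \<in> Obj C" using u C.Hom_ob by auto
  have "Idn C Y \<cdot> u \<in> {Zro C X Y}"
  proof (rule C.asum_map[OF C.decompose[OF ob(2)] C.ind_gens_hom ob(2,2), where F = "\<lambda>e. e \<cdot> u"])
    show "Zro C Y Y \<cdot> u \<in> {Zro C X Y}" using u ob by (simp add: C.cs)
    show "(Pls C f g) \<cdot> u \<in> {Zro C X Y}"
      if "f \<in> Hom C Y Y" "g \<in> Hom C Y Y" "f \<cdot> u \<in> {Zro C X Y}" "g \<cdot> u \<in> {Zro C X Y}" for f g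
      using that u ob by (simp add: C.cs)
    fix k assume "k \<in> C.ind_gens Y"
    then obtain i p B where B: "k = i \<cdot> p" "indecomposable C B" "i \<in> Hom C B Y" "p \<in> Hom C Y B"
      unfolding C.ind_gens_def by blast
    have pu: "p \<cdot> u \<in> Hom C X B" using B u C.cmp_hom by blast
    have "fmor F (p \<cdot> u) = Zro D (fob F X) (fob F B)"
      using F_cmp[OF u B(4)] z D.cmp_zro(1)[OF F_hom[OF B(4)] F_ob[OF ob(1)]] by simp
    then have "p \<cdot> u = Zro C X B" using faithful_indec[OF indec_image[OF B(2)] pu] by blast
    then show "k \<cdot> u \<in> {Zro C X Y}"
      unfolding B(1) using C.assoc[OF u B(4,3)] C.cmp_zro(1)[OF B(3) ob(1)] by simp
  qed
  then show ?thesis using C.cmp_idn(2)[OF u] by simp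
qed

lemma zero_reflect: "X \<in> Obj C \<Longrightarrow> zero_object D (fob F X) \<Longrightarrow> zero_object C X"
proof -
  assume X: "X \<in> Obj C" and z: "zero_object D (fob F X)"
  have "fmor F (Idn C X) = Zro D (fob F X) (fob F X)"
    using z F_idn[OF X] by (simp only: zero_object_def)
  then have "Idn C X = Zro C X X" by (rule faithful[OF C.idn_hom[OF X]])
  then show "zero_object C X" by (rule C.zero_objectI[OF X])
qed

lemma indec_reflect:
  assumes "Y \<in> Obj C" "indecomposable D (fob F Y)" shows "indecomposable C Y"
  unfolding indecomposable_def
proof (intro conjI allI impI)
  show "\<not> zero_object C Y" using D.indec_nz[OF assms(2)] F_zero_object by blast
  fix A B assume AB: "dsum2 C Y A B"
  then have "zero_object D (fob F A) \<or> zero_object D (fob F B)"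
    using F_dsum2[OF AB] assms(2)[unfolded indecomposable_def] by blast
  then show "zero_object C A \<or> zero_object C B"
    using zero_reflect[of A] zero_reflect[of B] C.dsum2_retract[OF AB] C.retract_ob[of A Y] C.retract_ob[of B Y]
    by blast
qed (rule assms)

text \<open>
  Between indecomposables the radical consists of the non-isomorphisms, and isomorphisms are
  reflected since split monomorphisms are.
\<close>

lemma crad_iff:
  assumes X: "indecomposable C X" and Y: "indecomposable C Y" and u: "u \<in> Hom C X Y"
  shows "fmor F u \<in> D.crad (fob F X) (fob F Y) \<longleftrightarrow> u \<in> C.crad X Y"
proof
  assume r: "fmor F u \<in> D.crad (fob F X) (fob F Y)"
  show "u \<in> C.crad X Y"
  proof (rule ccontr)
    assume "u \<notin> C.crad X Y"
    then obtain g where "iso_pair C X Y u g" using C.not_crad_iso[OF X Y u] by blast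
    from D.iso_pair_not_crad[OF F_iso_pair[OF this] r] show False
      using D.indec_nz[OF indec_image[OF X]] by blast
  qed
next
  assume r: "u \<in> C.crad X Y"
  show "fmor F u \<in> D.crad (fob F X) (fob F Y)"
  proof (rule ccontr)
    assume "fmor F u \<notin> D.crad (fob F X) (fob F Y)"
    then obtain d where "iso_pair D (fob F X) (fob F Y) (fmor F u) d"
      using D.not_crad_iso[OF indec_image[OF X] indec_image[OF Y] F_hom[OF u]] by blast
    then obtain c where "c \<in> Hom C Y X" "c \<cdot> u = Idn C X"
      using split_mono_reflect[OF indec_image[OF X] u, of d] unfolding iso_pair_def by blast
    then have "iso_pair C X Y u c" using C.retract_indec_iso[OF u _ _ C.indec_nz[OF X] Y] by blast
    from C.iso_pair_not_crad[OF this r] show False using C.indec_nz[OF X] by blast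
  qed
qed

text \<open>
  Approximations survive the covering: a map downstairs into \<open>add P\<close> is a sum of images of maps into
  lifts, and each of these factors upstairs.
\<close>

lemma left_approx_image:
  assumes lift: "\<And>Y. indecomposable C Y \<Longrightarrow> D.retract (fob F Y) P \<Longrightarrow> C.retract Y T"
    and f: "f \<in> Hom C X W" "\<And>g. g \<in> Hom C X T \<Longrightarrow> \<exists>h\<in>Hom C W T. g = h \<cdot> f"
    and V: "D.in_add P V" and v: "v \<in> Hom D (fob F X) V"
  shows "\<exists>h\<in>Hom D (fob F W) V. v = h \<bullet> fmor F f"
proof -
  have ob: "X \<in> Obj C" "W \<in> Obj C" using f C.Hom_ob by auto
  let ?S = "\<lambda>V. {h \<bullet> fmor F f | h. h \<in> Hom D (fob F W) V}"
  have Fmf: "fmor F f \<in> Hom D (fob F X) (fob F W)" using F_hom f by blast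
  have zro: "Zro D (fob F X) V \<in> ?S V" if "V \<in> Obj D" for V
    using D.cmp_zro(2)[OF Fmf that] D.zro_hom[OF F_ob[OF ob(2)] that]
    by (intro CollectI exI[of _ "Zro D (fob F W) V"]) simp
  have pls: "Pls D x y \<in> ?S V" if xy: "x \<in> ?S V" "y \<in> ?S V" for x y V
  proof -
    obtain h where 1: "h \<in> Hom D (fob F W) V" "x = h \<bullet> fmor F f" using xy(1) by blast
    obtain h' where 2: "h' \<in> Hom D (fob F W) V" "y = h' \<bullet> fmor F f" using xy(2) by blast
    show ?thesis using D.distrib(2)[OF Fmf 1(1) 2(1)] 1 2 D.pls_hom[OF 1(1) 2(1)] by (intro CollectI exI[of _ "Pls D h h'"]) simp
  qed
  have ind: "v \<in> ?S V" if V: "indecomposable D V" "D.retract V P" and v: "v \<in> Hom D (fob F X) V" for V v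
    using cov_out[OF V(1) ob(1) v]
  proof induction
    case asum_zro
    then show ?case using zro D.indec_ob V by blast
  next
    case (asum_gen k)
    then obtain Y \<phi> \<psi> u where Y: "k = \<phi> \<bullet> fmor F u" "iso_pair D (fob F Y) V \<phi> \<psi>" "u \<in> Hom C X Y" by blast
    have "indecomposable D (fob F Y)"
      using D.isomorphic_indec[OF V(1) D.isomorphicI[OF D.iso_pair_sym[OF Y(2)]]] .
    moreover have "D.retract (fob F Y) P" using D.retract_trans[OF _ V(2)] D.iso_pair_retract[OF Y(2)] by blast
    ultimately have "C.retract Y T" using lift indec_reflect C.Hom_ob[OF Y(3)] by blast
    then obtain s r where sr: "s \<in> Hom C Y T" "r \<in> Hom C T Y" "r \<cdot> s = Idn C Y" unfolding C.retract_def by blast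
    obtain h where h: "h \<in> Hom C W T" "s \<cdot> u = h \<cdot> f" using f(2)[OF C.cmp_hom[OF Y(3) sr(1)]] by blast
    have "u = r \<cdot> (s \<cdot> u)" using sr Y(3) C.cmp_reduce[OF sr(3,1,2)] by (simp add: C.cs)
    also have "\<dots> = (r \<cdot> h) \<cdot> f" unfolding h(2) using sr h(1) f(1) by (simp add: C.cs)
    finally have "fmor F u = fmor F (r \<cdot> h) \<bullet> fmor F f"
      using F_cmp[OF f(1) C.cmp_hom[OF h(1) sr(2)]] by simp
    moreover have rh: "fmor F (r \<cdot> h) \<in> Hom D (fob F W) (fob F Y)" using F_hom[OF C.cmp_hom[OF h(1) sr(2)]] .
    moreover have "\<phi> \<in> Hom D (fob F Y) V" using Y unfolding iso_pair_def by blast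
    ultimately have "k = (\<phi> \<bullet> fmor F (r \<cdot> h)) \<bullet> fmor F f" "\<phi> \<bullet> fmor F (r \<cdot> h) \<in> Hom D (fob F W) V"
      using Y(1) Fmf D.assoc[OF Fmf rh] D.cmp_hom by auto
    then show ?case by blast
  next
    case (asum_pls f g)
    then show ?case by (intro pls)
  qed
  have obV: "V \<in> Obj D" using V D.in_add_ob by blast
  have "Idn D V \<bullet> v \<in> ?S V"
  proof (rule D.asum_map[OF D.decompose[OF obV] D.ind_gens_hom obV obV, where F = "\<lambda>e. e \<bullet> v"])
    show "Zro D V V \<bullet> v \<in> ?S V" using D.cmp_zro(2)[OF v obV] zro[OF obV] by simp
    show "Pls D e e' \<bullet> v \<in> ?S V"
      if "e \<in> Hom D V V" "e' \<in> Hom D V V" "e \<bullet> v \<in> ?S V" "e' \<bullet> v \<in> ?S V" for e e'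
      using D.distrib(2)[OF v that(1,2)] pls[OF that(3,4)] by simp
    fix k assume "k \<in> D.ind_gens V"
    then obtain i p B where B: "k = i \<bullet> p" "indecomposable D B" "i \<in> Hom D B V" "p \<in> Hom D V B" "p \<bullet> i = Idn D B"
      unfolding D.ind_gens_def by blast
    have "D.retract B P" using D.indec_in_add[OF B(2) D.in_add_retract[OF V D.retractI[OF B(3-5)]]] .
    then obtain h where h: "h \<in> Hom D (fob F W) B" "p \<bullet> v = h \<bullet> fmor F f"
      using ind[OF B(2) \<open>D.retract B P\<close> D.cmp_hom[OF v B(4)]] by blast
    have "k \<bullet> v = (i \<bullet> h) \<bullet> fmor F f"
      unfolding B(1) D.assoc[OF v B(4,3)] h(2) D.assoc[OF Fmf h(1) B(3)] ..
    then show "k \<bullet> v \<in> ?S V" using D.cmp_hom[OF h(1) B(3)] by blast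
  qed
  then show ?thesis using D.cmp_idn(2)[OF v] by auto
qed

lemma right_approx_image:
  assumes lift: "\<And>Y. indecomposable C Y \<Longrightarrow> D.retract (fob F Y) P \<Longrightarrow> C.retract Y T"
    and f: "f \<in> Hom C W X" "\<And>g. g \<in> Hom C T X \<Longrightarrow> \<exists>h\<in>Hom C T W. g = f \<cdot> h"
    and V: "D.in_add P V" and v: "v \<in> Hom D V (fob F X)"
  shows "\<exists>h\<in>Hom D V (fob F W). v = fmor F f \<bullet> h"
proof -
  have ob: "X \<in> Obj C" "W \<in> Obj C" using f C.Hom_ob by auto
  let ?S = "\<lambda>V. {fmor F f \<bullet> h | h. h \<in> Hom D V (fob F W)}"
  have Fmf: "fmor F f \<in> Hom D (fob F W) (fob F X)" using F_hom f by blast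
  have zro: "Zro D V (fob F X) \<in> ?S V" if "V \<in> Obj D" for V
    using D.cmp_zro(1)[OF Fmf that] D.zro_hom[OF that F_ob[OF ob(2)]]
    by (intro CollectI exI[of _ "Zro D V (fob F W)"]) simp
  have pls: "Pls D x y \<in> ?S V" if xy: "x \<in> ?S V" "y \<in> ?S V" for x y V
  proof -
    obtain h where 1: "h \<in> Hom D V (fob F W)" "x = fmor F f \<bullet> h" using xy(1) by blast
    obtain h' where 2: "h' \<in> Hom D V (fob F W)" "y = fmor F f \<bullet> h'" using xy(2) by blast
    show ?thesis using D.distrib(1)[OF 1(1) Fmf 2(1)] 1 2 D.pls_hom[OF 1(1) 2(1)] by (intro CollectI exI[of _ "Pls D h h'"]) simp
  qed
  have ind: "v \<in> ?S V" if V: "indecomposable D V" "D.retract V P" and v: "v \<in> Hom D V (fob F X)" for V v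
    using cov_in[OF V(1) ob(1) v]
  proof induction
    case asum_zro
    then show ?case using zro D.indec_ob V by blast
  next
    case (asum_gen k)
    then obtain Y \<phi> \<psi> u where Y: "k = fmor F u \<bullet> \<psi>" "iso_pair D (fob F Y) V \<phi> \<psi>" "u \<in> Hom C Y X" by blast
    have "indecomposable D (fob F Y)"
      using D.isomorphic_indec[OF V(1) D.isomorphicI[OF D.iso_pair_sym[OF Y(2)]]] .
    moreover have "D.retract (fob F Y) P" using D.retract_trans[OF _ V(2)] D.iso_pair_retract[OF Y(2)] by blast
    ultimately have "C.retract Y T" using lift indec_reflect C.Hom_ob[OF Y(3)] by blast
    then obtain s r where sr: "s \<in> Hom C Y T" "r \<in> Hom C T Y" "r \<cdot> s = Idn C Y" unfolding C.retract_def by blast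
    obtain h where h: "h \<in> Hom C T W" "u \<cdot> r = f \<cdot> h" using f(2)[OF C.cmp_hom[OF sr(2) Y(3)]] by blast
    have "u = (u \<cdot> r) \<cdot> s" using sr Y(3) by (simp add: C.cs)
    also have "\<dots> = f \<cdot> (h \<cdot> s)" unfolding h(2) using sr h(1) f(1) by (simp add: C.cs)
    finally have "fmor F u = fmor F f \<bullet> fmor F (h \<cdot> s)"
      using F_cmp[OF C.cmp_hom[OF sr(1) h(1)] f(1)] by simp
    moreover have rh: "fmor F (h \<cdot> s) \<in> Hom D (fob F Y) (fob F W)" using F_hom[OF C.cmp_hom[OF sr(1) h(1)]] .
    moreover have \<psi>: "\<psi> \<in> Hom D V (fob F Y)" using Y unfolding iso_pair_def by blast
    ultimately have "k = fmor F f \<bullet> (fmor F (h \<cdot> s) \<bullet> \<psi>)" "fmor F (h \<cdot> s) \<bullet> \<psi> \<in> Hom D V (fob F W)"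
      using Y(1) D.assoc[OF \<psi> rh Fmf] D.cmp_hom[OF \<psi> rh] by auto
    then show ?case by blast
  next
    case (asum_pls f g)
    then show ?case by (intro pls)
  qed
  have obV: "V \<in> Obj D" using V D.in_add_ob by blast
  have "v \<bullet> Idn D V \<in> ?S V"
  proof (rule D.asum_map[OF D.decompose[OF obV] D.ind_gens_hom obV obV, where F = "\<lambda>e. v \<bullet> e"])
    show "v \<bullet> Zro D V V \<in> ?S V" using D.cmp_zro(1)[OF v obV] zro[OF obV] by simp
    show "v \<bullet> Pls D e e' \<in> ?S V"
      if "e \<in> Hom D V V" "e' \<in> Hom D V V" "v \<bullet> e \<in> ?S V" "v \<bullet> e' \<in> ?S V" for e e'
      using D.distrib(1)[OF that(1) v that(2)] pls[OF that(3,4)] by simp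
    fix k assume "k \<in> D.ind_gens V"
    then obtain i p B where B: "k = i \<bullet> p" "indecomposable D B" "i \<in> Hom D B V" "p \<in> Hom D V B" "p \<bullet> i = Idn D B"
      unfolding D.ind_gens_def by blast
    have "D.retract B P" using D.indec_in_add[OF B(2) D.in_add_retract[OF V D.retractI[OF B(3-5)]]] .
    then obtain h where h: "h \<in> Hom D B (fob F W)" "v \<bullet> i = fmor F f \<bullet> h"
      using ind[OF B(2) \<open>D.retract B P\<close> D.cmp_hom[OF B(3) v]] by blast
    have "v \<bullet> k = fmor F f \<bullet> (h \<bullet> p)"
      unfolding B(1) D.assoc[OF B(4,3) v, symmetric] h(2) D.assoc[OF B(4) h(1) Fmf] ..
    then show "v \<bullet> k \<in> ?S V" using D.cmp_hom[OF B(4) h(1)] by blast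
  qed
  then show ?thesis using D.cmp_idn(1)[OF v] by auto
qed

end

section \<open>The radical along a covering\<close>

lemma (in kspace) add_diff_cancel: "x \<in> carrier M \<Longrightarrow> y \<in> carrier M \<Longrightarrow> (x \<oplus> y) \<ominus> y = x"
  by (simp add: ab)

context covering_nz
begin

lemma fam_finite_surj:
  assumes R: "fibre_reps C D F A R \<phi> \<psi>" and fR: "finite R" and X: "X \<in> Obj C" and v: "v \<in> Hom D (fob F X) A"
  shows "\<exists>u. (\<forall>Y\<in>R. u Y \<in> Hom C X Y) \<and> v = finsum (hom_mod D (fob F X) A) (\<lambda>Y. \<phi> Y \<bullet> fmor F (u Y)) R"
proof -
  from v have "v \<in> (\<lambda>u. finsum (hom_mod D (fob F X) A) (\<lambda>Y. \<phi> Y \<bullet> fmor F (u Y))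
                 {Y \<in> R. u Y \<noteq> Zro C X Y}) ` fam_out C X R"
    by (simp only: bij_betw_imp_surj_on[OF fibre_reps_bij(1)[OF R X]])
  then obtain u where u: "u \<in> fam_out C X R" and
    v: "v = finsum (hom_mod D (fob F X) A) (\<lambda>Y. \<phi> Y \<bullet> fmor F (u Y)) {Y \<in> R. u Y \<noteq> Zro C X Y}"
    by (rule imageE)
  have uh: "\<And>Y. Y \<in> R \<Longrightarrow> u Y \<in> Hom C X Y" using u unfolding fam_out_def by blast
  have "v = finsum (hom_mod D (fob F X) A) (\<lambda>Y. \<phi> Y \<bullet> fmor F (u Y)) R"
    unfolding v by (rule fam_sum_superset[OF R X uh fR]) auto
  then show ?thesis using uh by blast
qed

text \<open>
  At most one member of the fibre is isomorphic to \<open>X\<close>. All other components are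
  radical anyway, so the remaining one can be isolated.
\<close>

lemma crad_components:
  assumes A: "indecomposable D A" and X: "indecomposable C X"
    and R: "fibre_reps C D F A R \<phi> \<psi>" and fR: "finite R" and u: "\<And>Y. Y \<in> R \<Longrightarrow> u Y \<in> Hom C X Y"
  shows "finsum (hom_mod D (fob F X) A) (\<lambda>Y. \<phi> Y \<bullet> fmor F (u Y)) R \<in> D.crad (fob F X) A \<longleftrightarrow>
    (\<forall>Y\<in>R. u Y \<in> C.crad X Y)"
proof
  let ?N = "hom_mod D (fob F X) A"
  have ob: "X \<in> Obj C" "A \<in> Obj D" "fob F X \<in> Obj D" using C.indec_ob[OF X] D.indec_ob[OF A] F_ob by auto
  interpret kspace ?N using D.hom_kspace ob by blast
  have vs: "vsubspace (D.crad (fob F X) A)" by (rule D.crad_vsubspace[OF ob(3,2)])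
  have RI: "indecomposable C Y" if "Y \<in> R" for Y
    using indec_reflect[OF fibre_repsD(1)[OF R that]
      D.isomorphic_indec[OF A D.isomorphic_sym[OF fibre_repsD(4)[OF R that]]]] .
  have th: "\<phi> Y \<bullet> fmor F (u Y) \<in> Hom D (fob F X) A" if "Y \<in> R" for Y
    using D.cmp_hom[OF F_hom[OF u[OF that]] fibre_repsD(5)[OF R that]] .
  have trm: "\<phi> Y \<bullet> fmor F (u Y) \<in> D.crad (fob F X) A" if "Y \<in> R" "u Y \<in> C.crad X Y" for Y
    using crad_iff[OF X RI[OF that(1)] u[OF that(1)]] that(2) D.crad_cmp_left[OF _ fibre_repsD(5)[OF R that(1)]] by blast
  show "finsum ?N (\<lambda>Y. \<phi> Y \<bullet> fmor F (u Y)) R \<in> D.crad (fob F X) A" if "\<forall>Y\<in>R. u Y \<in> C.crad X Y"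
    using trm that by (intro vsubspace_finsum[OF vs fR]) blast
  assume s: "finsum ?N (\<lambda>Y. \<phi> Y \<bullet> fmor F (u Y)) R \<in> D.crad (fob F X) A"
  show "\<forall>Y\<in>R. u Y \<in> C.crad X Y"
  proof
    fix Y assume Y: "Y \<in> R"
    show "u Y \<in> C.crad X Y"
    proof (cases "isomorphic C X Y")
      case False
      then show ?thesis using C.not_crad_iso[OF X RI[OF Y] u[OF Y]] C.isomorphicI by blast
    next
      case True
      have rest: "u Y' \<in> C.crad X Y'" if Y': "Y' \<in> R - {Y}" for Y'
      proof -
        have "\<not> isomorphic C X Y'"
          using iso_reps_eq[OF R Y _ C.isomorphic_trans[OF C.isomorphic_sym[OF True]], of Y'] Y' by blast
        then show ?thesis using C.not_crad_iso[OF X RI u] Y' C.isomorphicI by blast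
      qed
      let ?r = "finsum ?N (\<lambda>Y. \<phi> Y \<bullet> fmor F (u Y)) (R - {Y})"
      have r: "?r \<in> D.crad (fob F X) A"
        using trm rest fR by (intro vsubspace_finsum[OF vs]) auto
      have "finsum ?N (\<lambda>Y. \<phi> Y \<bullet> fmor F (u Y)) (insert Y (R - {Y})) = \<phi> Y \<bullet> fmor F (u Y) \<oplus>\<^bsub>?N\<^esub> ?r"
        using fR th Y by (intro M.finsum_insert) auto
      then have "finsum ?N (\<lambda>Y. \<phi> Y \<bullet> fmor F (u Y)) R = \<phi> Y \<bullet> fmor F (u Y) \<oplus>\<^bsub>?N\<^esub> ?r"
        by (simp only: insert_Diff[OF Y])
      then have "finsum ?N (\<lambda>Y. \<phi> Y \<bullet> fmor F (u Y)) R \<ominus>\<^bsub>?N\<^esub> ?r = \<phi> Y \<bullet> fmor F (u Y)"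
        using add_diff_cancel[of "\<phi> Y \<bullet> fmor F (u Y)" ?r] th[OF Y] vsubspaceD(1)[OF vs r] by simp
      then have "\<phi> Y \<bullet> fmor F (u Y) \<in> D.crad (fob F X) A"
        using vsubspaceD(6)[OF vs s r] by simp
      then have "\<psi> Y \<bullet> (\<phi> Y \<bullet> fmor F (u Y)) \<in> D.crad (fob F X) (fob F Y)"
        using D.crad_cmp_left[OF _ fibre_repsD(6)[OF R Y]] by blast
      moreover have "\<psi> Y \<bullet> (\<phi> Y \<bullet> fmor F (u Y)) = fmor F (u Y)"
        using fibre_repsD(2)[OF R Y] F_hom[OF u[OF Y]] D.cmp_reduce[of "\<psi> Y" "\<phi> Y"]
        unfolding iso_pair_def by (simp add: D.cs)
      ultimately show ?thesis using crad_iff[OF X RI[OF Y] u[OF Y]] by simp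
    qed
  qed
qed

text \<open>
  The squares of the radicals correspond as well: both factors of a composite downstairs are
  expanded, first along the fibre of the middle object, then along the fibre of \<open>A\<close>.
\<close>

lemma crad2_components:
  assumes A: "indecomposable D A" and X: "indecomposable C X"
    and R: "fibre_reps C D F A R \<phi> \<psi>" and fR: "finite R"
    and S: "\<And>Z. Z \<in> S \<longleftrightarrow> indecomposable C Z \<and> fob F Z \<in> Sb"
    and Sb: "\<And>B. B \<in> Sb \<Longrightarrow> indecomposable D B" "\<And>B B'. B \<in> Sb \<Longrightarrow> isomorphic D B' B \<Longrightarrow> B' \<in> Sb"
    and fin: "\<And>B. B \<in> Sb \<Longrightarrow> \<exists>R \<phi> \<psi>. fibre_reps C D F B R \<phi> \<psi> \<and> finite R"
  shows "D.crad2 Sb (fob F X) A =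
    {finsum (hom_mod D (fob F X) A) (\<lambda>Y. \<phi> Y \<bullet> fmor F (u Y)) R | u. \<forall>Y\<in>R. u Y \<in> C.crad2 S X Y}"
    (is "_ = ?W")
proof
  let ?N = "hom_mod D (fob F X) A"
  have ob: "X \<in> Obj C" "A \<in> Obj D" "fob F X \<in> Obj D" using C.indec_ob[OF X] D.indec_ob[OF A] F_ob by auto
  have obR: "Y \<in> Obj C" if "Y \<in> R" for Y by (rule fibre_repsD(1)[OF R that])
  interpret kspace ?N using D.hom_kspace ob by blast
  have c2h: "u \<in> Hom C X Y" if "u \<in> C.crad2 S X Y" "Y \<in> R" for u Y
    using C.crad_hom C.crad2_crad[OF ob(1) obR[OF that(2)]] that(1) by blast
  have W: "vsubspace ?W"
    by (rule direct_sum_vsubspace[OF fR F_klinear[OF ob(1) obR fibre_repsD(5)[OF R]] kspace_axioms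
        C.crad2_vsubspace[OF ob(1) obR]])
  show "D.crad2 Sb (fob F X) A \<subseteq> ?W"
  proof
    fix f assume "f \<in> D.crad2 Sb (fob F X) A"
    then show "f \<in> ?W"
      unfolding D.crad2_def
    proof induction
      case asum_zro
      then show ?case using vsubspaceD(2)[OF W] by simp
    next
      case (asum_gen k)
      then obtain a b B where k: "k = b \<bullet> a" "B \<in> Sb" "a \<in> D.crad (fob F X) B" "b \<in> D.crad B A" by blast
      obtain R' \<phi>' \<psi>' where R': "fibre_reps C D F B R' \<phi>' \<psi>'" and fR': "finite R'" using fin[OF k(2)] by blast
      have ah: "a \<in> Hom D (fob F X) B" and bh: "b \<in> Hom D B A" using k D.crad_hom by auto
      obtain \<alpha> where \<alpha>: "\<forall>Z\<in>R'. \<alpha> Z \<in> Hom C X Z"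
        "a = finsum (hom_mod D (fob F X) B) (\<lambda>Z. \<phi>' Z \<bullet> fmor F (\<alpha> Z)) R'"
        using fam_finite_surj[OF R' fR' ob(1) ah] by blast
      have \<alpha>h: "\<And>Z. Z \<in> R' \<Longrightarrow> \<alpha> Z \<in> Hom C X Z" using \<alpha>(1) by blast
      have \<alpha>r: "\<alpha> Z \<in> C.crad X Z" if "Z \<in> R'" for Z
        using crad_components[OF Sb(1)[OF k(2)] X R' fR' \<alpha>h] k(3) that unfolding \<alpha>(2) by blast
      have ta: "\<phi>' Z \<bullet> fmor F (\<alpha> Z) \<in> Hom D (fob F X) B" if "Z \<in> R'" for Z
        using D.cmp_hom[OF F_hom[OF \<alpha>h[OF that]] fibre_repsD(5)[OF R' that]] .
      have tW: "b \<bullet> ((\<phi>' Z \<bullet> fmor F (\<alpha> Z)) \<bullet> Idn D (fob F X)) \<in> ?W" if Z: "Z \<in> R'" for Z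
      proof -
        have Zi: "isomorphic D (fob F Z) B" by (rule fibre_repsD(4)[OF R' Z])
        have Zind: "indecomposable C Z"
          using indec_reflect[OF fibre_repsD(1)[OF R' Z] D.isomorphic_indec[OF Sb(1)[OF k(2)] D.isomorphic_sym[OF Zi]]] .
        have ZS: "Z \<in> S" using S Zind Sb(2)[OF k(2) Zi] by blast
        have obZ: "Z \<in> Obj C" by (rule C.indec_ob[OF Zind])
        note \<phi>Z = fibre_repsD(5)[OF R' Z]
        have br: "b \<bullet> \<phi>' Z \<in> D.crad (fob F Z) A" by (rule D.crad_cmp_right[OF k(4) \<phi>Z])
        obtain \<beta> where \<beta>: "\<forall>Y\<in>R. \<beta> Y \<in> Hom C Z Y"
          "b \<bullet> \<phi>' Z = finsum (hom_mod D (fob F Z) A) (\<lambda>Y. \<phi> Y \<bullet> fmor F (\<beta> Y)) R"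
          using fam_finite_surj[OF R fR obZ D.crad_hom[OF br]] by blast
        have \<beta>h: "\<And>Y. Y \<in> R \<Longrightarrow> \<beta> Y \<in> Hom C Z Y" using \<beta>(1) by blast
        have \<beta>r: "\<beta> Y \<in> C.crad Z Y" if "Y \<in> R" for Y
          using crad_components[OF A Zind R fR \<beta>h] br that unfolding \<beta>(2) by blast
        note Fa = F_hom[OF \<alpha>h[OF Z]]
        have th: "\<phi> Y \<bullet> fmor F (\<beta> Y) \<in> Hom D (fob F Z) A" if "Y \<in> R" for Y
          using D.cmp_hom[OF F_hom[OF \<beta>h[OF that]] fibre_repsD(5)[OF R that]] .
        have "b \<bullet> ((\<phi>' Z \<bullet> fmor F (\<alpha> Z)) \<bullet> Idn D (fob F X)) =
            Idn D A \<bullet> ((b \<bullet> \<phi>' Z) \<bullet> fmor F (\<alpha> Z))"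
          using bh \<phi>Z Fa ob by (simp add: D.cs)
        also have "\<dots> = finsum ?N (\<lambda>Y. Idn D A \<bullet> ((\<phi> Y \<bullet> fmor F (\<beta> Y)) \<bullet> fmor F (\<alpha> Z))) R"
          unfolding \<beta>(2) by (rule D.finsum_cmp[OF Fa D.idn_hom[OF ob(2)] fR th])
        also have "\<dots> = finsum ?N (\<lambda>Y. \<phi> Y \<bullet> fmor F (\<beta> Y \<cdot> \<alpha> Z)) R"
        proof (rule M.finsum_cong')
          fix Y assume Y: "Y \<in> R"
          show "Idn D A \<bullet> ((\<phi> Y \<bullet> fmor F (\<beta> Y)) \<bullet> fmor F (\<alpha> Z)) = \<phi> Y \<bullet> fmor F (\<beta> Y \<cdot> \<alpha> Z)"
            unfolding F_cmp[OF \<alpha>h[OF Z] \<beta>h[OF Y]]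
            using fibre_repsD(5)[OF R Y] F_hom[OF \<beta>h[OF Y]] Fa ob by (simp add: D.cs)
        next
          show "(\<lambda>Y. \<phi> Y \<bullet> fmor F (\<beta> Y \<cdot> \<alpha> Z)) \<in> R \<rightarrow> carrier ?N"
            using D.cmp_hom[OF F_hom[OF C.cmp_hom[OF \<alpha>h[OF Z] \<beta>h]] fibre_repsD(5)[OF R]] by auto
        qed simp
        finally show ?thesis
          using C.crad2_genI[OF ZS \<alpha>r[OF Z] \<beta>r]
          by (intro CollectI exI[of _ "\<lambda>Y. \<beta> Y \<cdot> \<alpha> Z"] conjI) auto
      qed
      have "k = b \<bullet> (a \<bullet> Idn D (fob F X))" using k(1) ah ob by (simp add: D.cs)
      also have "\<dots> = finsum ?N (\<lambda>Z. b \<bullet> ((\<phi>' Z \<bullet> fmor F (\<alpha> Z)) \<bullet> Idn D (fob F X))) R'"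
        unfolding \<alpha>(2) by (rule D.finsum_cmp[OF D.idn_hom[OF ob(3)] bh fR' ta])
      also have "\<dots> \<in> ?W" by (rule vsubspace_finsum[OF W fR' tW])
      finally show ?case .
    next
      case (asum_pls f g)
      then show ?case using vsubspaceD(3)[OF W, of f g] by simp
    qed
  qed
  show "?W \<subseteq> D.crad2 Sb (fob F X) A"
  proof
    fix f assume "f \<in> ?W"
    then obtain u where u: "f = finsum ?N (\<lambda>Y. \<phi> Y \<bullet> fmor F (u Y)) R" "\<forall>Y\<in>R. u Y \<in> C.crad2 S X Y" by blast
    show "f \<in> D.crad2 Sb (fob F X) A" unfolding u(1)
    proof (rule vsubspace_finsum[OF D.crad2_vsubspace[OF ob(3,2)] fR])
      fix Y assume Y: "Y \<in> R"
      note \<phi>Y = fibre_repsD(5)[OF R Y]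
      have Yi: "indecomposable C Y"
        using indec_reflect[OF obR[OF Y] D.isomorphic_indec[OF A D.isomorphic_sym[OF fibre_repsD(4)[OF R Y]]]] .
      have uY: "u Y \<in> C.asum X Y {b \<cdot> a | a b Z. Z \<in> S \<and> a \<in> C.crad X Z \<and> b \<in> C.crad Z Y}"
        using u(2) Y unfolding C.crad2_def by blast
      show "\<phi> Y \<bullet> fmor F (u Y) \<in> D.crad2 Sb (fob F X) A"
      proof (rule C.asum_map[OF uY C.crad2_gens_hom ob(1) obR[OF Y], where F = "\<lambda>x. \<phi> Y \<bullet> fmor F x"])
        show "\<phi> Y \<bullet> fmor F (Zro C X Y) \<in> D.crad2 Sb (fob F X) A"
          unfolding F_zro[OF ob(1) obR[OF Y]] D.cmp_zro(1)[OF \<phi>Y ob(3)] D.crad2_def by (rule D.asum_zro)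
        show "\<phi> Y \<bullet> fmor F (Pls C x y) \<in> D.crad2 Sb (fob F X) A"
          if "x \<in> Hom C X Y" "y \<in> Hom C X Y" "\<phi> Y \<bullet> fmor F x \<in> D.crad2 Sb (fob F X) A"
            "\<phi> Y \<bullet> fmor F y \<in> D.crad2 Sb (fob F X) A" for x y
          using that(3,4) unfolding F_pls[OF that(1,2)] D.distrib(1)[OF F_hom[OF that(1)] \<phi>Y F_hom[OF that(2)]] D.crad2_def
          by (rule D.asum_pls)
        fix k assume "k \<in> {b \<cdot> a | a b Z. Z \<in> S \<and> a \<in> C.crad X Z \<and> b \<in> C.crad Z Y}"
        then obtain a b Z where k: "k = b \<cdot> a" "Z \<in> S" "a \<in> C.crad X Z" "b \<in> C.crad Z Y" by blast
        have Z: "indecomposable C Z" "fob F Z \<in> Sb" using k(2) S by auto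
        note ah = C.crad_hom[OF k(3)] and bh = C.crad_hom[OF k(4)]
        have "fmor F a \<in> D.crad (fob F X) (fob F Z)" "fmor F b \<in> D.crad (fob F Z) (fob F Y)"
          using crad_iff[OF X Z(1) ah] crad_iff[OF Z(1) Yi bh] k by auto
        then have "(\<phi> Y \<bullet> fmor F b) \<bullet> fmor F a \<in> D.crad2 Sb (fob F X) A"
          using D.crad2_genI[OF Z(2)] D.crad_cmp_left[OF _ \<phi>Y] by blast
        then show "\<phi> Y \<bullet> fmor F k \<in> D.crad2 Sb (fob F X) A"
          unfolding k(1) F_cmp[OF ah bh] D.assoc[OF F_hom[OF ah] F_hom[OF bh] \<phi>Y] .
      qed
    qed
  qed
qed

text \<open>
  Along the fibre of \<open>A\<close>, the radical maps from \<open>F X\<close> to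
  \<open>A\<close> and their square are the direct sums of the corresponding spaces of maps from
  \<open>X\<close>. Hence the dimensions of the quotients add up.
\<close>

theorem irr_dim_fibre:
  assumes A: "indecomposable D A" and X: "indecomposable C X"
    and R: "fibre_reps C D F A R \<phi> \<psi>" and fR: "finite R"
    and S: "\<And>Z. Z \<in> S \<longleftrightarrow> indecomposable C Z \<and> fob F Z \<in> Sb"
    and Sb: "\<And>B. B \<in> Sb \<Longrightarrow> indecomposable D B" "\<And>B B'. B \<in> Sb \<Longrightarrow> isomorphic D B' B \<Longrightarrow> B' \<in> Sb"
    and fin: "\<And>B. B \<in> Sb \<Longrightarrow> \<exists>R \<phi> \<psi>. fibre_reps C D F B R \<phi> \<psi> \<and> finite R"
  shows "D.irr_dim Sb (fob F X) A = (\<Sum>Y\<in>R. C.irr_dim S X Y)"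
  unfolding D.irr_dim_def C.irr_dim_def
proof (rule quot_dim_direct_sum[OF fR])
  let ?N = "hom_mod D (fob F X) A"
  have ob: "X \<in> Obj C" "A \<in> Obj D" "fob F X \<in> Obj D" using C.indec_ob[OF X] D.indec_ob[OF A] F_ob by auto
  have obR: "Y \<in> Obj C" if "Y \<in> R" for Y by (rule fibre_repsD(1)[OF R that])
  show N: "kspace ?N" using D.hom_kspace ob by blast
  interpret kspace ?N by (rule N)
  show "klinear (hom_mod C X Y) ?N (\<lambda>u. \<phi> Y \<bullet> fmor F u)" if "Y \<in> R" for Y
    by (rule F_klinear[OF ob(1) obR[OF that] fibre_repsD(5)[OF R that]])
  show "kspace.fin_dim (hom_mod C X Y)" "kspace.vsubspace (hom_mod C X Y) (C.crad X Y)"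
    "kspace.vsubspace (hom_mod C X Y) (C.crad2 S X Y)" "C.crad2 S X Y \<subseteq> C.crad X Y" if "Y \<in> R" for Y
    using C.fin C.crad_vsubspace C.crad2_vsubspace C.crad2_crad ob(1) obR[OF that] by blast+
  show "vsubspace (D.crad (fob F X) A)" "vsubspace (D.crad2 Sb (fob F X) A)"
    using D.crad_vsubspace D.crad2_vsubspace ob by blast+
  show "D.crad2 Sb (fob F X) A = {finsum ?N (\<lambda>Y. \<phi> Y \<bullet> fmor F (u Y)) R | u. \<forall>Y\<in>R. u Y \<in> C.crad2 S X Y}"
    by (rule crad2_components[OF assms])
  show "D.crad (fob F X) A = {finsum ?N (\<lambda>Y. \<phi> Y \<bullet> fmor F (u Y)) R | u. \<forall>Y\<in>R. u Y \<in> C.crad X Y}"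
  proof (intro equalityI subsetI)
    fix v assume v: "v \<in> D.crad (fob F X) A"
    obtain u where u: "\<forall>Y\<in>R. u Y \<in> Hom C X Y" "v = finsum ?N (\<lambda>Y. \<phi> Y \<bullet> fmor F (u Y)) R"
      using fam_finite_surj[OF R fR ob(1) D.crad_hom[OF v]] by blast
    have "\<forall>Y\<in>R. u Y \<in> C.crad X Y" using crad_components[OF A X R fR, of u] u v by blast
    then show "v \<in> {finsum ?N (\<lambda>Y. \<phi> Y \<bullet> fmor F (u Y)) R | u. \<forall>Y\<in>R. u Y \<in> C.crad X Y}" using u(2) by blast
  next
    fix v assume "v \<in> {finsum ?N (\<lambda>Y. \<phi> Y \<bullet> fmor F (u Y)) R | u. \<forall>Y\<in>R. u Y \<in> C.crad X Y}"
    then obtain u where u: "v = finsum ?N (\<lambda>Y. \<phi> Y \<bullet> fmor F (u Y)) R" "\<forall>Y\<in>R. u Y \<in> C.crad X Y" by blast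
    then show "v \<in> D.crad (fob F X) A" using crad_components[OF A X R fR, of u] C.crad_hom by blast
  qed
  fix u assume uc: "\<And>Y. Y \<in> R \<Longrightarrow> u Y \<in> carrier (hom_mod C X Y)"
    and z: "finsum ?N (\<lambda>Y. \<phi> Y \<bullet> fmor F (u Y)) R = \<zero>\<^bsub>?N\<^esub>"
  have uh: "\<And>Y. Y \<in> R \<Longrightarrow> u Y \<in> Hom C X Y" using uc by simp
  have zh: "\<And>Y. Y \<in> R \<Longrightarrow> Zro C X Y \<in> Hom C X Y" using C.zro_hom[OF ob(1) obR] .
  have "finsum ?N (\<lambda>Y. \<phi> Y \<bullet> fmor F (Zro C X Y)) R = \<zero>\<^bsub>?N\<^esub>"
  proof (rule M.add.finprod_one_eqI)
    fix Y assume Y: "Y \<in> R"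
    show "\<phi> Y \<bullet> fmor F (Zro C X Y) = \<zero>\<^bsub>?N\<^esub>"
      unfolding F_zro[OF ob(1) obR[OF Y]] D.cmp_zro(1)[OF fibre_repsD(5)[OF R Y] ob(3)] by simp
  qed
  then have "finsum ?N (\<lambda>Y. \<phi> Y \<bullet> fmor F (u Y)) R = finsum ?N (\<lambda>Y. \<phi> Y \<bullet> fmor F (Zro C X Y)) R"
    using z by simp
  from fam_out_inj[OF R ob(1) uh zh fR order_refl _ _ this]
  show "\<forall>Y\<in>R. u Y = \<zero>\<^bsub>hom_mod C X Y\<^esub>" by simp
qed

end

section \<open>Orbit quivers\<close>

text \<open>
  The combinatorial core. A group acts on a quiver, freely on vertices and compatibly with the
  arrow numbers \<open>n\<close>; the vertices map to \<open>Vb\<close> with the orbits as fibres, and arrow numbers add up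
  along fibres. Then each arrow orbit has exactly one member starting in a chosen representative of
  its vertex orbit, so arrow orbits are counted by the numbers \<open>nb\<close>.
\<close>

lemma orbit_quiver_iso:
  fixes G :: "'g monoid"
  assumes G: "group G"
    and act_V: "\<And>g x. g \<in> carrier G \<Longrightarrow> x \<in> V \<Longrightarrow> act g x \<in> V"
    and act_one: "\<And>x. x \<in> V \<Longrightarrow> act \<one>\<^bsub>G\<^esub> x = x"
    and act_mult: "\<And>g h x. g \<in> carrier G \<Longrightarrow> h \<in> carrier G \<Longrightarrow> x \<in> V \<Longrightarrow> act (g \<otimes>\<^bsub>G\<^esub> h) x = act g (act h x)"
    and free: "\<And>g x. g \<in> carrier G \<Longrightarrow> x \<in> V \<Longrightarrow> act g x = x \<Longrightarrow> g = \<one>\<^bsub>G\<^esub>"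
    and n_inv: "\<And>g x y. g \<in> carrier G \<Longrightarrow> x \<in> V \<Longrightarrow> y \<in> V \<Longrightarrow> n (act g x) (act g y) = n x y"
    and p_V: "p ` V = Vb" and p_inv: "\<And>g x. g \<in> carrier G \<Longrightarrow> x \<in> V \<Longrightarrow> p (act g x) = p x"
    and p_fib: "\<And>x y. x \<in> V \<Longrightarrow> y \<in> V \<Longrightarrow> p x = p y \<Longrightarrow> \<exists>g\<in>carrier G. act g x = y"
    and finV: "finite V"
    and count: "\<And>x b. x \<in> V \<Longrightarrow> b \<in> Vb \<Longrightarrow> (\<Sum>y | y \<in> V \<and> p y = b. n x y) = (nb (p x) b :: nat)"
    and b: "\<And>x. x \<in> V \<Longrightarrow> bmap (orbit G act x) = p x"
  defines "aact \<equiv> (\<lambda>g (x, y, k). (act g x, act g y, k))"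
  shows "quiver_iso_over bmap
    (orbit_quiver G act aact
      \<lparr>verts = V, arcs = {(x, y, k). x \<in> V \<and> y \<in> V \<and> k < n x y}, tail = (\<lambda>(x, y, k). x), head = (\<lambda>(x, y, k). y)\<rparr>)
    \<lparr>verts = Vb, arcs = {(x, y, k). x \<in> Vb \<and> y \<in> Vb \<and> k < nb x y}, tail = (\<lambda>(x, y, k). x), head = (\<lambda>(x, y, k). y)\<rparr>"
    (is "quiver_iso_over bmap (orbit_quiver G act aact ?Q) ?Qb")
proof -
  interpret G: group G by (rule G)
  have inv_act: "act (inv\<^bsub>G\<^esub> g) (act g x) = x" "act g (act (inv\<^bsub>G\<^esub> g) x) = x" if "g \<in> carrier G" "x \<in> V" for g x
    using act_mult[of "inv\<^bsub>G\<^esub> g" g x] act_mult[of g "inv\<^bsub>G\<^esub> g" x] act_one that by auto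
  have "\<forall>a\<in>Vb. \<exists>x. x \<in> V \<and> p x = a" using p_V by blast
  then obtain s where "\<forall>a\<in>Vb. s a \<in> V \<and> p (s a) = a" by (rule bchoice[THEN exE])
  then have s: "\<And>a. a \<in> Vb \<Longrightarrow> s a \<in> V" "\<And>a. a \<in> Vb \<Longrightarrow> p (s a) = a" by blast+
  define E where "E = (\<lambda>a b. {(y, k). y \<in> V \<and> p y = b \<and> k < n (s a) y})"
  have "\<exists>e. bij_betw e (E a b) {..<nb a b}" if ab: "a \<in> Vb" "b \<in> Vb" for a b
  proof -
    have E: "E a b = (SIGMA y:{y \<in> V. p y = b}. {..<n (s a) y})" by (auto simp: E_def)
    have "finite (E a b)" unfolding E using finV by auto
    moreover have "card (E a b) = nb a b" unfolding E using finV count[OF s(1)[OF ab(1)] ab(2)] s(2)[OF ab(1)] by simp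
    ultimately show ?thesis by (intro finite_same_card_bij) auto
  qed
  then have "\<forall>q\<in>Vb \<times> Vb. \<exists>e. bij_betw e (E (fst q) (snd q)) {..<nb (fst q) (snd q)}" by auto
  then obtain e' where e': "\<forall>q\<in>Vb \<times> Vb. bij_betw (e' q) (E (fst q) (snd q)) {..<nb (fst q) (snd q)}"
    by (rule bchoice[THEN exE])
  define e where "e = (\<lambda>a b. e' (a, b))"
  have e: "bij_betw (e a b) (E a b) {..<nb a b}" if "a \<in> Vb" "b \<in> Vb" for a b
    using e'[rule_format, of "(a, b)"] that by (simp add: e_def)
  \<comment> \<open>The set \<open>T3\<close> parametrises the arrows of both quivers: \<open>th\<close> maps
    an arrow that starts in a representative to its orbit, and \<open>ka\<close> maps it to an
    arrow between the images of its vertices.\<close>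
  define T3 where "T3 = {(a, y, k). a \<in> Vb \<and> y \<in> V \<and> k < n (s a) y}"
  define th where "th = (\<lambda>(a, y, k). orbit G aact (s a, y, k))"
  define ka where "ka = (\<lambda>(a, y, k). (a, p y, e a (p y) (y, k)))"
  have aact_orbit: "orbit G aact (x, y, k) = {(act g x, act g y, k) | g. g \<in> carrier G}" for x y k
    unfolding orbit_def aact_def by simp
  have vorbit: "orbit G act x = {act g x | g. g \<in> carrier G}" for x unfolding orbit_def ..
  have inj_th: "inj_on th T3"
  proof (rule inj_onI)
    fix t t' assume "t \<in> T3" "t' \<in> T3" and eq: "th t = th t'"
    then obtain a y k a' y' k' where t: "t = (a, y, k)" "a \<in> Vb" "y \<in> V" "t' = (a', y', k')" "a' \<in> Vb" "y' \<in> V"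
      unfolding T3_def by auto
    have "(s a, y, k) \<in> th t" unfolding t th_def prod.case aact_orbit
      using act_one s(1)[OF t(2)] t(3) G.one_closed by (intro CollectI exI[of _ "\<one>\<^bsub>G\<^esub>"]) auto
    then obtain g where g: "g \<in> carrier G" "s a = act g (s a')" "y = act g y'" "k = k'"
      unfolding eq unfolding t th_def prod.case aact_orbit by blast
    have "a = p (s a)" using s(2) t by simp
    also have "\<dots> = a'" unfolding g(2) using p_inv[OF g(1) s(1)[OF t(5)]] s(2) t by simp
    finally have aa: "a = a'" .
    then have "g = \<one>\<^bsub>G\<^esub>" using free[OF g(1) s(1)[OF t(5)]] g(2) by simp
    then show "t = t'" using aa g t act_one by simp
  qed
  have surj_th: "th ` T3 = orbits G (arcs ?Q) aact"
  proof (intro equalityI subsetI)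
    fix o' assume "o' \<in> th ` T3"
    then obtain a y k where "a \<in> Vb" "y \<in> V" "k < n (s a) y" "o' = orbit G aact (s a, y, k)"
      unfolding T3_def th_def by auto
    then show "o' \<in> orbits G (arcs ?Q) aact" unfolding orbits_def using s(1) by auto
  next
    fix o' assume "o' \<in> orbits G (arcs ?Q) aact"
    then obtain x y k where xy: "x \<in> V" "y \<in> V" "k < n x y" "o' = orbit G aact (x, y, k)"
      unfolding orbits_def by auto
    have a: "p x \<in> Vb" using xy p_V by blast
    obtain g where g: "g \<in> carrier G" "act g (s (p x)) = x" using p_fib[OF s(1)[OF a] xy(1)] s(2)[OF a] by blast
    let ?g = "inv\<^bsub>G\<^esub> g"
    have gi: "?g \<in> carrier G" using g by simp
    have sx: "s (p x) = act ?g x" using inv_act(1)[OF g(1) s(1)[OF a]] g(2) by simp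
    have y': "act ?g y \<in> V" using act_V gi xy by blast
    have T: "(p x, act ?g y, k) \<in> T3" unfolding T3_def using a y' xy n_inv[OF gi xy(1,2)] sx by simp
    have "th (p x, act ?g y, k) = o'"
      unfolding th_def prod.case xy(4) aact_orbit sx
    proof (intro equalityI subsetI)
      fix z assume "z \<in> {(act h (act ?g x), act h (act ?g y), k) |h. h \<in> carrier G}"
      then obtain h where "h \<in> carrier G" "z = (act h (act ?g x), act h (act ?g y), k)" by blast
      then show "z \<in> {(act g x, act g y, k) |g. g \<in> carrier G}"
        using act_mult[of h ?g x] act_mult[of h ?g y] xy gi
        by (intro CollectI exI[of _ "h \<otimes>\<^bsub>G\<^esub> ?g"]) auto
    next
      fix z assume "z \<in> {(act g x, act g y, k) |g. g \<in> carrier G}"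
      then obtain h where "h \<in> carrier G" "z = (act h x, act h y, k)" by blast
      then show "z \<in> {(act h (act ?g x), act h (act ?g y), k) |h. h \<in> carrier G}"
        using act_mult[of h g "act ?g x"] act_mult[of h g "act ?g y"] inv_act(2)[OF g(1)] xy g act_V gi
        by (intro CollectI exI[of _ "h \<otimes>\<^bsub>G\<^esub> g"]) auto
    qed
    then show "o' \<in> th ` T3" using T by (metis imageI)
  qed
  have ka_bij: "bij_betw ka T3 (arcs ?Qb)"
  proof (rule bij_betw_imageI)
    show "inj_on ka T3"
    proof (rule inj_onI)
      fix t t' assume "t \<in> T3" "t' \<in> T3" and eq: "ka t = ka t'"
      then obtain a y k a' y' k' where t: "t = (a, y, k)" "a \<in> Vb" "y \<in> V" "k < n (s a) y"
        "t' = (a', y', k')" "a' \<in> Vb" "y' \<in> V" "k' < n (s a') y'"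
        unfolding T3_def by auto
      have *: "a' = a" "p y' = p y" "e a (p y) (y, k) = e a (p y) (y', k')"
        using eq unfolding t ka_def by auto
      have "(y, k) \<in> E a (p y)" "(y', k') \<in> E a (p y)" using t * unfolding E_def by auto
      moreover have "p y \<in> Vb" using t p_V by blast
      ultimately have "(y, k) = (y', k')" using *(3) e[OF t(2)] unfolding bij_betw_def inj_on_def by blast
      then show "t = t'" using t * by simp
    qed
    show "ka ` T3 = arcs ?Qb"
    proof (intro equalityI subsetI)
      fix z assume "z \<in> ka ` T3"
      then obtain a y k where t: "a \<in> Vb" "y \<in> V" "k < n (s a) y" "z = (a, p y, e a (p y) (y, k))"
        unfolding T3_def ka_def by auto
      have "p y \<in> Vb" using t p_V by blast
      moreover have "(y, k) \<in> E a (p y)" using t unfolding E_def by auto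
      ultimately have "e a (p y) (y, k) < nb a (p y)" using bij_betwE[OF e[OF t(1)]] by blast
      then show "z \<in> arcs ?Qb" using t \<open>p y \<in> Vb\<close> by simp
    next
      fix z assume "z \<in> arcs ?Qb"
      then obtain a b k where z: "z = (a, b, k)" "a \<in> Vb" "b \<in> Vb" "k < nb a b" by auto
      then have "k \<in> e a b ` E a b" using e[OF z(2,3)] unfolding bij_betw_def by simp
      then obtain y l where "(y, l) \<in> E a b" "k = e a b (y, l)" by auto
      then have "(a, y, l) \<in> T3" "z = ka (a, y, l)" using z unfolding E_def T3_def ka_def by auto
      then show "z \<in> ka ` T3" by blast
    qed
  qed
  let ?O = "orbit_quiver G act aact ?Q"
  define ha where "ha = (\<lambda>o'. ka (the_inv_into T3 th o'))"
  have ha_th: "ha (th t) = ka t" if "t \<in> T3" for t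
    unfolding ha_def using the_inv_into_f_f[OF inj_th that] by simp
  have ends: "tail ?O (th (a, y, k)) = orbit G act (s a)" "head ?O (th (a, y, k)) = orbit G act y" for a y k
    unfolding orbit_quiver_def th_def prod.case aact_orbit vorbit by (auto simp: image_def)
  define h where "h = \<lparr>iso_verts = bmap, iso_arcs = ha, iso_head = (\<lambda>(x, y, k). y), iso_tail = (\<lambda>(x, y, k). x)\<rparr>"
  have arcsO: "arcs ?O = th ` T3" unfolding surj_th by (simp add: orbit_quiver_def)
  have vertsO: "verts ?O = orbit G act ` V" unfolding orbit_quiver_def orbits_def by auto
  have img_ha: "ha ` arcs ?O = arcs ?Qb"
    unfolding arcsO bij_betw_imp_surj_on[OF ka_bij, symmetric] using ha_th by (force simp: image_def)
  have orbit_eq: "orbit G act x = orbit G act y" if xy: "x \<in> V" "y \<in> V" "p x = p y" for x y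
  proof -
    have sub: "orbit G act y \<subseteq> orbit G act x" if xy: "x \<in> V" "y \<in> V" "p x = p y" for x y
    proof -
      obtain g where g: "g \<in> carrier G" "act g x = y" using p_fib[OF xy] by blast
      show ?thesis
      proof
        fix z assume "z \<in> orbit G act y"
        then obtain h where h: "h \<in> carrier G" "z = act h y" unfolding vorbit by blast
        then have "z = act (h \<otimes>\<^bsub>G\<^esub> g) x" using act_mult[OF h(1) g(1) xy(1)] g(2) by simp
        then show "z \<in> orbit G act x" unfolding vorbit using h g by blast
      qed
    qed
    show ?thesis using sub[OF xy] sub[OF xy(2,1) xy(3)[symmetric]] by blast
  qed
  have "pre_digraph.digraph_isomorphism ?O h"
    unfolding pre_digraph.digraph_isomorphism_def
  proof (intro conjI ballI)
    show "wf_digraph ?O"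
    proof
      fix o' assume "o' \<in> arcs ?O"
      then obtain a y k where "a \<in> Vb" "y \<in> V" "o' = th (a, y, k)" unfolding arcsO T3_def by auto
      then show "tail ?O o' \<in> verts ?O" "head ?O o' \<in> verts ?O" using ends s(1) vertsO by auto
    qed
    show "inj_on (iso_verts h) (verts ?O)"
    proof (rule inj_onI)
      fix o1 o2 assume "o1 \<in> verts ?O" "o2 \<in> verts ?O" and eq: "iso_verts h o1 = iso_verts h o2"
      then obtain x y where xy: "o1 = orbit G act x" "x \<in> V" "o2 = orbit G act y" "y \<in> V" unfolding vertsO by blast
      then have "p x = p y" using eq b by (simp add: h_def)
      then show "o1 = o2" using orbit_eq xy by blast
    qed
    show "inj_on (iso_arcs h) (arcs ?O)"
    proof (rule inj_onI)
      fix o1 o2 assume "o1 \<in> arcs ?O" "o2 \<in> arcs ?O" and eq: "iso_arcs h o1 = iso_arcs h o2"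
      then obtain t1 t2 where t: "o1 = th t1" "t1 \<in> T3" "o2 = th t2" "t2 \<in> T3" unfolding arcsO by blast
      have "ka t1 = ka t2" using eq ha_th t by (simp add: h_def)
      then have "t1 = t2" by (rule inj_onD[OF bij_betw_imp_inj_on[OF ka_bij] _ t(2,4)])
      then show "o1 = o2" using t by simp
    qed
    fix o' assume "o' \<in> arcs ?O"
    then obtain a y k where t: "a \<in> Vb" "y \<in> V" "(a, y, k) \<in> T3" "o' = th (a, y, k)" unfolding arcsO T3_def by auto
    show "iso_verts h (tail ?O o') = iso_tail h (iso_arcs h o')"
      using t ends b s ha_th[OF t(3)] by (simp add: h_def ka_def)
    show "iso_verts h (head ?O o') = iso_head h (iso_arcs h o')"
      using t ends b s ha_th[OF t(3)] by (simp add: h_def ka_def)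
  qed
  moreover have "?Qb = app_iso h ?O"
  proof -
    have "bmap ` orbit G act ` V = Vb" unfolding image_image p_V[symmetric] using b by (rule image_cong[OF refl])
    then show ?thesis unfolding app_iso_def using img_ha vertsO by (simp add: h_def)
  qed
  ultimately show ?thesis unfolding quiver_iso_over_def by (intro exI[of _ h]) (simp add: h_def)
qed

section \<open>Galois coverings and quivers\<close>

locale galois_nz = covering_nz C D F
  for C :: "('o, 'm, 'k::field, 'y) lcat_scheme" and D :: "('p, 'n, 'k, 'z) lcat_scheme" and F +
  fixes G :: "'g monoid" and \<rho> :: "'g \<Rightarrow> ('o, 'm, 'o, 'm) func"
  assumes galois: "galois_covering G \<rho> C D F"
begin

lemmas galois_parts = galois[unfolded galois_covering_def]
lemmas acts = galois_parts[THEN conjunct1, unfolded acts_by_automorphisms_def]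
lemmas acts_free = galois_parts[THEN conjunct2, THEN conjunct1, unfolded acts_freely_def, rule_format]
lemmas galois_inv = galois_parts[THEN conjunct2, THEN conjunct2, THEN conjunct2, THEN conjunct2, THEN conjunct1, rule_format]
lemmas galois_dense = galois_parts[THEN conjunct2, THEN conjunct2, THEN conjunct2, THEN conjunct2, THEN conjunct2,
    THEN conjunct1, rule_format]
lemmas galois_fibre = galois_parts[THEN conjunct2, THEN conjunct2, THEN conjunct2, THEN conjunct2, THEN conjunct2,
    THEN conjunct2, rule_format]

lemma G: "group G" by (rule acts[THEN conjunct1])

lemma rho_auto: "g \<in> carrier G \<Longrightarrow> linear_automorphism C (\<rho> g)"
  using acts[THEN conjunct2, THEN conjunct1] by blast

lemma rho_functor: "g \<in> carrier G \<Longrightarrow> linfunctor C C (\<rho> g)"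
  using rho_auto unfolding linear_automorphism_def
  by (intro linfunctor.intro linfunctor_axioms.intro C.lincat_axioms) blast

lemma rho_one: "X \<in> Obj C \<Longrightarrow> fob (\<rho> \<one>\<^bsub>G\<^esub>) X = X" "f \<in> Arr C \<Longrightarrow> fmor (\<rho> \<one>\<^bsub>G\<^esub>) f = f"
  using acts[THEN conjunct2, THEN conjunct2, THEN conjunct1]
    acts[THEN conjunct2, THEN conjunct2, THEN conjunct2, THEN conjunct1] by blast+

lemma rho_mult:
  assumes "g \<in> carrier G" "h \<in> carrier G"
  shows "X \<in> Obj C \<Longrightarrow> fob (\<rho> (g \<otimes>\<^bsub>G\<^esub> h)) X = fob (\<rho> g) (fob (\<rho> h) X)"
    "f \<in> Arr C \<Longrightarrow> fmor (\<rho> (g \<otimes>\<^bsub>G\<^esub> h)) f = fmor (\<rho> g) (fmor (\<rho> h) f)"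
  using acts[THEN conjunct2, THEN conjunct2, THEN conjunct2, THEN conjunct2] assms by blast+

lemma F_rho: "g \<in> carrier G \<Longrightarrow> X \<in> Obj C \<Longrightarrow> fob F (fob (\<rho> g) X) = fob F X"
  "g \<in> carrier G \<Longrightarrow> f \<in> Arr C \<Longrightarrow> fmor F (fmor (\<rho> g) f) = fmor F f"
  using galois_inv[of g] by blast+

lemma rho_ob: "g \<in> carrier G \<Longrightarrow> X \<in> Obj C \<Longrightarrow> fob (\<rho> g) X \<in> Obj C"
  by (rule linfunctor.F_ob[OF rho_functor])

lemma rho_inv:
  assumes "g \<in> carrier G"
  shows "X \<in> Obj C \<Longrightarrow> fob (\<rho> (inv\<^bsub>G\<^esub> g)) (fob (\<rho> g) X) = X"
    "X \<in> Obj C \<Longrightarrow> fob (\<rho> g) (fob (\<rho> (inv\<^bsub>G\<^esub> g)) X) = X"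
    "f \<in> Arr C \<Longrightarrow> fmor (\<rho> (inv\<^bsub>G\<^esub> g)) (fmor (\<rho> g) f) = f"
    "f \<in> Arr C \<Longrightarrow> fmor (\<rho> g) (fmor (\<rho> (inv\<^bsub>G\<^esub> g)) f) = f"
proof -
  interpret group G by (rule G)
  have "inv\<^bsub>G\<^esub> g \<in> carrier G" using assms by simp
  note m = rho_mult[OF this assms, symmetric] rho_mult[OF assms this, symmetric]
  show "X \<in> Obj C \<Longrightarrow> fob (\<rho> (inv\<^bsub>G\<^esub> g)) (fob (\<rho> g) X) = X"
    "X \<in> Obj C \<Longrightarrow> fob (\<rho> g) (fob (\<rho> (inv\<^bsub>G\<^esub> g)) X) = X"
    "f \<in> Arr C \<Longrightarrow> fmor (\<rho> (inv\<^bsub>G\<^esub> g)) (fmor (\<rho> g) f) = f"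
    "f \<in> Arr C \<Longrightarrow> fmor (\<rho> g) (fmor (\<rho> (inv\<^bsub>G\<^esub> g)) f) = f"
    using assms by (simp_all add: m rho_one)
qed

lemma rho_indec:
  assumes "g \<in> carrier G" "indecomposable C X" shows "indecomposable C (fob (\<rho> g) X)"
  using indec_reflect[OF rho_ob[OF assms(1) C.indec_ob[OF assms(2)]]] F_rho(1)[OF assms(1) C.indec_ob[OF assms(2)]]
    indec_image[OF assms(2)] by simp

lemma indec_dense:
  assumes A: "indecomposable D A"
  shows "\<exists>X. indecomposable C X \<and> isomorphic D (fob F X) A"
proof -
  obtain X where X: "X \<in> Obj C" "isomorphic D (fob F X) A" using galois_dense[OF D.indec_ob[OF A]] by blast
  have "indecomposable C X" using indec_reflect[OF X(1) D.isomorphic_indec[OF A D.isomorphic_sym[OF X(2)]]] .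
  then show ?thesis using X by blast
qed

lemma fibre_transitive:
  assumes "indecomposable C X" "indecomposable C Y" "isomorphic D (fob F X) (fob F Y)"
  shows "\<exists>g\<in>carrier G. isomorphic C (fob (\<rho> g) X) Y"
  using galois_fibre[OF indec_image[OF assms(2)] C.indec_ob[OF assms(1)] C.indec_ob[OF assms(2)]]
    assms(3) D.isomorphic_refl[OF F_ob[OF C.indec_ob[OF assms(2)]]] by blast

text \<open>The functor \<open>F\<close> detects the radical and does not see the action.\<close>

lemma rho_crad_iff:
  assumes g: "g \<in> carrier G" and X: "indecomposable C X" and Y: "indecomposable C Y" and u: "u \<in> Hom C X Y"
  shows "fmor (\<rho> g) u \<in> C.crad (fob (\<rho> g) X) (fob (\<rho> g) Y) \<longleftrightarrow> u \<in> C.crad X Y"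
proof -
  have "fmor F (fmor (\<rho> g) u) = fmor F u" using F_rho(2)[OF g] u unfolding Hom_def by blast
  then show ?thesis
    using crad_iff[OF rho_indec[OF g X] rho_indec[OF g Y] linfunctor.F_hom[OF rho_functor[OF g] u]]
      crad_iff[OF X Y u] F_rho(1)[OF g C.indec_ob[OF X]] F_rho(1)[OF g C.indec_ob[OF Y]] by simp
qed

lemma irr_dim_rho:
  assumes g: "g \<in> carrier G" and X: "indecomposable C X" and Y: "indecomposable C Y"
    and S: "\<And>Z. Z \<in> S \<Longrightarrow> indecomposable C Z" "\<And>g Z. g \<in> carrier G \<Longrightarrow> Z \<in> S \<Longrightarrow> fob (\<rho> g) Z \<in> S"
  shows "C.irr_dim S (fob (\<rho> g) X) (fob (\<rho> g) Y) = C.irr_dim S X Y"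
proof -
  interpret gr: group G by (rule G)
  have gi: "inv\<^bsub>G\<^esub> g \<in> carrier G" using g by simp
  have sub: "fmor (\<rho> g) ` C.crad X Y \<subseteq> C.crad (fob (\<rho> g) X) (fob (\<rho> g) Y)"
    "fmor (\<rho> g) ` C.crad2 S X Y \<subseteq> C.crad2 S (fob (\<rho> g) X) (fob (\<rho> g) Y)"
    if g: "g \<in> carrier G" and X: "indecomposable C X" and Y: "indecomposable C Y" for g X Y
  proof -
    interpret g: linfunctor C C "\<rho> g" by (rule rho_functor[OF g])
    note ob = C.indec_ob[OF X] C.indec_ob[OF Y]
    show "fmor (\<rho> g) ` C.crad X Y \<subseteq> C.crad (fob (\<rho> g) X) (fob (\<rho> g) Y)"
      using rho_crad_iff[OF g X Y] C.crad_hom by blast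
    show "fmor (\<rho> g) ` C.crad2 S X Y \<subseteq> C.crad2 S (fob (\<rho> g) X) (fob (\<rho> g) Y)"
    proof (rule image_subsetI)
      fix f assume f: "f \<in> C.crad2 S X Y"
      show "fmor (\<rho> g) f \<in> C.crad2 S (fob (\<rho> g) X) (fob (\<rho> g) Y)"
      proof (rule C.asum_map[OF f[unfolded C.crad2_def] C.crad2_gens_hom ob, where F = "fmor (\<rho> g)"])
        show "fmor (\<rho> g) (Zro C X Y) \<in> C.crad2 S (fob (\<rho> g) X) (fob (\<rho> g) Y)"
          unfolding g.F_zro[OF ob] C.crad2_def by (rule C.asum_zro)
        show "fmor (\<rho> g) (Pls C x y) \<in> C.crad2 S (fob (\<rho> g) X) (fob (\<rho> g) Y)"
          if "x \<in> Hom C X Y" "y \<in> Hom C X Y" "fmor (\<rho> g) x \<in> C.crad2 S (fob (\<rho> g) X) (fob (\<rho> g) Y)"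
            "fmor (\<rho> g) y \<in> C.crad2 S (fob (\<rho> g) X) (fob (\<rho> g) Y)" for x y
          using that(3,4) unfolding g.F_pls[OF that(1,2)] C.crad2_def by (rule C.asum_pls)
        fix k assume "k \<in> {b \<cdot> a | a b Z. Z \<in> S \<and> a \<in> C.crad X Z \<and> b \<in> C.crad Z Y}"
        then obtain a b Z where k: "k = b \<cdot> a" "Z \<in> S" "a \<in> C.crad X Z" "b \<in> C.crad Z Y" by blast
        note ah = C.crad_hom[OF k(3)] and bh = C.crad_hom[OF k(4)]
        show "fmor (\<rho> g) k \<in> C.crad2 S (fob (\<rho> g) X) (fob (\<rho> g) Y)"
          unfolding k(1) g.F_cmp[OF ah bh]
          using k rho_crad_iff[OF g X S(1)[OF k(2)] ah] rho_crad_iff[OF g S(1)[OF k(2)] Y bh]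
          by (intro C.crad2_genI[OF S(2)[OF g k(2)]]) simp_all
      qed
    qed
  qed
  interpret g: linfunctor C C "\<rho> g" by (rule rho_functor[OF g])
  note ob = C.indec_ob[OF X] C.indec_ob[OF Y]
  note gob = rho_ob[OF g ob(1)] rho_ob[OF g ob(2)]
  have img: "fmor (\<rho> g) ` U X Y = U (fob (\<rho> g) X) (fob (\<rho> g) Y)"
    if U: "\<And>g X Y. g \<in> carrier G \<Longrightarrow> indecomposable C X \<Longrightarrow> indecomposable C Y \<Longrightarrow>
        fmor (\<rho> g) ` U X Y \<subseteq> U (fob (\<rho> g) X) (fob (\<rho> g) Y)"
      and Uh: "\<And>X Y. X \<in> Obj C \<Longrightarrow> Y \<in> Obj C \<Longrightarrow> U X Y \<subseteq> Hom C X Y" for U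
  proof
    show "fmor (\<rho> g) ` U X Y \<subseteq> U (fob (\<rho> g) X) (fob (\<rho> g) Y)" by (rule U[OF g X Y])
    show "U (fob (\<rho> g) X) (fob (\<rho> g) Y) \<subseteq> fmor (\<rho> g) ` U X Y"
    proof
      fix f assume f: "f \<in> U (fob (\<rho> g) X) (fob (\<rho> g) Y)"
      then have "f \<in> Arr C" using Uh[OF gob] unfolding Hom_def by blast
      then have "f = fmor (\<rho> g) (fmor (\<rho> (inv\<^bsub>G\<^esub> g)) f)" using rho_inv(4)[OF g] by simp
      moreover have "fmor (\<rho> (inv\<^bsub>G\<^esub> g)) f \<in> U X Y"
        using U[OF gi rho_indec[OF g X] rho_indec[OF g Y]] f rho_inv(1)[OF g] ob by auto
      ultimately show "f \<in> fmor (\<rho> g) ` U X Y" by (rule image_eqI)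
    qed
  qed
  have "klinear (hom_mod C X Y) (hom_mod C (fob (\<rho> g) X) (fob (\<rho> g) Y)) (\<lambda>u. Idn C (fob (\<rho> g) Y) \<cdot> fmor (\<rho> g) u)"
    by (rule g.F_klinear[OF ob C.idn_hom[OF gob(2)]])
  then interpret L: klinear "hom_mod C X Y" "hom_mod C (fob (\<rho> g) X) (fob (\<rho> g) Y)"
    "\<lambda>u. Idn C (fob (\<rho> g) Y) \<cdot> fmor (\<rho> g) u" .
  have L: "Idn C (fob (\<rho> g) Y) \<cdot> fmor (\<rho> g) u = fmor (\<rho> g) u" if "u \<in> Hom C X Y" for u
    using C.cmp_idn(2)[OF g.F_hom[OF that]] .
  have c2: "C.crad2 S X Y \<subseteq> Hom C X Y" if "X \<in> Obj C" "Y \<in> Obj C" for X Y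
    using C.crad2_crad[OF that] C.crad_hom by blast
  have LI: "(\<lambda>u. Idn C (fob (\<rho> g) Y) \<cdot> fmor (\<rho> g) u) ` C.crad X Y = C.crad (fob (\<rho> g) X) (fob (\<rho> g) Y)"
    "(\<lambda>u. Idn C (fob (\<rho> g) Y) \<cdot> fmor (\<rho> g) u) ` C.crad2 S X Y = C.crad2 S (fob (\<rho> g) X) (fob (\<rho> g) Y)"
  proof -
    have c1: "C.crad X Y \<subseteq> Hom C X Y" for X Y using C.crad_hom by blast
    have im: "(\<lambda>u. Idn C (fob (\<rho> g) Y) \<cdot> fmor (\<rho> g) u) ` U = fmor (\<rho> g) ` U" if "U \<subseteq> Hom C X Y" for U
      using that L by (intro image_cong[OF refl]) blast
    show "(\<lambda>u. Idn C (fob (\<rho> g) Y) \<cdot> fmor (\<rho> g) u) ` C.crad X Y = C.crad (fob (\<rho> g) X) (fob (\<rho> g) Y)"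
      unfolding im[OF c1] by (rule img[of C.crad, OF sub(1) c1])
    show "(\<lambda>u. Idn C (fob (\<rho> g) Y) \<cdot> fmor (\<rho> g) u) ` C.crad2 S X Y = C.crad2 S (fob (\<rho> g) X) (fob (\<rho> g) Y)"
      unfolding im[OF c2[OF ob]] by (rule img[of "C.crad2 S", OF sub(2) c2])
  qed
  have "quot_dim (hom_mod C (fob (\<rho> g) X) (fob (\<rho> g) Y)) (C.crad (fob (\<rho> g) X) (fob (\<rho> g) Y))
      (C.crad2 S (fob (\<rho> g) X) (fob (\<rho> g) Y)) = quot_dim (hom_mod C X Y) (C.crad X Y) (C.crad2 S X Y)"
    unfolding LI[symmetric]
  proof (rule L.quot_dim_image[OF C.fin[OF ob] C.crad_vsubspace[OF ob] C.crad2_vsubspace[OF ob] C.crad2_crad[OF ob]])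
    fix u assume "u \<in> carrier (hom_mod C X Y)"
      and z: "Idn C (fob (\<rho> g) Y) \<cdot> fmor (\<rho> g) u = \<zero>\<^bsub>hom_mod C (fob (\<rho> g) X) (fob (\<rho> g) Y)\<^esub>"
    then have u: "u \<in> Hom C X Y" by simp
    have uA: "u \<in> Arr C" using u unfolding Hom_def by blast
    have "fmor F u = fmor F (fmor (\<rho> g) u)" using F_rho(2)[OF g uA] by simp
    also have "\<dots> = fmor F (Zro C (fob (\<rho> g) X) (fob (\<rho> g) Y))" using z L[OF u] by simp
    also have "\<dots> = Zro D (fob F X) (fob F Y)" using F_zro[OF gob] F_rho(1)[OF g ob(1)] F_rho(1)[OF g ob(2)] by simp
    finally show "u = \<zero>\<^bsub>hom_mod C X Y\<^esub>" using faithful[OF u] by simp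
  qed
  then show ?thesis unfolding C.irr_dim_def .
qed

text \<open>
  The arrows from \<open>F X\<close> to \<open>B\<close> are counted by the arrows from
  \<open>X\<close> to all members of the fibre of \<open>B\<close>. Since the action is free on
  vertices and transitive on fibres, these are the orbits of arrows between the two fibres.
\<close>

theorem quiver_of_image:
  assumes T: "T \<in> Obj C" and Tb: "Tb \<in> Obj D"
    and H: "\<And>X. indecomposable C X \<Longrightarrow> C.retract X T \<longleftrightarrow> D.retract (fob F X) Tb"
  shows "same_ind_summands D Tb (fob F T)"
    and "quiver_iso_over (orbit_image D F)
      (orbit_quiver G (vertex_action C \<rho>) (arrow_action C \<rho>) (end_quiver C T)) (end_quiver D Tb)"
proof -
  interpret gr: group G by (rule G)
  let ?S = "ind_summands C T" and ?Sb = "ind_summands D Tb"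
  show "same_ind_summands D Tb (fob F T)"
    unfolding same_ind_summands_def
  proof (intro conjI equalityI subsetI)
    show "Tb \<in> Obj D" "fob F T \<in> Obj D" using Tb F_ob[OF T] by auto
    fix A assume "A \<in> ind_summands D Tb"
    then have A: "indecomposable D A" "D.retract A Tb" by (simp_all add: D.ind_summands_iff)
    obtain X where X: "indecomposable C X" "isomorphic D (fob F X) A" using indec_dense[OF A(1)] by blast
    have "D.retract (fob F X) Tb" using D.retract_trans[OF _ A(2)] D.isomorphic_retract[OF X(2)] by blast
    then have "D.retract (fob F X) (fob F T)" using H[OF X(1)] F_retract by blast
    then have "D.retract A (fob F T)" using D.retract_trans D.isomorphic_retract[OF X(2)] by blast
    then show "A \<in> ind_summands D (fob F T)" using A by (simp add: D.ind_summands_iff)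
  next
    fix A assume "A \<in> ind_summands D (fob F T)"
    then have A: "indecomposable D A" "D.retract A (fob F T)" by (simp_all add: D.ind_summands_iff)
    have "\<exists>B. D.retract A B \<and> D.retract B Tb"
    proof (rule D.indec_retract_sum[OF A F_idn_asum[OF C.decompose[OF T] C.ind_gens_hom T]])
      fix k assume "k \<in> fmor F ` C.ind_gens T"
      then obtain i p Y where Y: "indecomposable C Y" "i \<in> Hom C Y T" "p \<in> Hom C T Y" "p \<cdot> i = Idn C Y"
        "k = fmor F (i \<cdot> p)" unfolding C.ind_gens_def by blast
      have "D.retract (fob F Y) Tb" using H[OF Y(1)] C.retractI[OF Y(2-4)] by blast
      then show "\<exists>B a b. a \<in> Hom D (fob F T) B \<and> b \<in> Hom D B (fob F T) \<and> k = b \<bullet> a \<and> D.retract B Tb"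
        using F_hom[OF Y(2)] F_hom[OF Y(3)] F_cmp[OF Y(3,2)] Y(5) by blast
    qed
    then have "D.retract A Tb" using D.retract_trans by blast
    then show "A \<in> ind_summands D Tb" using A by (simp add: D.ind_summands_iff)
  qed
  have S: "X \<in> ?S \<longleftrightarrow> indecomposable C X \<and> fob F X \<in> ?Sb" for X
    using H[of X] indec_image[of X] unfolding C.ind_summands_iff D.ind_summands_iff by blast
  have SbI: "indecomposable D B" if "B \<in> ?Sb" for B using that unfolding D.ind_summands_iff by blast
  have Sbi: "B' \<in> ?Sb" if B: "B \<in> ?Sb" "isomorphic D B' B" for B B'
  proof -
    have "indecomposable D B'" by (rule D.isomorphic_indec[OF SbI[OF B(1)] D.isomorphic_sym[OF B(2)]])
    moreover have "D.retract B' Tb"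
      using D.retract_trans[of B' B Tb] D.isomorphic_retract[OF B(2)] B(1) unfolding D.ind_summands_iff by blast
    ultimately show ?thesis unfolding D.ind_summands_iff by blast
  qed
  have RS: "R \<subseteq> ?S" "inj_on (iso_class C) R" "finite R" if B: "B \<in> ?Sb" and R: "fibre_reps C D F B R \<phi> \<psi>" for B R \<phi> \<psi>
  proof -
    show R1: "R \<subseteq> ?S"
    proof
      fix Y assume Y: "Y \<in> R"
      have i: "isomorphic D (fob F Y) B" by (rule fibre_repsD(4)[OF R Y])
      have "indecomposable C Y"
        using indec_reflect[OF fibre_repsD(1)[OF R Y] D.isomorphic_indec[OF SbI[OF B] D.isomorphic_sym[OF i]]] .
      then show "Y \<in> ?S" using S Sbi[OF B i] by blast
    qed
    show inj: "inj_on (iso_class C) R"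
    proof (rule inj_onI)
      fix Y Z assume YZ: "Y \<in> R" "Z \<in> R" "iso_class C Y = iso_class C Z"
      then have "isomorphic C Y Z" using C.iso_class_eq_iff[OF fibre_repsD(1)[OF R YZ(1)]] by blast
      then show "Y = Z" by (rule iso_reps_eq[OF R YZ(1,2)])
    qed
    have "iso_class C ` R \<subseteq> quiver_vertices C T" using R1 unfolding quiver_vertices_def by blast
    then show "finite R" using C.finite_quiver_vertices[OF T] inj finite_subset finite_imageD by blast
  qed
  have fin: "\<exists>R \<phi> \<psi>. fibre_reps C D F B R \<phi> \<psi> \<and> finite R" if B: "B \<in> ?Sb" for B
  proof -
    obtain R \<phi> \<psi> where R: "fibre_reps C D F B R \<phi> \<psi>" using fibre_reps_exist[OF SbI[OF B]] .
    then show ?thesis using RS(3)[OF B R] by blast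
  qed
  have Sob: "X \<in> Obj C" "indecomposable C X" if "X \<in> ?S" for X
    using that C.indec_ob unfolding C.ind_summands_iff by blast+
  have rhoS: "fob (\<rho> g) X \<in> ?S" if g: "g \<in> carrier G" and X: "X \<in> ?S" for g X
    using S X rho_indec[OF g Sob(2)[OF X]] F_rho(1)[OF g Sob(1)[OF X]] by simp
  let ?V = "quiver_vertices C T" and ?Vb = "quiver_vertices D Tb" and ?act = "vertex_action C \<rho>"
  have V: "x \<in> ?V \<longleftrightarrow> (\<exists>X\<in>?S. x = iso_class C X)" for x unfolding quiver_vertices_def by blast
  have Vb: "b \<in> ?Vb \<longleftrightarrow> (\<exists>B\<in>?Sb. b = iso_class D B)" for b unfolding quiver_vertices_def by blast
  have act: "?act g (iso_class C X) = iso_class C (fob (\<rho> g) X)" if g: "g \<in> carrier G" and X: "X \<in> Obj C" for g X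
  proof -
    interpret g: linfunctor C C "\<rho> g" by (rule rho_functor[OF g])
    have "iso_class C (fob (\<rho> g) Y) = iso_class C (fob (\<rho> g) X)" if "Y \<in> iso_class C X" for Y
      using that g.F_isomorphic[of X Y] C.iso_class_eq_iff[OF rho_ob[OF g X], of "fob (\<rho> g) Y"]
      unfolding iso_class_def by simp
    moreover have "X \<in> iso_class C X" using C.isomorphic_refl[OF X] unfolding iso_class_def by simp
    ultimately show ?thesis unfolding vertex_action_def by blast
  qed
  define p where "p = (\<lambda>x. \<Union>X\<in>x. iso_class D (fob F X))"
  have p: "p (iso_class C X) = iso_class D (fob F X)" if X: "X \<in> Obj C" for X
  proof -
    have "iso_class D (fob F Y) = iso_class D (fob F X)" if "Y \<in> iso_class C X" for Y
      using that F_isomorphic[of X Y] D.iso_class_eq_iff[OF F_ob[OF X], of "fob F Y"]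
      unfolding iso_class_def by simp
    moreover have "X \<in> iso_class C X" using C.isomorphic_refl[OF X] unfolding iso_class_def by simp
    ultimately show ?thesis unfolding p_def by blast
  qed
  have num: "arrow_number C T (iso_class C X) (iso_class C Y) = C.irr_dim ?S X Y" if "X \<in> ?S" "Y \<in> ?S" for X Y
    by (rule C.arrow_number_eq[OF that])
  have act_V: "?act g x \<in> ?V" if "g \<in> carrier G" "x \<in> ?V" for g x
    using that V act rhoS Sob by auto
  have p_inv: "p (?act g x) = p x" if g: "g \<in> carrier G" and x: "x \<in> ?V" for g x
  proof -
    obtain X where X: "X \<in> ?S" "x = iso_class C X" using x V by blast
    show ?thesis unfolding X(2) act[OF g Sob(1)[OF X(1)]] p[OF Sob(1)[OF X(1)]] p[OF rho_ob[OF g Sob(1)[OF X(1)]]]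
        F_rho(1)[OF g Sob(1)[OF X(1)]] ..
  qed
  have "quiver_iso_over (orbit_image D F)
    (orbit_quiver G ?act (\<lambda>g (x, y, k). (?act g x, ?act g y, k))
      \<lparr>verts = ?V, arcs = {(x, y, k). x \<in> ?V \<and> y \<in> ?V \<and> k < arrow_number C T x y}, tail = (\<lambda>(x, y, k). x), head = (\<lambda>(x, y, k). y)\<rparr>)
    \<lparr>verts = ?Vb, arcs = {(x, y, k). x \<in> ?Vb \<and> y \<in> ?Vb \<and> k < arrow_number D Tb x y}, tail = (\<lambda>(x, y, k). x), head = (\<lambda>(x, y, k). y)\<rparr>"
  proof (rule orbit_quiver_iso[OF G])
    show "?act g x \<in> ?V" if "g \<in> carrier G" "x \<in> ?V" for g x by (rule act_V[OF that])
    show "?act \<one>\<^bsub>G\<^esub> x = x" if x: "x \<in> ?V" for x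
    proof -
      obtain X where X: "X \<in> ?S" "x = iso_class C X" using x V by blast
      show ?thesis unfolding X(2) act[OF gr.one_closed Sob(1)[OF X(1)]] rho_one(1)[OF Sob(1)[OF X(1)]] ..
    qed
    show "?act (g \<otimes>\<^bsub>G\<^esub> h) x = ?act g (?act h x)" if g: "g \<in> carrier G" "h \<in> carrier G" and x: "x \<in> ?V" for g h x
    proof -
      obtain X where X: "X \<in> ?S" "x = iso_class C X" using x V by blast
      note ob = Sob(1)[OF X(1)]
      show ?thesis unfolding X(2) act[OF g(2) ob] act[OF g(1) rho_ob[OF g(2) ob]] act[OF gr.m_closed[OF g] ob]
          rho_mult(1)[OF g ob] ..
    qed
    show "g = \<one>\<^bsub>G\<^esub>" if g: "g \<in> carrier G" and x: "x \<in> ?V" and e: "?act g x = x" for g x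
    proof -
      obtain X where X: "X \<in> ?S" "x = iso_class C X" using x V by blast
      have "isomorphic C (fob (\<rho> g) X) X"
        using e act[OF g Sob(1)[OF X(1)]] C.iso_class_eq_iff[OF rho_ob[OF g Sob(1)[OF X(1)]]] X(2) by simp
      then show ?thesis using acts_free[of g X] g Sob(2)[OF X(1)] by blast
    qed
    show "arrow_number C T (?act g x) (?act g y) = arrow_number C T x y" if g: "g \<in> carrier G" and x: "x \<in> ?V" and y: "y \<in> ?V" for g x y
    proof -
      obtain X where X: "X \<in> ?S" "x = iso_class C X" using x V by blast
      obtain Y where Y: "Y \<in> ?S" "y = iso_class C Y" using y V by blast
      show ?thesis
        unfolding X(2) Y(2) act[OF g Sob(1)[OF X(1)]] act[OF g Sob(1)[OF Y(1)]]
          num[OF rhoS[OF g X(1)] rhoS[OF g Y(1)]] num[OF X(1) Y(1)]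
        by (rule irr_dim_rho[OF g Sob(2)[OF X(1)] Sob(2)[OF Y(1)] Sob(2) rhoS])
    qed
    show "p ` ?V = ?Vb"
    proof (intro equalityI subsetI)
      fix b assume "b \<in> p ` ?V"
      then obtain x where x: "b = p x" "x \<in> ?V" by (rule imageE)
      obtain X where X: "X \<in> ?S" "x = iso_class C X" using x(2) V by blast
      have "b = iso_class D (fob F X)" unfolding x(1) X(2) by (rule p[OF Sob(1)[OF X(1)]])
      moreover have "fob F X \<in> ?Sb" using S[of X] X(1) by blast
      ultimately show "b \<in> ?Vb" unfolding quiver_vertices_def by (rule image_eqI)
    next
      fix b assume "b \<in> ?Vb"
      then obtain B where B: "B \<in> ?Sb" "b = iso_class D B" using Vb by blast
      obtain X where X: "indecomposable C X" "isomorphic D (fob F X) B" using indec_dense[OF SbI[OF B(1)]] by blast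
      have XS: "X \<in> ?S" using S X(1) Sbi[OF B(1) X(2)] by blast
      have "b = p (iso_class C X)"
        unfolding p[OF Sob(1)[OF XS]] B(2)
        by (rule D.iso_class_eq_iff[OF F_ob[OF Sob(1)[OF XS]], THEN iffD2, OF X(2), symmetric])
      moreover have "iso_class C X \<in> ?V" using XS unfolding quiver_vertices_def by (rule imageI)
      ultimately show "b \<in> p ` ?V" by (rule image_eqI)
    qed
    show "p (?act g x) = p x" if "g \<in> carrier G" "x \<in> ?V" for g x by (rule p_inv[OF that])
    show "\<exists>g\<in>carrier G. ?act g x = y" if x: "x \<in> ?V" and y: "y \<in> ?V" and e: "p x = p y" for x y
    proof -
      obtain X where X: "X \<in> ?S" "x = iso_class C X" using x V by blast
      obtain Y where Y: "Y \<in> ?S" "y = iso_class C Y" using y V by blast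
      note ob = Sob(1)[OF X(1)] Sob(1)[OF Y(1)]
      have "isomorphic D (fob F X) (fob F Y)"
        using e p[OF ob(1)] p[OF ob(2)] D.iso_class_eq_iff[OF F_ob[OF ob(1)]] X(2) Y(2) by simp
      then obtain g where g: "g \<in> carrier G" "isomorphic C (fob (\<rho> g) X) Y"
        using fibre_transitive[OF Sob(2)[OF X(1)] Sob(2)[OF Y(1)]] by blast
      then have "?act g x = y" unfolding X(2) Y(2) act[OF g(1) ob(1)]
        using C.iso_class_eq_iff[OF rho_ob[OF g(1) ob(1)]] by blast
      then show ?thesis using g(1) by blast
    qed
    show "finite ?V" by (rule C.finite_quiver_vertices[OF T])
    show "(\<Sum>y | y \<in> ?V \<and> p y = b. arrow_number C T x y) = arrow_number D Tb (p x) b"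
      if x: "x \<in> ?V" and b: "b \<in> ?Vb" for x b
    proof -
      obtain X where X: "X \<in> ?S" "x = iso_class C X" using x V by blast
      obtain B where B: "B \<in> ?Sb" "b = iso_class D B" using b Vb by blast
      obtain R \<phi> \<psi> where R: "fibre_reps C D F B R \<phi> \<psi>" using fibre_reps_exist[OF SbI[OF B(1)]] .
      note RS' = RS[OF B(1) R]
      have set: "{y. y \<in> ?V \<and> p y = b} = iso_class C ` R"
      proof (intro equalityI subsetI)
        fix y assume "y \<in> {y. y \<in> ?V \<and> p y = b}"
        then obtain Y where Y: "Y \<in> ?S" "y = iso_class C Y" "p y = b" using V by blast
        have "isomorphic D (fob F Y) B"
          using Y p[OF Sob(1)[OF Y(1)]] B(2) D.iso_class_eq_iff[OF F_ob[OF Sob(1)[OF Y(1)]]] by simp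
        then obtain Z where Z: "Z \<in> R" "isomorphic C Y Z" using fibre_repsD(3)[OF R Sob(1)[OF Y(1)]] by blast
        have "y = iso_class C Z" using C.iso_class_eq_iff[OF Sob(1)[OF Y(1)]] Z(2) Y(2) by blast
        then show "y \<in> iso_class C ` R" using Z(1) by blast
      next
        fix y assume "y \<in> iso_class C ` R"
        then obtain Y where Y: "Y \<in> R" "y = iso_class C Y" by blast
        have YS: "Y \<in> ?S" using Y RS'(1) by blast
        have "p y = b"
          using p[OF Sob(1)[OF YS]] Y(2) B(2) D.iso_class_eq_iff[OF F_ob[OF Sob(1)[OF YS]]]
            fibre_repsD(4)[OF R Y(1)] by simp
        then show "y \<in> {y. y \<in> ?V \<and> p y = b}" using YS Y(2) V by blast
      qed
      have FX: "fob F X \<in> ?Sb" using S X(1) by blast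
      have "(\<Sum>y | y \<in> ?V \<and> p y = b. arrow_number C T x y) = (\<Sum>Y\<in>R. arrow_number C T x (iso_class C Y))"
        unfolding set by (rule sum.reindex_cong[OF RS'(2) refl refl])
      also have "\<dots> = (\<Sum>Y\<in>R. C.irr_dim ?S X Y)"
        unfolding X(2) using num[OF X(1)] RS'(1) by (intro sum.cong) auto
      also have "\<dots> = D.irr_dim ?Sb (fob F X) B"
        by (rule irr_dim_fibre[OF SbI[OF B(1)] Sob(2)[OF X(1)] R RS'(3) S SbI Sbi fin, symmetric])
      also have "\<dots> = arrow_number D Tb (p x) b"
        unfolding X(2) p[OF Sob(1)[OF X(1)]] B(2) by (rule D.arrow_number_eq[OF FX B(1), symmetric])
      finally show ?thesis .
    qed
    show "orbit_image D F (orbit G ?act x) = p x" if x: "x \<in> ?V" for x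
    proof -
      have "orbit_image D F (orbit G ?act x) = (\<Union>g\<in>carrier G. p (?act g x))"
        unfolding orbit_image_def orbit_def p_def by blast
      also have "\<dots> = p x" using p_inv[OF _ x] gr.one_closed by auto
      finally show ?thesis .
    qed
  qed
  then show "quiver_iso_over (orbit_image D F)
      (orbit_quiver G (vertex_action C \<rho>) (arrow_action C \<rho>) (end_quiver C T)) (end_quiver D Tb)"
    unfolding end_quiver_def arrow_action_def .
qed

end

section \<open>Approximations\<close>

context lincat
begin

lemma in_add_zero_right:
  assumes "in_add T Y" "\<And>h. h \<in> Hom C W T \<Longrightarrow> h = Zro C W T" "f \<in> Hom C W Y"
  shows "f = Zro C W Y"
proof -
  have ob: "Y \<in> Obj C" "W \<in> Obj C" using assms(3) Hom_ob by auto
  have "Idn C Y \<star> f \<in> {Zro C W Y}"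
  proof (rule asum_map[OF _ thru_gens_hom ob(1,1), where F = "\<lambda>g. g \<star> f"])
    show "Idn C Y \<in> thru T Y Y" using assms(1) unfolding in_add_def by blast
    show "Zro C Y Y \<star> f \<in> {Zro C W Y}" using cmp_zro(2)[OF assms(3) ob(1)] by simp
    show "k \<star> f \<in> {Zro C W Y}" if k: "k \<in> thru_gens T Y Y" for k
    proof -
      obtain a b where ab: "a \<in> Hom C Y T" "b \<in> Hom C T Y" "k = b \<star> a" using k unfolding thru_gens_def by blast
      have "a \<star> f = Zro C W T" using assms(2)[OF cmp_hom[OF assms(3) ab(1)]] .
      then show ?thesis using assoc[OF assms(3) ab(1,2)] ab(3) cmp_zro(1)[OF ab(2) ob(2)] by simp
    qed
    show "(g \<boxplus> h) \<star> f \<in> {Zro C W Y}"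
      if "g \<in> Hom C Y Y" "h \<in> Hom C Y Y" "g \<star> f \<in> {Zro C W Y}" "h \<star> f \<in> {Zro C W Y}" for g h
      using distrib(2)[OF assms(3) that(1,2)] that(3,4) hom_module_laws(1)[OF zro_hom[OF ob(2,1)]] by simp
  qed
  then show ?thesis using cmp_idn(2)[OF assms(3)] by simp
qed

lemma in_add_dsum2:
  assumes "in_add T A" "in_add T B" "dsum2 C Z A B" shows "in_add T Z"
  using assms(3)
proof (rule dsum2D)
  fix i p j q assume *: "i \<in> Hom C A Z" "p \<in> Hom C Z A" "j \<in> Hom C B Z" "q \<in> Hom C Z B" "(i \<star> p) \<boxplus> (j \<star> q) = Idn C Z"
  have "(i \<star> p) \<boxplus> (j \<star> q) \<in> asum Z Z {i \<star> p, j \<star> q}" by (intro asum_pls asum_gen) auto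
  then show ?thesis unfolding *(5)
    by (rule in_add_trans_gen[rotated]) (use * assms(1,2) Hom_ob in blast)+
qed

lemma right_approx_in_add:
  assumes q: "q \<in> Hom C B N" "\<And>g. g \<in> Hom C T N \<Longrightarrow> \<exists>h\<in>Hom C T B. g = q \<star> h"
    and Y: "in_add T Y" and g: "g \<in> Hom C Y N"
  shows "\<exists>h\<in>Hom C Y B. g = q \<star> h"
proof -
  have ob: "Y \<in> Obj C" "B \<in> Obj C" using g q Hom_ob by auto
  let ?S = "{q \<star> h | h. h \<in> Hom C Y B}"
  have "g \<star> Idn C Y \<in> ?S"
  proof (rule asum_map[OF _ thru_gens_hom ob(1,1), where F = "\<lambda>e. g \<star> e"])
    show "Idn C Y \<in> thru T Y Y" using Y unfolding in_add_def by blast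
    show "g \<star> Zro C Y Y \<in> ?S"
      using cmp_zro(1)[OF g ob(1)] cmp_zro(1)[OF q(1) ob(1)] zro_hom[OF ob] by (intro CollectI exI[of _ "Zro C Y B"]) simp
    show "g \<star> k \<in> ?S" if k: "k \<in> thru_gens T Y Y" for k
    proof -
      obtain a b where ab: "a \<in> Hom C Y T" "b \<in> Hom C T Y" "k = b \<star> a" using k unfolding thru_gens_def by blast
      obtain h where h: "h \<in> Hom C T B" "g \<star> b = q \<star> h" using q(2)[OF cmp_hom[OF ab(2) g]] by blast
      have "g \<star> k = q \<star> (h \<star> a)"
        unfolding ab(3) assoc[OF ab(1,2) g, symmetric] h(2) assoc[OF ab(1) h(1) q(1)] ..
      then show ?thesis using cmp_hom[OF ab(1) h(1)] by blast
    qed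
    show "g \<star> (x \<boxplus> y) \<in> ?S" if xy: "x \<in> Hom C Y Y" "y \<in> Hom C Y Y" "g \<star> x \<in> ?S" "g \<star> y \<in> ?S" for x y
    proof -
      obtain h where 1: "h \<in> Hom C Y B" "g \<star> x = q \<star> h" using xy(3) by blast
      obtain h' where 2: "h' \<in> Hom C Y B" "g \<star> y = q \<star> h'" using xy(4) by blast
      show ?thesis using distrib(1)[OF xy(1) g xy(2)] distrib(1)[OF 1(1) q(1) 2(1)] 1 2 pls_hom[OF 1(1) 2(1)]
        by (intro CollectI exI[of _ "h \<boxplus> h'"]) simp
    qed
  qed
  then show ?thesis using cmp_idn(1)[OF g] by auto
qed

lemma left_approx_in_add:
  assumes f: "f \<in> Hom C X W" "\<And>g. g \<in> Hom C X T \<Longrightarrow> \<exists>h\<in>Hom C W T. g = h \<star> f"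
    and Y: "in_add T Y" and g: "g \<in> Hom C X Y"
  shows "\<exists>h\<in>Hom C W Y. g = h \<star> f"
proof -
  have ob: "Y \<in> Obj C" "W \<in> Obj C" using g f Hom_ob by auto
  let ?S = "{h \<star> f | h. h \<in> Hom C W Y}"
  have "Idn C Y \<star> g \<in> ?S"
  proof (rule asum_map[OF _ thru_gens_hom ob(1,1), where F = "\<lambda>e. e \<star> g"])
    show "Idn C Y \<in> thru T Y Y" using Y unfolding in_add_def by blast
    show "Zro C Y Y \<star> g \<in> ?S"
      using cmp_zro(2)[OF g ob(1)] cmp_zro(2)[OF f(1) ob(1)] zro_hom[OF ob(2,1)] by (intro CollectI exI[of _ "Zro C W Y"]) simp
    show "k \<star> g \<in> ?S" if k: "k \<in> thru_gens T Y Y" for k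
    proof -
      obtain a b where ab: "a \<in> Hom C Y T" "b \<in> Hom C T Y" "k = b \<star> a" using k unfolding thru_gens_def by blast
      obtain h where h: "h \<in> Hom C W T" "a \<star> g = h \<star> f" using f(2)[OF cmp_hom[OF g ab(1)]] by blast
      have "k \<star> g = (b \<star> h) \<star> f"
        unfolding ab(3) assoc[OF g ab(1,2)] h(2) assoc[OF f(1) h(1) ab(2)] ..
      then show ?thesis using cmp_hom[OF h(1) ab(2)] by blast
    qed
    show "(x \<boxplus> y) \<star> g \<in> ?S" if xy: "x \<in> Hom C Y Y" "y \<in> Hom C Y Y" "x \<star> g \<in> ?S" "y \<star> g \<in> ?S" for x y
    proof -
      obtain h where 1: "h \<in> Hom C W Y" "x \<star> g = h \<star> f" using xy(3) by blast
      obtain h' where 2: "h' \<in> Hom C W Y" "y \<star> g = h' \<star> f" using xy(4) by blast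
      show ?thesis using distrib(2)[OF g xy(1,2)] distrib(2)[OF f(1) 1(1) 2(1)] 1 2 pls_hom[OF 1(1) 2(1)]
        by (intro CollectI exI[of _ "h \<boxplus> h'"]) simp
    qed
  qed
  then show ?thesis using cmp_idn(2)[OF g] by auto
qed

end

context kscat
begin

text \<open>Sum up a basis of the maps from \<open>T\<close> to \<open>N\<close>.\<close>

lemma right_approx_exists:
  assumes T: "T \<in> Obj C" and N: "N \<in> Obj C"
  shows "\<exists>B q. in_add T B \<and> q \<in> Hom C B N \<and> (\<forall>g\<in>Hom C T N. \<exists>h\<in>Hom C T B. g = q \<star> h)"
proof -
  interpret H: kspace "hom_mod C T N" by (rule hom_kspace[OF T N])
  obtain S where S: "H.qbasis (Hom C T N) {Zro C T N} S (\<lambda>x. x)"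
    using H.fin_dim_basis[OF fin[OF T N]] unfolding hom_sel .
  have fS: "finite S" and ST: "S \<subseteq> Hom C T N" using H.qbasisD(1,2)[OF S] by auto
  have "\<exists>B q. in_add T B \<and> q \<in> Hom C B N \<and> (\<forall>g\<in>S. \<exists>h\<in>Hom C T B. g = q \<star> h)"
    using fS ST
  proof (induction S rule: finite_induct)
    case empty
    then show ?case using in_add_refl[OF T] zro_hom[OF T N] by blast
  next
    case (insert g S)
    then obtain B q where Bq: "in_add T B" "q \<in> Hom C B N" "\<forall>g\<in>S. \<exists>h\<in>Hom C T B. g = q \<star> h" by auto
    have g: "g \<in> Hom C T N" using insert by auto
    obtain Z where Z: "dsum2 C Z B T" using dsum2_exists[OF in_add_ob[OF Bq(1)] T] by blast
    then show ?case
    proof (rule dsum2D)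
      fix i p j r assume *: "i \<in> Hom C B Z" "p \<in> Hom C Z B" "j \<in> Hom C T Z" "r \<in> Hom C Z T"
        "p \<star> i = Idn C B" "r \<star> j = Idn C T" "r \<star> i = Zro C B T" "p \<star> j = Zro C T B"
      have ob: "B \<in> Obj C" using in_add_ob[OF Bq(1)] .
      let ?q = "(q \<star> p) \<boxplus> (g \<star> r)"
      have qh: "?q \<in> Hom C Z N" using * Bq g by (blast intro: hom_intros)
      have qi: "?q \<star> i = q" and qj: "?q \<star> j = g" using * Bq(2) g ob T N by (simp_all add: cs)
      have "\<exists>h\<in>Hom C T Z. g' = ?q \<star> h" if g': "g' \<in> insert g S" for g'
      proof (cases "g' = g")
        case True
        then show ?thesis using qj *(3) by (intro bexI[of _ j]) simp_all
      next
        case False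
        then have "g' \<in> S" using g' by simp
        from bspec[OF Bq(3) this] obtain h where h: "h \<in> Hom C T B" "g' = q \<star> h" by blast
        have "g' = ?q \<star> (i \<star> h)" unfolding h(2) assoc[OF h(1) *(1) qh, symmetric] qi ..
        then show ?thesis using cmp_hom[OF h(1) *(1)] by blast
      qed
      then show ?thesis using in_add_dsum2[OF Bq(1) in_add_refl[OF T] Z] qh by blast
    qed
  qed
  then obtain B q where Bq: "in_add T B" "q \<in> Hom C B N" "\<forall>g\<in>S. \<exists>h\<in>Hom C T B. g = q \<star> h" by blast
  have ob: "B \<in> Obj C" using in_add_ob[OF Bq(1)] .
  interpret L: klinear "hom_mod C T B" "hom_mod C T N" "\<lambda>h. q \<star> (h \<star> Idn C T)"
    by (rule klinear_cmp[OF idn_hom[OF T] Bq(2)])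
  have im: "(\<lambda>h. q \<star> (h \<star> Idn C T)) ` Hom C T B = {q \<star> h | h. h \<in> Hom C T B}"
    using cmp_idn(1)[of _ T B] by (force simp: image_def)
  have vs: "H.vsubspace {q \<star> h | h. h \<in> Hom C T B}"
    using L.image_vsubspace[OF L.M.vsubspace_carrier] unfolding hom_sel im .
  have "\<exists>h\<in>Hom C T B. g = q \<star> h" if g: "g \<in> Hom C T N" for g
  proof -
    obtain c where c: "g \<ominus>\<^bsub>hom_mod C T N\<^esub> H.lincomb S c (\<lambda>x. x) \<in> {Zro C T N}" using H.qbasisD(3)[OF S g] by blast
    have lc: "H.lincomb S c (\<lambda>x. x) \<in> {q \<star> h | h. h \<in> Hom C T B}"
      using Bq(3) by (intro H.vsubspace_lincomb[OF vs fS]) blast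
    have lh: "H.lincomb S c (\<lambda>x. x) \<in> carrier (hom_mod C T N)" using H.vsubspaceD(1)[OF vs lc] .
    have "g = H.lincomb S c (\<lambda>x. x)"
    proof -
      have gh: "g \<in> carrier (hom_mod C T N)" using g by simp
      let ?L = "H.lincomb S c (\<lambda>x. x)" let ?N = "hom_mod C T N"
      have "g \<oplus>\<^bsub>?N\<^esub> \<ominus>\<^bsub>?N\<^esub> ?L = \<zero>\<^bsub>?N\<^esub>" using c by (simp add: H.M.minus_eq)
      then have "\<ominus>\<^bsub>?N\<^esub> (\<ominus>\<^bsub>?N\<^esub> ?L) = g" using H.M.minus_equality[OF _ H.M.a_inv_closed[OF lh] gh] by blast
      then show ?thesis using H.M.minus_minus[OF lh] by simp
    qed
    then show ?thesis using lc by blast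
  qed
  then show ?thesis using Bq by blast
qed

text \<open>
  Minimise the dimension of \<open>End B\<close>: if \<open>q e = q\<close> for an idempotent
  \<open>e\<close>, the restriction of \<open>q\<close> to the image of \<open>e\<close> is again
  an approximation.
\<close>

lemma right_minimal_approx_exists:
  assumes T: "T \<in> Obj C" and N: "N \<in> Obj C"
  obtains B q where "in_add T B" "q \<in> Hom C B N" "\<And>g. g \<in> Hom C T N \<Longrightarrow> \<exists>h\<in>Hom C T B. g = q \<star> h"
    "\<And>e. e \<in> Hom C B B \<Longrightarrow> e \<star> e = e \<Longrightarrow> q \<star> e = q \<Longrightarrow> e = Idn C B"
proof -
  let ?P = "\<lambda>B. \<exists>q. in_add T B \<and> q \<in> Hom C B N \<and> (\<forall>g\<in>Hom C T N. \<exists>h\<in>Hom C T B. g = q \<star> h)"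
  let ?d = "\<lambda>B. kspace.vdim (End C B)"
  have ex: "\<exists>B. ?P B" by (rule right_approx_exists[OF T N])
  define B where "B = arg_min ?d ?P"
  have B: "?P B" and min: "\<And>B'. ?P B' \<Longrightarrow> ?d B \<le> ?d B'"
    using arg_min_nat_lemma[of ?P _ ?d] ex unfolding B_def by blast+
  from B obtain q where q: "in_add T B" "q \<in> Hom C B N" "\<forall>g\<in>Hom C T N. \<exists>h\<in>Hom C T B. g = q \<star> h" by blast
  have ob: "B \<in> Obj C" using in_add_ob[OF q(1)] .
  have "e = Idn C B" if e: "e \<in> Hom C B B" "e \<star> e = e" "q \<star> e = q" for e
  proof -
    obtain B' i p where ip: "i \<in> Hom C B' B" "p \<in> Hom C B B'" "p \<star> i = Idn C B'" "i \<star> p = e"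
      using split_idem[OF e(1,2)] .
    obtain Y j r where jr: "dsum2 C B B' Y" "j \<in> Hom C Y B" "r \<in> Hom C B Y" "r \<star> j = Idn C Y"
      "j \<star> r = Idn C B \<boxplus> neg (i \<star> p)" using retract_dsum2[OF ip(1-3)] .
    have "\<exists>h\<in>Hom C T B'. g = (q \<star> i) \<star> h" if g: "g \<in> Hom C T N" for g
    proof -
      obtain h where h: "h \<in> Hom C T B" "g = q \<star> h" using q(3) g by blast
      have "g = (q \<star> e) \<star> h" using h e(3) by simp
      also have "\<dots> = (q \<star> i) \<star> (p \<star> h)" unfolding ip(4)[symmetric] using ip(1,2) h(1) q(2) by (simp add: cs)
      finally show ?thesis using cmp_hom[OF h(1) ip(2)] by blast
    qed
    then have "?P B'" using in_add_retract[OF q(1) retractI[OF ip(1-3)]] cmp_hom[OF ip(1) q(2)] by blast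
    then have "zero_object C Y" using min vdim_summand_less[OF jr(1)] by (meson not_less)
    then have "j = Zro C Y B" using zero_object_hom jr by blast
    then have "j \<star> r = Zro C B B" using cmp_zro(2)[OF jr(3) ob] by simp
    then have "Idn C B \<boxplus> neg e = Zro C B B" using jr(5) ip(4) by simp
    then show ?thesis using neg_eq_zro_iff[OF idn_hom[OF ob] e(1)] by simp
  qed
  then show thesis using q by (intro that[of B q]) auto
qed

text \<open>
  Basic objects have no repeated summands: modulo the radical, the endomorphisms of \<open>Z =
  \<Oplus>S\<close> factoring through a member of \<open>S\<close> form a division ring, which has
  no two nonzero orthogonal idempotents. Two copies of \<open>M\<close> in \<open>Z\<close> would
  provide such idempotents.
\<close>

lemma basic_complement_disjoint:
  assumes basic: "basic_object C Z" and Z: "dsum2 C Z M W" and M: "indecomposable C M"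
  shows "\<not> retract M W"
proof
  assume "retract M W"
  then obtain s t where st: "s \<in> Hom C M W" "t \<in> Hom C W M" "t \<star> s = Idn C M" unfolding retract_def by blast
  obtain S where S: "\<And>X. X \<in> S \<Longrightarrow> indecomposable C X" "\<And>X Y. X \<in> S \<Longrightarrow> Y \<in> S \<Longrightarrow> isomorphic C X Y \<Longrightarrow> X = Y"
    "dsum C Z S (\<lambda>X. X)" using basic unfolding basic_object_def by blast
  obtain i1 p1 j q where d: "i1 \<in> Hom C M Z" "p1 \<in> Hom C Z M" "j \<in> Hom C W Z" "q \<in> Hom C Z W"
    "p1 \<star> i1 = Idn C M" "q \<star> j = Idn C W" "q \<star> i1 = Zro C M W" "p1 \<star> j = Zro C W M"
    by (rule dsum2D[OF Z]) (rule that)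
  have ob: "M \<in> Obj C" "Z \<in> Obj C" "W \<in> Obj C" using d Hom_ob by auto
  let ?i2 = "j \<star> s" and ?p2 = "t \<star> q"
  have h2: "?i2 \<in> Hom C M Z" "?p2 \<in> Hom C Z M" using st d cmp_hom by blast+
  have e22: "?p2 \<star> ?i2 = Idn C M" and e21: "?p2 \<star> i1 = Zro C M M"
    using st d(1-4) d(7) cmp_reduce[OF d(6,3,4)] ob by (simp_all add: cs)
  obtain \<iota> \<pi> where ip: "\<And>k. k \<in> S \<Longrightarrow> \<iota> k \<in> Hom C k Z" "\<And>k. k \<in> S \<Longrightarrow> \<pi> k \<in> Hom C Z k"
    "\<And>k. k \<in> S \<Longrightarrow> \<pi> k \<star> \<iota> k = Idn C k"
    "\<And>k l. k \<in> S \<Longrightarrow> l \<in> S \<Longrightarrow> k \<noteq> l \<Longrightarrow> \<pi> l \<star> \<iota> k = Zro C k l"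
    "Idn C Z \<in> asum Z Z ((\<lambda>k. \<iota> k \<star> \<pi> k) ` S)"
    by (rule dsumD[OF S(3)]) (rule that; assumption)
  let ?K = "(\<lambda>k. \<iota> k \<star> \<pi> k) ` S"
  have Kh: "?K \<subseteq> Hom C Z Z" using ip(1,2) cmp_hom by blast
  have "p1 \<star> (Idn C Z \<star> i1) = Idn C M" using d ob by (simp add: cs)
  from local_sum_cmp[OF M ip(5) Kh d(1,2) this]
  \<comment> \<open>This \<open>k\<close> is the member of \<open>S\<close> isomorphic to \<open>M\<close>.\<close>
  obtain k g where k: "k \<in> S" "iso_pair C M M (p1 \<star> ((\<iota> k \<star> \<pi> k) \<star> i1)) g" by blast
  note kS = S(1)[OF k(1)]
  have hk: "\<iota> k \<in> Hom C k Z" "\<pi> k \<in> Hom C Z k" using ip k by auto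
  have "\<pi> k \<star> i1 \<notin> crad M k"
  proof
    assume "\<pi> k \<star> i1 \<in> crad M k"
    then have "(p1 \<star> \<iota> k) \<star> (\<pi> k \<star> i1) \<in> crad M M" using crad_cmp_left[OF _ cmp_hom[OF hk(1) d(2)]] by blast
    moreover have "(p1 \<star> \<iota> k) \<star> (\<pi> k \<star> i1) = p1 \<star> ((\<iota> k \<star> \<pi> k) \<star> i1)" using hk d by (simp add: cs)
    ultimately show False using iso_pair_not_crad[OF k(2)] indec_nz[OF M] by simp
  qed
  then obtain \<alpha> where al: "iso_pair C M k (\<pi> k \<star> i1) \<alpha>"
    using not_crad_iso[OF M kS cmp_hom[OF d(1) hk(2)]] by blast
  let ?r = "Idn C Z \<boxplus> neg (\<iota> k \<star> \<pi> k)"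
  have rh: "?r \<in> Hom C Z Z" using hk ob by (simp add: cs)
  have rest: "p \<star> (?r \<star> i) \<in> crad M M" if i: "i \<in> Hom C M Z" and p: "p \<in> Hom C Z M" for i p
  proof -
    have "(p \<star> ?r) \<star> (Idn C Z \<star> i) \<in> crad M M"
    proof (rule asum_map[OF ip(5) Kh ob(2,2), where F = "\<lambda>x. (p \<star> ?r) \<star> (x \<star> i)"])
      have pr: "p \<star> ?r \<in> Hom C Z M" by (rule cmp_hom[OF rh p])
      show "(p \<star> ?r) \<star> (Zro C Z Z \<star> i) \<in> crad M M"
        using cmp_zro(2)[OF i ob(2)] cmp_zro(1)[OF pr ob(1)] crad_zro[OF ob(1,1)] by simp
      show "(p \<star> ?r) \<star> ((x \<boxplus> y) \<star> i) \<in> crad M M"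
        if "x \<in> Hom C Z Z" "y \<in> Hom C Z Z" "(p \<star> ?r) \<star> (x \<star> i) \<in> crad M M" "(p \<star> ?r) \<star> (y \<star> i) \<in> crad M M" for x y
        using crad_pls[OF that(3,4)] distrib(2)[OF i that(1,2)]
          distrib(1)[OF cmp_hom[OF i that(1)] pr cmp_hom[OF i that(2)]] by simp
      fix x assume "x \<in> ?K"
      then obtain l where l: "l \<in> S" "x = \<iota> l \<star> \<pi> l" by blast
      have hl: "\<iota> l \<in> Hom C l Z" "\<pi> l \<in> Hom C Z l" using ip l by auto
      have obl: "l \<in> Obj C" using hl Hom_ob by blast
      show "(p \<star> ?r) \<star> (x \<star> i) \<in> crad M M"
      proof (cases "l = k")
        case True
        have "?r \<star> \<iota> k = Zro C k Z" using hk ob obl True ip(3)[OF k(1)] by (simp add: cs)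
        then have "(?r \<star> \<iota> k) \<star> (\<pi> k \<star> i) = Zro C M Z" using cmp_zro(2)[OF cmp_hom[OF i hk(2)] ob(2)] by simp
        moreover have "(p \<star> ?r) \<star> (x \<star> i) = p \<star> ((?r \<star> \<iota> k) \<star> (\<pi> k \<star> i))"
          unfolding l(2) True using assoc[OF cmp_hom[OF i cmp_hom[OF hk(2,1)]] rh p]
            assoc[OF cmp_hom[OF i hk(2)] hk(1) rh] assoc[OF i hk(2,1)] by simp
        ultimately show ?thesis using cmp_zro(1)[OF p ob(1)] crad_zro[OF ob(1,1)] by simp
      next
        case False
        have "\<not> isomorphic C M l"
          using S(2)[OF l(1) k(1)] False isomorphic_trans[OF isomorphic_sym isomorphicI[OF al]] by blast
        then have "\<pi> l \<star> i \<in> crad M l"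
          using not_crad_iso[OF M S(1)[OF l(1)] cmp_hom[OF i hl(2)]] isomorphicI by blast
        then have "((p \<star> ?r) \<star> \<iota> l) \<star> (\<pi> l \<star> i) \<in> crad M M"
          using crad_cmp_left[OF _ cmp_hom[OF hl(1) pr]] by blast
        then show ?thesis unfolding l(2) assoc[OF i hl(2,1)] assoc[OF cmp_hom[OF i hl(2)] hl(1) pr] .
      qed
    qed
    then show ?thesis using cmp_idn(2)[OF i] assoc[OF i rh p] by simp
  qed
  have split: "p \<star> i = ((p \<star> \<iota> k) \<star> (\<pi> k \<star> i)) \<boxplus> (p \<star> (?r \<star> i))" if i: "i \<in> Hom C M Z" and p: "p \<in> Hom C Z M" for i p
    using i p hk ob by (simp add: cs pls_ac)
  have "?p2 \<star> \<iota> k \<notin> crad k M"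
  proof
    assume "?p2 \<star> \<iota> k \<in> crad k M"
    then have "(?p2 \<star> \<iota> k) \<star> (\<pi> k \<star> ?i2) \<in> crad M M" using crad_cmp_right[OF _ cmp_hom[OF h2(1) hk(2)]] by blast
    then have "Idn C M \<in> crad M M" using split[OF h2] crad_pls[OF _ rest[OF h2]] e22 by simp
    then show False using idn_in_crad indec_nz[OF M] by blast
  qed
  then obtain \<beta> where be: "iso_pair C k M (?p2 \<star> \<iota> k) \<beta>"
    using not_crad_iso[OF kS M cmp_hom[OF hk(1) h2(2)]] by blast
  have iso: "iso_pair C M M ((?p2 \<star> \<iota> k) \<star> (\<pi> k \<star> i1)) (\<alpha> \<star> \<beta>)" by (rule iso_pair_trans[OF al be])
  have xh: "(?p2 \<star> \<iota> k) \<star> (\<pi> k \<star> i1) \<in> Hom C M M" using iso unfolding iso_pair_def by blast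
  have yr: "?p2 \<star> (?r \<star> i1) \<in> crad M M" by (rule rest[OF d(1) h2(2)])
  have sum: "((?p2 \<star> \<iota> k) \<star> (\<pi> k \<star> i1)) \<boxplus> (?p2 \<star> (?r \<star> i1)) = Zro C M M"
    using split[OF d(1) h2(2)] e21 by simp
  have yh: "?p2 \<star> (?r \<star> i1) \<in> Hom C M M" using yr crad_hom by blast
  have "(?p2 \<star> \<iota> k) \<star> (\<pi> k \<star> i1) = neg (?p2 \<star> (?r \<star> i1))"
  proof -
    have "neg (neg (?p2 \<star> (?r \<star> i1))) = ?p2 \<star> (?r \<star> i1)" using hom_module_laws(10,12)[OF yh] by simp
    then show ?thesis using sum neg_eq_zro_iff[OF xh scl_hom[OF yh, of "-1"]] by simp
  qed
  then have "(?p2 \<star> \<iota> k) \<star> (\<pi> k \<star> i1) \<in> crad M M" using crad_scl[OF yr, of "-1"] by simp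
  then show False using iso_pair_not_crad[OF iso] indec_nz[OF M] by blast
qed

end

section \<open>Triangulated categories\<close>

locale tricat = kscat C for C :: "('o, 'm, 'k::field, 'z) tcat_scheme" (structure) +
  assumes tri: "triangulated_category C"
begin

abbreviation so where "so \<equiv> fob (Sh C)"
abbreviation sm where "sm \<equiv> fmor (Sh C)"

lemmas tri_parts = tri[unfolded triangulated_category_def]
lemmas shift_equiv = tri_parts[THEN conjunct2, THEN conjunct1]
lemmas TR1_ob = tri_parts[THEN conjunct2, THEN conjunct2, THEN conjunct1, rule_format]
lemmas TR1_iso = tri_parts[THEN conjunct2, THEN conjunct2, THEN conjunct2, THEN conjunct1, rule_format]
lemmas TR1_idn = tri_parts[THEN conjunct2, THEN conjunct2, THEN conjunct2, THEN conjunct2, THEN conjunct1, rule_format]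
lemmas TR1_cone = tri_parts[THEN conjunct2, THEN conjunct2, THEN conjunct2, THEN conjunct2, THEN conjunct2,
    THEN conjunct1, rule_format]
lemmas TR2 = tri_parts[THEN conjunct2, THEN conjunct2, THEN conjunct2, THEN conjunct2, THEN conjunct2,
    THEN conjunct2, THEN conjunct1, rule_format]
lemmas TR3 = tri_parts[THEN conjunct2, THEN conjunct2, THEN conjunct2, THEN conjunct2, THEN conjunct2,
    THEN conjunct2, THEN conjunct2, THEN conjunct1, rule_format]

sublocale S: linfunctor C C "Sh C"
  using shift_equiv unfolding linear_equivalence_def by unfold_locales blast

lemma shift_full:
  assumes "h \<in> Hom C (so X) (so Y)" "X \<in> Obj C" "Y \<in> Obj C"
  obtains f where "f \<in> Hom C X Y" "sm f = h"
proof -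
  have "bij_betw sm (Hom C X Y) (Hom C (so X) (so Y))"
    using shift_equiv assms unfolding linear_equivalence_def by blast
  then have "h \<in> sm ` Hom C X Y" using assms(1) by (simp only: bij_betw_imp_surj_on)
  then show thesis using that by blast
qed

lemma shift_faithful:
  assumes "f \<in> Hom C X Y" "g \<in> Hom C X Y" "sm f = sm g" shows "f = g"
proof -
  have "bij_betw sm (Hom C X Y) (Hom C (so X) (so Y))"
    using shift_equiv Hom_ob[OF assms(1)] unfolding linear_equivalence_def by blast
  then show ?thesis using assms unfolding bij_betw_def inj_on_def by blast
qed

lemma shift_dense: "Z \<in> Obj C \<Longrightarrow> \<exists>X\<in>Obj C. isomorphic C (so X) Z"
  using shift_equiv unfolding linear_equivalence_def by blast

lemma tri_homs:
  assumes "(f, g, h) \<in> Tri C" "f \<in> Hom C X Y"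
  shows "g \<in> Hom C Y (Cod C g)" "h \<in> Hom C (Cod C g) (so X)" "(f, g, h) \<in> triangles_on C X Y (Cod C g)"
proof -
  obtain X' Y' Z where "(f, g, h) \<in> triangles_on C X' Y' Z" using TR1_ob[OF assms(1)] by blast
  then show "g \<in> Hom C Y (Cod C g)" "h \<in> Hom C (Cod C g) (so X)" "(f, g, h) \<in> triangles_on C X Y (Cod C g)"
    using assms(2) unfolding triangles_on_def Hom_def by auto
qed

lemma rotate:
  assumes "(f, g, h) \<in> Tri C" "f \<in> Hom C X Y" "g \<in> Hom C Y Z" "h \<in> Hom C Z (so X)"
  shows "(g, h, neg (sm f)) \<in> Tri C"
proof -
  have "X \<in> Obj C" "Y \<in> Obj C" "Z \<in> Obj C" "(f, g, h) \<in> triangles_on C X Y Z"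
    using assms Hom_ob[OF assms(2)] Hom_ob[OF assms(3)] unfolding triangles_on_def by auto
  then show ?thesis using TR2[of X Y Z f g h] assms(1) by blast
qed

lemma rotate_back:
  assumes "(g, h, neg (sm f)) \<in> Tri C" "f \<in> Hom C X Y" "g \<in> Hom C Y Z" "h \<in> Hom C Z (so X)"
  shows "(f, g, h) \<in> Tri C"
proof -
  have "X \<in> Obj C" "Y \<in> Obj C" "Z \<in> Obj C" "(f, g, h) \<in> triangles_on C X Y Z"
    using assms Hom_ob[OF assms(2)] Hom_ob[OF assms(3)] unfolding triangles_on_def by auto
  then show ?thesis using TR2[of X Y Z f g h] assms(1) by blast
qed

lemma triangle_fill:
  assumes t: "(f, g, h) \<in> Tri C" "f \<in> Hom C X Y" "g \<in> Hom C Y Z" "h \<in> Hom C Z (so X)"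
    and t': "(f', g', h') \<in> Tri C" "f' \<in> Hom C X' Y'" "g' \<in> Hom C Y' Z'" "h' \<in> Hom C Z' (so X')"
    and u: "u \<in> Hom C X X'" and v: "v \<in> Hom C Y Y'" and e: "v \<star> f = f' \<star> u"
  obtains w where "w \<in> Hom C Z Z'" "w \<star> g = g' \<star> v" "sm u \<star> h = h' \<star> w"
proof -
  have d: "Dom C f = X" "Dom C f' = X'" "Dom C g = Y" "Dom C g' = Y'" "Dom C h = Z" "Dom C h' = Z'"
    using t t' unfolding Hom_def by auto
  have "\<exists>w. triangle_map C (f, g, h) (f', g', h') (u, v, w)"
    by (rule TR3) (use t t' u v e d in auto)
  then show thesis using that unfolding triangle_map_def prod.case d by blast
qed

lemma so_ob: "X \<in> Obj C \<Longrightarrow> so X \<in> Obj C" by (rule S.F_ob)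

lemma shift_zero_object: "zero_object C X \<Longrightarrow> zero_object C (so X)" by (rule S.F_zero_object)

lemma zero_object_ob: "zero_object C Z \<Longrightarrow> Z \<in> Obj C" unfolding zero_object_def by blast

text \<open>
  Two consecutive maps compose to zero: compare the triangle with the one on the identity of its
  first object.
\<close>

lemma tri_cmp_zero:
  assumes t: "(f, g, h) \<in> Tri C" "f \<in> Hom C X Y" "g \<in> Hom C Y Z" "h \<in> Hom C Z (so X)"
  shows "g \<star> f = Zro C X Z" "h \<star> g = Zro C Y (so X)" "sm f \<star> h = Zro C Z (so Y)"
proof -
  obtain U where U: "zero_object C U" using zero_exists by blast
  have gf0: "g \<star> f = Zro C X Z"
    if t: "(f, g, h) \<in> Tri C" "f \<in> Hom C X Y" "g \<in> Hom C Y Z" "h \<in> Hom C Z (so X)" for f g h X Y Z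
  proof -
    have ob: "X \<in> Obj C" "Z \<in> Obj C" "U \<in> Obj C" using Hom_ob[OF t(2)] Hom_ob[OF t(3)] zero_object_ob[OF U] by auto
    obtain w where "w \<in> Hom C U Z" "w \<star> Zro C X U = g \<star> f"
    proof (rule triangle_fill[OF TR1_idn[OF ob(1) U] _ _ _ t])
      show "Idn C X \<in> Hom C X X" "Idn C X \<in> Hom C X X" "Zro C X U \<in> Hom C X U" "Zro C U (so X) \<in> Hom C U (so X)" "f \<in> Hom C X Y"
        using ob so_ob t hom_intros by auto
    qed (use t in auto)
    then show ?thesis using cmp_zro(1)[of w U Z X] ob by simp
  qed
  note r1 = rotate[OF t]
  have n: "neg (sm f) \<in> Hom C (so X) (so Y)" using S.F_hom[OF t(2)] scl_hom by blast
  have n2: "neg (sm g) \<in> Hom C (so Y) (so Z)" using S.F_hom[OF t(3)] scl_hom by blast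
  show "g \<star> f = Zro C X Z" by (rule gf0[OF t])
  show "h \<star> g = Zro C Y (so X)" by (rule gf0[OF r1 t(3,4) n])
  have "neg (sm f) \<star> h = Zro C Z (so Y)" by (rule gf0[OF rotate[OF r1 t(3,4) n] t(4) n n2])
  then have "neg (neg (sm f) \<star> h) = Zro C Z (so Y)"
    using hom_module_laws(14)[OF zro_hom, of Z "so Y"] Hom_ob[OF t(4)] Hom_ob[OF S.F_hom[OF t(2)]] by simp
  then show "sm f \<star> h = Zro C Z (so Y)"
    using distrib(4)[OF t(4) S.F_hom[OF t(2)], of "-1"] hom_module_laws(10,12)[OF cmp_hom[OF t(4) S.F_hom[OF t(2)]]] by simp
qed

text \<open>
  Morphism functors are exact on triangles. This and the following lemmas are the instances of
  exactness needed below, at the various places of the long exact sequence.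
\<close>

lemma tri_lift:
  assumes t: "(f, g, h) \<in> Tri C" "f \<in> Hom C X Y" "g \<in> Hom C Y Z" "h \<in> Hom C Z (so X)"
    and a: "a \<in> Hom C W Y" "g \<star> a = Zro C W Z"
  shows "\<exists>b\<in>Hom C W X. a = f \<star> b"
proof -
  obtain U where U: "zero_object C U" using zero_exists by blast
  have ob: "X \<in> Obj C" "Y \<in> Obj C" "Z \<in> Obj C" "W \<in> Obj C" "U \<in> Obj C"
    using Hom_ob[OF t(2)] Hom_ob[OF t(3)] Hom_ob[OF a(1)] zero_object_ob[OF U] by auto
  have "(Idn C W, Zro C W U, Zro C U (so W)) \<in> Tri C" by (rule TR1_idn[OF ob(4) U])
  then have r: "(Zro C W U, Zro C U (so W), neg (sm (Idn C W))) \<in> Tri C"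
    by (rule rotate) (use idn_hom[OF ob(4)] zro_hom[OF ob(4,5)] zro_hom[OF ob(5) so_ob[OF ob(4)]] in blast)+
  have n: "neg (sm f) \<in> Hom C (so X) (so Y)" using S.F_hom[OF t(2)] scl_hom by blast
  obtain w where w: "w \<in> Hom C (so W) (so X)" "sm a \<star> neg (sm (Idn C W)) = neg (sm f) \<star> w"
  proof (rule triangle_fill[OF r _ _ _ rotate[OF t] t(3,4) n a(1)])
    show "Zro C W U \<in> Hom C W U" "Zro C U (so W) \<in> Hom C U (so W)" "neg (sm (Idn C W)) \<in> Hom C (so W) (so W)"
      "Zro C U Z \<in> Hom C U Z"
      using zro_hom[OF ob(4,5)] zro_hom[OF ob(5) so_ob[OF ob(4)]] scl_hom[OF S.F_hom[OF idn_hom[OF ob(4)]]] zro_hom[OF ob(5,3)] by blast+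
    show "Zro C U Z \<star> Zro C W U = g \<star> a"
      unfolding a(2) by (rule cmp_zro(2)[OF zro_hom[OF ob(4,5)] ob(3)])
  qed
  obtain b where b: "b \<in> Hom C W X" "sm b = w" using shift_full[OF w(1) ob(4,1)] .
  have ah: "sm a \<in> Hom C (so W) (so Y)" by (rule S.F_hom[OF a(1)])
  have fh: "sm f \<in> Hom C (so X) (so Y)" by (rule S.F_hom[OF t(2)])
  have "neg (sm a) = neg (sm f \<star> w)"
    using w(2) S.F_idn[OF ob(4)] ah fh w(1) so_ob[OF ob(4)] by (simp add: cs)
  then have "neg (neg (sm a)) = neg (neg (sm f \<star> w))" by simp
  then have "sm a = sm f \<star> w"
    using hom_module_laws(10,12)[OF ah] hom_module_laws(10,12)[OF cmp_hom[OF w(1) fh]] by simp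
  also have "\<dots> = sm (f \<star> b)" using S.F_cmp[OF b(1) t(2)] b(2) by simp
  finally have "a = f \<star> b" by (rule shift_faithful[OF a(1) cmp_hom[OF b(1) t(2)]])
  then show ?thesis using b(1) by blast
qed

lemma tri_extend:
  assumes t: "(f, g, h) \<in> Tri C" "f \<in> Hom C X Y" "g \<in> Hom C Y Z" "h \<in> Hom C Z (so X)"
    and c: "c \<in> Hom C Y W" "c \<star> f = Zro C X W"
  shows "\<exists>d\<in>Hom C Z W. c = d \<star> g"
proof -
  obtain U where U: "zero_object C U" using zero_exists by blast
  have ob: "X \<in> Obj C" "W \<in> Obj C" "U \<in> Obj C" "so U \<in> Obj C"
    using Hom_ob[OF t(2)] Hom_ob[OF c(1)] zero_object_ob[OF U] so_ob by auto
  have z: "Zro C U W \<in> Hom C U W" "Zro C W (so U) \<in> Hom C W (so U)" "Idn C W \<in> Hom C W W"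
    using ob hom_intros by auto
  have "neg (sm (Zro C U W)) = Zro C (so U) (so W)"
    using S.F_zro[OF ob(3,2)] hom_module_laws(14)[OF zro_hom[OF ob(4) so_ob[OF ob(2)]]] by simp
  then have "(Zro C U W, Idn C W, Zro C W (so U)) \<in> Tri C"
    using TR1_idn[OF ob(2) shift_zero_object[OF U]] by (intro rotate_back[OF _ z(1,3,2)]) simp
  then obtain w where "w \<in> Hom C Z W" "w \<star> g = Idn C W \<star> c"
  proof (rule triangle_fill[OF t _ z(1,3,2) zro_hom[OF ob(1,3)] c(1)])
    show "c \<star> f = Zro C U W \<star> Zro C X U"
      unfolding c(2) by (rule cmp_zro(2)[OF zro_hom[OF ob(1,3)] ob(2), symmetric])
  qed
  then show ?thesis using cmp_idn(2)[OF c(1)] by auto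
qed

lemma tri_lift_shift:
  assumes t: "(f, g, h) \<in> Tri C" "f \<in> Hom C X Y" "g \<in> Hom C Y Z" "h \<in> Hom C Z (so X)"
    and a: "a \<in> Hom C W (so X)" "sm f \<star> a = Zro C W (so Y)"
  shows "\<exists>b\<in>Hom C W Z. a = h \<star> b"
proof (rule tri_lift[OF rotate[OF rotate[OF t] t(3,4)] t(4)])
  have fh: "sm f \<in> Hom C (so X) (so Y)" by (rule S.F_hom[OF t(2)])
  show n: "neg (sm f) \<in> Hom C (so X) (so Y)" "neg (sm f) \<in> Hom C (so X) (so Y)" using fh scl_hom by blast+
  show "neg (sm g) \<in> Hom C (so Y) (so Z)" using S.F_hom[OF t(3)] scl_hom by blast
  show "a \<in> Hom C W (so X)" by (rule a)
  show "neg (sm f) \<star> a = Zro C W (so Y)"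
    using distrib(4)[OF a(1) fh, of "-1"] a(2) hom_module_laws(14)[OF cmp_hom[OF a(1) fh]] by simp
qed

lemma tri_extend_shift:
  assumes t: "(f, g, h) \<in> Tri C" "f \<in> Hom C X Y" "g \<in> Hom C Y Z" "h \<in> Hom C Z (so X)"
    and v: "v \<in> Hom C X V" "sm v \<star> h = Zro C Z (so V)"
  shows "\<exists>d\<in>Hom C Y V. v = d \<star> f"
proof -
  have ob: "X \<in> Obj C" "Y \<in> Obj C" "V \<in> Obj C" using Hom_ob[OF t(2)] Hom_ob[OF v(1)] by auto
  have fh: "sm f \<in> Hom C (so X) (so Y)" by (rule S.F_hom[OF t(2)])
  have n: "neg (sm f) \<in> Hom C (so X) (so Y)" using fh scl_hom by blast
  have n2: "neg (sm g) \<in> Hom C (so Y) (so Z)" using S.F_hom[OF t(3)] scl_hom by blast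
  obtain d where d: "d \<in> Hom C (so Y) (so V)" "sm v = d \<star> neg (sm f)"
    using tri_extend[OF rotate[OF rotate[OF t] t(3,4) n] t(4) n n2 S.F_hom[OF v(1)] v(2)] by blast
  obtain e where e: "e \<in> Hom C Y V" "sm e = d" using shift_full[OF d(1) ob(2,3)] .
  have "sm v = neg d \<star> sm f" using d fh by (simp add: cs)
  also have "\<dots> = sm (neg e \<star> f)" using S.F_cmp[OF t(2) scl_hom[OF e(1)]] S.F_scl[OF e(1)] e(2) by simp
  finally have "v = neg e \<star> f" by (rule shift_faithful[OF v(1) cmp_hom[OF t(2) scl_hom[OF e(1)]]])
  then show ?thesis using scl_hom[OF e(1)] by blast
qed

lemma tri_extend_cone:
  assumes t: "(f, g, h) \<in> Tri C" "f \<in> Hom C X Y" "g \<in> Hom C Y Z" "h \<in> Hom C Z (so X)"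
    and c: "c \<in> Hom C Z (so V)" "c \<star> g = Zro C Y (so V)" and V: "V \<in> Obj C"
  shows "\<exists>v\<in>Hom C X V. c = sm v \<star> h"
proof -
  have ob: "X \<in> Obj C" using Hom_ob[OF t(2)] by auto
  have n: "neg (sm f) \<in> Hom C (so X) (so Y)" using S.F_hom[OF t(2)] scl_hom by blast
  obtain d where d: "d \<in> Hom C (so X) (so V)" "c = d \<star> h"
    using tri_extend[OF rotate[OF t] t(3,4) n c(1,2)] by blast
  then show ?thesis using shift_full[OF d(1) ob V] by blast
qed

text \<open>
  Rotate the cone of \<open>q\<close> backwards. Its third object is only isomorphic to a shift
  and has to be replaced.
\<close>

lemma cocone:
  assumes q: "q \<in> Hom C B N"
  obtains A f w where "(f, q, w) \<in> Tri C" "f \<in> Hom C A B" "w \<in> Hom C N (so A)"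
proof -
  have ob: "B \<in> Obj C" "N \<in> Obj C" using Hom_ob[OF q] by auto
  obtain g h where t: "(q, g, h) \<in> Tri C" using TR1_cone[OF ob q] by blast
  let ?Z = "Cod C g"
  note th = tri_homs[OF t q]
  have obZ: "?Z \<in> Obj C" using Hom_ob[OF th(1)] by blast
  obtain A where A: "A \<in> Obj C" "isomorphic C (so A) ?Z" using shift_dense[OF obZ] by blast
  obtain j k where jk: "iso_pair C ?Z (so A) j k" using isomorphic_sym[OF A(2)] unfolding isomorphic_def by blast
  note jh = jk[unfolded iso_pair_def]
  have jh1: "j \<in> Hom C ?Z (so A)" "k \<in> Hom C (so A) ?Z" using jh by auto
  have w: "j \<star> g \<in> Hom C N (so A)" by (rule cmp_hom[OF th(1) jh1(1)])
  have hk: "h \<star> k \<in> Hom C (so A) (so B)" by (rule cmp_hom[OF jh1(2) th(2)])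
  obtain f0 where f0: "f0 \<in> Hom C A B" "sm f0 = h \<star> k" using shift_full[OF hk A(1) ob(1)] .
  let ?f = "neg f0"
  have fh: "?f \<in> Hom C A B" by (rule scl_hom[OF f0(1)])
  have nf: "neg (sm ?f) = h \<star> k"
    using S.F_scl[OF f0(1), of "-1"] f0(2) hom_module_laws(10,12)[OF hk] by simp
  have "(q, j \<star> g, h \<star> k) \<in> Tri C"
  proof (rule TR1_iso[OF ob so_ob[OF A(1)] t])
    show "(q, j \<star> g, h \<star> k) \<in> triangles_on C B N (so A)" unfolding triangles_on_def using q w hk by blast
    have d: "Dom C q = B" "Dom C g = N" "Dom C h = ?Z" "Dom C (j \<star> g) = N" "Dom C (h \<star> k) = so A"
      using q th(1,2) w hk unfolding Hom_def by auto
    have iso: "is_iso C (Idn C X)" if "X \<in> Obj C" for X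
      unfolding is_iso_def iso_pair_def using idn_hom[OF that] cmp_idn(1)[OF idn_hom[OF that]] unfolding Hom_def by auto
    have isoj: "is_iso C j" unfolding is_iso_def using jk jh1 unfolding Hom_def by auto
    have "triangle_map C (q, g, h) (q, j \<star> g, h \<star> k) (Idn C B, Idn C N, j)"
      unfolding triangle_map_def prod.case d
    proof (intro conjI)
      show "sm (Idn C B) \<star> h = (h \<star> k) \<star> j"
        unfolding S.F_idn[OF ob(1)] assoc[OF jh1 th(2)] using jh cmp_idn[OF th(2)] by simp
    qed (use ob idn_hom jh1 cmp_idn[OF q] cmp_idn[OF w] in auto)
    then show "triangle_iso C (q, g, h) (q, j \<star> g, h \<star> k)" unfolding triangle_iso_def using iso[OF ob(1)] iso[OF ob(2)] isoj by blast
  qed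
  then have "(?f, q, j \<star> g) \<in> Tri C" using rotate_back[OF _ fh q w] nf by simp
  then show thesis using fh w by (rule that)
qed

section \<open>Cluster-tilting objects and their mutation\<close>

lemma ct_ob: "cluster_tilting C T \<Longrightarrow> T \<in> Obj C" unfolding cluster_tilting_def by blast

lemma ct_rigid:
  assumes T: "cluster_tilting C T" and X: "in_add T X" and Y: "in_add T Y" and f: "f \<in> Hom C X (so Y)"
  shows "f = Zro C X (so Y)"
proof -
  have ob: "T \<in> Obj C" by (rule ct_ob[OF T])
  have TT: "T \<in> add_closure C T" by (rule retract_add_closure[OF retract_refl[OF ob]])
  then have *: "Hom C T (so T) = {Zro C T (so T)}" using T unfolding cluster_tilting_def by blast
  have "g = Zro C T (so Y)" if g: "g \<in> Hom C T (so Y)" for g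
    by (rule in_add_zero_right[OF S.F_in_add[OF Y ob] _ g]) (use * in blast)
  then show ?thesis using in_add_zero_left[OF X _ f] by blast
qed

lemma ct_max_left:
  assumes T: "cluster_tilting C T" and X: "X \<in> Obj C" and z: "\<And>f. f \<in> Hom C T (so X) \<Longrightarrow> f = Zro C T (so X)"
  shows "in_add T X"
proof -
  have "Hom C Y (so X) = {Zro C Y (so X)}" if Y: "Y \<in> add_closure C T" for Y
    using in_add_zero_left[OF add_closure_in_add[OF Y] z] zro_hom[OF in_add_ob[OF add_closure_in_add[OF Y]] so_ob[OF X]]
    by blast
  then have "X \<in> add_closure C T" using T X unfolding cluster_tilting_def by blast
  then show ?thesis by (rule add_closure_in_add)
qed

lemma ct_max_right:
  assumes T: "cluster_tilting C T" and X: "X \<in> Obj C" and z: "\<And>f. f \<in> Hom C X (so T) \<Longrightarrow> f = Zro C X (so T)"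
  shows "in_add T X"
proof -
  have ob: "T \<in> Obj C" by (rule ct_ob[OF T])
  have "Hom C X (so Y) = {Zro C X (so Y)}" if Y: "Y \<in> add_closure C T" for Y
    using in_add_zero_right[OF S.F_in_add[OF add_closure_in_add[OF Y] ob] z]
      zro_hom[OF X so_ob[OF in_add_ob[OF add_closure_in_add[OF Y]]]] by blast
  then have "X \<in> add_closure C T" using T X unfolding cluster_tilting_def by blast
  then show ?thesis by (rule add_closure_in_add)
qed

text \<open>
  Following Dehy and Keller, take a right minimal \<open>add (M \<oplus> W)\<close>-approximation
  \<open>q: B \<rightarrow> N\<close> and its cocone \<open>f: A \<rightarrow> B\<close>. Rigidity
  of \<open>N\<close> makes every map \<open>A \<rightarrow> B\<close> a sum of maps factoring
  through \<open>f\<close> on either side, so \<open>M\<close> cannot be a common summand of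
  \<open>A\<close> and \<open>B\<close>. If \<open>M\<close> were a summand of \<open>B\<close>,
  then \<open>A\<close> would lie in \<open>add W\<close>, the triangle would split and
  \<open>N\<close> would be a summand of \<open>B\<close>. So \<open>B\<close> lies in \<open>add
  W\<close>, and all maps from \<open>M\<close> to \<open>N\<close> factor through it.
\<close>

theorem exchange:
  assumes T: "cluster_tilting C T" "dsum2 C T M W" and T': "cluster_tilting C T'" "dsum2 C T' N W"
    and M: "indecomposable C M" and N: "indecomposable C N"
    and MN: "\<not> isomorphic C N M" and MW: "\<not> retract M W"
  obtains B q where "in_add W B" "q \<in> Hom C B N" "\<And>v. v \<in> Hom C M N \<Longrightarrow> \<exists>a\<in>Hom C M B. v = q \<star> a"
proof -
  have ob: "T \<in> Obj C" "T' \<in> Obj C" "N \<in> Obj C" using ct_ob T T' indec_ob[OF N] by auto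
  have MT: "in_add T M" and WT: "in_add T W" using dsum2_retract[OF T(2)] retract_in_add by auto
  have NT': "in_add T' N" and WT': "in_add T' W" using dsum2_retract[OF T'(2)] retract_in_add by auto
  note W_T = in_add_trans[OF WT] and W_T' = in_add_trans[OF WT']
  have NW: "\<not> retract N W"
  proof
    assume "retract N W"
    then have "in_add T T'" using in_add_dsum2[OF W_T[OF retract_in_add] WT T'(2)] by blast
    then have "in_add T' M"
      using ct_rigid[OF T(1) _ MT] by (intro ct_max_left[OF T'(1) indec_ob[OF M]]) blast
    then have "retract M T'" by (rule indec_in_add[OF M])
    then have "retract M N" using indec_retract_dsum2[OF M _ T'(2)] MW by blast
    then show False using MN isomorphic_sym[OF retract_indec_isomorphic[OF _ indec_nz[OF M] N]] by blast
  qed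
  obtain B q where B: "in_add T B" and q: "q \<in> Hom C B N" and app: "\<And>g. g \<in> Hom C T N \<Longrightarrow> \<exists>h\<in>Hom C T B. g = q \<star> h"
    and min: "\<And>e. e \<in> Hom C B B \<Longrightarrow> e \<star> e = e \<Longrightarrow> q \<star> e = q \<Longrightarrow> e = Idn C B"
    using right_minimal_approx_exists[OF ob(1,3)] by metis
  have app': "\<exists>h\<in>Hom C Y B. g = q \<star> h" if "in_add T Y" "g \<in> Hom C Y N" for Y g
    using right_approx_in_add[OF q _ that] app by blast
  obtain A f w where t: "(f, q, w) \<in> Tri C" "f \<in> Hom C A B" "w \<in> Hom C N (so A)" using cocone[OF q] .
  note t' = t(1,2) q t(3)
  note z = tri_cmp_zero[OF t']
  have obA: "A \<in> Obj C" "B \<in> Obj C" using Hom_ob[OF t(2)] by auto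
  have A: "in_add T A"
  proof (rule ct_max_left[OF T(1) obA(1)])
    fix c assume c: "c \<in> Hom C T (so A)"
    have "sm f \<star> c = Zro C T (so B)"
      by (rule ct_rigid[OF T(1) in_add_refl[OF ob(1)] B cmp_hom[OF c S.F_hom[OF t(2)]]])
    then obtain b where b: "b \<in> Hom C T N" "c = w \<star> b" using tri_lift_shift[OF t' c] by blast
    obtain h where h: "h \<in> Hom C T B" "b = q \<star> h" using app[OF b(1)] by blast
    have "c = (w \<star> q) \<star> h" unfolding b(2) h(2) assoc[OF h(1) q t(3)] ..
    then show "c = Zro C T (so A)" using z(2) cmp_zro(2)[OF h(1) so_ob[OF obA(1)]] by simp
  qed
  \<comment> \<open>The obstruction to extending \<open>q g\<close> along \<open>f\<close> is a map from
    \<open>N\<close> to its own shift.\<close>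
  have DK: "\<exists>h'\<in>Hom C B B. \<exists>k\<in>Hom C A A. g = (h' \<star> f) \<boxplus> (f \<star> k)" if g: "g \<in> Hom C A B" for g
  proof -
    have qg: "q \<star> g \<in> Hom C A N" by (rule cmp_hom[OF g q])
    have "sm (q \<star> g) \<star> w = Zro C N (so N)" by (rule ct_rigid[OF T'(1) NT' NT' cmp_hom[OF t(3) S.F_hom[OF qg]]])
    then obtain h0 where h0: "h0 \<in> Hom C B N" "q \<star> g = h0 \<star> f" using tri_extend_shift[OF t' qg] by blast
    obtain h' where h': "h' \<in> Hom C B B" "h0 = q \<star> h'" using app'[OF B h0(1)] by blast
    let ?d = "g \<boxplus> neg (h' \<star> f)"
    have dh: "?d \<in> Hom C A B" by (rule pls_hom[OF g scl_hom[OF cmp_hom[OF t(2) h'(1)]]])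
    have "q \<star> ?d = (q \<star> g) \<boxplus> neg (h0 \<star> f)" unfolding h'(2) using q g h'(1) t(2) by (simp add: cs)
    also have "\<dots> = Zro C A N" unfolding h0(2) by (rule hom_module_laws(3)[OF cmp_hom[OF t(2) h0(1)]])
    finally obtain k where k: "k \<in> Hom C A A" "?d = f \<star> k" using tri_lift[OF t' dh] by blast
    have "g = (h' \<star> f) \<boxplus> ?d" using g h'(1) t(2) by (simp add: cs pls_ac)
    then show ?thesis using k h' by auto
  qed
  \<comment> \<open>Otherwise \<open>f al be\<close> is an idempotent of \<open>B\<close> killed by
    \<open>q\<close>, against minimality.\<close>
  have no_split: False if be: "be \<in> Hom C B M" and al: "al \<in> Hom C M A" and e: "be \<star> (f \<star> al) = Idn C M" for be al
  proof -
    let ?\<epsilon> = "(f \<star> al) \<star> be"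
    have fa: "f \<star> al \<in> Hom C M B" by (rule cmp_hom[OF al t(2)])
    have eh: "?\<epsilon> \<in> Hom C B B" by (rule cmp_hom[OF be fa])
    have ee: "?\<epsilon> \<star> ?\<epsilon> = ?\<epsilon>" using fa be cmp_reduce[OF e fa be] by (simp add: cs)
    have qe: "q \<star> ?\<epsilon> = Zro C B N"
    proof -
      have "q \<star> ?\<epsilon> = (q \<star> f) \<star> (al \<star> be)" using q t(2) al be by (simp add: cs)
      then show ?thesis using z(1) cmp_zro(2)[OF cmp_hom[OF be al] ob(3)] by simp
    qed
    have oh: "Idn C B \<boxplus> neg ?\<epsilon> \<in> Hom C B B" using pls_hom[OF idn_hom[OF obA(2)] scl_hom[OF eh]] .
    have "(Idn C B \<boxplus> neg ?\<epsilon>) \<star> (Idn C B \<boxplus> neg ?\<epsilon>) = Idn C B \<boxplus> neg ?\<epsilon>"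
    proof -
      have "\<And>x. x \<in> Hom C B B \<Longrightarrow> x \<star> x = x \<Longrightarrow> (Idn C B \<boxplus> neg x) \<star> (Idn C B \<boxplus> neg x) = Idn C B \<boxplus> neg x"
        using obA by (simp add: cs)
      then show ?thesis using eh ee by blast
    qed
    moreover have "q \<star> (Idn C B \<boxplus> neg ?\<epsilon>) = q"
      using distrib(1)[OF idn_hom[OF obA(2)] q scl_hom[OF eh, of "-1"]] distrib(3)[OF eh q, of "-1"] qe cmp_idn(1)[OF q]
        hom_module_laws(14)[OF zro_hom[OF obA(2) ob(3)]] hom_module_laws(1)[OF q] by simp
    ultimately have "Idn C B \<boxplus> neg ?\<epsilon> = Idn C B" using min oh by blast
    then have "(Idn C B \<boxplus> neg ?\<epsilon>) \<boxplus> ?\<epsilon> = Idn C B \<boxplus> ?\<epsilon>" by simp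
    then have "neg (Idn C B) \<boxplus> ((Idn C B \<boxplus> neg ?\<epsilon>) \<boxplus> ?\<epsilon>) = neg (Idn C B) \<boxplus> (Idn C B \<boxplus> ?\<epsilon>)" by simp
    moreover have "\<And>x. x \<in> Hom C B B \<Longrightarrow> neg (Idn C B) \<boxplus> ((Idn C B \<boxplus> neg x) \<boxplus> x) = Zro C B B"
      "\<And>x. x \<in> Hom C B B \<Longrightarrow> neg (Idn C B) \<boxplus> (Idn C B \<boxplus> x) = x" using obA by (simp_all add: cs)
    ultimately have "?\<epsilon> = Zro C B B" using eh by simp
    then have "be \<star> (?\<epsilon> \<star> (f \<star> al)) = Zro C M M"
      using cmp_zro(2)[OF fa obA(2)] cmp_zro(1)[OF be indec_ob[OF M]] by simp
    moreover have "be \<star> (?\<epsilon> \<star> (f \<star> al)) = Idn C M"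
      unfolding assoc[OF fa be fa] e using cmp_idn(1)[OF fa] e by simp
    ultimately show False using zero_objectI[OF indec_ob[OF M]] indec_nz[OF M] by simp
  qed
  have common: "\<not> (retract M A \<and> retract M B)"
  proof
    assume "retract M A \<and> retract M B"
    then obtain i p j r where h: "i \<in> Hom C M A" "p \<in> Hom C A M" "p \<star> i = Idn C M"
      "j \<in> Hom C M B" "r \<in> Hom C B M" "r \<star> j = Idn C M" unfolding retract_def by blast
    obtain h' k where g: "h' \<in> Hom C B B" "k \<in> Hom C A A" "j \<star> p = (h' \<star> f) \<boxplus> (f \<star> k)"
      using DK[OF cmp_hom[OF h(2,4)]] by blast
    have hf: "h' \<star> f \<in> Hom C A B" and fk: "f \<star> k \<in> Hom C A B" using g t(2) cmp_hom by blast+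
    have "r \<star> ((j \<star> p) \<star> i) = Idn C M" using h cmp_reduce[OF h(6,4,5)] by (simp add: cs)
    moreover have "j \<star> p \<in> asum A B {h' \<star> f, f \<star> k}" unfolding g(3) by (intro asum_pls asum_gen) auto
    moreover have "{h' \<star> f, f \<star> k} \<subseteq> Hom C A B" using hf fk by blast
    ultimately obtain y x where y: "y \<in> {h' \<star> f, f \<star> k}" "iso_pair C M M (r \<star> (y \<star> i)) x"
      using local_sum_cmp[OF M _ _ h(1,5), of "j \<star> p" "{h' \<star> f, f \<star> k}"] by blast
    have x: "x \<in> Hom C M M" "x \<star> (r \<star> (y \<star> i)) = Idn C M" using y(2) unfolding iso_pair_def by auto
    from y(1) consider "y = h' \<star> f" | "y = f \<star> k" by blast
    then show False
    proof cases
      case 1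
      have "((x \<star> r) \<star> h') \<star> (f \<star> i) = Idn C M" using x h(1,5) g(1) t(2) unfolding 1 by (simp add: cs)
      then show False using no_split[OF _ h(1), of "(x \<star> r) \<star> h'"] cmp_hom[OF g(1) cmp_hom[OF h(5) x(1)]] by blast
    next
      case 2
      have "(x \<star> r) \<star> (f \<star> (k \<star> i)) = Idn C M" using x h(1,5) g(2) t(2) unfolding 2 by (simp add: cs)
      then show False using no_split[OF cmp_hom[OF h(5) x(1)] cmp_hom[OF h(1) g(2)]] by blast
    qed
  qed
  have toW: "in_add W X" if X: "in_add T X" "\<not> retract M X" for X
  proof (rule in_add_indecI[OF in_add_ob[OF X(1)]])
    fix Y assume Y: "indecomposable C Y" "retract Y X"
    have "retract Y T" by (rule indec_in_add[OF Y(1) in_add_retract[OF X(1) Y(2)]])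
    then consider "retract Y M" | "retract Y W" using indec_retract_dsum2[OF Y(1) _ T(2)] by blast
    then show "retract Y W"
    proof cases
      case 1
      then have "isomorphic C Y M" by (rule retract_indec_isomorphic[OF _ indec_nz[OF Y(1)] M])
      then have "retract M X" using isomorphic_retract retract_trans Y(2) by blast
      then show ?thesis using X(2) by blast
    qed
  qed
  have "\<not> retract M B"
  proof
    assume "retract M B"
    then have "in_add W A" using common toW[OF A] by blast
    then have "w = Zro C N (so A)" using ct_rigid[OF T'(1) NT' W_T' t(3)] by blast
    then have "w \<star> Idn C N = Zro C N (so A)" using cmp_idn(1)[OF t(3)] by simp
    moreover have n: "neg (sm f) \<in> Hom C (so A) (so B)" using S.F_hom[OF t(2)] scl_hom by blast
    ultimately obtain s where s: "s \<in> Hom C N B" "Idn C N = q \<star> s"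
      using tri_lift[OF rotate[OF t'] q t(3) n idn_hom[OF ob(3)]] by blast
    have "retract N B" by (rule retractI[OF s(1) q s(2)[symmetric]])
    then have "retract N T" by (rule indec_in_add[OF N in_add_retract[OF B]])
    then have "retract N M" using indec_retract_dsum2[OF N _ T(2)] NW by blast
    then show False using MN retract_indec_isomorphic[OF _ indec_nz[OF N] M] by blast
  qed
  then have "in_add W B" by (rule toW[OF B])
  then show thesis using q app'[OF MT] by (rule that)
qed

end

section \<open>Characters of quotients of path algebras\<close>

context wf_digraph
begin

lemma awlast_append: "awlast u (p @ q) = awlast (awlast u p) q"
  by (induction p arbitrary: u) (auto simp: awalk_verts_non_Nil)

lemma path_iff: "(u, p) \<in> paths G \<longleftrightarrow> awalk u p (awlast u p)"
proof
  assume "(u, p) \<in> paths G"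
  then obtain v where "awalk u p v" unfolding paths_def by blast
  then show "awalk u p (awlast u p)" by auto
qed (auto simp: paths_def)

lemma path_append: "(u, p) \<in> paths G \<Longrightarrow> (awlast u p, q) \<in> paths G \<Longrightarrow> (u, p @ q) \<in> paths G"
  unfolding path_iff using awalk_appendI[of u p "awlast u p" q] awlast_append[of u p q] by simp

lemma path_verts: "(u, p) \<in> paths G \<Longrightarrow> u \<in> verts G" "(u, p) \<in> paths G \<Longrightarrow> awlast u p \<in> verts G"
  unfolding path_iff by (auto simp: awalk_def) (metis awalk_def awalk_last_in_verts)?

lemma trivial_path: "v \<in> verts G \<Longrightarrow> (v, []) \<in> paths G"
  unfolding path_iff by (simp add: awalk_Nil_iff)

abbreviation path_ring :: "('k::field, ('a \<times> 'b list) \<Rightarrow> 'k) module" where "path_ring \<equiv> path_algebra G"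

lemma path_ring_mult: "(f \<otimes>\<^bsub>path_ring\<^esub> g) (u, p) =
    (\<Sum>i\<le>length p. f (awlast u (take i p), drop i p) * g (u, take i p))"
  by (simp add: path_algebra_def complete_path_algebra_def)

lemma path_ring_simps:
  "f \<in> carrier path_ring \<longleftrightarrow> (\<forall>w. w \<notin> paths G \<longrightarrow> f w = 0) \<and> finite {w. f w \<noteq> 0}"
  "(f \<oplus>\<^bsub>path_ring\<^esub> g) = (\<lambda>w. f w + g w)" "\<zero>\<^bsub>path_ring\<^esub> = (\<lambda>w. 0)"
  "\<one>\<^bsub>path_ring\<^esub> = (\<lambda>(u, p). if u \<in> verts G \<and> p = [] then 1 else 0)"
  "c \<odot>\<^bsub>path_ring\<^esub> f = (\<lambda>w. c * f w)"
  by (auto simp: path_algebra_def complete_path_algebra_def)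

lemma path_ring_mult_nz:
  assumes "(f \<otimes>\<^bsub>path_ring\<^esub> g) (u, p) \<noteq> 0"
  obtains q r where "p = q @ r" "f (awlast u q, r) \<noteq> 0" "g (u, q) \<noteq> 0"
proof -
  obtain i where "f (awlast u (take i p), drop i p) * g (u, take i p) \<noteq> 0"
    using assms unfolding path_ring_mult by (meson sum.not_neutral_contains_not_neutral)
  then show thesis using that[of "take i p" "drop i p"] by auto
qed

text \<open>
  Supports are finite since every path in the support of a product is a concatenation of paths in
  the supports of the factors.
\<close>

lemma path_ring_closed:
  assumes f: "f \<in> carrier path_ring" and g: "g \<in> carrier path_ring"
  shows "f \<otimes>\<^bsub>path_ring\<^esub> g \<in> carrier path_ring"
  unfolding path_ring_simps
proof (intro conjI allI impI)
  fix w assume w: "w \<notin> paths G"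
  obtain u p where up: "w = (u, p)" by (cases w)
  show "(f \<otimes>\<^bsub>path_ring\<^esub> g) w = 0"
  proof (rule ccontr)
    assume "(f \<otimes>\<^bsub>path_ring\<^esub> g) w \<noteq> 0"
    then obtain q r where "p = q @ r" "f (awlast u q, r) \<noteq> 0" "g (u, q) \<noteq> 0"
      using path_ring_mult_nz up by metis
    then show False using path_append[of u q r] f g w up unfolding path_ring_simps by blast
  qed
next
  let ?S = "(\<lambda>(x, y). (fst y, snd y @ snd x)) ` ({w. f w \<noteq> 0} \<times> {w. g w \<noteq> 0})"
  have "{w. (f \<otimes>\<^bsub>path_ring\<^esub> g) w \<noteq> 0} \<subseteq> ?S"
  proof
    fix w assume "w \<in> {w. (f \<otimes>\<^bsub>path_ring\<^esub> g) w \<noteq> 0}"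
    moreover obtain u p where up: "w = (u, p)" by (cases w)
    ultimately obtain q r where *: "p = q @ r" "f (awlast u q, r) \<noteq> 0" "g (u, q) \<noteq> 0"
      using path_ring_mult_nz by blast
    have "((awlast u q, r), (u, q)) \<in> {w. f w \<noteq> 0} \<times> {w. g w \<noteq> 0}" using * by blast
    then have "(\<lambda>(x, y). (fst y, snd y @ snd x)) ((awlast u q, r), (u, q)) \<in> ?S" by (rule imageI)
    then show "w \<in> ?S" unfolding up *(1) by simp
  qed
  moreover have "finite ?S" using f g unfolding path_ring_simps by blast
  ultimately show "finite {w. (f \<otimes>\<^bsub>path_ring\<^esub> g) w \<noteq> 0}" by (rule finite_subset)
qed

text \<open>Both bracketings of a triple product sum over the decompositions of a path into three pieces.\<close>

lemma path_ring_assoc: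
  fixes f g h :: "('a \<times> 'b list) \<Rightarrow> 'k::field"
  shows "(f \<otimes>\<^bsub>path_ring\<^esub> g) \<otimes>\<^bsub>path_ring\<^esub> h = f \<otimes>\<^bsub>path_ring\<^esub> (g \<otimes>\<^bsub>path_ring\<^esub> h)"
proof (rule ext, clarify)
  fix u p
  let ?t = "\<lambda>i j. f (awlast u (take i p), drop i p) * (g (awlast u (take j p), drop j (take i p)) * h (u, take j p))"
  have "((f \<otimes>\<^bsub>path_ring\<^esub> g) \<otimes>\<^bsub>path_ring\<^esub> h) (u, p) =
      (\<Sum>j\<le>length p. \<Sum>m\<le>length p - j. ?t (j + m) j)"
    unfolding path_ring_mult
  proof (rule sum.cong[OF refl])
    fix j assume "j \<in> {..length p}"
    then have j: "j \<le> length p" by simp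
    have "awlast (awlast u (take j p)) (take m (drop j p)) = awlast u (take (j + m) p)" for m
      by (simp add: take_add flip: awlast_append)
    moreover have "drop j (take (j + m) p) = take m (drop j p)" for m by (simp add: take_drop add.commute)
    ultimately show "(\<Sum>i\<le>length (drop j p). f (awlast (awlast u (take j p)) (take i (drop j p)), drop i (drop j p)) *
          g (awlast u (take j p), take i (drop j p))) * h (u, take j p) = (\<Sum>m\<le>length p - j. ?t (j + m) j)"
      using j by (simp add: sum_distrib_right mult.assoc add.commute)
  qed
  also have "\<dots> = (\<Sum>(j, m)\<in>(SIGMA j:{..length p}. {..length p - j}). ?t (j + m) j)"
    by (simp add: sum.Sigma)
  also have "\<dots> = (\<Sum>(i, j)\<in>(SIGMA i:{..length p}. {..i}). ?t i j)"
    by (rule sum.reindex_bij_witness[where i = "\<lambda>(i, j). (j, i - j)" and j = "\<lambda>(j, m). (j + m, j)"]) auto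
  also have "\<dots> = (\<Sum>i\<le>length p. \<Sum>j\<le>i. ?t i j)" by (simp add: sum.Sigma)
  also have "\<dots> = (f \<otimes>\<^bsub>path_ring\<^esub> (g \<otimes>\<^bsub>path_ring\<^esub> h)) (u, p)"
    unfolding path_ring_mult by (rule sum.cong[OF refl]) (simp add: sum_distrib_left min_absorb1 min_absorb2)
  finally show "((f \<otimes>\<^bsub>path_ring\<^esub> g) \<otimes>\<^bsub>path_ring\<^esub> h) (u, p) = (f \<otimes>\<^bsub>path_ring\<^esub> (g \<otimes>\<^bsub>path_ring\<^esub> h)) (u, p)" .
qed

lemma path_ring_unit:
  assumes f: "f \<in> carrier path_ring"
  shows "\<one>\<^bsub>path_ring\<^esub> \<otimes>\<^bsub>path_ring\<^esub> f = f" "f \<otimes>\<^bsub>path_ring\<^esub> \<one>\<^bsub>path_ring\<^esub> = f"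
proof -
  have z: "f (u, p) = 0" if "u \<notin> verts G \<or> awlast u p \<notin> verts G" for u p
    using f that path_verts unfolding path_ring_simps by blast
  show "\<one>\<^bsub>path_ring\<^esub> \<otimes>\<^bsub>path_ring\<^esub> f = f"
  proof (rule ext, clarify)
    fix u p
    have "(\<one>\<^bsub>path_ring\<^esub> \<otimes>\<^bsub>path_ring\<^esub> f) (u, p) = (\<Sum>i\<le>length p. if i = length p then f (u, p) else 0)"
      unfolding path_ring_mult by (rule sum.cong[OF refl]) (use z in \<open>auto simp: path_ring_simps\<close>)
    then show "(\<one>\<^bsub>path_ring\<^esub> \<otimes>\<^bsub>path_ring\<^esub> f) (u, p) = f (u, p)" by simp
  qed
  show "f \<otimes>\<^bsub>path_ring\<^esub> \<one>\<^bsub>path_ring\<^esub> = f"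
  proof (rule ext, clarify)
    fix u p
    have "(f \<otimes>\<^bsub>path_ring\<^esub> \<one>\<^bsub>path_ring\<^esub>) (u, p) = (\<Sum>i\<le>length p. if i = 0 then f (u, p) else 0)"
      unfolding path_ring_mult by (rule sum.cong[OF refl]) (use z in \<open>auto simp: path_ring_simps\<close>)
    then show "(f \<otimes>\<^bsub>path_ring\<^esub> \<one>\<^bsub>path_ring\<^esub>) (u, p) = f (u, p)" by simp
  qed
qed

lemma path_ring_add_closed:
  assumes "f \<in> carrier path_ring" "g \<in> carrier path_ring" shows "(\<lambda>w. f w + g w) \<in> carrier path_ring"
  unfolding path_ring_simps
proof (intro conjI)
  have "{w. f w + g w \<noteq> 0} \<subseteq> {w. f w \<noteq> 0} \<union> {w. g w \<noteq> 0}" by auto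
  then show "finite {w. f w + g w \<noteq> 0}" using assms finite_subset unfolding path_ring_simps by blast
qed (use assms in \<open>simp add: path_ring_simps\<close>)

lemma path_ring_smult_closed:
  assumes "f \<in> carrier path_ring" shows "(\<lambda>w. c * f w) \<in> carrier path_ring"
proof -
  have "{w. c * f w \<noteq> 0} \<subseteq> {w. f w \<noteq> 0}" by auto
  then show ?thesis using assms finite_subset unfolding path_ring_simps by auto
qed

lemma path_ring_ring:
  assumes "finite (verts G)"
  shows "ring (path_ring :: ('k::field, ('a \<times> 'b list) \<Rightarrow> 'k) module)"
proof (rule ringI)
  show "abelian_group (path_ring :: ('k, ('a \<times> 'b list) \<Rightarrow> 'k) module)"
  proof (rule abelian_groupI)
    fix f :: "('a \<times> 'b list) \<Rightarrow> 'k" assume f: "f \<in> carrier path_ring"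
    show "\<exists>y\<in>carrier path_ring. y \<oplus>\<^bsub>path_ring\<^esub> f = \<zero>\<^bsub>path_ring\<^esub>"
      using path_ring_smult_closed[OF f, of "-1"] by (intro bexI[of _ "\<lambda>w. - 1 * f w"]) (simp_all add: path_ring_simps(2,3))
  qed (auto simp: path_ring_simps(2,3) add_ac intro: path_ring_add_closed, simp add: path_ring_simps)
  have "{w. (case w of (u, p :: 'b list) \<Rightarrow> if u \<in> verts G \<and> p = [] then 1 :: 'k else 0) \<noteq> 0} \<subseteq> (\<lambda>u. (u, [])) ` verts G"
    by (auto split: if_splits)
  then have fin: "finite {w. (case w of (u, p :: 'b list) \<Rightarrow> if u \<in> verts G \<and> p = [] then 1 :: 'k else 0) \<noteq> 0}"
    using assms finite_subset by blast
  have "\<one>\<^bsub>path_ring\<^esub> \<in> (carrier path_ring :: (('a \<times> 'b list) \<Rightarrow> 'k) set)"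
    unfolding path_ring_simps using fin trivial_path by auto
  then show "monoid (path_ring :: ('k, ('a \<times> 'b list) \<Rightarrow> 'k) module)"
    by (intro monoidI) (simp_all add: path_ring_closed path_ring_assoc path_ring_unit)
qed (rule ext, clarify, simp add: path_ring_mult path_ring_simps(2) distrib_left distrib_right sum.distrib)+

lemma vertex_value_ideal:
  assumes fin: "finite (verts G)" and v: "v \<in> verts G"
  shows "ideal {f \<in> carrier path_ring. f (v, []) = 0} (path_ring :: ('k::field, ('a \<times> 'b list) \<Rightarrow> 'k) module)"
proof -
  interpret R: ring "path_ring :: ('k, ('a \<times> 'b list) \<Rightarrow> 'k) module" by (rule path_ring_ring[OF fin])
  have m: "(f \<otimes>\<^bsub>path_ring\<^esub> g) (v, []) = f (v, []) * g (v, [])" for f g :: "('a \<times> 'b list) \<Rightarrow> 'k"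
    by (simp add: path_ring_mult)
  show ?thesis
  proof (rule idealI)
    show "ring (path_ring :: ('k, ('a \<times> 'b list) \<Rightarrow> 'k) module)" by (rule R.ring_axioms)
    show "subgroup {f \<in> carrier path_ring. f (v, []) = 0} (add_monoid (path_ring :: ('k, ('a \<times> 'b list) \<Rightarrow> 'k) module))"
    proof (rule R.add.subgroupI)
      fix f assume f: "f \<in> {f \<in> carrier path_ring. f (v, []) = (0::'k)}"
      have "(\<lambda>w. - 1 * f w) \<oplus>\<^bsub>path_ring\<^esub> f = \<zero>\<^bsub>path_ring\<^esub>" by (simp add: path_ring_simps(2,3))
      then have "\<ominus>\<^bsub>path_ring\<^esub> f = (\<lambda>w. - 1 * f w)"
        using R.minus_equality f path_ring_smult_closed[of f "-1"] by simp
      then show "\<ominus>\<^bsub>path_ring\<^esub> f \<in> {f \<in> carrier path_ring. f (v, []) = 0}"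
        using f path_ring_smult_closed[of f "-1"] by simp
    next
      show "{f \<in> carrier path_ring. f (v, []) = (0::'k)} \<noteq> {}"
        using R.zero_closed by (auto simp: path_ring_simps(3))
    qed (auto simp: path_ring_simps(2) path_ring_add_closed)
  qed (simp_all add: m path_ring_closed)
qed

text \<open>
  Evaluation at the trivial path at \<open>v\<close> is an algebra homomorphism to the ground field. It kills
  all paths of positive length, so it descends to any quotient by relations of positive length.
  The trivial paths show that different vertices give different characters.
\<close>

theorem vertex_characters:
  fixes A :: "('k::field, 'c) module"
  assumes fin: "finite (verts G)" and n: "n \<ge> 1" and A: "given_by_paths_of_length n G A"
  obtains \<chi> :: "'a \<Rightarrow> 'c \<Rightarrow> 'k" where
    "\<And>v a b. v \<in> verts G \<Longrightarrow> a \<in> carrier A \<Longrightarrow> b \<in> carrier A \<Longrightarrow> \<chi> v (a \<otimes>\<^bsub>A\<^esub> b) = \<chi> v a * \<chi> v b"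
    "\<And>v a b. v \<in> verts G \<Longrightarrow> a \<in> carrier A \<Longrightarrow> b \<in> carrier A \<Longrightarrow> \<chi> v (a \<oplus>\<^bsub>A\<^esub> b) = \<chi> v a + \<chi> v b"
    "\<And>v a c. v \<in> verts G \<Longrightarrow> a \<in> carrier A \<Longrightarrow> \<chi> v (c \<odot>\<^bsub>A\<^esub> a) = c * \<chi> v a"
    "\<And>v. v \<in> verts G \<Longrightarrow> \<chi> v \<one>\<^bsub>A\<^esub> = 1"
    "\<And>v w. v \<in> verts G \<Longrightarrow> w \<in> verts G \<Longrightarrow> v \<noteq> w \<Longrightarrow> \<exists>a\<in>carrier A. \<chi> v a \<noteq> \<chi> w a"
proof -
  let ?R = "path_ring :: ('k, ('a \<times> 'b list) \<Rightarrow> 'k) module"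
  let ?S = "{path_element (u, p) | u p. (u, p) \<in> paths G \<and> length p = n} :: (('a \<times> 'b list) \<Rightarrow> 'k) set"
  let ?I = "genideal ?R ?S"
  interpret R: ring ?R by (rule path_ring_ring[OF fin])
  have pe: "path_element w \<in> carrier ?R" if "w \<in> paths G" for w
    using that unfolding path_ring_simps path_element_def by (auto simp: Collect_conv_if)
  then have SR: "?S \<subseteq> carrier ?R" by blast
  interpret I: ideal ?I ?R by (rule R.genideal_ideal[OF SR])
  have I0: "f (v, []) = 0" if "f \<in> ?I" "v \<in> verts G" for f v
  proof -
    have "?S \<subseteq> {f \<in> carrier ?R. f (v, []) = 0}" using SR n by (auto simp: path_element_def)
    then show ?thesis using R.genideal_minimal[OF vertex_value_ideal[OF fin that(2)]] that(1) by blast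
  qed
  obtain h where h: "h \<in> ring_iso (?R Quot ?I) A"
    and hs: "\<And>c x. x \<in> carrier ?R \<Longrightarrow> h (?I +>\<^bsub>?R\<^esub> (c \<odot>\<^bsub>?R\<^esub> x)) = c \<odot>\<^bsub>A\<^esub> h (?I +>\<^bsub>?R\<^esub> x)"
    using A unfolding given_by_paths_of_length_def quot_algebra_iso_def by blast
  let ?h = "\<lambda>x. h (?I +>\<^bsub>?R\<^esub> x)"
  have hh: "h \<in> ring_hom (?R Quot ?I) A" and hb: "bij_betw h (carrier (?R Quot ?I)) (carrier A)"
    using h unfolding ring_iso_def by auto
  have co: "?I +>\<^bsub>?R\<^esub> x \<in> carrier (?R Quot ?I)" if "x \<in> carrier ?R" for x
    using that R.a_rcosetsI[OF I.a_subset that] unfolding FactRing_def by simp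
  have surj: "\<exists>x\<in>carrier ?R. ?h x = a" if "a \<in> carrier A" for a
  proof -
    have "a \<in> h ` carrier (?R Quot ?I)" using that hb unfolding bij_betw_def by blast
    then show ?thesis unfolding FactRing_def A_RCOSETS_def' by auto
  qed
  have hc: "?h x \<in> carrier A" if "x \<in> carrier ?R" for x using co[OF that] hb unfolding bij_betw_def by blast
  have val: "x (v, []) = y (v, [])" if "x \<in> carrier ?R" "y \<in> carrier ?R" "?h x = ?h y" "v \<in> verts G" for x y v
  proof -
    have "?I +>\<^bsub>?R\<^esub> x = ?I +>\<^bsub>?R\<^esub> y" using that co hb unfolding bij_betw_def inj_on_def by blast
    then have "x \<in> ?I +>\<^bsub>?R\<^esub> y" using I.a_rcos_self[OF that(1)] by simp
    then obtain i where i: "i \<in> ?I" "x = i \<oplus>\<^bsub>?R\<^esub> y" unfolding a_r_coset_def' by blast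
    then show ?thesis using I0[OF i(1) that(4)] by (simp add: path_ring_simps(2))
  qed
  have hm: "?h (x \<otimes>\<^bsub>?R\<^esub> y) = ?h x \<otimes>\<^bsub>A\<^esub> ?h y" if "x \<in> carrier ?R" "y \<in> carrier ?R" for x y
    using ring_hom_mult[OF hh co[OF that(1)] co[OF that(2)]] I.rcoset_mult_add[OF that] unfolding FactRing_def by simp
  have ha: "?h (x \<oplus>\<^bsub>?R\<^esub> y) = ?h x \<oplus>\<^bsub>A\<^esub> ?h y" if "x \<in> carrier ?R" "y \<in> carrier ?R" for x y
    using ring_hom_add[OF hh co[OF that(1)] co[OF that(2)]] I.a_rcos_sum[OF that] unfolding FactRing_def by simp
  have h1: "?h \<one>\<^bsub>?R\<^esub> = \<one>\<^bsub>A\<^esub>" using ring_hom_one[OF hh] unfolding FactRing_def by simp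
  define \<chi> where "\<chi> v a = (SOME x. x \<in> carrier ?R \<and> ?h x = a) (v, [])" for v a
  have chi: "\<chi> v (?h x) = x (v, [])" if "v \<in> verts G" "x \<in> carrier ?R" for v x
  proof -
    have "(SOME x'. x' \<in> carrier ?R \<and> ?h x' = ?h x) \<in> carrier ?R \<and> ?h (SOME x'. x' \<in> carrier ?R \<and> ?h x' = ?h x) = ?h x"
      by (rule someI[of _ x]) (use that in simp)
    then show ?thesis unfolding \<chi>_def using val that by blast
  qed
  show thesis
  proof (rule that[of \<chi>])
    fix v w assume v: "v \<in> verts G" and w: "w \<in> verts G" "v \<noteq> w"
    have "path_element (v, []) \<in> carrier ?R" by (rule pe[OF trivial_path[OF v]])
    then show "\<exists>a\<in>carrier A. \<chi> v a \<noteq> \<chi> w a"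
      using chi v w hc by (intro bexI[of _ "?h (path_element (v, []))"]) (auto simp: path_element_def)
  next
    fix v a b assume v: "v \<in> verts G" and ab: "a \<in> carrier A" "b \<in> carrier A"
    obtain x where x: "x \<in> carrier ?R" "?h x = a" using surj[OF ab(1)] by blast
    obtain y where y: "y \<in> carrier ?R" "?h y = b" using surj[OF ab(2)] by blast
    show "\<chi> v (a \<otimes>\<^bsub>A\<^esub> b) = \<chi> v a * \<chi> v b"
      using chi[OF v x(1)] chi[OF v y(1)] chi[OF v R.m_closed[OF x(1) y(1)]] hm[OF x(1) y(1)] x y
      by (simp add: path_ring_mult)
    show "\<chi> v (a \<oplus>\<^bsub>A\<^esub> b) = \<chi> v a + \<chi> v b"
      using chi[OF v x(1)] chi[OF v y(1)] chi[OF v R.a_closed[OF x(1) y(1)]] ha[OF x(1) y(1)] x y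
      by (simp add: path_ring_simps(2))
  next
    fix v a and c :: 'k assume v: "v \<in> verts G" and a: "a \<in> carrier A"
    obtain x where x: "x \<in> carrier ?R" "?h x = a" using surj[OF a] by blast
    have "c \<odot>\<^bsub>?R\<^esub> x \<in> carrier ?R" using path_ring_smult_closed[OF x(1)] by (simp add: path_ring_simps(5))
    then show "\<chi> v (c \<odot>\<^bsub>A\<^esub> a) = c * \<chi> v a"
      using chi[OF v x(1)] chi[OF v, of "c \<odot>\<^bsub>?R\<^esub> x"] hs[OF x(1), of c] x by (simp add: path_ring_simps(5))
  next
    fix v assume v: "v \<in> verts G"
    show "\<chi> v \<one>\<^bsub>A\<^esub> = 1" using chi[OF v R.one_closed] h1 v by (simp add: path_ring_simps(4))
  qed
qed

end

section \<open>The quotient by an additive subcategory\<close>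

context lincat
begin

lemma dsum_append:
  assumes 1: "dsum C A {..<n::nat} (\<lambda>_. T)" and 2: "dsum C B {..<m::nat} (\<lambda>_. T)" and Z: "dsum2 C Z A B"
  shows "dsum C Z {..<n + m} (\<lambda>_. T)"
proof -
  obtain i p where ip: "\<forall>k\<in>{..<n}. i k \<in> Hom C T A \<and> p k \<in> Hom C A T"
    "\<forall>k\<in>{..<n}. \<forall>l\<in>{..<n}. p l \<star> i k = (if k = l then Idn C T else Zro C T T)"
    "finsum (End C A) (\<lambda>k. i k \<star> p k) {..<n} = Idn C A"
    using 1 unfolding dsum_def by blast
  obtain j q where jq: "\<forall>k\<in>{..<m}. j k \<in> Hom C T B \<and> q k \<in> Hom C B T"
    "\<forall>k\<in>{..<m}. \<forall>l\<in>{..<m}. q l \<star> j k = (if k = l then Idn C T else Zro C T T)"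
    "finsum (End C B) (\<lambda>k. j k \<star> q k) {..<m} = Idn C B"
    using 2 unfolding dsum_def by blast
  obtain a r b s where d: "a \<in> Hom C A Z" "r \<in> Hom C Z A" "b \<in> Hom C B Z" "s \<in> Hom C Z B"
    "r \<star> a = Idn C A" "s \<star> b = Idn C B" "s \<star> a = Zro C A B" "r \<star> b = Zro C B A" "(a \<star> r) \<boxplus> (b \<star> s) = Idn C Z"
    by (rule dsum2D[OF Z]) (rule that)
  have ob: "A \<in> Obj C" "B \<in> Obj C" "Z \<in> Obj C" using Hom_ob[OF d(1)] Hom_ob[OF d(3)] by auto
  let ?i = "\<lambda>k. if k < n then a \<star> i k else b \<star> j (k - n)"
  let ?p = "\<lambda>k. if k < n then p k \<star> r else q (k - n) \<star> s"
  have ih: "i k \<in> Hom C T A" "p k \<in> Hom C A T" if "k < n" for k using ip(1) that by auto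
  have jh: "j (k - n) \<in> Hom C T B" "q (k - n) \<in> Hom C B T" if "k < n + m" "\<not> k < n" for k using jq(1) that by auto
  have T: "T \<in> Obj C" if "n + m > 0"
  proof (cases "n > 0")
    case True then show ?thesis using ih[of 0] Hom_ob by blast
  next
    case False then show ?thesis using jh[of 0] that Hom_ob by auto
  qed
  have rel: "?p l \<star> ?i k = (if k = l then Idn C T else Zro C T T)" if kl: "k < n + m" "l < n + m" for k l
  proof -
    have TT: "T \<in> Obj C" by (rule T) (use kl in linarith)
    consider "k < n" "l < n" | "k < n" "\<not> l < n" | "\<not> k < n" "l < n" | "\<not> k < n" "\<not> l < n" by blast
    then show ?thesis
    proof cases
      case 1
      have "(p l \<star> r) \<star> (a \<star> i k) = p l \<star> i k" using ih 1 d(1,2) cmp_reduce[OF d(5,1,2)] by (simp add: cs)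
      then show ?thesis using ip(2) 1 by simp
    next
      case 2
      have "(q (l - n) \<star> s) \<star> (a \<star> i k) = q (l - n) \<star> ((s \<star> a) \<star> i k)" using ih[OF 2(1)] jh[OF kl(2) 2(2)] d(1,4) by (simp add: cs)
      then show ?thesis using 2 ih[OF 2(1)] jh[OF kl(2) 2(2)] ob TT unfolding d(7) by (simp add: cs)
    next
      case 3
      have "(p l \<star> r) \<star> (b \<star> j (k - n)) = p l \<star> ((r \<star> b) \<star> j (k - n))" using ih[OF 3(2)] jh[OF kl(1) 3(1)] d(2,3) by (simp add: cs)
      then show ?thesis using 3 ih[OF 3(2)] jh[OF kl(1) 3(1)] ob TT unfolding d(8) by (auto simp: cs)
    next
      case 4
      have "(q (l - n) \<star> s) \<star> (b \<star> j (k - n)) = q (l - n) \<star> j (k - n)"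
        using jh[OF kl(2) 4(2)] jh[OF kl(1) 4(1)] d(3,4) cmp_reduce[OF d(6,3,4)] by (simp add: cs)
      moreover have "q (l - n) \<star> j (k - n) = (if k - n = l - n then Idn C T else Zro C T T)"
        using jq(2) 4 kl by simp
      ultimately show ?thesis using 4 by auto
    qed
  qed
  interpret E: kspace "End C Z" using hom_kspace ob by blast
  interpret EA: kspace "End C A" using hom_kspace ob by blast
  interpret EB: kspace "End C B" using hom_kspace ob by blast
  interpret LA: klinear "End C A" "End C Z" "\<lambda>f. a \<star> (f \<star> r)" by (rule klinear_cmp[OF d(2,1)])
  interpret LB: klinear "End C B" "End C Z" "\<lambda>f. b \<star> (f \<star> s)" by (rule klinear_cmp[OF d(4,3)])
  have "finsum (End C Z) (\<lambda>k. ?i k \<star> ?p k) {..<n + m} =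
      finsum (End C Z) (\<lambda>k. ?i k \<star> ?p k) {..<n} \<boxplus> finsum (End C Z) (\<lambda>k. ?i k \<star> ?p k) {n..<n + m}"
  proof -
    have u: "{..<n + m} = {..<n} \<union> {n..<n + m}" by auto
    have sp: "finsum (End C Z) g {..<n + m} = finsum (End C Z) g {..<n} \<boxplus> finsum (End C Z) g {n..<n + m}"
      if "\<And>k. k < n + m \<Longrightarrow> g k \<in> Hom C Z Z" for g
      unfolding u by (subst E.M.finsum_Un_disjoint) (use that in auto)
    have "?i k \<star> ?p k \<in> Hom C Z Z" if "k < n + m" for k
      using ih jh that d(1-4) by (auto intro!: cmp_hom)
    then show ?thesis by (rule sp)
  qed
  moreover have "finsum (End C Z) (\<lambda>k. ?i k \<star> ?p k) {..<n} = a \<star> r"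
  proof -
    have "finsum (End C Z) (\<lambda>k. ?i k \<star> ?p k) {..<n} = finsum (End C Z) (\<lambda>k. a \<star> ((i k \<star> p k) \<star> r)) {..<n}"
      by (rule E.M.finsum_cong') (use ih d(1,2) in \<open>auto simp: cs\<close>)
    also have "\<dots> = a \<star> (finsum (End C A) (\<lambda>k. i k \<star> p k) {..<n} \<star> r)"
      by (rule LA.L_finsum[symmetric]) (use ih in \<open>auto intro!: cmp_hom\<close>)
    finally show ?thesis unfolding ip(3) using cmp_idn(2)[OF d(2)] by simp
  qed
  moreover have "finsum (End C Z) (\<lambda>k. ?i k \<star> ?p k) {n..<n + m} = b \<star> s"
  proof -
    have jh': "j k \<in> Hom C T B" "q k \<in> Hom C B T" if "k < m" for k using jq(1) that by auto
    have "finsum (End C Z) (\<lambda>k. ?i k \<star> ?p k) {n..<n + m} = finsum (End C Z) (\<lambda>k. ?i k \<star> ?p k) ((\<lambda>k. k + n) ` {..<m})"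
    proof -
      have "(\<lambda>k. k + n) ` {..<m} = {n..<n + m}"
        using image_add_atLeastLessThan'[of n 0 m] by (simp add: lessThan_atLeast0 add.commute)
      then show ?thesis by simp
    qed
    also have "\<dots> = finsum (End C Z) (\<lambda>k. ?i (k + n) \<star> ?p (k + n)) {..<m}"
      by (rule E.M.finsum_reindex) (use jh' d(3,4) in \<open>auto simp: inj_on_def intro!: cmp_hom\<close>)
    also have "\<dots> = finsum (End C Z) (\<lambda>k. b \<star> ((j k \<star> q k) \<star> s)) {..<m}"
      by (rule E.M.finsum_cong') (use jh' d(3,4) in \<open>auto simp: cs\<close>)
    also have "\<dots> = b \<star> (finsum (End C B) (\<lambda>k. j k \<star> q k) {..<m} \<star> s)"
      by (rule LB.L_finsum[symmetric]) (use jh' in \<open>auto intro!: cmp_hom\<close>)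
    finally show ?thesis unfolding jq(3) using cmp_idn(2)[OF d(4)] by simp
  qed
  ultimately have fs: "finsum (End C Z) (\<lambda>k. ?i k \<star> ?p k) {..<n + m} = Idn C Z" using d(9) by simp
  have h: "\<forall>k\<in>{..<n + m}. ?i k \<in> Hom C T Z \<and> ?p k \<in> Hom C Z T"
    using ih jh d(1-4) by (auto intro!: cmp_hom)
  have rel': "\<forall>k\<in>{..<n + m}. \<forall>l\<in>{..<n + m}. ?p l \<star> ?i k = (if k = l then Idn C T else Zro C T T)"
    using rel by blast
  have "\<exists>i p. (\<forall>k\<in>{..<n + m}. i k \<in> Hom C T Z \<and> p k \<in> Hom C Z T) \<and>
      (\<forall>k\<in>{..<n + m}. \<forall>l\<in>{..<n + m}. p l \<star> i k = (if k = l then Idn C T else Zro C T T)) \<and>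
      finsum (End C Z) (\<lambda>k. i k \<star> p k) {..<n + m} = Idn C Z"
    by (rule exI[of _ ?i], rule exI[of _ ?p]) (use h rel' fs in blast)
  moreover have "\<forall>k\<in>{..<n + m}. T \<in> Obj C" by (intro ballI T, unfold lessThan_iff) linarith
  ultimately show ?thesis unfolding dsum_def using ob(3) by simp
qed

lemma factor_idealE:
  assumes "f \<in> factor_ideal C S \<inter> Hom C X Y"
  obtains W a b where "W \<in> S" "a \<in> Hom C X W" "b \<in> Hom C W Y" "f = b \<star> a"
proof -
  obtain a b X' W Y' where f: "W \<in> S" "a \<in> Hom C X' W" "b \<in> Hom C W Y'" "f = b \<star> a"
    using assms unfolding factor_ideal_def by blast
  have "f \<in> Hom C X' Y'" using cmp_hom[OF f(2,3)] f(4) by simp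
  then have "X' = X" "Y' = Y" using assms unfolding Hom_def by auto
  then show thesis using that f by blast
qed

end

context kscat
begin

lemma add_closure_dsum2:
  assumes X: "X \<in> add_closure C T" and Y: "Y \<in> add_closure C T" and Z: "dsum2 C Z X Y"
  shows "Z \<in> add_closure C T"
proof -
  obtain n A where A: "dsum C A {..<n::nat} (\<lambda>_. T)" "summand C X A" using X unfolding add_closure_def by blast
  obtain m B where B: "dsum C B {..<m::nat} (\<lambda>_. T)" "summand C Y B" using Y unfolding add_closure_def by blast
  have ob: "A \<in> Obj C" "B \<in> Obj C" using A(1) B(1) unfolding dsum_def by auto
  obtain W where W: "dsum2 C W A B" using dsum2_exists[OF ob] by blast
  have WT: "dsum C W {..<n + m} (\<lambda>_. T)" by (rule dsum_append[OF A(1) B(1) W])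
  obtain i p where ip: "i \<in> Hom C X A" "p \<in> Hom C A X" "p \<star> i = Idn C X"
    using A(2) unfolding summand_iff_retract retract_def by blast
  obtain j q where jq: "j \<in> Hom C Y B" "q \<in> Hom C B Y" "q \<star> j = Idn C Y"
    using B(2) unfolding summand_iff_retract retract_def by blast
  obtain a r b s where d: "a \<in> Hom C A W" "r \<in> Hom C W A" "b \<in> Hom C B W" "s \<in> Hom C W B"
    "r \<star> a = Idn C A" "s \<star> b = Idn C B" "s \<star> a = Zro C A B" "r \<star> b = Zro C B A"
    by (rule dsum2D[OF W]) (rule that)
  obtain a' r' b' s' where e: "a' \<in> Hom C X Z" "r' \<in> Hom C Z X" "b' \<in> Hom C Y Z" "s' \<in> Hom C Z Y"
    "(a' \<star> r') \<boxplus> (b' \<star> s') = Idn C Z"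
    by (rule dsum2D[OF Z]) (rule that)
  let ?i = "(a \<star> (i \<star> r')) \<boxplus> (b \<star> (j \<star> s'))" and ?p = "(a' \<star> (p \<star> r)) \<boxplus> (b' \<star> (q \<star> s))"
  have obs: "X \<in> Obj C" "Y \<in> Obj C" "Z \<in> Obj C" using Hom_ob[OF e(1)] Hom_ob[OF e(3)] by auto
  have h: "i \<star> r' \<in> Hom C Z A" "j \<star> s' \<in> Hom C Z B" "p \<star> r \<in> Hom C W X" "q \<star> s \<in> Hom C W Y"
    using ip jq d e cmp_hom by blast+
  have h1: "a \<star> (i \<star> r') \<in> Hom C Z W" "b \<star> (j \<star> s') \<in> Hom C Z W" "a' \<star> (p \<star> r) \<in> Hom C W Z" "b' \<star> (q \<star> s) \<in> Hom C W Z"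
    using h d e cmp_hom by blast+
  have ih: "?i \<in> Hom C Z W" "?p \<in> Hom C W Z" using pls_hom h1 by blast+
  have 1: "(p \<star> r) \<star> ?i = r'"
  proof -
    have "(p \<star> r) \<star> (a \<star> (i \<star> r')) = p \<star> ((r \<star> a) \<star> (i \<star> r'))" "(p \<star> r) \<star> (b \<star> (j \<star> s')) = p \<star> ((r \<star> b) \<star> (j \<star> s'))"
      using assoc[OF cmp_hom[OF h(1) d(1)] d(2) ip(2)] assoc[OF h(1) d(1,2)]
        assoc[OF cmp_hom[OF h(2) d(3)] d(2) ip(2)] assoc[OF h(2) d(3,2)] by simp_all
    moreover have "p \<star> (i \<star> r') = r'" using assoc[OF e(2) ip(1,2)] ip(3) cmp_idn(2)[OF e(2)] by simp
    ultimately have "(p \<star> r) \<star> (a \<star> (i \<star> r')) = r'" "(p \<star> r) \<star> (b \<star> (j \<star> s')) = Zro C Z X"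
      using cmp_idn(2)[OF h(1)] cmp_zro(2)[OF h(2) ob(1)] cmp_zro(1)[OF ip(2) obs(3)] d(5,8) by simp_all
    then show ?thesis using distrib(1)[OF h1(1) h(3) h1(2)] hom_module_laws(1)[OF e(2)] hom_module_laws(2)[OF e(2)] by simp
  qed
  have 2: "(q \<star> s) \<star> ?i = s'"
  proof -
    have "(q \<star> s) \<star> (a \<star> (i \<star> r')) = q \<star> ((s \<star> a) \<star> (i \<star> r'))" "(q \<star> s) \<star> (b \<star> (j \<star> s')) = q \<star> ((s \<star> b) \<star> (j \<star> s'))"
      using assoc[OF cmp_hom[OF h(1) d(1)] d(4) jq(2)] assoc[OF h(1) d(1,4)]
        assoc[OF cmp_hom[OF h(2) d(3)] d(4) jq(2)] assoc[OF h(2) d(3,4)] by simp_all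
    moreover have "q \<star> (j \<star> s') = s'" using assoc[OF e(4) jq(1,2)] jq(3) cmp_idn(2)[OF e(4)] by simp
    ultimately have "(q \<star> s) \<star> (b \<star> (j \<star> s')) = s'" "(q \<star> s) \<star> (a \<star> (i \<star> r')) = Zro C Z Y"
      using cmp_idn(2)[OF h(2)] cmp_zro(2)[OF h(1) ob(2)] cmp_zro(1)[OF jq(2) obs(3)] d(6,7) by simp_all
    then show ?thesis using distrib(1)[OF h1(1) h(4) h1(2)] hom_module_laws(1)[OF e(4)] hom_module_laws(2)[OF e(4)] by simp
  qed
  have "?p \<star> ?i = (a' \<star> ((p \<star> r) \<star> ?i)) \<boxplus> (b' \<star> ((q \<star> s) \<star> ?i))"
    using distrib(2)[OF ih(1) h1(3,4)] assoc[OF ih(1) h(3) e(1)] assoc[OF ih(1) h(4) e(3)] by simp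
  then have "?p \<star> ?i = Idn C Z" unfolding 1 2 e(5) .
  then have "summand C Z W" unfolding summand_iff_retract by (rule retractI[OF ih])
  then show ?thesis using WT unfolding add_closure_def by blast
qed

text \<open>Closure of the ideal under sums uses that \<open>add T\<close> has direct sums.\<close>

lemma factor_ideal_add:
  assumes "f \<in> factor_ideal C (add_closure C T) \<inter> Hom C X Y" "g \<in> factor_ideal C (add_closure C T) \<inter> Hom C X Y"
  shows "f \<boxplus> g \<in> factor_ideal C (add_closure C T) \<inter> Hom C X Y"
proof -
  obtain a b V where f: "V \<in> add_closure C T" "a \<in> Hom C X V" "b \<in> Hom C V Y" "f = b \<star> a"
    using factor_idealE[OF assms(1)] by blast
  obtain a' b' W where g: "W \<in> add_closure C T" "a' \<in> Hom C X W" "b' \<in> Hom C W Y" "g = b' \<star> a'"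
    using factor_idealE[OF assms(2)] by blast
  have ob: "V \<in> Obj C" "W \<in> Obj C" "X \<in> Obj C" "Y \<in> Obj C" using f g Hom_ob by auto
  obtain Z where Z: "dsum2 C Z V W" using dsum2_exists[OF ob(1,2)] by blast
  obtain i p j q where d: "i \<in> Hom C V Z" "p \<in> Hom C Z V" "j \<in> Hom C W Z" "q \<in> Hom C Z W"
    "p \<star> i = Idn C V" "q \<star> j = Idn C W" "q \<star> i = Zro C V W" "p \<star> j = Zro C W V"
    by (rule dsum2D[OF Z]) (rule that)
  let ?u = "(i \<star> a) \<boxplus> (j \<star> a')" and ?v = "(b \<star> p) \<boxplus> (b' \<star> q)"
  have u: "?u \<in> Hom C X Z" and v: "?v \<in> Hom C Z Y" using d f g by (blast intro: hom_intros)+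
  have vi: "?v \<star> i = b" and vj: "?v \<star> j = b'" using d f g ob by (simp_all add: cs)
  have "?v \<star> ?u = (?v \<star> (i \<star> a)) \<boxplus> (?v \<star> (j \<star> a'))"
    by (rule distrib(1)[OF cmp_hom[OF f(2) d(1)] v cmp_hom[OF g(2) d(3)]])
  also have "\<dots> = f \<boxplus> g" unfolding assoc[OF f(2) d(1) v, symmetric] assoc[OF g(2) d(3) v, symmetric] vi vj f(4) g(4) ..
  finally have "f \<boxplus> g = ?v \<star> ?u" ..
  then have "f \<boxplus> g \<in> factor_ideal C (add_closure C T)"
    unfolding factor_ideal_def using add_closure_dsum2[OF f(1) g(1) Z] u v ob by blast
  then show ?thesis using pls_hom assms by blast
qed

end

locale add_quotient = kscat C for C :: "('o, 'm, 'k::field, 'z) lcat_scheme" (structure) +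
  fixes T :: 'o
  assumes T: "T \<in> Obj C"
begin

abbreviation fi where "fi X Y \<equiv> factor_ideal C (add_closure C T) \<inter> Hom C X Y"
abbreviation cl where "cl \<equiv> mor_class C (factor_ideal C (add_closure C T))"
abbreviation Q where "Q \<equiv> quot_cat C (factor_ideal C (add_closure C T))"

lemma fiI: "W \<in> add_closure C T \<Longrightarrow> a \<in> Hom C X W \<Longrightarrow> b \<in> Hom C W Y \<Longrightarrow> b \<star> a \<in> fi X Y"
  unfolding factor_ideal_def using Hom_ob[of a X W] Hom_ob[of b W Y] cmp_hom[of a X W b Y] by blast

lemma fi_zro: assumes "X \<in> Obj C" "Y \<in> Obj C" shows "Zro C X Y \<in> fi X Y"
  using fiI[OF retract_add_closure[OF retract_refl[OF T]] zro_hom[OF assms(1) T] zro_hom[OF T assms(2)]]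
    cmp_zro(1)[OF zro_hom[OF T assms(2)] assms(1)] by simp

lemma fi_left: assumes "f \<in> fi X Y" "g \<in> Hom C Y Z" shows "g \<star> f \<in> fi X Z"
proof -
  obtain W a b where f: "W \<in> add_closure C T" "a \<in> Hom C X W" "b \<in> Hom C W Y" "f = b \<star> a"
    using factor_idealE[OF assms(1)] by blast
  show ?thesis using fiI[OF f(1,2) cmp_hom[OF f(3) assms(2)]] assoc[OF f(2,3) assms(2)] f(4) by simp
qed

lemma fi_right: assumes "f \<in> fi Y Z" "g \<in> Hom C X Y" shows "f \<star> g \<in> fi X Z"
proof -
  obtain W a b where f: "W \<in> add_closure C T" "a \<in> Hom C Y W" "b \<in> Hom C W Z" "f = b \<star> a"
    using factor_idealE[OF assms(1)] by blast
  show ?thesis using fiI[OF f(1) cmp_hom[OF assms(2) f(2)] f(3)] assoc[OF assms(2) f(2,3)] f(4) by simp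
qed

lemma fi_scl: assumes "f \<in> fi X Y" shows "Scl C c f \<in> fi X Y"
proof -
  obtain W a b where f: "W \<in> add_closure C T" "a \<in> Hom C X W" "b \<in> Hom C W Y" "f = b \<star> a"
    using factor_idealE[OF assms(1)] by blast
  show ?thesis using fiI[OF f(1,2) scl_hom[OF f(3)], of c] distrib(4)[OF f(2,3)] f(4) by simp
qed

lemma cl_eq: "f \<in> Hom C X Y \<Longrightarrow> cl f = {f \<boxplus> h | h. h \<in> fi X Y}"
  unfolding mor_class_def Hom_def by auto

lemma cl_hom: "f \<in> Hom C X Y \<Longrightarrow> g \<in> cl f \<Longrightarrow> g \<in> Hom C X Y"
  unfolding cl_eq using pls_hom by blast

lemma cl_self: assumes f: "f \<in> Hom C X Y" shows "f \<in> cl f"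
  unfolding cl_eq[OF f] using fi_zro Hom_ob[OF f] hom_module_laws(1)[OF f]
  by (intro CollectI exI[of _ "Zro C X Y"]) simp

lemma cl_absorb:
  assumes f: "f \<in> Hom C X Y" and h: "h \<in> fi X Y" shows "cl (f \<boxplus> h) = cl f"
proof -
  have hh: "h \<in> Hom C X Y" using h by blast
  have fh: "f \<boxplus> h \<in> Hom C X Y" by (rule pls_hom[OF f hh])
  have "\<exists>k'\<in>fi X Y. (f \<boxplus> h) \<boxplus> k = f \<boxplus> k'" if k: "k \<in> fi X Y" for k
    using factor_ideal_add[OF h k] hh k f by (intro bexI[of _ "h \<boxplus> k"]) (auto simp: cs)
  moreover have "\<exists>k'\<in>fi X Y. f \<boxplus> k = (f \<boxplus> h) \<boxplus> k'" if k: "k \<in> fi X Y" for k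
  proof
    have kh: "k \<in> Hom C X Y" using k by blast
    show "neg h \<boxplus> k \<in> fi X Y" by (rule factor_ideal_add[OF fi_scl[OF h] k])
    show "f \<boxplus> k = (f \<boxplus> h) \<boxplus> (neg h \<boxplus> k)" using f hh kh by (simp add: cs pls_ac)
  qed
  ultimately show ?thesis unfolding cl_eq[OF f] cl_eq[OF fh] by blast
qed

lemma cl_mem: "f \<in> Hom C X Y \<Longrightarrow> g \<in> cl f \<Longrightarrow> \<exists>h\<in>fi X Y. g = f \<boxplus> h"
  unfolding cl_eq by blast

text \<open>
  The operations of the quotient are unions over representatives. They do not depend on these
  because the maps factoring through \<open>add T\<close> form an ideal.
\<close>

lemma quot_End:
  assumes Z: "Z \<in> Obj C"
  shows "carrier (End Q Z) = cl ` Hom C Z Z" "\<one>\<^bsub>End Q Z\<^esub> = cl (Idn C Z)"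
    "f \<in> Hom C Z Z \<Longrightarrow> g \<in> Hom C Z Z \<Longrightarrow> cl g \<otimes>\<^bsub>End Q Z\<^esub> cl f = cl (g \<star> f)"
    "f \<in> Hom C Z Z \<Longrightarrow> g \<in> Hom C Z Z \<Longrightarrow> cl f \<oplus>\<^bsub>End Q Z\<^esub> cl g = cl (f \<boxplus> g)"
    "f \<in> Hom C Z Z \<Longrightarrow> c \<odot>\<^bsub>End Q Z\<^esub> cl f = cl (Scl C c f)"
proof -
  have some: "(SOME g. g \<in> cl f) \<in> Hom C X Y" if f: "f \<in> Hom C X Y" for f X Y
    using cl_hom[OF f someI[of "\<lambda>g. g \<in> cl f", OF cl_self[OF f]]] .
  show "carrier (End Q Z) = cl ` Hom C Z Z"
  proof (rule subset_antisym; rule subsetI)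
    fix B assume "B \<in> carrier (End Q Z)"
    then obtain f where f: "f \<in> Arr C" "B = cl f" "Dom C (SOME g. g \<in> B) = Z" "Cod C (SOME g. g \<in> B) = Z"
      unfolding hom_mod_def Hom_def quot_cat_def by auto
    have fh: "f \<in> Hom C (Dom C f) (Cod C f)" using f(1) unfolding Hom_def by simp
    have "f \<in> Hom C Z Z" using some[OF fh] f unfolding Hom_def by auto
    then show "B \<in> cl ` Hom C Z Z" using f(2) by blast
  next
    fix B assume "B \<in> cl ` Hom C Z Z"
    then obtain f where f: "f \<in> Hom C Z Z" "B = cl f" by blast
    then show "B \<in> carrier (End Q Z)" using some[OF f(1)] unfolding hom_mod_def quot_cat_def Hom_def by auto
  qed
  have const: "(\<Union>a\<in>A. H a) = K" if "A \<noteq> {}" "\<And>a. a \<in> A \<Longrightarrow> H a = K" for A :: "'m set" and H and K :: "'m set"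
    using that by auto
  have ne: "cl f \<noteq> {}" if "f \<in> Hom C Z Z" for f using cl_self[OF that] by blast
  show "\<one>\<^bsub>End Q Z\<^esub> = cl (Idn C Z)" unfolding hom_mod_def quot_cat_def by simp
  show "cl g \<otimes>\<^bsub>End Q Z\<^esub> cl f = cl (g \<star> f)" if f: "f \<in> Hom C Z Z" and g: "g \<in> Hom C Z Z"
  proof -
    have "cl (b \<star> a) = cl (g \<star> f)" if a: "a \<in> cl f" and b: "b \<in> cl g" for a b
    proof -
      obtain h where h: "h \<in> fi Z Z" "a = f \<boxplus> h" using cl_mem[OF f a] by blast
      obtain k where k: "k \<in> fi Z Z" "b = g \<boxplus> k" using cl_mem[OF g b] by blast
      have ah: "a \<in> Hom C Z Z" by (rule cl_hom[OF f a])
      have hh: "h \<in> Hom C Z Z" "k \<in> Hom C Z Z" using h k by auto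
      have 1: "g \<star> h \<in> fi Z Z" "k \<star> a \<in> fi Z Z" using fi_left[OF h(1) g] fi_right[OF k(1) ah] by auto
      have 2: "g \<star> a = (g \<star> f) \<boxplus> (g \<star> h)" unfolding h(2) by (rule distrib(1)[OF f g hh(1)])
      have "b \<star> a = (g \<star> a) \<boxplus> (k \<star> a)" unfolding k(2) by (rule distrib(2)[OF ah g hh(2)])
      then have "b \<star> a = (g \<star> f) \<boxplus> ((g \<star> h) \<boxplus> (k \<star> a))"
        unfolding 2 using hom_module_laws(6)[OF cmp_hom[OF f g] cmp_hom[OF hh(1) g] cmp_hom[OF ah hh(2)]] by simp
      then show ?thesis using cl_absorb[OF cmp_hom[OF f g] factor_ideal_add[OF 1]] by simp
    qed
    then have "(\<Union>b\<in>cl g. \<Union>a\<in>cl f. cl (b \<star> a)) = cl (g \<star> f)"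
      using ne[OF f] ne[OF g] by (intro const) blast+
    then show ?thesis unfolding hom_mod_def quot_cat_def by simp
  qed
  show "cl f \<oplus>\<^bsub>End Q Z\<^esub> cl g = cl (f \<boxplus> g)" if f: "f \<in> Hom C Z Z" and g: "g \<in> Hom C Z Z"
  proof -
    have "cl (a \<boxplus> b) = cl (f \<boxplus> g)" if a: "a \<in> cl f" and b: "b \<in> cl g" for a b
    proof -
      obtain h where h: "h \<in> fi Z Z" "a = f \<boxplus> h" using cl_mem[OF f a] by blast
      obtain k where k: "k \<in> fi Z Z" "b = g \<boxplus> k" using cl_mem[OF g b] by blast
      have hh: "h \<in> Hom C Z Z" "k \<in> Hom C Z Z" using h k by auto
      have "a \<boxplus> b = (f \<boxplus> g) \<boxplus> (h \<boxplus> k)" unfolding h(2) k(2) using f g hh by (simp add: cs pls_ac)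
      then show ?thesis using cl_absorb[OF pls_hom[OF f g] factor_ideal_add[OF h(1) k(1)]] by simp
    qed
    then have "(\<Union>a\<in>cl f. \<Union>b\<in>cl g. cl (a \<boxplus> b)) = cl (f \<boxplus> g)"
      using ne[OF f] ne[OF g] by (intro const) blast+
    then show ?thesis unfolding hom_mod_def quot_cat_def by simp
  qed
  show "c \<odot>\<^bsub>End Q Z\<^esub> cl f = cl (Scl C c f)" if f: "f \<in> Hom C Z Z"
  proof -
    have "cl (Scl C c a) = cl (Scl C c f)" if a: "a \<in> cl f" for a
    proof -
      obtain h where h: "h \<in> fi Z Z" "a = f \<boxplus> h" using cl_mem[OF f a] by blast
      have hh: "h \<in> Hom C Z Z" using h by auto
      have "Scl C c a = Scl C c f \<boxplus> Scl C c h" unfolding h(2) using f hh by (simp add: cs)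
      then show ?thesis using cl_absorb[OF scl_hom[OF f] fi_scl[OF h(1)]] by simp
    qed
    then have "(\<Union>a\<in>cl f. cl (Scl C c a)) = cl (Scl C c f)"
      using ne[OF f] by (intro const) blast+
    then show ?thesis unfolding hom_mod_def quot_cat_def by simp
  qed
qed

end

section \<open>Indecomposables in the kernel of a covering\<close>

context kscat
begin

definition character :: "'o \<Rightarrow> ('m \<Rightarrow> 'k) \<Rightarrow> bool" where
  "character Z \<chi> \<longleftrightarrow> \<chi> (Idn C Z) = 1 \<and>
    (\<forall>f\<in>Hom C Z Z. \<forall>g\<in>Hom C Z Z. \<chi> (g \<star> f) = \<chi> g * \<chi> f \<and> \<chi> (f \<boxplus> g) = \<chi> f + \<chi> g) \<and>
    (\<forall>f\<in>Hom C Z Z. \<forall>c. \<chi> (Scl C c f) = c * \<chi> f)"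

lemma characterD:
  assumes "character Z \<chi>"
  shows "\<chi> (Idn C Z) = 1" "f \<in> Hom C Z Z \<Longrightarrow> g \<in> Hom C Z Z \<Longrightarrow> \<chi> (g \<star> f) = \<chi> g * \<chi> f"
    "f \<in> Hom C Z Z \<Longrightarrow> g \<in> Hom C Z Z \<Longrightarrow> \<chi> (f \<boxplus> g) = \<chi> f + \<chi> g"
    "f \<in> Hom C Z Z \<Longrightarrow> \<chi> (Scl C c f) = c * \<chi> f"
  using assms unfolding character_def by auto

lemma character_zro:
  assumes "character Z \<chi>" "Z \<in> Obj C" shows "\<chi> (Zro C Z Z) = 0"
  using characterD(4)[OF assms(1) zro_hom[OF assms(2,2)], of 0] hom_module_laws(11)[OF zro_hom[OF assms(2,2)]] by simp

text \<open>
  A character not vanishing on the idempotent of an indecomposable summand \<open>X\<close> factors through the local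
  algebra \<open>End X\<close>. There, \<open>a\<close> minus its value is not invertible, hence nilpotent, so every other
  such character takes the same value on \<open>a\<close>.
\<close>

lemma character_unique:
  assumes X: "indecomposable C X" and ip: "i \<in> Hom C X Z" "p \<in> Hom C Z X" "p \<star> i = Idn C X"
    and c: "character Z \<chi>" "\<chi> (i \<star> p) \<noteq> 0" and c': "character Z \<psi>" "\<psi> (i \<star> p) \<noteq> 0" and a: "a \<in> Hom C Z Z"
  shows "\<chi> a = \<psi> a"
proof -
  have ob: "X \<in> Obj C" "Z \<in> Obj C" using ip Hom_ob by auto
  let ?e = "i \<star> p"
  have e: "?e \<in> Hom C Z Z" by (rule cmp_hom[OF ip(2,1)])
  have ee: "?e \<star> ?e = ?e" using ip cmp_reduce[OF ip(3,1,2)] by (simp add: cs)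
  have idem: "x = 1" if "x * x = x" "x \<noteq> 0" for x :: 'k using that by simp
  have e1: "\<chi> ?e = 1" "\<psi> ?e = 1"
    using idem[of "\<chi> ?e"] idem[of "\<psi> ?e"] characterD(2)[OF c(1) e e] characterD(2)[OF c'(1) e e] ee c(2) c'(2) by auto
  let ?w = "(p \<star> (a \<star> i)) \<boxplus> Scl C (- \<chi> a) (Idn C X)"
  have pai: "p \<star> (a \<star> i) \<in> Hom C X X" by (rule cmp_hom[OF cmp_hom[OF ip(1) a] ip(2)])
  have w: "?w \<in> Hom C X X" by (rule pls_hom[OF pai scl_hom[OF idn_hom[OF ob(1)]]])
  let ?lift = "\<lambda>f. i \<star> (f \<star> p)"
  have lift: "?lift f \<in> Hom C Z Z" if "f \<in> Hom C X X" for f by (rule cmp_hom[OF cmp_hom[OF ip(2) that] ip(1)])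
  have lift_cmp: "?lift g \<star> ?lift f = ?lift (g \<star> f)" if "f \<in> Hom C X X" "g \<in> Hom C X X" for f g
    using ip cmp_reduce[OF ip(3,1,2)] that by (simp add: cs)
  have lift_idn: "?lift (Idn C X) = ?e" using cmp_idn(2)[OF ip(2)] by simp
  have y: "?lift ?w = (?e \<star> (a \<star> ?e)) \<boxplus> Scl C (- \<chi> a) ?e" using ip a ob by (simp add: cs)
  have val: "\<eta> (?lift ?w) = \<eta> a - \<chi> a" if n: "character Z \<eta>" "\<eta> ?e = 1" for \<eta>
    unfolding y using characterD(3)[OF n(1) cmp_hom[OF cmp_hom[OF e a] e] scl_hom[OF e], of "- \<chi> a"] characterD(4)[OF n(1) e, of "- \<chi> a"]
      characterD(2)[OF n(1) cmp_hom[OF e a] e] characterD(2)[OF n(1) e a] n(2) by simp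
  show ?thesis
  proof (cases "\<exists>g. iso_pair C X X ?w g")
    case True
    then obtain g where g: "g \<in> Hom C X X" "g \<star> ?w = Idn C X" unfolding iso_pair_def by blast
    have "\<chi> (?lift g) * \<chi> (?lift ?w) = \<chi> (?lift (g \<star> ?w))"
      using characterD(2)[OF c(1) lift[OF w] lift[OF g(1)]] lift_cmp[OF w g(1)] by simp
    then have "\<chi> ?e = 0" unfolding g(2) lift_idn val[OF c(1) e1(1)] by simp
    then show ?thesis using c(2) by simp
  next
    case False
    then obtain n :: nat where n: "?w [^]\<^bsub>End C X\<^esub> n = Zro C X X" using indec_nilpotent_or_iso[OF X w] by blast
    have pow: "\<psi> (?lift (?w [^]\<^bsub>End C X\<^esub> m)) = (\<psi> (?lift ?w)) ^ m" for m :: nat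
    proof (induction m)
      case 0
      then show ?case unfolding End_pow(3)[OF w] lift_idn using e1 by simp
    next
      case (Suc m)
      have pm: "?w [^]\<^bsub>End C X\<^esub> m \<in> Hom C X X" by (rule End_pow(1)[OF w])
      have "\<psi> (?lift (?w [^]\<^bsub>End C X\<^esub> Suc m)) = \<psi> (?lift (?w [^]\<^bsub>End C X\<^esub> m)) * \<psi> (?lift ?w)"
        unfolding End_pow(2)[OF w] lift_cmp[OF w pm, symmetric] by (rule characterD(2)[OF c'(1) lift[OF w] lift[OF pm]])
      then show ?case using Suc by (simp add: mult.commute)
    qed
    have "?lift (Zro C X X) = Zro C Z Z" using cmp_zro(2)[OF ip(2) ob(1)] cmp_zro(1)[OF ip(1) ob(2)] by simp
    then have "(\<psi> (?lift ?w)) ^ n = 0" using pow[of n] character_zro[OF c'(1) ob(2)] unfolding n by simp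
    then show ?thesis using val[OF c'(1) e1(2)] by simp
  qed
qed

text \<open>Hence characters of \<open>End Z\<close> are told apart by the indecomposable summands on which they live.\<close>

lemma card_characters:
  fixes \<chi> :: "'v \<Rightarrow> 'm \<Rightarrow> 'k"
  assumes Z: "dsum C Z S (\<lambda>X. X)" and S: "\<And>X. X \<in> S \<Longrightarrow> indecomposable C X"
    and X0: "X0 \<in> S" "\<And>v i p. v \<in> V \<Longrightarrow> i \<in> Hom C X0 Z \<Longrightarrow> p \<in> Hom C Z X0 \<Longrightarrow> \<chi> v (i \<star> p) = 0"
    and chi: "\<And>v. v \<in> V \<Longrightarrow> character Z (\<chi> v)"
    and sep: "\<And>v w. v \<in> V \<Longrightarrow> w \<in> V \<Longrightarrow> v \<noteq> w \<Longrightarrow> \<exists>a\<in>Hom C Z Z. \<chi> v a \<noteq> \<chi> w a"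
  shows "card V < card S"
proof -
  have fS: "finite S" and obZ: "Z \<in> Obj C" using Z unfolding dsum_def by auto
  obtain \<iota> \<pi> where ip: "\<And>k. k \<in> S \<Longrightarrow> \<iota> k \<in> Hom C k Z" "\<And>k. k \<in> S \<Longrightarrow> \<pi> k \<in> Hom C Z k"
    "\<And>k. k \<in> S \<Longrightarrow> \<pi> k \<star> \<iota> k = Idn C k" "Idn C Z \<in> asum Z Z ((\<lambda>k. \<iota> k \<star> \<pi> k) ` S)"
    by (rule dsumD[OF Z]) (rule that; assumption)
  have Kh: "(\<lambda>k. \<iota> k \<star> \<pi> k) ` S \<subseteq> Hom C Z Z" using ip(1,2) cmp_hom by blast
  have ex: "\<exists>k\<in>S. \<chi> v (\<iota> k \<star> \<pi> k) \<noteq> 0" if v: "v \<in> V" for v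
  proof (rule ccontr)
    assume neg: "\<not> ?thesis"
    have "\<chi> v (Idn C Z) = 0"
      by (rule asum_map[OF ip(4) Kh obZ obZ, where F = "\<lambda>f. f" and S = "{f. \<chi> v f = 0}", simplified])
        (use neg character_zro[OF chi[OF v] obZ] characterD(3)[OF chi[OF v]] in auto)
    then show False using characterD(1)[OF chi[OF v]] by simp
  qed
  define k where "k v = (SOME k. k \<in> S \<and> \<chi> v (\<iota> k \<star> \<pi> k) \<noteq> 0)" for v
  have k: "k v \<in> S" "\<chi> v (\<iota> (k v) \<star> \<pi> (k v)) \<noteq> 0" if "v \<in> V" for v
    using someI_ex[of "\<lambda>k. k \<in> S \<and> \<chi> v (\<iota> k \<star> \<pi> k) \<noteq> 0"] ex[OF that] unfolding k_def by auto
  have inj: "inj_on k V"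
  proof (rule inj_onI, rule ccontr)
    fix v w assume vw: "v \<in> V" "w \<in> V" "k v = k w" "v \<noteq> w"
    obtain a where a: "a \<in> Hom C Z Z" "\<chi> v a \<noteq> \<chi> w a" using sep[OF vw(1,2,4)] by blast
    note kv = k[OF vw(1)] and kw = k[OF vw(2)]
    have "\<chi> v a = \<chi> w a"
      by (rule character_unique[OF S[OF kv(1)] ip(1)[OF kv(1)] ip(2)[OF kv(1)] ip(3)[OF kv(1)] chi[OF vw(1)] kv(2) chi[OF vw(2)] _ a(1)])
        (use kw(2) vw(3) in simp)
    then show False using a by blast
  qed
  have "k v \<noteq> X0" if "v \<in> V" for v using k[OF that] X0(2)[OF that] ip(1,2)[OF X0(1)] by blast
  then have "k ` V \<subseteq> S - {X0}" using k(1) by blast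
  then have "card V \<le> card (S - {X0})" using inj fS by (metis card_inj_on_le finite_Diff)
  then show ?thesis using X0(1) fS by (metis card_Diff1_less order_le_less_trans)
qed

end

context covering
begin

text \<open>
  An indecomposable object killed by \<open>F\<close> is a summand of both lifts, since zero is a summand of every
  object. Its idempotent in \<open>End T\<^sub>m\<close> becomes zero modulo \<open>add T\<^sub>f\<close>, so the quotient algebra has fewer
  characters than \<open>T\<^sub>m\<close> has summands. But the path algebra presentation provides one character for
  each summand.
\<close>

theorem indec_not_killed:
  assumes Mb: "Mb \<in> Obj D" and Fb: "Fb \<in> Obj D" and Tm: "is_lift C D F Mb Tm" and Tf: "is_lift C D F Fb Tf"
    and n: "n \<ge> 1"
    and A: "given_by_paths_of_length n (induce_subgraph (end_quiver C T0) (quiver_vertices C Tm))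
      (End (quot_cat C (factor_ideal C (add_closure C Tf))) Tm)"
    and X: "indecomposable C X"
  shows "\<not> zero_object D (fob F X)"
proof
  assume z: "zero_object D (fob F X)"
  have zr: "summand D (fob F X) Y" if Y: "Y \<in> Obj D" for Y
  proof -
    have ob: "fob F X \<in> Obj D" by (rule F_ob[OF C.indec_ob[OF X]])
    have "D.retract (fob F X) Y"
      by (rule D.retractI[OF D.zro_hom[OF ob Y] D.zro_hom[OF Y ob]])
        (use z D.cmp_zro(1)[OF D.zro_hom[OF Y ob] ob] in \<open>simp add: zero_object_def\<close>)
    then show ?thesis unfolding D.summand_iff_retract .
  qed
  obtain S where S0: "\<forall>X\<in>S. indecomposable C X \<and> summand D (fob F X) Mb"
    "\<forall>X. indecomposable C X \<and> summand D (fob F X) Mb \<longrightarrow> (\<exists>!Z. Z \<in> S \<and> isomorphic C X Z)" "dsum C Tm S (\<lambda>X. X)"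
    using Tm unfolding is_lift_def by (elim exE conjE) (rule that)
  note S = S0(1)[rule_format] S0(2)[rule_format, OF conjI] S0(3)
  obtain S' where S0': "\<forall>X\<in>S'. indecomposable C X \<and> summand D (fob F X) Fb"
    "\<forall>X. indecomposable C X \<and> summand D (fob F X) Fb \<longrightarrow> (\<exists>!Z. Z \<in> S' \<and> isomorphic C X Z)" "dsum C Tf S' (\<lambda>X. X)"
    using Tf unfolding is_lift_def by (elim exE conjE) (rule that)
  note S' = S0'(2)[rule_format, OF conjI] S0'(3)
  have dr: "C.retract Y Z" if ZR: "dsum C Z R (\<lambda>Y. Y)" and YR: "Y \<in> R" for Y Z R
  proof -
    obtain \<iota> \<pi> where "\<And>k. k \<in> R \<Longrightarrow> \<iota> k \<in> Hom C k Z" "\<And>k. k \<in> R \<Longrightarrow> \<pi> k \<in> Hom C Z k"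
      "\<And>k. k \<in> R \<Longrightarrow> \<pi> k \<cdot> \<iota> k = Idn C k"
      by (rule C.dsumD[OF ZR]) (rule that; assumption)
    then show ?thesis using C.retractI YR by blast
  qed
  obtain X0 where X0: "X0 \<in> S" "isomorphic C X X0" using ex1_implies_ex[OF S(2)[OF X zr[OF Mb]]] by (elim exE conjE) (rule that)
  obtain X1 where X1: "X1 \<in> S'" "isomorphic C X X1" using ex1_implies_ex[OF S'(1)[OF X zr[OF Fb]]] by (elim exE conjE) (rule that)
  have ob: "Tm \<in> Obj C" "Tf \<in> Obj C" using S(3) S'(2) unfolding dsum_def by auto
  have "isomorphic C X0 X1" using C.isomorphic_trans[OF C.isomorphic_sym[OF X0(2)] X1(2)] .
  then have "C.retract X0 Tf" using C.retract_trans[OF conjunct1[OF C.isomorphic_retract] dr[OF S'(2) X1(1)]] by blast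
  then have X0f: "X0 \<in> add_closure C Tf" by (rule C.retract_add_closure)
  interpret W: add_quotient C Tf by unfold_locales (rule ob(2))
  let ?V = "quiver_vertices C Tm" let ?Q = "induce_subgraph (end_quiver C T0) (quiver_vertices C Tm)"
  interpret wf_digraph ?Q
    by unfold_locales (auto simp: induce_subgraph_def)
  have fV: "finite ?V" by (rule C.finite_quiver_vertices[OF ob(1)])
  have vQ: "verts ?Q = ?V" by simp
  let ?A = "End (quot_cat C (factor_ideal C (add_closure C Tf))) Tm"
  obtain \<chi> :: "'o set \<Rightarrow> 'm set \<Rightarrow> 'k" where \<chi>:
    "\<And>v a b. v \<in> ?V \<Longrightarrow> a \<in> carrier ?A \<Longrightarrow> b \<in> carrier ?A \<Longrightarrow> \<chi> v (a \<otimes>\<^bsub>?A\<^esub> b) = \<chi> v a * \<chi> v b"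
    "\<And>v a b. v \<in> ?V \<Longrightarrow> a \<in> carrier ?A \<Longrightarrow> b \<in> carrier ?A \<Longrightarrow> \<chi> v (a \<oplus>\<^bsub>?A\<^esub> b) = \<chi> v a + \<chi> v b"
    "\<And>v a c. v \<in> ?V \<Longrightarrow> a \<in> carrier ?A \<Longrightarrow> \<chi> v (c \<odot>\<^bsub>?A\<^esub> a) = c * \<chi> v a"
    "\<And>v. v \<in> ?V \<Longrightarrow> \<chi> v \<one>\<^bsub>?A\<^esub> = 1"
    "\<And>v w. v \<in> ?V \<Longrightarrow> w \<in> ?V \<Longrightarrow> v \<noteq> w \<Longrightarrow> \<exists>a\<in>carrier ?A. \<chi> v a \<noteq> \<chi> w a"
    by (rule vertex_characters[OF _ n A]; unfold vQ; (rule fV | rule that; assumption))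
  note qe = W.quot_End[OF ob(1)]
  have ca: "W.cl f \<in> carrier ?A" if "f \<in> Hom C Tm Tm" for f using that unfolding qe(1) by blast
  have "card ?V < card S"
  proof (rule C.card_characters[OF S(3) _ X0(1), where \<chi> = "\<lambda>v f. \<chi> v (W.cl f)"])
    show "indecomposable C Y" if "Y \<in> S" for Y using S(1)[OF that] by blast
    show "C.character Tm (\<lambda>f. \<chi> v (W.cl f))" if v: "v \<in> ?V" for v
      unfolding C.character_def
      using \<chi>(1)[OF v ca ca] \<chi>(2)[OF v ca ca] \<chi>(3)[OF v ca] \<chi>(4)[OF v] qe(2-5) by simp
    show "\<chi> v (W.cl (i \<cdot> p)) = 0" if v: "v \<in> ?V" and ip: "i \<in> Hom C X0 Tm" "p \<in> Hom C Tm X0" for v i p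
    proof -
      have f: "i \<cdot> p \<in> W.fi Tm Tm" by (rule W.fiI[OF X0f ip(2,1)])
      then have fh: "i \<cdot> p \<in> Hom C Tm Tm" by blast
      have "\<chi> v (W.cl (i \<cdot> p)) = \<chi> v (W.cl (i \<cdot> p)) + \<chi> v (W.cl (i \<cdot> p))"
        using \<chi>(2)[OF v ca[OF fh] ca[OF fh]] qe(4)[OF fh fh] W.cl_absorb[OF fh f] by simp
      then show ?thesis by (simp only: add_cancel_right_right)
    qed
    show "\<exists>a\<in>Hom C Tm Tm. \<chi> v (W.cl a) \<noteq> \<chi> w (W.cl a)" if "v \<in> ?V" "w \<in> ?V" "v \<noteq> w" for v w
      using \<chi>(5)[OF that] unfolding qe(1) by blast
  qed
  moreover have "card S \<le> card ?V"
  proof (rule card_inj_on_le[OF _ _ fV])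
    show "inj_on (iso_class C) S"
    proof (rule inj_onI)
      fix Y Z assume YZ: "Y \<in> S" "Z \<in> S" "iso_class C Y = iso_class C Z"
      have obY: "Y \<in> Obj C" using S(1)[OF YZ(1)] C.indec_ob by blast
      have "isomorphic C Y Z" using YZ(3) C.iso_class_eq_iff[OF obY] by blast
      moreover have "\<exists>!Z. Z \<in> S \<and> isomorphic C Y Z" using S(2)[of Y] S(1)[OF YZ(1)] by simp
      ultimately show "Y = Z" using YZ(1,2) C.isomorphic_refl[OF obY] by blast
    qed
    show "iso_class C ` S \<subseteq> ?V"
      unfolding quiver_vertices_def using S(1) dr[OF S(3)] C.ind_summands_iff by blast
  qed
  ultimately show False by simp
qed

end

section \<open>Mutation and the covering\<close>

context covering
begin

lemma lift_reflect:
  assumes L: "is_lift C D F P L" and Y: "indecomposable C Y" "D.retract (fob F Y) P"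
  shows "C.retract Y L"
proof -
  obtain S where S: "\<forall>X. indecomposable C X \<and> summand D (fob F X) P \<longrightarrow> (\<exists>!Z. Z \<in> S \<and> isomorphic C X Z)" "dsum C L S (\<lambda>X. X)"
    using L unfolding is_lift_def by (elim exE conjE) (rule that)
  have "\<exists>!Z. Z \<in> S \<and> isomorphic C Y Z" using S(1) Y unfolding D.summand_iff_retract by simp
  then obtain Z where Z: "Z \<in> S" "isomorphic C Y Z" by (elim ex1E conjE) (rule that)
  obtain \<iota> \<pi> where "\<And>k. k \<in> S \<Longrightarrow> \<iota> k \<in> Hom C k L" "\<And>k. k \<in> S \<Longrightarrow> \<pi> k \<in> Hom C L k"
    "\<And>k. k \<in> S \<Longrightarrow> \<pi> k \<cdot> \<iota> k = Idn C k"
    by (rule C.dsumD[OF S(2)]) (rule that; assumption)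
  then have "C.retract Z L" using C.retractI Z(1) by blast
  then show ?thesis using C.retract_trans C.isomorphic_retract[OF Z(2)] by blast
qed

lemma lift_ob: "is_lift C D F P L \<Longrightarrow> L \<in> Obj C"
  unfolding is_lift_def dsum_def by (elim exE conjE)

lemma lift_image:
  assumes L: "is_lift C D F P L" shows "D.in_add P (fob F L)"
proof -
  obtain S where S: "\<forall>X\<in>S. indecomposable C X \<and> summand D (fob F X) P" "dsum C L S (\<lambda>X. X)"
    using L unfolding is_lift_def by (elim exE conjE) (rule that)
  have ob: "L \<in> Obj C" by (rule lift_ob[OF L])
  obtain \<iota> \<pi> where ip: "\<And>k. k \<in> S \<Longrightarrow> \<iota> k \<in> Hom C k L" "\<And>k. k \<in> S \<Longrightarrow> \<pi> k \<in> Hom C L k"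
    "Idn C L \<in> C.asum L L ((\<lambda>k. \<iota> k \<cdot> \<pi> k) ` S)"
    by (rule C.dsumD[OF S(2)]) (rule that; assumption)
  have K: "(\<lambda>k. \<iota> k \<cdot> \<pi> k) ` S \<subseteq> Hom C L L" using ip(1,2) C.cmp_hom by blast
  have "Idn D (fob F L) \<in> D.asum (fob F L) (fob F L) (fmor F ` (\<lambda>k. \<iota> k \<cdot> \<pi> k) ` S)"
    using F_asum[OF ip(3) K ob ob] F_idn[OF ob] by simp
  then show ?thesis
  proof (rule D.in_add_trans_gen[OF F_ob[OF ob]])
    fix e assume "e \<in> fmor F ` (\<lambda>k. \<iota> k \<cdot> \<pi> k) ` S"
    then obtain k where k: "k \<in> S" "e = fmor F (\<iota> k \<cdot> \<pi> k)" by blast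
    have "D.in_add P (fob F k)" using S(1) k(1) D.retract_in_add unfolding D.summand_iff_retract by blast
    moreover have "e = fmor F (\<iota> k) \<bullet> fmor F (\<pi> k)" using F_cmp[OF ip(2)[OF k(1)] ip(1)[OF k(1)]] k(2) by simp
    ultimately show "\<exists>Y a b. D.in_add P Y \<and> a \<in> Hom D (fob F L) Y \<and> b \<in> Hom D Y (fob F L) \<and> e = b \<bullet> a"
      using F_hom[OF ip(2)[OF k(1)]] F_hom[OF ip(1)[OF k(1)]] by blast
  qed
qed

end

text \<open>
  The exchange situation in letters: \<open>M\<close> and \<open>N\<close> are the two complements
  of \<open>W\<close>, with cluster-tilting objects \<open>T\<close> and \<open>T1\<close>.
  Upstairs, \<open>T\<^sub>m\<close> and \<open>T\<^sub>f\<close> are the lifts of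
  \<open>M\<close> and \<open>W\<close>, and \<open>(f, g, h)\<close> is the triangle on a left
  \<open>add T\<^sub>f\<close>-approximation of \<open>T\<^sub>m\<close> that computes
  \<open>T\<^sub>m\<langle>1\<rangle>\<close>.
\<close>

locale mutation = covering_nz C D F + C: tricat C + D: tricat D
  for C :: "('o, 'm, 'k::field, 'y) tcat_scheme" and D :: "('p, 'n, 'k, 'z) tcat_scheme" and F +
  fixes \<theta> :: "'o \<Rightarrow> 'n" and T M W T1 N :: 'p and Tm Tf Tm1 V :: 'o and f g h :: 'm
  assumes theta: "\<And>X. X \<in> Obj C \<Longrightarrow> \<theta> X \<in> Hom D (fob F (fob (Sh C) X)) (fob (Sh D) (fob F X))"
      "\<And>X. X \<in> Obj C \<Longrightarrow> is_iso D (\<theta> X)"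
    and tri_image: "\<And>f g h. (f, g, h) \<in> Tri C \<Longrightarrow> (fmor F f, fmor F g, \<theta> (Dom C f) \<bullet> fmor F h) \<in> Tri D"
    and T: "cluster_tilting D T" "dsum2 D T M W" and T1: "cluster_tilting D T1" "dsum2 D T1 N W"
    and M: "indecomposable D M" and N: "indecomposable D N"
    and NM: "\<not> isomorphic D N M" and MW: "\<not> D.retract M W"
    and Tm: "is_lift C D F M Tm" and Tf: "is_lift C D F W Tf"
    and exch: "(f, g, h) \<in> Tri C" "f \<in> Hom C Tm V" "g \<in> Hom C V Tm1" "h \<in> Hom C Tm1 (fob (Sh C) Tm)"
    and V: "C.in_add Tf V" and f_approx: "\<And>v. v \<in> Hom C Tm Tf \<Longrightarrow> \<exists>d\<in>Hom C V Tf. v = d \<cdot> f"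
begin

lemma tri_image_homs:
  assumes "(a, b, c) \<in> Tri C" "a \<in> Hom C X Y" "b \<in> Hom C Y Z" "c \<in> Hom C Z (C.so X)"
  shows "(fmor F a, fmor F b, \<theta> X \<bullet> fmor F c) \<in> Tri D" "fmor F a \<in> Hom D (fob F X) (fob F Y)"
    "fmor F b \<in> Hom D (fob F Y) (fob F Z)" "\<theta> X \<bullet> fmor F c \<in> Hom D (fob F Z) (D.so (fob F X))"
proof -
  have X: "Dom C a = X" "X \<in> Obj C" using assms(2) C.Hom_ob unfolding Hom_def by auto
  show "(fmor F a, fmor F b, \<theta> X \<bullet> fmor F c) \<in> Tri D" using tri_image[OF assms(1)] unfolding X(1) .
  show "\<theta> X \<bullet> fmor F c \<in> Hom D (fob F Z) (D.so (fob F X))" by (rule D.cmp_hom[OF F_hom[OF assms(4)] theta(1)[OF X(2)]])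
qed (rule F_hom[OF assms(2)], rule F_hom[OF assms(3)])

lemma obs: "T \<in> Obj D" "T1 \<in> Obj D" "M \<in> Obj D" "N \<in> Obj D" "W \<in> Obj D" "Tm \<in> Obj C" "Tf \<in> Obj C" "Tm1 \<in> Obj C"
  using D.ct_ob[OF T(1)] D.ct_ob[OF T1(1)] D.indec_ob M N D.retract_ob D.dsum2_retract[OF T(2)] lift_ob Tm Tf C.Hom_ob[OF exch(3)]
  by blast+

lemma add_W: "D.in_add W X \<Longrightarrow> D.in_add T X" "D.in_add W X \<Longrightarrow> D.in_add T1 X"
  using D.in_add_trans[OF D.retract_in_add] D.dsum2_retract[OF T(2)] D.dsum2_retract[OF T1(2)] by blast+

lemma image_Tf: "C.in_add Tf X \<Longrightarrow> D.in_add W (fob F X)"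
  by (rule D.in_add_trans[OF lift_image[OF Tf] F_in_add[OF _ obs(7)]])

text \<open>
  A map from the image of \<open>T\<^sub>m\<langle>1\<rangle>\<close> to the shift of
  \<open>T1\<close> comes from a map \<open>v\<close> defined on the image of
  \<open>T\<^sub>m\<close>. As maps from \<open>M\<close> to \<open>N\<close> factor through
  \<open>add W\<close>, the map \<open>v\<close> extends along the image of the left
  approximation, which forces the original map to vanish. So maximality of \<open>T1\<close>
  applies.
\<close>

lemma image_Tm1: "D.in_add T1 (fob F Tm1)"
proof (rule D.ct_max_right[OF T1(1) F_ob[OF obs(8)]])
  fix c assume c: "c \<in> Hom D (fob F Tm1) (D.so T1)"
  note t = tri_image_homs[OF exch]
  have FV: "D.in_add W (fob F V)" by (rule image_Tf[OF V])
  have "c \<bullet> fmor F g = Zro D (fob F V) (D.so T1)"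
    by (rule D.ct_rigid[OF T1(1) add_W(2)[OF FV] D.in_add_refl[OF obs(2)] D.cmp_hom[OF t(3) c]])
  then obtain v where v: "v \<in> Hom D (fob F Tm) T1" "c = D.sm v \<bullet> (\<theta> Tm \<bullet> fmor F h)"
    using D.tri_extend_cone[OF t c _ obs(2)] by blast
  have ext: "\<exists>d\<in>Hom D (fob F V) Y. u = d \<bullet> fmor F f" if "D.in_add W Y" "u \<in> Hom D (fob F Tm) Y" for u Y
    by (rule left_approx_image[OF lift_reflect[OF Tf] exch(2) f_approx that])
  obtain B q where q: "D.in_add W B" "q \<in> Hom D B N" "\<And>v. v \<in> Hom D M N \<Longrightarrow> \<exists>a\<in>Hom D M B. v = q \<bullet> a"
    by (rule D.exchange[OF T T1 M N NM MW]) (rule that; assumption)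
  obtain i p j r where d: "i \<in> Hom D N T1" "p \<in> Hom D T1 N" "j \<in> Hom D W T1" "r \<in> Hom D T1 W"
    "Pls D (i \<bullet> p) (j \<bullet> r) = Idn D T1"
    by (rule D.dsum2D[OF T1(2)]) (rule that; assumption)
  obtain u where u: "u \<in> Hom D (fob F Tm) B" "p \<bullet> v = q \<bullet> u"
    using D.right_approx_in_add[OF q(2,3) lift_image[OF Tm] D.cmp_hom[OF v(1) d(2)]] by blast
  obtain u' where u': "u' \<in> Hom D (fob F V) B" "u = u' \<bullet> fmor F f" using ext[OF q(1) u(1)] by blast
  obtain w where w: "w \<in> Hom D (fob F V) W" "r \<bullet> v = w \<bullet> fmor F f"
    using ext[OF D.in_add_refl[OF obs(5)] D.cmp_hom[OF v(1) d(4)]] by blast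
  let ?d = "Pls D (i \<bullet> (q \<bullet> u')) (j \<bullet> w)"
  have iqu: "i \<bullet> (q \<bullet> u') \<in> Hom D (fob F V) T1" and jw: "j \<bullet> w \<in> Hom D (fob F V) T1"
    using D.cmp_hom[OF D.cmp_hom[OF u'(1) q(2)] d(1)] D.cmp_hom[OF w(1) d(3)] .
  have dh: "?d \<in> Hom D (fob F V) T1" by (rule D.pls_hom[OF iqu jw])
  have "v = Idn D T1 \<bullet> v" using D.cmp_idn(2)[OF v(1)] by simp
  also have "\<dots> = Pls D (i \<bullet> (p \<bullet> v)) (j \<bullet> (r \<bullet> v))"
    unfolding d(5)[symmetric] using D.distrib(2)[OF v(1) D.cmp_hom[OF d(2,1)] D.cmp_hom[OF d(4,3)]]
      D.assoc[OF v(1) d(2,1)] D.assoc[OF v(1) d(4,3)] by simp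
  also have "\<dots> = ?d \<bullet> fmor F f"
    unfolding u(2) u'(2) w(2) using D.distrib(2)[OF t(2) iqu jw] D.assoc[OF t(2) u'(1) q(2)]
      D.assoc[OF t(2) D.cmp_hom[OF u'(1) q(2)] d(1)] D.assoc[OF t(2) w(1) d(3)] by simp
  finally have vd: "v = ?d \<bullet> fmor F f" .
  have sd: "D.sm ?d \<in> Hom D (D.so (fob F V)) (D.so T1)" by (rule D.S.F_hom[OF dh])
  have sv: "D.sm v = D.sm ?d \<bullet> D.sm (fmor F f)" unfolding vd by (rule D.S.F_cmp[OF t(2) dh])
  have "c = D.sm ?d \<bullet> (D.sm (fmor F f) \<bullet> (\<theta> Tm \<bullet> fmor F h))"
    unfolding v(2) sv by (rule D.assoc[OF t(4) D.S.F_hom[OF t(2)] sd])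
  then show "c = Zro D (fob F Tm1) (D.so T1)"
    unfolding D.tri_cmp_zero(3)[OF t] using D.cmp_zro(1)[OF sd F_ob[OF obs(8)]] by simp
qed

text \<open>Rigidity holds downstairs, and \<open>F\<close> is faithful.\<close>

lemma shift_rigid:
  assumes X: "D.in_add T1 (fob F X)" and Y: "C.in_add Tf Y" and u: "u \<in> Hom C X (C.so Y)"
  shows "u = Zro C X (C.so Y)"
proof (rule faithful[OF u])
  have ob: "Y \<in> Obj C" "X \<in> Obj C" "C.so Y \<in> Obj C" using C.in_add_ob[OF Y] C.Hom_ob[OF u] by auto
  have th: "\<theta> Y \<in> Hom D (fob F (C.so Y)) (D.so (fob F Y))" "is_iso D (\<theta> Y)" using theta ob by auto
  have z: "\<theta> Y \<bullet> fmor F u = Zro D (fob F X) (D.so (fob F Y))"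
    by (rule D.ct_rigid[OF T1(1) X add_W(2)[OF image_Tf[OF Y]] D.cmp_hom[OF F_hom[OF u] th(1)]])
  obtain k where "iso_pair D (Dom D (\<theta> Y)) (Cod D (\<theta> Y)) (\<theta> Y) k" using th(2) unfolding is_iso_def by blast
  then have k: "k \<in> Hom D (D.so (fob F Y)) (fob F (C.so Y))" "k \<bullet> \<theta> Y = Idn D (fob F (C.so Y))"
    using th(1) unfolding iso_pair_def Hom_def by auto
  have "fmor F u = k \<bullet> (\<theta> Y \<bullet> fmor F u)"
    using D.assoc[OF F_hom[OF u] th(1) k(1)] k(2) D.cmp_idn(2)[OF F_hom[OF u]] by simp
  then show "fmor F u = Zro D (fob F X) (fob F (C.so Y))" unfolding z using D.cmp_zro(1)[OF k(1) F_ob[OF ob(2)]] by simp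
qed

text \<open>
  The right approximation \<open>q\<close> stays one after applying \<open>F\<close>, and maps
  from \<open>M\<close> to \<open>N\<close> factor through \<open>add W\<close>. Hence all maps
  from \<open>T\<close> to the image of \<open>X\<close> factor through \<open>F q\<close>, and
  there are no maps from \<open>T\<close> to the shift of the image of the cocone.
\<close>

lemma cocone_image:
  assumes X: "iso_pair D (fob F X) N al be"
    and t: "(a, q, b) \<in> Tri C" "a \<in> Hom C Y D'" "q \<in> Hom C D' X" "b \<in> Hom C X (C.so Y)"
    and D': "C.in_add Tf D'" and q: "\<And>v. v \<in> Hom C Tf X \<Longrightarrow> \<exists>u\<in>Hom C Tf D'. v = q \<cdot> u"
  shows "D.in_add T (fob F Y)"
proof -
  note ti = tri_image_homs[OF t]
  have obY: "Y \<in> Obj C" using C.Hom_ob[OF t(2)] by blast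
  have al: "al \<in> Hom D (fob F X) N" "be \<in> Hom D N (fob F X)" "be \<bullet> al = Idn D (fob F X)"
    using X unfolding iso_pair_def by auto
  have lift: "\<exists>u\<in>Hom D Z (fob F D'). v = fmor F q \<bullet> u" if "D.in_add W Z" "v \<in> Hom D Z (fob F X)" for v Z
    by (rule right_approx_image[OF lift_reflect[OF Tf] t(3) q that])
  obtain B q0 where q0: "D.in_add W B" "q0 \<in> Hom D B N" "\<And>v. v \<in> Hom D M N \<Longrightarrow> \<exists>a\<in>Hom D M B. v = q0 \<bullet> a"
    by (rule D.exchange[OF T T1 M N NM MW]) (rule that; assumption)
  obtain i p j r where d: "i \<in> Hom D M T" "p \<in> Hom D T M" "j \<in> Hom D W T" "r \<in> Hom D T W"
    "Pls D (i \<bullet> p) (j \<bullet> r) = Idn D T"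
    by (rule D.dsum2D[OF T(2)]) (rule that; assumption)
  show ?thesis
  proof (rule D.ct_max_left[OF T(1) F_ob[OF obY]])
    fix c assume c: "c \<in> Hom D T (D.so (fob F Y))"
    have "D.sm (fmor F a) \<bullet> c = Zro D T (D.so (fob F D'))"
      by (rule D.ct_rigid[OF T(1) D.in_add_refl[OF obs(1)] add_W(1)[OF image_Tf[OF D']] D.cmp_hom[OF c D.S.F_hom[OF ti(2)]]])
    then obtain u where u: "u \<in> Hom D T (fob F X)" "c = (\<theta> Y \<bullet> fmor F b) \<bullet> u"
      using D.tri_lift_shift[OF ti c] by blast
    have ui: "u \<bullet> i \<in> Hom D M (fob F X)" by (rule D.cmp_hom[OF d(1) u(1)])
    obtain w where w: "w \<in> Hom D M B" "al \<bullet> (u \<bullet> i) = q0 \<bullet> w"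
      using q0(3)[OF D.cmp_hom[OF ui al(1)]] by blast
    obtain s where s: "s \<in> Hom D B (fob F D')" "be \<bullet> q0 = fmor F q \<bullet> s"
      using lift[OF q0(1) D.cmp_hom[OF q0(2) al(2)]] by blast
    have "u \<bullet> i = be \<bullet> (al \<bullet> (u \<bullet> i))"
      using D.assoc[OF ui al(1,2)] al(3) D.cmp_idn(2)[OF ui] by simp
    then have ui': "u \<bullet> i = fmor F q \<bullet> (s \<bullet> w)"
      unfolding w(2) using D.assoc[OF w(1) q0(2) al(2)] s(2) D.assoc[OF w(1) s(1) ti(3)] by simp
    obtain s' where s': "s' \<in> Hom D W (fob F D')" "u \<bullet> j = fmor F q \<bullet> s'"
      using lift[OF D.in_add_refl[OF obs(5)] D.cmp_hom[OF d(3) u(1)]] by blast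
    let ?v = "Pls D ((s \<bullet> w) \<bullet> p) (s' \<bullet> r)"
    have h1: "(s \<bullet> w) \<bullet> p \<in> Hom D T (fob F D')" "s' \<bullet> r \<in> Hom D T (fob F D')"
      using D.cmp_hom[OF d(2) D.cmp_hom[OF w(1) s(1)]] D.cmp_hom[OF d(4) s'(1)] by auto
    have vh: "?v \<in> Hom D T (fob F D')" by (rule D.pls_hom[OF h1])
    have "u = u \<bullet> Idn D T" using D.cmp_idn(1)[OF u(1)] by simp
    also have "\<dots> = Pls D ((u \<bullet> i) \<bullet> p) ((u \<bullet> j) \<bullet> r)"
      unfolding d(5)[symmetric] using D.distrib(1)[OF D.cmp_hom[OF d(2,1)] u(1) D.cmp_hom[OF d(4,3)]]
        D.assoc[OF d(2,1) u(1)] D.assoc[OF d(4,3) u(1)] by simp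
    also have "\<dots> = fmor F q \<bullet> ?v"
      unfolding ui' s'(2) using D.distrib(1)[OF h1(1) ti(3) h1(2)] D.assoc[OF d(2) D.cmp_hom[OF w(1) s(1)] ti(3)]
        D.assoc[OF d(4) s'(1) ti(3)] by simp
    finally have uv: "u = fmor F q \<bullet> ?v" .
    have "c = ((\<theta> Y \<bullet> fmor F b) \<bullet> fmor F q) \<bullet> ?v"
      unfolding u(2) uv by (rule D.assoc[OF vh ti(3,4), symmetric])
    then show "c = Zro D T (D.so (fob F Y))"
      unfolding D.tri_cmp_zero(2)[OF ti] using D.cmp_zro(2)[OF vh D.so_ob[OF F_ob[OF obY]]] by simp
  qed
qed

lemma not_retract_crad:
  assumes X: "indecomposable C X" and Z: "\<not> C.retract X Z" and s: "s \<in> Hom C X Z" and t: "t \<in> Hom C Z X"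
  shows "t \<cdot> s \<in> C.crad X X"
proof (rule ccontr)
  have ts: "t \<cdot> s \<in> Hom C X X" by (rule C.cmp_hom[OF s t])
  assume "t \<cdot> s \<notin> C.crad X X"
  then obtain k where "iso_pair C X X (t \<cdot> s) k" using C.not_crad_iso[OF X X ts] by blast
  then have k: "k \<in> Hom C X X" "k \<cdot> (t \<cdot> s) = Idn C X" unfolding iso_pair_def by auto
  then have "(k \<cdot> t) \<cdot> s = Idn C X" using C.assoc[OF s t k(1)] by simp
  then show False using Z C.retractI[OF s C.cmp_hom[OF t k(1)]] by blast
qed

text \<open>
  Let \<open>Y\<close> be the cocone of a right \<open>add T\<^sub>f\<close>-approximation
  \<open>D' \<rightarrow> X\<close>. Each indecomposable summand of \<open>Y\<close> is a summand
  of \<open>T\<^sub>m\<close> or \<open>T\<^sub>f\<close>. Comparing its triangle with the one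
  that defines \<open>T\<^sub>m\<langle>1\<rangle>\<close>, the identity of \<open>Y\<close>
  induces an endomorphism of \<open>X\<close> that factors through copies of
  \<open>T\<^sub>m\<langle>1\<rangle>\<close> and differs from the identity by a map through
  \<open>D'\<close>. As \<open>End X\<close> is local, \<open>X\<close> is a summand of
  \<open>T\<^sub>m\<langle>1\<rangle>\<close> or of \<open>D'\<close>.
\<close>

lemma summand_over_N:
  assumes X: "indecomposable C X" and XN: "isomorphic D (fob F X) N"
  shows "C.retract X Tm1 \<or> C.retract X Tf"
proof (rule ccontr)
  assume "\<not> ?thesis"
  then have not: "\<not> C.retract X Tm1" "\<not> C.retract X Tf" by auto
  obtain al be where iso: "iso_pair D (fob F X) N al be" using XN unfolding isomorphic_def by blast
  have obX: "X \<in> Obj C" by (rule C.indec_ob[OF X])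
  obtain D' q where q: "C.in_add Tf D'" "q \<in> Hom C D' X" "\<forall>v\<in>Hom C Tf X. \<exists>u\<in>Hom C Tf D'. v = q \<cdot> u"
    using C.right_approx_exists[OF obs(7) obX] by blast
  obtain Y a b where t: "(a, q, b) \<in> Tri C" "a \<in> Hom C Y D'" "b \<in> Hom C X (C.so Y)"
    by (rule C.cocone[OF q(2)]) (rule that; assumption)
  note t' = t(1,2) q(2) t(3)
  have obY: "Y \<in> Obj C" "D' \<in> Obj C" using C.Hom_ob[OF t(2)] by auto
  have FY: "D.in_add T (fob F Y)" by (rule cocone_image[OF iso t' q(1)]) (use q(3) in blast)
  have FX: "D.in_add T1 (fob F X)"
    using D.retract_in_add[OF D.retract_trans] D.isomorphic_retract[OF XN] D.dsum2_retract[OF T1(2)] by blast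
  note rigid = shift_rigid[OF FX]
  have ext: "\<exists>d\<in>Hom C D' Z. v = d \<cdot> a" if Z: "C.in_add Tf Z" and v: "v \<in> Hom C Y Z" for v Z
    by (rule C.tri_extend_shift[OF t' v rigid[OF Z C.cmp_hom[OF t(3) C.S.F_hom[OF v]]]])
  \<comment> \<open>The endomorphisms of \<open>Y\<close> whose shift can be moved past \<open>b\<close> as a
    radical endomorphism of \<open>X\<close>. It suffices to treat the idempotents of the
    summands of \<open>Y\<close>.\<close>
  let ?G = "{e. \<exists>\<tau>\<in>C.crad X X. C.sm e \<cdot> b = b \<cdot> \<tau>}"
  have "Idn C Y \<in> ?G"
  proof (rule C.asum_map[OF C.decompose[OF obY(1)] C.ind_gens_hom obY(1,1), where F = "\<lambda>e. e"])
    show "Zro C Y Y \<in> ?G"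
      using C.S.F_zro[OF obY(1,1)] C.cmp_zro(2)[OF t(3) C.so_ob[OF obY(1)]] C.cmp_zro(1)[OF t(3) obX] C.crad_zro[OF obX obX]
      by (intro CollectI bexI[of _ "Zro C X X"]) simp_all
  next
    fix e e' assume e: "e \<in> Hom C Y Y" "e' \<in> Hom C Y Y" and "e \<in> ?G" "e' \<in> ?G"
    then obtain \<tau> \<tau>' where tt: "\<tau> \<in> C.crad X X" "\<tau>' \<in> C.crad X X" "C.sm e \<cdot> b = b \<cdot> \<tau>" "C.sm e' \<cdot> b = b \<cdot> \<tau>'"
      by blast
    have th: "\<tau> \<in> Hom C X X" "\<tau>' \<in> Hom C X X" using tt C.crad_hom by auto
    have "C.sm (Pls C e e') \<cdot> b = b \<cdot> Pls C \<tau> \<tau>'"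
      using C.S.F_pls[OF e] C.distrib(2)[OF t(3) C.S.F_hom[OF e(1)] C.S.F_hom[OF e(2)]] C.distrib(1)[OF th(1) t(3) th(2)] tt by simp
    then show "Pls C e e' \<in> ?G" using C.crad_pls[OF tt(1,2)] by blast
  next
    fix e assume "e \<in> C.ind_gens Y"
    then obtain y p Z where e: "e = y \<cdot> p" "indecomposable C Z" "y \<in> Hom C Z Y" "p \<in> Hom C Y Z" "p \<cdot> y = Idn C Z"
      unfolding C.ind_gens_def by blast
    have "D.retract (fob F Z) (fob F Y)" by (rule F_retract[OF C.retractI[OF e(3-5)]])
    then have "D.retract (fob F Z) T" by (rule D.indec_in_add[OF indec_image[OF e(2)] D.in_add_retract[OF FY]])
    then consider "D.retract (fob F Z) M" | "D.retract (fob F Z) W"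
      using D.indec_retract_dsum2[OF indec_image[OF e(2)] _ T(2)] by blast
    then show "e \<in> ?G"
    proof cases
      case 1
      have "C.retract Z Tm" by (rule lift_reflect[OF Tm e(2) 1])
      then obtain k r where kr: "k \<in> Hom C Z Tm" "r \<in> Hom C Tm Z" "r \<cdot> k = Idn C Z" unfolding C.retract_def by blast
      let ?p = "k \<cdot> p" and ?y = "y \<cdot> r"
      have p: "?p \<in> Hom C Y Tm" and y: "?y \<in> Hom C Tm Y" using C.cmp_hom[OF e(4) kr(1)] C.cmp_hom[OF kr(2) e(3)] .
      have yp: "e = ?y \<cdot> ?p"
      proof -
        have "r \<cdot> (k \<cdot> p) = p" using C.assoc[OF e(4) kr(1,2)] kr(3) C.cmp_idn(2)[OF e(4)] by simp
        then show ?thesis using C.assoc[OF p kr(2) e(3)] e(1) by simp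
      qed
      obtain v where v: "v \<in> Hom C D' V" "f \<cdot> ?p = v \<cdot> a" using ext[OF V C.cmp_hom[OF p exch(2)]] by blast
      obtain s where s: "s \<in> Hom C X Tm1" "C.sm ?p \<cdot> b = h \<cdot> s"
        by (rule C.triangle_fill[OF t' exch p v(1) v(2)[symmetric]]) (rule that; assumption)
      obtain v' where v': "v' \<in> Hom C V D'" "a \<cdot> ?y = v' \<cdot> f"
        using C.left_approx_in_add[OF exch(2) f_approx q(1) C.cmp_hom[OF y t(2)]] by blast
      obtain s' where s': "s' \<in> Hom C Tm1 X" "C.sm ?y \<cdot> h = b \<cdot> s'"
        by (rule C.triangle_fill[OF exch t' y v'(1) v'(2)[symmetric]]) (rule that; assumption)
      have "C.sm e \<cdot> b = C.sm ?y \<cdot> (C.sm ?p \<cdot> b)"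
        unfolding yp C.S.F_cmp[OF p y] by (rule C.assoc[OF t(3) C.S.F_hom[OF p] C.S.F_hom[OF y]])
      also have "\<dots> = b \<cdot> (s' \<cdot> s)"
        unfolding s(2) using C.assoc[OF s(1) exch(4) C.S.F_hom[OF y]] s'(2) C.assoc[OF s(1) s'(1) t(3)] by simp
      finally show ?thesis using not_retract_crad[OF X not(1) s(1) s'(1)] by blast
    next
      case 2
      have Z: "C.in_add Tf Z" by (rule C.retract_in_add[OF lift_reflect[OF Tf e(2) 2]])
      have "C.sm e \<cdot> b = C.sm y \<cdot> (C.sm p \<cdot> b)"
        unfolding e(1) C.S.F_cmp[OF e(4,3)] by (rule C.assoc[OF t(3) C.S.F_hom[OF e(4)] C.S.F_hom[OF e(3)]])
      also have "\<dots> = Zro C X (C.so Y)"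
        unfolding rigid[OF Z C.cmp_hom[OF t(3) C.S.F_hom[OF e(4)]]] by (rule C.cmp_zro(1)[OF C.S.F_hom[OF e(3)] obX])
      also have "\<dots> = b \<cdot> Zro C X X" using C.cmp_zro(1)[OF t(3) obX] by simp
      finally show ?thesis using C.crad_zro[OF obX obX] by blast
    qed
  qed
  then obtain \<tau> where tau: "\<tau> \<in> C.crad X X" "b = b \<cdot> \<tau>"
    using C.S.F_idn[OF obY(1)] C.cmp_idn(2)[OF t(3)] by auto
  have th: "\<tau> \<in> Hom C X X" using tau C.crad_hom by blast
  \<comment> \<open>Since \<open>b\<close> kills \<open>1 - \<tau>\<close>, this endomorphism factors through
    \<open>q\<close>. So it is radical as well, and the identity of \<open>X\<close> is
    radical.\<close>
  let ?n = "Pls C (Idn C X) (Scl C (- 1) \<tau>)"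
  have nh: "?n \<in> Hom C X X" by (rule C.pls_hom[OF C.idn_hom[OF obX] C.scl_hom[OF th]])
  have "b \<cdot> ?n = Pls C b (Scl C (- 1) (b \<cdot> \<tau>))"
    using C.distrib(1)[OF C.idn_hom[OF obX] t(3) C.scl_hom[OF th]] C.distrib(3)[OF th t(3)] C.cmp_idn(1)[OF t(3)] by simp
  then have "b \<cdot> ?n = Zro C X (C.so Y)"
    unfolding tau(2)[symmetric] using C.hom_module_laws(3)[OF t(3)] by simp
  then obtain u where u: "u \<in> Hom C X D'" "?n = q \<cdot> u"
    using C.tri_lift[OF C.rotate[OF t'] q(2) t(3) C.scl_hom[OF C.S.F_hom[OF t(2)]] nh] by blast
  have "\<not> C.retract X D'" using not(2) C.indec_in_add[OF X C.in_add_retract[OF q(1)]] by blast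
  then have "?n \<in> C.crad X X" unfolding u(2) by (rule not_retract_crad[OF X _ u(1) q(2)])
  then have "Pls C ?n \<tau> \<in> C.crad X X" using C.crad_pls tau(1) by blast
  moreover have "Pls C ?n \<tau> = Idn C X"
    using C.hom_module_laws(6)[OF C.idn_hom[OF obX] C.scl_hom[OF th] th] C.hom_module_laws(4)[OF th] C.hom_module_laws(1)[OF C.idn_hom[OF obX]] by simp
  ultimately show False using C.idn_in_crad C.indec_nz[OF X] by simp
qed

theorem summands_of_mutation:
  assumes T': "dsum2 C T' Tm1 Tf" and Tb: "dsum2 D Tb N W" and X: "indecomposable C X"
  shows "C.retract X T' \<longleftrightarrow> D.retract (fob F X) Tb"
proof
  note FX = indec_image[OF X]
  assume "C.retract X T'"
  then consider "C.retract X Tm1" | "C.retract X Tf" using C.indec_retract_dsum2[OF X _ T'] by blast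
  then have "D.retract (fob F X) N \<or> D.retract (fob F X) W"
  proof cases
    case 1
    have "D.retract (fob F X) T1" by (rule D.indec_in_add[OF FX D.in_add_retract[OF image_Tm1 F_retract[OF 1]]])
    then show ?thesis by (rule D.indec_retract_dsum2[OF FX _ T1(2)])
  next
    case 2
    then show ?thesis using D.indec_in_add[OF FX image_Tf[OF C.retract_in_add]] by blast
  qed
  then show "D.retract (fob F X) Tb" using D.retract_trans D.dsum2_retract[OF Tb] by blast
next
  note FX = indec_image[OF X]
  assume "D.retract (fob F X) Tb"
  then consider "D.retract (fob F X) N" | "D.retract (fob F X) W" using D.indec_retract_dsum2[OF FX _ Tb] by blast
  then have "C.retract X Tm1 \<or> C.retract X Tf"
  proof cases
    case 1
    then show ?thesis by (rule summand_over_N[OF X D.retract_indec_isomorphic[OF _ D.indec_nz[OF FX] N]])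
  next
    case 2
    then show ?thesis using lift_reflect[OF Tf X] by blast
  qed
  then show "C.retract X T'" using C.retract_trans C.dsum2_retract[OF T'] by blast
qed

end

theorem theorem4p4:
  fixes T :: "('o, 'm, 'k::alg_closed_field) tcat"
    and Tbar :: "('p, 'n, 'k) tcat"
    and E :: "('a, 'b, 'k) ecat" and Ebar :: "('c, 'd, 'k) ecat"
    and G :: "'g monoid" and \<rho> :: "'g \<Rightarrow> ('o, 'm, 'o, 'm) func"
    and \<pi> :: "('o, 'm, 'p, 'n) func"
    and T0 Tm Tf Tm1 T' :: 'o
    and Tbar0 Tbarm Tbarf Tbarm' Tbar' :: 'p
    and l :: nat
  defines "Q \<equiv> end_quiver T T0"
    and "Q' \<equiv> end_quiver T T'"
    and "Qbar' \<equiv> end_quiver Tbar Tbar'"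
    and "Qmm \<equiv> induce_subgraph (end_quiver T T0) (quiver_vertices T Tm)"
    and "Tm_quot \<equiv> quot_cat T (factor_ideal T (add_closure T Tf))"
    and "Tbarm_quot \<equiv> quot_cat Tbar (factor_ideal Tbar (add_closure Tbar Tbarf))"
  assumes "hom_finite_krull_schmidt T" and "hom_finite_krull_schmidt Tbar"
    and "triangulated_category T" and "triangulated_category Tbar"
    and "algebraic_via E T" and "algebraic_via Ebar Tbar"
    and "two_calabi_yau T" and "two_calabi_yau Tbar"
    and "galois_covering G \<rho> T Tbar \<pi>" and "triangle_functor T Tbar \<pi>"
    and "basic_object Tbar Tbar0" and "cluster_tilting Tbar Tbar0"
    and "dsum2 Tbar Tbar0 Tbarm Tbarf" and "indecomposable Tbar Tbarm"
    and "complement Tbar Tbarf Tbarm'" and "\<not> isomorphic Tbar Tbarm' Tbarm"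
    and "dsum2 Tbar Tbar' Tbarm' Tbarf"
    and "is_lift T Tbar \<pi> Tbarm Tm" and "is_lift T Tbar \<pi> Tbarf Tf" and "dsum2 T T0 Tm Tf"
    and "iy_shift T (add_closure T Tf) Tm Tm1" and "dsum2 T T' Tm1 Tf"
    and a: "\<And>Z. cluster_tilting T Z \<Longrightarrow> no_loops_or_2cycles (end_quiver T Z)"
    and b: "l \<ge> 3" "\<exists>r. digraph_iso Qmm (oriented_cycles r l)"
    and c: "given_by_potential Q (End T T0)"
    and d: "given_by_paths_of_length (l - 1) Qmm (End Tm_quot Tm)"
    and e: "card (verts (end_quiver Tbarm_quot Tbarm)) = 1"
           "card (arcs (end_quiver Tbarm_quot Tbarm)) \<le> 1"
  shows "same_ind_summands Tbar Tbar' (fob \<pi> T') \<and>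
    quiver_iso_over (orbit_image Tbar \<pi>)
      (orbit_quiver G (vertex_action T \<rho>) (arrow_action T \<rho>) Q') Qbar'"
proof -
  interpret C: tricat T by unfold_locales (rule assms)+
  interpret D: tricat Tbar by unfold_locales (rule assms)+
  have gal: "galois_covering G \<rho> T Tbar \<pi>" by (rule assms)
  have cov: "covering_functor T Tbar \<pi>" using gal unfolding galois_covering_def by blast
  then have lin: "linear_functor T Tbar \<pi>" unfolding covering_functor_def by (rule conjunct1)
  interpret covering T Tbar \<pi> by unfold_locales (rule lin, rule cov)
  have liftm: "is_lift T Tbar \<pi> Tbarm Tm" and liftf: "is_lift T Tbar \<pi> Tbarf Tf" by (rule assms)+
  have ds: "dsum2 Tbar Tbar0 Tbarm Tbarf" "dsum2 Tbar Tbar' Tbarm' Tbarf" "dsum2 T T' Tm1 Tf" by (rule assms)+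
  have Mind: "indecomposable Tbar Tbarm" and ct: "cluster_tilting Tbar Tbar0"
    and NM: "\<not> isomorphic Tbar Tbarm' Tbarm" by (rule assms)+
  have ob: "Tbarm \<in> Obj Tbar" "Tbarf \<in> Obj Tbar" "T' \<in> Obj T" "Tbar' \<in> Obj Tbar" "Tf \<in> Obj T"
    using D.dsum2_retract[OF ds(1)] D.retract_ob D.dsum2_retract[OF ds(2)] C.dsum2_retract[OF ds(3)] C.retract_ob by blast+
  have l: "l - 1 \<ge> 1" using b(1) by simp
  have nz: "\<not> zero_object Tbar (fob \<pi> X)" if "indecomposable T X" for X
    by (rule indec_not_killed[OF ob(1,2) liftm liftf l d[unfolded Qmm_def Tm_quot_def] that])
  interpret galois_nz T Tbar \<pi> G \<rho> by unfold_locales (rule nz, assumption, rule gal)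
  have "complement Tbar Tbarf Tbarm'" by (rule assms)
  then obtain T1 where N: "indecomposable Tbar Tbarm'" and T1: "dsum2 Tbar T1 Tbarm' Tbarf" "cluster_tilting Tbar T1"
    unfolding complement_def by blast
  have "iy_shift T (add_closure T Tf) Tm Tm1" by (rule assms)
  then obtain V f g h where ap: "minimal_left_approx T (add_closure T Tf) Tm V f"
    and tri: "(f, g, h) \<in> triangles_on T Tm V Tm1" "(f, g, h) \<in> Tri T"
    unfolding iy_shift_def by blast
  have V: "V \<in> add_closure T Tf" and fa: "\<forall>U\<in>add_closure T Tf. \<forall>v\<in>Hom T Tm U. \<exists>d\<in>Hom T V U. d \<star>\<^bsub>T\<^esub> f = v"
    using ap unfolding minimal_left_approx_def by auto
  have "triangle_functor T Tbar \<pi>" by (rule assms)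
  then obtain \<theta> where th: "\<forall>X\<in>Obj T. \<theta> X \<in> Hom Tbar (fob \<pi> (fob (Sh T) X)) (fob (Sh Tbar) (fob \<pi> X)) \<and> is_iso Tbar (\<theta> X)"
    "\<forall>(f, g, h)\<in>Tri T. (fmor \<pi> f, fmor \<pi> g, \<theta> (Dom T f) \<star>\<^bsub>Tbar\<^esub> fmor \<pi> h) \<in> Tri Tbar"
    unfolding triangle_functor_def by blast
  interpret mutation T Tbar \<pi> \<theta> Tbar0 Tbarm Tbarf T1 Tbarm' Tm Tf Tm1 V f g h
  proof unfold_locales
    show "\<theta> X \<in> Hom Tbar (fob \<pi> (fob (Sh T) X)) (fob (Sh Tbar) (fob \<pi> X))" "is_iso Tbar (\<theta> X)" if "X \<in> Obj T" for X
      using th(1) that by blast+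
    show "(fmor \<pi> f, fmor \<pi> g, \<theta> (Dom T f) \<star>\<^bsub>Tbar\<^esub> fmor \<pi> h) \<in> Tri Tbar" if "(f, g, h) \<in> Tri T" for f g h
      using th(2) that by blast
    show "\<not> D.retract Tbarm Tbarf" by (rule D.basic_complement_disjoint[OF _ ds(1) Mind]) (rule assms)
    show "f \<in> Hom T Tm V" "g \<in> Hom T V Tm1" "h \<in> Hom T Tm1 (fob (Sh T) Tm)" using tri(1) unfolding triangles_on_def by auto
    show "C.in_add Tf V" by (rule C.add_closure_in_add[OF V])
    show "\<exists>d\<in>Hom T V Tf. v = d \<star>\<^bsub>T\<^esub> f" if "v \<in> Hom T Tm Tf" for v
      using bspec[OF bspec[OF fa C.retract_add_closure[OF C.retract_refl[OF ob(5)]]] that] by blast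
  qed (fact ct ds(1) T1 Mind N NM liftm liftf tri(2))+
  show ?thesis
    unfolding Q'_def Qbar'_def using quiver_of_image[OF ob(3,4) summands_of_mutation[OF ds(3,2)]] by blast
qed

end
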